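(* There exists an absolute constant $C>0$ such that for all integers $n\ge1$, $k\ge 2$ and all $\rho_n\in(0,1]$, $$\sup_{W_0\in\mathcal W^+[k]}\mathbb E_{W_0}\big[\delta_\square(\widetilde f_{\boldsymbol A},f_0)\big]\ \le\ C\left[\rho_n\min\left(\sqrt{\frac{k}{n\log(k)}},\ \frac1{\sqrt{\log(n)}}\right)+\sqrt{\frac{\rho_n}{n}}\right],$$ where $f_0=\rho_nW_0$ and $1/\sqrt{\log(n)}$ is read as $+\infty$ for $n=1$.
   Context: $[m]=\{1,\dots,m\}$. $\mathcal W^+$ is the set of graphons, i.e. symmetric measurable functions $W:[0,1]^2\to[0,1]$. $\mathcal W^+[k]$ is the set of $k$-step graphons: those $W\in\mathcal W^+$ such that for some symmetric $\boldsymbol Q\in[0,1]^{k\times k}$ and some $\phi:[0,1]\to[k]$, $W(x,y)=\boldsymbol Q_{\phi(x),\phi(y)}$ for all $x,y\in[0,1]$. $W$-random graph model: $\xi_1,\dots,\xi_n$ are i.i.d. uniform on $[0,1]$ (unobserved); given $W_0\in\mathcal W^+$ and $\rho_n\in(0,1]$, $\boldsymbol\Theta_0$ is the symmetric $n\times n$ matrix with entries $\boldsymbol\Theta_{ij}=\rho_nW_0(\xi_i,\xi_j)$ for $i\ne j$ and $\boldsymbol\Theta_{ii}=0$. Conditionally on $\boldsymbol\Theta_0$, the adjacency matrix $\boldsymbol A$ is a symmetric $\{0,1\}$-valued $n\times n$ matrix with zero diagonal whose entries $\boldsymbol A_{ij}$, $i<j$, are independent Bernoulli with parameters $\boldsymbol\Theta_{ij}$.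 $\mathbb E_{W_0}$ is the expectation in this model. For an $n\times n$ matrix $\boldsymbol B$ with entries in $[0,1]$, the empirical graphon is $\widetilde f_{\boldsymbol B}(x,y)=\boldsymbol B_{\lceil nx\rceil,\lceil ny\rceil}$ for $x,y\in(0,1]$. The cut norm of a bounded symmetric measurable $W$ on $[0,1]^2$ is $\|W\|_\square=\sup_{S,T\subset[0,1]}\big|\int_{S\times T}W(x,y)\,dx\,dy\big|$ (sup over measurable $S,T$). The cut distance is $\delta_\square(W_1,W_2)=\inf_{\tau}\|W_1-W_2^\tau\|_\square$, the infimum being over all measure-preserving bijections $\tau:[0,1]\to[0,1]$, with $W^\tau(x,y)=W(\tau(x),\tau(y))$. *)

theory Defs
  imports "HOL-Probability.Probability"
begin

text \<open>
  Functions on the unit square are total functions on pairs of reals of which only the values on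
  the square matter. ``Measurable'' means Lebesgue measurable. The index set of an
  \<open>n \<times> n\<close> matrix is \<open>{1..n}\<close>.
\<close>

abbreviation unit_leb :: "real measure" where
  "unit_leb \<equiv> lebesgue_on {0..1}"

definition graphons :: "(real \<Rightarrow> real \<Rightarrow> real) set" where
  "graphons = {W.
     (\<lambda>z. W (fst z) (snd z)) \<in> borel_measurable (lebesgue_on ({0..1} \<times> {0..1})) \<and>
     (\<forall>x\<in>{0..1}. \<forall>y\<in>{0..1}. W x y = W y x \<and> W x y \<in> {0..1})}"

text \<open>Measurability of \<open>W\<close> is required, measurability of the labelling \<open>\<phi>\<close> is not.\<close>

definition step_graphons :: "nat \<Rightarrow> (real \<Rightarrow> real \<Rightarrow> real) set" where
  "step_graphons k = {W \<in> graphons. \<exists>(Q :: nat \<Rightarrow> nat \<Rightarrow> real) (\<phi> :: real \<Rightarrow> nat).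
     (\<forall>a\<in>{1..k}. \<forall>b\<in>{1..k}. Q a b = Q b a \<and> Q a b \<in> {0..1}) \<and>
     \<phi> \<in> {0..1} \<rightarrow> {1..k} \<and>
     (\<forall>x\<in>{0..1}. \<forall>y\<in>{0..1}. W x y = Q (\<phi> x) (\<phi> y))}"

definition cut_norm :: "(real \<Rightarrow> real \<Rightarrow> real) \<Rightarrow> real" where
  "cut_norm W = (SUP (S, T) \<in> sets unit_leb \<times> sets unit_leb.
     \<bar>LINT z:S \<times> T|lebesgue. W (fst z) (snd z)\<bar>)"

definition mp_bijections :: "(real \<Rightarrow> real) set" where
  "mp_bijections = {\<tau>. bij_betw \<tau> {0..1} {0..1} \<and> \<tau> \<in> measurable unit_leb unit_leb \<and>
     distr unit_leb unit_leb \<tau> = unit_leb}"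

definition cut_distance :: "(real \<Rightarrow> real \<Rightarrow> real) \<Rightarrow> (real \<Rightarrow> real \<Rightarrow> real) \<Rightarrow> real" where
  "cut_distance W1 W2 =
     (INF \<tau>\<in>mp_bijections. cut_norm (\<lambda>x y. W1 x y - W2 (\<tau> x) (\<tau> y)))"

text \<open>On the null set where \<open>x = 0\<close> or \<open>y = 0\<close> this reads \<open>B\<close> outside \<open>{1..n}\<close>.\<close>

definition empirical_graphon :: "nat \<Rightarrow> (nat \<Rightarrow> nat \<Rightarrow> real) \<Rightarrow> real \<Rightarrow> real \<Rightarrow> real" where
  "empirical_graphon n B x y = B (nat \<lceil>real n * x\<rceil>) (nat \<lceil>real n * y\<rceil>)"

text \<open>
  The law of \<open>(\<xi>\<^sub>1, \<dots>, \<xi>\<^sub>n)\<close>. The product measure is completed because \<open>W\<^sub>0(\<xi>\<^sub>i, \<xi>\<^sub>j)\<close> need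
  not be measurable for the uncompleted product when \<open>W\<^sub>0\<close> is only Lebesgue measurable.
\<close>

definition latent_measure :: "nat \<Rightarrow> (nat \<Rightarrow> real) measure" where
  "latent_measure n = completion (Pi\<^sub>M {1..n} (\<lambda>_. unit_leb))"

definition prob_matrix ::
    "real \<Rightarrow> (real \<Rightarrow> real \<Rightarrow> real) \<Rightarrow> (nat \<Rightarrow> real) \<Rightarrow> nat \<Rightarrow> nat \<Rightarrow> real" where
  "prob_matrix \<rho> W \<xi> i j = (if i = j then 0 else \<rho> * W (\<xi> i) (\<xi> j))"

text \<open>
  The independent edge indicators live on the pairs \<open>i < j\<close> and are \<open>False\<close> elsewhere, in
  particular on the diagonal and outside \<open>{1..n}\<close>.
\<close>

definition adjacency_pmf :: "nat \<Rightarrow> (nat \<Rightarrow> nat \<Rightarrow> real) \<Rightarrow> (nat \<Rightarrow> nat \<Rightarrow> real) pmf" where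
  "adjacency_pmf n \<Theta> =
     map_pmf (\<lambda>e i j. of_bool (e (min i j, max i j)))
       (Pi_pmf {(i, j). 1 \<le> i \<and> i < j \<and> j \<le> n} False (\<lambda>(i, j). bernoulli_pmf (\<Theta> i j)))"

text \<open>The (unconditional) law of the adjacency matrix in the \<open>W\<close>-random graph model.\<close>

definition graph_law ::
    "nat \<Rightarrow> real \<Rightarrow> (real \<Rightarrow> real \<Rightarrow> real) \<Rightarrow> (nat \<Rightarrow> nat \<Rightarrow> real) measure" where
  "graph_law n \<rho> W =
     latent_measure n \<bind> (\<lambda>\<xi>. measure_pmf (adjacency_pmf n (prob_matrix \<rho> W \<xi>)))"

end

theory Submission
  imports Defs
begin

text \<open>
  The cut distance is at most the contribution of the adjacency noise \<open>A - \<Theta>\<close>, of order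
  \<open>sqrt (\<rho> / n)\<close> by an exponential moment and a union bound over sign vectors, plus the sampling
  error of the step graphon. Cut the interval into a fine grid on which both the graphon and the
  sample are labelled, and rearrange cells so that equal labels are matched as far as possible, and
  among the remaining cells equal classes of a partition of the labels into \<open>4 ^ r\<close> classes. By weak
  regularity the partition may be chosen so that the step matrix is within \<open>1 / sqrt r\<close> in cut
  norm of a matrix constant on classes. Unmatched classes cost \<open>2 ^ r / sqrt n\<close>; unmatched labels
  only meet the regularity residual, weighted by the fluctuations of the label frequencies, which
  have size \<open>sqrt (lam a / n)\<close> and total \<open>sqrt (k / n)\<close>, so they cost \<open>sqrt (k / (n * r))\<close>.
  Symmetrization, contraction and decoupling bound the random cut norms in expectation. The depth
  \<open>r\<close> is of order \<open>ln k\<close> if \<open>k \<le> n\<close>; for the bound free of \<open>k\<close> the residual is bounded in full, by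
  \<open>1 / sqrt r\<close> with \<open>r\<close> of order \<open>ln n\<close>.
\<close>

text \<open>Matching label frequencies alone would cost their total variation distance, of order
  \<open>sqrt (k / n)\<close>, and lose the logarithm. The gain comes from a matrix constant on
  classes: it does not see a mismatch inside a class, so mismatched labels are paid for only through
  the regularity residual. This makes the depth a trade-off between \<open>2 ^ r\<close> and
  \<open>1 / sqrt r\<close>; an \<open>r\<close> near \<open>ln k / 4\<close> keeps
  \<open>2 ^ r\<close> within the order of \<open>sqrt (k / ln k)\<close>. The residual must be
  bounded uniformly over sign vectors. No union bound over them is taken there: contraction strips
  the absolute values, and what remains are single columns, controlled by second moments. Only the
  labels of the sample points matter, so the sample is an element of a finite product set and its
  expectations are finite weighted sums; measure theory is confined to the grid, to the choice of a
  measurable labelling and to the law of the random graph. The grid error is arbitrarily small for a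
  fixed sample and is sent to 0 before any expectation is taken.\<close>

lemma MAX_leI:
  fixes f :: "'t \<Rightarrow> real"
  assumes "finite T" "T \<noteq> {}" "\<And>t. t \<in> T \<Longrightarrow> f t \<le> c"
  shows "(MAX t\<in>T. f t) \<le> c"
  using assms by simp

lemma MAX_geI:
  fixes f :: "'t \<Rightarrow> real"
  assumes "finite T" "t \<in> T" "c \<le> f t"
  shows "c \<le> (MAX t\<in>T. f t)"
  using assms by (meson Max_ge finite_imageI imageI order_trans)

lemma MAX_mono:
  fixes f g :: "'t \<Rightarrow> real"
  assumes "finite T" "T \<noteq> {}" "\<And>t. t \<in> T \<Longrightarrow> f t \<le> g t"
  shows "(MAX t\<in>T. f t) \<le> (MAX t\<in>T. g t)"
  by (rule MAX_leI[OF assms(1,2)]) (rule MAX_geI[OF assms(1)], use assms(3) in auto)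

lemma MAX_attained:
  fixes f :: "'t \<Rightarrow> real"
  assumes "finite T" "T \<noteq> {}"
  obtains t where "t \<in> T" "(MAX t\<in>T. f t) = f t"
proof -
  have "Max (f ` T) \<in> f ` T" using assms by (intro Max_in) auto
  then show ?thesis using that by auto
qed

lemma MAX_cmult:
  fixes f :: "'t \<Rightarrow> real"
  assumes "finite T" "T \<noteq> {}" "c \<ge> 0"
  shows "(MAX t\<in>T. c * f t) = c * (MAX t\<in>T. f t)"
proof (rule antisym)
  show "(MAX t\<in>T. c * f t) \<le> c * (MAX t\<in>T. f t)"
    by (rule MAX_leI[OF assms(1,2)]) (rule mult_left_mono[OF MAX_geI[OF assms(1)] assms(3)], auto)
  obtain t where "t \<in> T" "(MAX t\<in>T. f t) = f t" using MAX_attained[OF assms(1,2)] .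
  then show "c * (MAX t\<in>T. f t) \<le> (MAX t\<in>T. c * f t)"
    using assms(1) by (intro MAX_geI) auto
qed

lemma MAX_add_le:
  fixes f g :: "'t \<Rightarrow> real"
  assumes "finite T" "T \<noteq> {}"
  shows "(MAX t\<in>T. f t + g t) \<le> (MAX t\<in>T. f t) + (MAX t\<in>T. g t)"
  by (rule MAX_leI[OF assms]) (intro add_mono MAX_geI[OF assms(1)], auto)

section \<open>Finite product expectations and Rademacher averages\<close>

definition prob_weights :: "'b set \<Rightarrow> ('b \<Rightarrow> real) \<Rightarrow> bool" where
  "prob_weights K p \<longleftrightarrow> finite K \<and> (\<forall>a\<in>K. p a \<ge> 0) \<and> (\<Sum>a\<in>K. p a) = 1"

lemma prob_weightsD:
  assumes "prob_weights K p"
  shows "finite K" "\<And>a. a \<in> K \<Longrightarrow> p a \<ge> 0" "(\<Sum>a\<in>K. p a) = 1" "K \<noteq> {}"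
  using assms by (auto simp: prob_weights_def)

text \<open>Expectation over independent coordinates of law \<open>p\<close>. As a finite sum it
  raises no question of measurability or integrability, so maxima over sign vectors can be averaged
  freely.\<close>

definition pexp :: "'i set \<Rightarrow> 'b set \<Rightarrow> ('b \<Rightarrow> real) \<Rightarrow> (('i \<Rightarrow> 'b) \<Rightarrow> real) \<Rightarrow> real" where
  "pexp I K p f = (\<Sum>x\<in>I \<rightarrow>\<^sub>E K. (\<Prod>i\<in>I. p (x i)) * f x)"

abbreviation signs :: "'i set \<Rightarrow> ('i \<Rightarrow> real) set" where
  "signs J \<equiv> J \<rightarrow>\<^sub>E {-1, 1}"

abbreviation rad :: "'i set \<Rightarrow> (('i \<Rightarrow> real) \<Rightarrow> real) \<Rightarrow> real" where
  "rad J \<equiv> pexp J {-1, 1} (\<lambda>_. 1/2)"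

lemma prob_weights_rad [simp]: "prob_weights {-1, 1::real} (\<lambda>_. 1/2)"
  by (simp add: prob_weights_def)

lemma finite_signs [simp]: "finite J \<Longrightarrow> finite (signs J)"
  by (simp add: finite_PiE)

lemma signs_nonempty [simp]: "signs J \<noteq> {}"
  by (simp add: PiE_eq_empty_iff)

lemma signs_cases: "e \<in> signs J \<Longrightarrow> j \<in> J \<Longrightarrow> e j = 1 \<or> e j = -1"
  by (auto simp: PiE_iff)

lemma signs_abs: "e \<in> signs J \<Longrightarrow> j \<in> J \<Longrightarrow> \<bar>e j\<bar> = 1"
  by (auto dest: signs_cases)

lemma signs_sq: "e \<in> signs J \<Longrightarrow> j \<in> J \<Longrightarrow> e j * e j = 1"
  by (auto dest: signs_cases)

lemma pexp_cong:
  "(\<And>x. x \<in> I \<rightarrow>\<^sub>E K \<Longrightarrow> f x = g x) \<Longrightarrow> pexp I K p f = pexp I K p g"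
  unfolding pexp_def by (intro sum.cong) auto

lemma pexp_mono:
  assumes "prob_weights K p" "\<And>x. x \<in> I \<rightarrow>\<^sub>E K \<Longrightarrow> f x \<le> g x"
  shows "pexp I K p f \<le> pexp I K p g"
  unfolding pexp_def
  by (intro sum_mono mult_left_mono prod_nonneg assms ballI) (auto intro!: prob_weightsD(2)[OF assms(1)])

lemma pexp_add: "pexp I K p (\<lambda>x. f x + g x) = pexp I K p f + pexp I K p g"
  unfolding pexp_def by (simp add: algebra_simps sum.distrib)

lemma pexp_diff: "pexp I K p (\<lambda>x. f x - g x) = pexp I K p f - pexp I K p g"
  unfolding pexp_def by (simp add: algebra_simps sum_subtractf)

lemma pexp_cmult: "pexp I K p (\<lambda>x. c * f x) = c * pexp I K p f"
  unfolding pexp_def by (simp add: sum_distrib_left mult.left_commute)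

lemma pexp_cmult_right: "pexp I K p (\<lambda>x. f x * c) = pexp I K p f * c"
  unfolding pexp_def by (simp add: sum_distrib_right mult.assoc)

lemma pexp_sum: "pexp I K p (\<lambda>x. \<Sum>j\<in>J. f j x) = (\<Sum>j\<in>J. pexp I K p (f j))"
  unfolding pexp_def by (simp add: sum_distrib_left) (rule sum.swap)

lemma pexp_const:
  assumes "finite I" "prob_weights K p"
  shows "pexp I K p (\<lambda>x. c) = c"
proof -
  have "(\<Sum>x\<in>I \<rightarrow>\<^sub>E K. \<Prod>i\<in>I. p (x i)) = (\<Prod>i\<in>I. \<Sum>a\<in>K. p a)"
    using prob_weightsD(1)[OF assms(2)] assms(1) by (subst prod_sum_PiE) auto
  also have "\<dots> = 1" using prob_weightsD(3)[OF assms(2)] by simp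
  finally show ?thesis unfolding pexp_def by (simp add: sum_distrib_right[symmetric])
qed

lemma pexp_swap:
  "pexp I K p (\<lambda>x. pexp J L q (\<lambda>y. f x y)) = pexp J L q (\<lambda>y. pexp I K p (\<lambda>x. f x y))"
  unfolding pexp_def
  by (simp add: sum_distrib_left) (subst sum.swap, simp add: mult_ac)

text \<open>Conditioning on one coordinate. The inductions over the index set rest on this.\<close>

lemma pexp_insert:
  assumes "finite J" "j \<notin> J"
  shows "pexp (insert j J) K p f = (\<Sum>a\<in>K. p a * pexp J K p (\<lambda>x. f (x(j := a))))"
proof -
  have *: "(\<Prod>i\<in>insert j J. p ((x(j:=a)) i)) = p a * (\<Prod>i\<in>J. p (x i))" for x a
  proof -
    have "(\<Prod>i\<in>J. p ((x(j:=a)) i)) = (\<Prod>i\<in>J. p (x i))"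
      using assms by (intro prod.cong) auto
    then show ?thesis using assms by simp
  qed
  have "pexp (insert j J) K p f
      = (\<Sum>(a, x)\<in>K \<times> (J \<rightarrow>\<^sub>E K). (\<Prod>i\<in>insert j J. p ((x(j:=a)) i)) * f (x(j := a)))"
    unfolding pexp_def PiE_insert_eq
    by (subst sum.reindex) (use inj_combinator[OF assms(2), of "\<lambda>_. K"] in
       \<open>auto simp: case_prod_unfold inj_on_def fun_eq_iff\<close>)
  also have "\<dots> = (\<Sum>a\<in>K. \<Sum>x\<in>J \<rightarrow>\<^sub>E K. (\<Prod>i\<in>insert j J. p ((x(j:=a)) i)) * f (x(j := a)))"
    by (simp add: sum.cartesian_product)
  also have "\<dots> = (\<Sum>a\<in>K. p a * pexp J K p (\<lambda>x. f (x(j := a))))"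
    unfolding * pexp_def by (simp add: sum_distrib_left mult.assoc)
  finally show ?thesis .
qed

lemma rad_insert:
  assumes "finite J" "j \<notin> J"
  shows "rad (insert j J) f = (rad J (\<lambda>e. f (e(j := 1))) + rad J (\<lambda>e. f (e(j := -1)))) / 2"
  by (simp add: pexp_insert[OF assms])

lemma pexp_coord:
  assumes "finite I" "i \<in> I" "prob_weights K p"
  shows "pexp I K p (\<lambda>x. g (x i)) = (\<Sum>a\<in>K. p a * g a)"
proof -
  have I: "I = insert i (I - {i})" using assms by auto
  show ?thesis
    by (subst I, subst pexp_insert) (use assms in \<open>auto simp: pexp_const\<close>)
qed

text \<open>Nonnegativity of the variance.\<close>

lemma pexp_pow2_le:
  assumes "finite I" "prob_weights K p"
  shows "(pexp I K p f)\<^sup>2 \<le> pexp I K p (\<lambda>x. (f x)\<^sup>2)"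
proof -
  let ?m = "pexp I K p f"
  have "0 \<le> pexp I K p (\<lambda>x. (f x - ?m)\<^sup>2)"
    using pexp_mono[OF assms(2), of I "\<lambda>_. 0" "\<lambda>x. (f x - ?m)\<^sup>2"] assms by (simp add: pexp_const)
  also have "\<dots> = pexp I K p (\<lambda>x. (f x)\<^sup>2 + (?m\<^sup>2 - (2 * ?m) * f x))"
    by (intro pexp_cong) (simp add: power2_diff algebra_simps)
  also have "\<dots> = pexp I K p (\<lambda>x. (f x)\<^sup>2) - ?m\<^sup>2"
    unfolding pexp_add pexp_diff pexp_cmult pexp_const[OF assms]
    by (simp add: power2_eq_square)
  finally show ?thesis by simp
qed

lemma pexp_abs_le_sqrt:
  assumes "finite I" "prob_weights K p"
  shows "pexp I K p (\<lambda>x. \<bar>f x\<bar>) \<le> sqrt (pexp I K p (\<lambda>x. (f x)\<^sup>2))"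
  using pexp_pow2_le[OF assms, of "\<lambda>x. \<bar>f x\<bar>"] by (intro real_le_rsqrt) simp

lemma pexp_sqrt_le:
  assumes "finite I" "prob_weights K p" "\<And>x. x \<in> I \<rightarrow>\<^sub>E K \<Longrightarrow> f x \<ge> 0"
  shows "pexp I K p (\<lambda>x. sqrt (f x)) \<le> sqrt (pexp I K p f)"
proof -
  have "pexp I K p (\<lambda>x. sqrt (f x)) \<le> pexp I K p (\<lambda>x. \<bar>sqrt (f x)\<bar>)"
    by (intro pexp_mono assms) auto
  also have "\<dots> \<le> sqrt (pexp I K p (\<lambda>x. (sqrt (f x))\<^sup>2))" by (rule pexp_abs_le_sqrt[OF assms(1,2)])
  also have "pexp I K p (\<lambda>x. (sqrt (f x))\<^sup>2) = pexp I K p f" by (intro pexp_cong) (simp add: assms)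
  finally show ?thesis .
qed

lemma MAX_pexp_le:
  fixes f :: "'t \<Rightarrow> ('i \<Rightarrow> 'b) \<Rightarrow> real"
  assumes "finite T" "T \<noteq> {}" "prob_weights K p"
  shows "(MAX t\<in>T. pexp I K p (f t)) \<le> pexp I K p (\<lambda>x. MAX t\<in>T. f t x)"
  by (rule MAX_leI[OF assms(1,2)], rule pexp_mono[OF assms(3)], rule MAX_geI[OF assms(1)]) auto

lemma pexp_Un:
  assumes "finite I" "finite J" "I \<inter> J = {}"
  shows "pexp (I \<union> J) K p f = pexp I K p (\<lambda>x. pexp J K p (\<lambda>y. f (\<lambda>i. if i \<in> I then x i else y i)))"
  using assms(1,3)
proof (induction I arbitrary: f)
  case empty
  then show ?case by (simp add: pexp_def)
next
  case (insert i I)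
  have "pexp (insert i I \<union> J) K p f = pexp (insert i (I \<union> J)) K p f" by simp
  also have "\<dots> = (\<Sum>a\<in>K. p a * pexp (I \<union> J) K p (\<lambda>x. f (x(i := a))))"
    using insert assms(2) by (intro pexp_insert) auto
  also have "\<dots> = (\<Sum>a\<in>K. p a * pexp I K p (\<lambda>x. pexp J K p (\<lambda>y. f ((\<lambda>l. if l \<in> I then x l else y l)(i := a)))))"
    using insert by (intro sum.cong arg_cong2[of _ _ _ _ "(*)"] refl insert.IH) auto
  also have "\<dots> = pexp (insert i I) K p (\<lambda>x. pexp J K p (\<lambda>y. f (\<lambda>l. if l \<in> insert i I then x l else y l)))"
    unfolding pexp_insert[OF insert.hyps]
    by (intro sum.cong arg_cong2[of _ _ _ _ "(*)"] refl pexp_cong arg_cong[of _ _ f])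
       (use insert.hyps in \<open>auto simp: fun_eq_iff\<close>)
  finally show ?case .
qed

text \<open>Used in pairs: \<open>exch I B x y\<close> and \<open>exch I B y x\<close> together swap
  the coordinates in \<open>B\<close> between two samples. The restriction to \<open>I\<close> keeps
  them extensional.\<close>

definition exch :: "'i set \<Rightarrow> 'i set \<Rightarrow> ('i \<Rightarrow> 'b) \<Rightarrow> ('i \<Rightarrow> 'b) \<Rightarrow> 'i \<Rightarrow> 'b" where
  "exch I B x y = (\<lambda>i\<in>I. if i \<in> B then y i else x i)"

lemma exch_in: "x \<in> I \<rightarrow>\<^sub>E K \<Longrightarrow> y \<in> I \<rightarrow>\<^sub>E K \<Longrightarrow> exch I B x y \<in> I \<rightarrow>\<^sub>E K"
  by (auto simp: exch_def PiE_iff)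

lemma exch_exch: "x \<in> I \<rightarrow>\<^sub>E K \<Longrightarrow> y \<in> I \<rightarrow>\<^sub>E K \<Longrightarrow> exch I B (exch I B x y) (exch I B y x) = x"
  by (auto simp: exch_def PiE_iff fun_eq_iff extensional_def)

text \<open>Swapping coordinates is an involution on pairs of samples, and it preserves the product
  weight because it only interchanges the two factors belonging to an index.\<close>

lemma pexp_exch:
  assumes "finite I" "finite K"
  shows "pexp I K p (\<lambda>x. pexp I K p (\<lambda>y. F x y))
       = pexp I K p (\<lambda>x. pexp I K p (\<lambda>y. F (exch I B x y) (exch I B y x)))"
proof -
  let ?S = "(I \<rightarrow>\<^sub>E K) \<times> (I \<rightarrow>\<^sub>E K)"
  let ?w = "\<lambda>x. \<Prod>i\<in>I. p (x i)"
  let ?g = "\<lambda>(x, y). (exch I B x y, exch I B y x)"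
  have w: "?w (exch I B x y) * ?w (exch I B y x) = ?w x * ?w y" for x y
    unfolding prod.distrib[symmetric] by (intro prod.cong) (auto simp: exch_def)
  have flat: "pexp I K p (\<lambda>x. pexp I K p (\<lambda>y. H x y)) = (\<Sum>(x, y)\<in>?S. ?w x * ?w y * H x y)" for H
    unfolding pexp_def by (simp add: sum_distrib_left sum.cartesian_product[symmetric] mult.assoc)
  have "(\<Sum>(x, y)\<in>?S. ?w x * ?w y * F (exch I B x y) (exch I B y x)) = (\<Sum>(x, y)\<in>?S. ?w x * ?w y * F x y)"
    by (rule sum.reindex_bij_witness[of _ ?g ?g]) (auto simp: exch_exch w simp del: PiE_iff intro!: exch_in)
  then show ?thesis unfolding flat by simp
qed

lemma rad_uminus:
  assumes "finite J"
  shows "rad J (\<lambda>e. f (\<lambda>j\<in>J. - e j)) = rad J f"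
  unfolding pexp_def
  by (rule sum.reindex_bij_witness[of _ "\<lambda>e. \<lambda>j\<in>J. - e j" "\<lambda>e. \<lambda>j\<in>J. - e j"])
     (auto simp: PiE_iff fun_eq_iff extensional_def)

text \<open>The constant \<open>c\<close> is there for the induction: a removed sign turns it into
  \<open>c + x j\<close> or \<open>c - x j\<close>, and the mean of the two squares is
  \<open>c\<^sup>2 + (x j)\<^sup>2\<close>.\<close>

lemma rad_sq:
  assumes "finite J"
  shows "rad J (\<lambda>e. (c + (\<Sum>j\<in>J. e j * x j))\<^sup>2) = c\<^sup>2 + (\<Sum>j\<in>J. (x j)\<^sup>2)"
  using assms
proof (induction J arbitrary: c)
  case empty
  show ?case by (simp add: pexp_def)
next
  case (insert j J)
  have *: "(\<Sum>i\<in>insert j J. (e(j := s)) i * x i) = s * x j + (\<Sum>i\<in>J. e i * x i)" for e s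
  proof -
    have "(\<Sum>i\<in>J. (e(j := s)) i * x i) = (\<Sum>i\<in>J. e i * x i)" using insert by (intro sum.cong) auto
    then show ?thesis using insert by simp
  qed
  have "rad (insert j J) (\<lambda>e. (c + (\<Sum>i\<in>insert j J. e i * x i))\<^sup>2)
    = (rad J (\<lambda>e. ((c + x j) + (\<Sum>i\<in>J. e i * x i))\<^sup>2) + rad J (\<lambda>e. ((c - x j) + (\<Sum>i\<in>J. e i * x i))\<^sup>2)) / 2"
    unfolding rad_insert[OF insert.hyps] * by (simp add: algebra_simps)
  also have "\<dots> = c\<^sup>2 + (\<Sum>j\<in>insert j J. (x j)\<^sup>2)"
    unfolding insert.IH using insert.hyps by (simp add: power2_eq_square algebra_simps)
  finally show ?case .
qed

text \<open>The easy direction of Khintchine's inequality, from second moments, hence with constant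
  1.\<close>

lemma khintchine:
  assumes "finite J"
  shows "rad J (\<lambda>e. \<bar>\<Sum>j\<in>J. e j * x j\<bar>) \<le> sqrt (\<Sum>j\<in>J. (x j)\<^sup>2)"
  using pexp_abs_le_sqrt[OF assms prob_weights_rad, of "\<lambda>e. \<Sum>j\<in>J. e j * x j"] rad_sq[OF assms, of 0 x]
  by simp

text \<open>The comparison principle for Rademacher averages, for the contraction
  \<open>abs\<close>. Absolute values are removed one index at a time, and \<open>A\<close> absorbs
  the terms of indices already split off. For a single sign the two maxima are attained at some
  \<open>t1\<close> and \<open>t2\<close>, and
  \<open>\<bar>u t1 j\<bar> - \<bar>u t2 j\<bar>\<close> is at most \<open>u t1 j - u t2 j\<close>
  or its negative; the signs of the right-hand side realize both.\<close>

lemma contraction_abs: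
  fixes A :: "'t \<Rightarrow> real"
  assumes "finite J" "finite T" "T \<noteq> {}"
  shows "rad J (\<lambda>e. MAX t\<in>T. A t + (\<Sum>j\<in>J. e j * \<bar>u t j\<bar>)) \<le> rad J (\<lambda>e. MAX t\<in>T. A t + (\<Sum>j\<in>J. e j * u t j))"
  using assms(1)
proof (induction J arbitrary: A)
  case empty
  show ?case by simp
next
  case (insert j J)
  have *: "(\<Sum>i\<in>insert j J. (e(j := s)) i * v i) = s * v j + (\<Sum>i\<in>J. e i * v i)" for e s and v :: "_ \<Rightarrow> real"
  proof -
    have "(\<Sum>i\<in>J. (e(j := s)) i * v i) = (\<Sum>i\<in>J. e i * v i)" using insert by (intro sum.cong) auto
    then show ?thesis using insert by simp
  qed
  let ?S = "\<lambda>e t. \<Sum>i\<in>J. e i * u t i"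
  have two: "(MAX t\<in>T. (A t + \<bar>u t j\<bar>) + ?S e t) + (MAX t\<in>T. (A t - \<bar>u t j\<bar>) + ?S e t)
      \<le> (MAX t\<in>T. (A t + u t j) + ?S e t) + (MAX t\<in>T. (A t - u t j) + ?S e t)" for e
  proof -
    obtain t1 where t1: "t1 \<in> T" "(MAX t\<in>T. (A t + \<bar>u t j\<bar>) + ?S e t) = (A t1 + \<bar>u t1 j\<bar>) + ?S e t1"
      using MAX_attained[OF assms(2,3), of "\<lambda>t. (A t + \<bar>u t j\<bar>) + ?S e t"] by blast
    obtain t2 where t2: "t2 \<in> T" "(MAX t\<in>T. (A t - \<bar>u t j\<bar>) + ?S e t) = (A t2 - \<bar>u t2 j\<bar>) + ?S e t2"
      using MAX_attained[OF assms(2,3), of "\<lambda>t. (A t - \<bar>u t j\<bar>) + ?S e t"] by blast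
    have g: "(A t + u t j) + ?S e t \<le> (MAX t\<in>T. (A t + u t j) + ?S e t)"
            "(A t - u t j) + ?S e t \<le> (MAX t\<in>T. (A t - u t j) + ?S e t)" if "t \<in> T" for t
      using that by (auto intro!: MAX_geI[OF assms(2)])
    show ?thesis using t1 t2 g[OF t1(1)] g[OF t2(1)] by linarith
  qed
  have "rad (insert j J) (\<lambda>e. MAX t\<in>T. A t + (\<Sum>i\<in>insert j J. e i * \<bar>u t i\<bar>))
    = (rad J (\<lambda>e. MAX t\<in>T. (A t + \<bar>u t j\<bar>) + (\<Sum>i\<in>J. e i * \<bar>u t i\<bar>)) +
       rad J (\<lambda>e. MAX t\<in>T. (A t - \<bar>u t j\<bar>) + (\<Sum>i\<in>J. e i * \<bar>u t i\<bar>))) / 2"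
    unfolding rad_insert[OF insert.hyps] * by (simp add: algebra_simps)
  also have "\<dots> \<le> (rad J (\<lambda>e. MAX t\<in>T. (A t + \<bar>u t j\<bar>) + ?S e t) +
       rad J (\<lambda>e. MAX t\<in>T. (A t - \<bar>u t j\<bar>) + ?S e t)) / 2"
    using insert.IH[of "\<lambda>t. A t + \<bar>u t j\<bar>"] insert.IH[of "\<lambda>t. A t - \<bar>u t j\<bar>"] by simp
  also have "\<dots> \<le> (rad J (\<lambda>e. MAX t\<in>T. (A t + u t j) + ?S e t) +
       rad J (\<lambda>e. MAX t\<in>T. (A t - u t j) + ?S e t)) / 2"
    unfolding pexp_add[symmetric] by (intro divide_right_mono pexp_mono two) auto
  also have "\<dots> = rad (insert j J) (\<lambda>e. MAX t\<in>T. A t + (\<Sum>i\<in>insert j J. e i * u t i))"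
    unfolding rad_insert[OF insert.hyps] * by (simp add: algebra_simps)
  finally show ?case .
qed

text \<open>
  Symmetrization for independent blocks: the \<open>j\<close>-th summand depends on the coordinates in the
  block \<open>b -` {j}\<close> only, and exchanging a block with an independent copy flips its sign.
\<close>

lemma symmetrization:
  fixes h :: "'t \<Rightarrow> 'j \<Rightarrow> ('i \<Rightarrow> 'b) \<Rightarrow> real"
  assumes fin: "finite I" "finite J" "finite T" "T \<noteq> {}" and p: "prob_weights K p"
    and dep: "\<And>t j x y. j \<in> J \<Longrightarrow> (\<And>i. i \<in> I \<Longrightarrow> b i = j \<Longrightarrow> x i = y i) \<Longrightarrow> h t j x = h t j y"
  shows "pexp I K p (\<lambda>x. MAX t\<in>T. \<Sum>j\<in>J. (h t j x - pexp I K p (h t j)))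
      \<le> 2 * pexp I K p (\<lambda>x. rad J (\<lambda>e. MAX t\<in>T. \<Sum>j\<in>J. e j * h t j x))"
proof -
  let ?E = "pexp I K p"
  note KF = prob_weightsD(1)[OF p]
  have 1: "(MAX t\<in>T. \<Sum>j\<in>J. (h t j x - ?E (h t j))) \<le> ?E (\<lambda>y. MAX t\<in>T. \<Sum>j\<in>J. (h t j x - h t j y))" for x
  proof -
    have "(\<Sum>j\<in>J. (h t j x - ?E (h t j))) = ?E (\<lambda>y. \<Sum>j\<in>J. (h t j x - h t j y))" for t
      unfolding pexp_sum pexp_diff pexp_const[OF fin(1) p] ..
    then show ?thesis using MAX_pexp_le[OF fin(3,4) p] by simp
  qed
  have 2: "?E (\<lambda>x. ?E (\<lambda>y. MAX t\<in>T. \<Sum>j\<in>J. (h t j x - h t j y)))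
         = ?E (\<lambda>x. ?E (\<lambda>y. MAX t\<in>T. \<Sum>j\<in>J. e j * (h t j x - h t j y)))" if e: "e \<in> signs J" for e
  proof -
    let ?B = "{i. b i \<in> J \<and> e (b i) = -1}"
    have "h t j (exch I ?B x y) - h t j (exch I ?B y x) = e j * (h t j x - h t j y)" if j: "j \<in> J" for t j x y
    proof (cases "e j = 1")
      case True
      then have "h t j (exch I ?B x y) = h t j x" "h t j (exch I ?B y x) = h t j y"
        using j by (auto intro!: dep simp: exch_def)
      then show ?thesis using True by simp
    next
      case False
      then have m: "e j = -1" using signs_cases[OF e j] by auto
      then have "h t j (exch I ?B x y) = h t j y" "h t j (exch I ?B y x) = h t j x"
        using j by (auto intro!: dep simp: exch_def)
      then show ?thesis using m by simp
    qed
    then show ?thesis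
      by (subst pexp_exch[OF fin(1) KF, where B = ?B]) (simp cong: sum.cong)
  qed
  have "?E (\<lambda>x. MAX t\<in>T. \<Sum>j\<in>J. (h t j x - ?E (h t j)))
      \<le> ?E (\<lambda>x. ?E (\<lambda>y. MAX t\<in>T. \<Sum>j\<in>J. (h t j x - h t j y)))"
    by (rule pexp_mono[OF p 1])
  also have "\<dots> = rad J (\<lambda>e. ?E (\<lambda>x. ?E (\<lambda>y. MAX t\<in>T. \<Sum>j\<in>J. (h t j x - h t j y))))"
    by (simp add: pexp_const fin)
  also have "\<dots> = rad J (\<lambda>e. ?E (\<lambda>x. ?E (\<lambda>y. MAX t\<in>T. \<Sum>j\<in>J. e j * (h t j x - h t j y))))"
    by (intro pexp_cong 2) auto
  also have "\<dots> \<le> rad J (\<lambda>e. ?E (\<lambda>x. ?E (\<lambda>y. (MAX t\<in>T. \<Sum>j\<in>J. e j * h t j x)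
       + (MAX t\<in>T. \<Sum>j\<in>J. (\<lambda>j\<in>J. - e j) j * h t j y))))"
  proof (intro pexp_mono p prob_weights_rad)
    fix e x y
    have "(\<Sum>j\<in>J. e j * (h t j x - h t j y)) = (\<Sum>j\<in>J. e j * h t j x) + (\<Sum>j\<in>J. (\<lambda>j\<in>J. - e j) j * h t j y)" for t
      by (simp add: sum.distrib[symmetric] algebra_simps cong: sum.cong)
    then show "(MAX t\<in>T. \<Sum>j\<in>J. e j * (h t j x - h t j y)) \<le> (MAX t\<in>T. \<Sum>j\<in>J. e j * h t j x)
       + (MAX t\<in>T. \<Sum>j\<in>J. (\<lambda>j\<in>J. - e j) j * h t j y)"
      using MAX_add_le[OF fin(3,4)] by simp
  qed
  also have "\<dots> = ?E (\<lambda>x. rad J (\<lambda>e. MAX t\<in>T. \<Sum>j\<in>J. e j * h t j x))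
        + rad J (\<lambda>e. ?E (\<lambda>y. MAX t\<in>T. \<Sum>j\<in>J. (\<lambda>j\<in>J. - e j) j * h t j y))"
    unfolding pexp_add pexp_const[OF fin(1) p] by (simp add: pexp_swap[of J])
  also have "rad J (\<lambda>e. ?E (\<lambda>y. MAX t\<in>T. \<Sum>j\<in>J. (\<lambda>j\<in>J. - e j) j * h t j y))
     = rad J (\<lambda>e. ?E (\<lambda>y. MAX t\<in>T. \<Sum>j\<in>J. e j * h t j y))"
    by (rule rad_uminus[OF fin(2)])
  also have "\<dots> = ?E (\<lambda>x. rad J (\<lambda>e. MAX t\<in>T. \<Sum>j\<in>J. e j * h t j x))"
    by (rule pexp_swap)
  finally show ?thesis by simp
qed

section \<open>The cut norm of finite matrices and label counts\<close>

text \<open>The operator norm from l-infinity to l-1. The inner absolute values stand for the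
  optimal row signs, so this is the maximum of the bilinear form over pairs of sign vectors, which
  is equivalent to the matrix cut norm up to a factor 4.\<close>

definition infone :: "'a set \<Rightarrow> 'b set \<Rightarrow> ('a \<Rightarrow> 'b \<Rightarrow> real) \<Rightarrow> real" where
  "infone A B X = (MAX t\<in>signs B. \<Sum>a\<in>A. \<bar>\<Sum>b\<in>B. t b * X a b\<bar>)"

lemma infone_ge:
  assumes "finite B" "t \<in> signs B"
  shows "(\<Sum>a\<in>A. \<bar>\<Sum>b\<in>B. t b * X a b\<bar>) \<le> infone A B X"
  unfolding infone_def using assms by (intro MAX_geI) auto

lemma infone_cong:
  assumes "\<And>a b. a \<in> A \<Longrightarrow> b \<in> B \<Longrightarrow> X a b = Y a b"
  shows "infone A B X = infone A B Y"
  unfolding infone_def using assms by (simp cong: sum.cong)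

lemma sum_abs_signs:
  fixes c :: "'b \<Rightarrow> real"
  obtains t where "t \<in> signs B" "(\<Sum>b\<in>B. \<bar>c b\<bar>) = (\<Sum>b\<in>B. t b * c b)"
proof
  let ?t = "\<lambda>b\<in>B. if c b \<ge> 0 then 1 else -1::real"
  show "?t \<in> signs B" by (auto simp: PiE_iff)
  show "(\<Sum>b\<in>B. \<bar>c b\<bar>) = (\<Sum>b\<in>B. ?t b * c b)" by (intro sum.cong) auto
qed

lemma sum_mult_le_sum_abs:
  fixes c t :: "'b \<Rightarrow> real"
  assumes "\<And>b. b \<in> B \<Longrightarrow> \<bar>t b\<bar> \<le> 1"
  shows "(\<Sum>b\<in>B. t b * c b) \<le> (\<Sum>b\<in>B. \<bar>c b\<bar>)"
proof (rule sum_mono)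
  fix b assume "b \<in> B"
  then have "\<bar>t b\<bar> * \<bar>c b\<bar> \<le> 1 * \<bar>c b\<bar>" using assms by (intro mult_right_mono) auto
  then show "t b * c b \<le> \<bar>c b\<bar>" using abs_ge_self[of "t b * c b"] by (simp add: abs_mult)
qed

text \<open>The form is linear in each argument separately, so the columns and then the rows can be
  rounded to signs without decreasing it.\<close>

lemma bilinear_le_infone:
  assumes "finite B" "\<And>a. a \<in> A \<Longrightarrow> \<bar>s a\<bar> \<le> 1" "\<And>b. b \<in> B \<Longrightarrow> \<bar>t b\<bar> \<le> 1"
  shows "(\<Sum>a\<in>A. \<Sum>b\<in>B. s a * t b * X a b) \<le> infone A B X"
proof -
  have "(\<Sum>a\<in>A. \<Sum>b\<in>B. s a * t b * X a b) = (\<Sum>b\<in>B. t b * (\<Sum>a\<in>A. s a * X a b))"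
    by (subst sum.swap) (simp add: sum_distrib_left mult_ac)
  also have "\<dots> \<le> (\<Sum>b\<in>B. \<bar>\<Sum>a\<in>A. s a * X a b\<bar>)" by (rule sum_mult_le_sum_abs[OF assms(3)])
  also obtain t' where t': "t' \<in> signs B"
    "(\<Sum>b\<in>B. \<bar>\<Sum>a\<in>A. s a * X a b\<bar>) = (\<Sum>b\<in>B. t' b * (\<Sum>a\<in>A. s a * X a b))" by (rule sum_abs_signs)
  note t'(2)
  also have "(\<Sum>b\<in>B. t' b * (\<Sum>a\<in>A. s a * X a b)) = (\<Sum>a\<in>A. s a * (\<Sum>b\<in>B. t' b * X a b))"
    unfolding sum_distrib_left by (subst sum.swap) (simp add: mult_ac)
  also have "\<dots> \<le> (\<Sum>a\<in>A. \<bar>\<Sum>b\<in>B. t' b * X a b\<bar>)" by (rule sum_mult_le_sum_abs[OF assms(2)])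
  also have "\<dots> \<le> infone A B X" by (rule infone_ge[OF assms(1) t'(1)])
  finally show ?thesis .
qed

lemma infone_attained:
  assumes "finite B"
  obtains s t where "s \<in> signs A" "t \<in> signs B" "infone A B X = (\<Sum>a\<in>A. \<Sum>b\<in>B. s a * t b * X a b)"
proof -
  obtain t where t: "t \<in> signs B" "infone A B X = (\<Sum>a\<in>A. \<bar>\<Sum>b\<in>B. t b * X a b\<bar>)"
    unfolding infone_def
    using MAX_attained[OF finite_signs[OF assms] signs_nonempty, of "\<lambda>t. \<Sum>a\<in>A. \<bar>\<Sum>b\<in>B. t b * X a b\<bar>"] by blast
  obtain s where s: "s \<in> signs A"
    "(\<Sum>a\<in>A. \<bar>\<Sum>b\<in>B. t b * X a b\<bar>) = (\<Sum>a\<in>A. s a * (\<Sum>b\<in>B. t b * X a b))" by (rule sum_abs_signs)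
  show ?thesis
    by (rule that[OF s(1) t(1)]) (simp add: t(2) s(2) sum_distrib_left mult_ac)
qed

lemma infone_leI:
  assumes "finite B" "\<And>s t. s \<in> signs A \<Longrightarrow> t \<in> signs B \<Longrightarrow> (\<Sum>a\<in>A. \<Sum>b\<in>B. s a * t b * X a b) \<le> c"
  shows "infone A B X \<le> c"
proof -
  obtain s t where "s \<in> signs A" "t \<in> signs B" "infone A B X = (\<Sum>a\<in>A. \<Sum>b\<in>B. s a * t b * X a b)"
    by (rule infone_attained[OF assms(1)])
  then show ?thesis using assms(2) by simp
qed

lemma infone_nonneg: "finite B \<Longrightarrow> infone A B X \<ge> 0"
  using bilinear_le_infone[of B A "\<lambda>_. 0" "\<lambda>_. 0" X] by simp

lemma infone_transpose_le:
  assumes "finite A" "finite B"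
  shows "infone A B X \<le> infone B A (\<lambda>b a. X a b)"
proof (rule infone_leI[OF assms(2)])
  fix s t assume st: "s \<in> signs A" "t \<in> signs B"
  have "(\<Sum>a\<in>A. \<Sum>b\<in>B. s a * t b * X a b) = (\<Sum>b\<in>B. \<Sum>a\<in>A. t b * s a * X a b)"
    by (subst sum.swap) (simp add: mult_ac)
  also have "\<dots> \<le> infone B A (\<lambda>b a. X a b)"
    by (rule bilinear_le_infone[OF assms(1)]) (use st in \<open>auto simp: signs_abs\<close>)
  finally show "(\<Sum>a\<in>A. \<Sum>b\<in>B. s a * t b * X a b) \<le> infone B A (\<lambda>b a. X a b)" .
qed

lemma infone_transpose:
  assumes "finite A" "finite B"
  shows "infone A B X = infone B A (\<lambda>b a. X a b)"
  using infone_transpose_le[OF assms, of X] infone_transpose_le[OF assms(2,1), of "\<lambda>b a. X a b"] by simp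

text \<open>The quotients \<open>S a / \<mu> a\<close> and \<open>T b / \<nu> b\<close> lie in the
  unit interval around 0 and can play the role of signs.\<close>

lemma weighted_bilinear_le_infone:
  assumes "finite B" "\<And>a. a \<in> A \<Longrightarrow> \<bar>S a\<bar> \<le> \<mu> a" "\<And>b. b \<in> B \<Longrightarrow> \<bar>T b\<bar> \<le> \<nu> b"
  shows "(\<Sum>a\<in>A. \<Sum>b\<in>B. S a * T b * X a b) \<le> infone A B (\<lambda>a b. \<mu> a * \<nu> b * X a b)"
proof -
  \<comment> \<open>For \<open>m = 0\<close> the bound forces \<open>c = 0\<close>, and division by
    zero returns 0, so vanishing weights fit in.\<close>
  have q: "c / m * m = c" "\<bar>c / m\<bar> \<le> 1" if "\<bar>c\<bar> \<le> m" for c m :: real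
    using that by (auto simp: divide_le_eq_1)
  have "(\<Sum>a\<in>A. \<Sum>b\<in>B. S a * T b * X a b)
      = (\<Sum>a\<in>A. \<Sum>b\<in>B. (S a / \<mu> a) * (T b / \<nu> b) * (\<mu> a * \<nu> b * X a b))"
  proof (intro sum.cong refl)
    fix a b assume ab: "a \<in> A" "b \<in> B"
    have "(S a / \<mu> a) * (T b / \<nu> b) * (\<mu> a * \<nu> b * X a b)
        = (S a / \<mu> a * \<mu> a) * (T b / \<nu> b * \<nu> b) * X a b" by (simp only: mult_ac)
    then show "S a * T b * X a b = (S a / \<mu> a) * (T b / \<nu> b) * (\<mu> a * \<nu> b * X a b)"
      using q(1)[OF assms(2)[OF ab(1)]] q(1)[OF assms(3)[OF ab(2)]] by simp
  qed
  also have "\<dots> \<le> infone A B (\<lambda>a b. \<mu> a * \<nu> b * X a b)"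
    by (rule bilinear_le_infone[OF assms(1)]) (rule q(2), erule assms)+
  finally show ?thesis .
qed

text \<open>The entries may have any sign, yet shrinking weights cannot increase the norm: the ratio
  of small to large weight is absorbed into the sign vectors.\<close>

lemma infone_mono_weights:
  assumes "finite B" "\<And>a. a \<in> A \<Longrightarrow> \<bar>\<mu> a\<bar> \<le> \<mu>' a" "\<And>b. b \<in> B \<Longrightarrow> \<bar>\<nu> b\<bar> \<le> \<nu>' b"
  shows "infone A B (\<lambda>a b. \<mu> a * \<nu> b * X a b) \<le> infone A B (\<lambda>a b. \<mu>' a * \<nu>' b * X a b)"
proof (rule infone_leI[OF assms(1)])
  fix s t assume st: "s \<in> signs A" "t \<in> signs B"
  have "(\<Sum>a\<in>A. \<Sum>b\<in>B. s a * t b * (\<mu> a * \<nu> b * X a b)) = (\<Sum>a\<in>A. \<Sum>b\<in>B. (s a * \<mu> a) * (t b * \<nu> b) * X a b)"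
    by (simp add: mult_ac)
  also have "\<dots> \<le> infone A B (\<lambda>a b. \<mu>' a * \<nu>' b * X a b)"
    by (rule weighted_bilinear_le_infone[OF assms(1)]) (use st assms(2,3) in \<open>auto simp: abs_mult signs_abs\<close>)
  finally show "(\<Sum>a\<in>A. \<Sum>b\<in>B. s a * t b * (\<mu> a * \<nu> b * X a b)) \<le> infone A B (\<lambda>a b. \<mu>' a * \<nu>' b * X a b)" .
qed

lemma infone_add_le:
  assumes "finite B"
  shows "infone A B (\<lambda>a b. X a b + Y a b) \<le> infone A B X + infone A B Y"
proof (rule infone_leI[OF assms(1)])
  fix s t assume st: "s \<in> signs A" "t \<in> signs B"
  have "(\<Sum>a\<in>A. \<Sum>b\<in>B. s a * t b * (X a b + Y a b))
      = (\<Sum>a\<in>A. \<Sum>b\<in>B. s a * t b * X a b) + (\<Sum>a\<in>A. \<Sum>b\<in>B. s a * t b * Y a b)"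
    by (simp add: sum.distrib algebra_simps)
  also have "\<dots> \<le> infone A B X + infone A B Y"
    by (intro add_mono bilinear_le_infone[OF assms(1)]) (use st in \<open>auto simp: signs_abs\<close>)
  finally show "(\<Sum>a\<in>A. \<Sum>b\<in>B. s a * t b * (X a b + Y a b)) \<le> infone A B X + infone A B Y" .
qed

lemma infone_cmult:
  assumes "finite B" "c \<ge> 0"
  shows "infone A B (\<lambda>a b. c * X a b) = c * infone A B X"
proof -
  have "(\<Sum>b\<in>B. t b * (c * X a b)) = c * (\<Sum>b\<in>B. t b * X a b)" for t :: "_ \<Rightarrow> real" and a
    by (simp add: sum_distrib_left mult_ac)
  then have "infone A B (\<lambda>a b. c * X a b) = (MAX t\<in>signs B. c * (\<Sum>a\<in>A. \<bar>\<Sum>b\<in>B. t b * X a b\<bar>))"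
    unfolding infone_def using assms(2) by (simp only: abs_mult sum_distrib_left[symmetric] abs_of_nonneg)
  also have "\<dots> = c * infone A B X"
    unfolding infone_def by (rule MAX_cmult) (use assms in auto)
  finally show ?thesis .
qed

lemma infone_le_sum_abs:
  assumes "finite B"
  shows "infone A B X \<le> (\<Sum>a\<in>A. \<Sum>b\<in>B. \<bar>X a b\<bar>)"
proof (rule infone_leI[OF assms(1)])
  fix s t assume st: "s \<in> signs A" "t \<in> signs B"
  have "s a * t b * X a b \<le> \<bar>X a b\<bar>" if "a \<in> A" "b \<in> B" for a b
    using abs_ge_self[of "s a * t b * X a b"] st that by (simp add: abs_mult signs_abs)
  then show "(\<Sum>a\<in>A. \<Sum>b\<in>B. s a * t b * X a b) \<le> (\<Sum>a\<in>A. \<Sum>b\<in>B. \<bar>X a b\<bar>)"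
    by (intro sum_mono) auto
qed

section \<open>Label counts and expected cut norms of count matrices\<close>

definition cnt :: "'i set \<Rightarrow> ('i \<Rightarrow> 'b) \<Rightarrow> 'b \<Rightarrow> real" where
  "cnt I x a = real (card {i \<in> I. x i = a})"

lemma cnt_nonneg [simp]: "cnt I x a \<ge> 0" by (simp add: cnt_def)

lemma cnt_cong: "(\<And>i. i \<in> I \<Longrightarrow> x i = y i) \<Longrightarrow> cnt I x a = cnt I y a"
  unfolding cnt_def by (metis (mono_tags, lifting) Collect_cong)

lemma cnt_sum:
  fixes f :: "'b \<Rightarrow> real"
  assumes "finite I" "finite K" "\<And>i. i \<in> I \<Longrightarrow> x i \<in> K"
  shows "(\<Sum>a\<in>K. cnt I x a * f a) = (\<Sum>i\<in>I. f (x i))"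
proof -
  have "(\<Sum>i\<in>I. f (x i)) = (\<Sum>a\<in>K. \<Sum>i\<in>{i\<in>I. x i = a}. f (x i))"
    by (rule sum.group[symmetric]) (use assms in auto)
  also have "\<dots> = (\<Sum>a\<in>K. cnt I x a * f a)"
    by (intro sum.cong refl) (simp add: cnt_def)
  finally show ?thesis by simp
qed

lemma cnt_sum_1:
  assumes "finite I" "finite K" "\<And>i. i \<in> I \<Longrightarrow> x i \<in> K"
  shows "(\<Sum>a\<in>K. cnt I x a) = card I"
  using cnt_sum[OF assms, where f = "\<lambda>_. 1"] by simp

text \<open>A row enters through an absolute value, which is homogeneous; weighting it by a count is
  the same as repeating it that many times.\<close>

lemma infone_cnt:
  assumes "finite I" "finite K" "finite B" "\<And>i. i \<in> I \<Longrightarrow> x i \<in> K"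
  shows "infone K B (\<lambda>a b. cnt I x a * Y a b) = infone I B (\<lambda>i b. Y (x i) b)"
proof -
  have "(\<Sum>a\<in>K. \<bar>\<Sum>b\<in>B. t b * (cnt I x a * Y a b)\<bar>) = (\<Sum>i\<in>I. \<bar>\<Sum>b\<in>B. t b * Y (x i) b\<bar>)" for t :: "_ \<Rightarrow> real"
  proof -
    have "(\<Sum>b\<in>B. t b * (cnt I x a * Y a b)) = cnt I x a * (\<Sum>b\<in>B. t b * Y a b)" for a
      by (simp add: sum_distrib_left mult_ac)
    then have "(\<Sum>a\<in>K. \<bar>\<Sum>b\<in>B. t b * (cnt I x a * Y a b)\<bar>) = (\<Sum>a\<in>K. cnt I x a * \<bar>\<Sum>b\<in>B. t b * Y a b\<bar>)"
      by (simp add: abs_mult)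
    then show ?thesis using cnt_sum[OF assms(1,2,4), where f = "\<lambda>a. \<bar>\<Sum>b\<in>B. t b * Y a b\<bar>"] by simp
  qed
  then show ?thesis unfolding infone_def by simp
qed

text \<open>For fixed column signs the sum over rows has independent terms, and its mean is covered
  by the first summand. The supremum of the fluctuation is symmetrized; contraction then removes the
  absolute values, after which the column signs can be optimized separately in each column and
  \<open>khintchine\<close> gives the square roots.\<close>

lemma sampled_rows:
  assumes fin: "finite I" "finite B" and p: "prob_weights K p"
  shows "pexp I K p (\<lambda>x. infone I B (\<lambda>i b. y (x i) b))
    \<le> card I * infone K B (\<lambda>a b. p a * y a b) + 2 * pexp I K p (\<lambda>x. \<Sum>b\<in>B. sqrt (\<Sum>i\<in>I. (y (x i) b)\<^sup>2))"
proof -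
  let ?g = "\<lambda>t a. \<Sum>b\<in>B. t b * y a b"
  let ?E = "pexp I K p"
  let ?T = "signs B"
  have T: "finite ?T" "?T \<noteq> {}" using fin by auto
  have E: "?E (\<lambda>x. \<bar>?g t (x i)\<bar>) = (\<Sum>a\<in>K. p a * \<bar>?g t a\<bar>)" if "i \<in> I" for i t
    by (rule pexp_coord[OF fin(1) that p])
  have M: "(\<Sum>a\<in>K. p a * \<bar>?g t a\<bar>) \<le> infone K B (\<lambda>a b. p a * y a b)" if "t \<in> ?T" for t
  proof -
    have "(\<Sum>a\<in>K. p a * \<bar>?g t a\<bar>) = (\<Sum>a\<in>K. \<bar>\<Sum>b\<in>B. t b * (p a * y a b)\<bar>)"
    proof (intro sum.cong refl)
      fix a assume "a \<in> K"
      have "(\<Sum>b\<in>B. t b * (p a * y a b)) = p a * ?g t a" by (simp add: sum_distrib_left mult_ac)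
      then show "p a * \<bar>?g t a\<bar> = \<bar>\<Sum>b\<in>B. t b * (p a * y a b)\<bar>"
        using prob_weightsD(2)[OF p \<open>a \<in> K\<close>] by (simp add: abs_mult)
    qed
    also have "\<dots> \<le> infone K B (\<lambda>a b. p a * y a b)" by (rule infone_ge[OF fin(2) that])
    finally show ?thesis .
  qed
  have "?E (\<lambda>x. infone I B (\<lambda>i b. y (x i) b))
     \<le> ?E (\<lambda>x. (MAX t\<in>?T. \<Sum>i\<in>I. (\<bar>?g t (x i)\<bar> - ?E (\<lambda>x. \<bar>?g t (x i)\<bar>))) + card I * infone K B (\<lambda>a b. p a * y a b))"
  proof (intro pexp_mono p)
    fix x
    have "infone I B (\<lambda>i b. y (x i) b) \<le> (MAX t\<in>?T. (\<Sum>i\<in>I. (\<bar>?g t (x i)\<bar> - ?E (\<lambda>x. \<bar>?g t (x i)\<bar>)))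
        + card I * infone K B (\<lambda>a b. p a * y a b))"
      unfolding infone_def[of I]
    proof (rule MAX_mono[OF T])
      fix t assume t: "t \<in> ?T"
      have "(\<Sum>i\<in>I. ?E (\<lambda>x. \<bar>?g t (x i)\<bar>)) = card I * (\<Sum>a\<in>K. p a * \<bar>?g t a\<bar>)" using E by simp
      also have "\<dots> \<le> card I * infone K B (\<lambda>a b. p a * y a b)" by (intro mult_left_mono M t) auto
      finally show "(\<Sum>i\<in>I. \<bar>?g t (x i)\<bar>) \<le> (\<Sum>i\<in>I. (\<bar>?g t (x i)\<bar> - ?E (\<lambda>x. \<bar>?g t (x i)\<bar>)))
        + card I * infone K B (\<lambda>a b. p a * y a b)" by (simp add: sum_subtractf)
    qed
    also have "\<dots> \<le> (MAX t\<in>?T. (\<Sum>i\<in>I. (\<bar>?g t (x i)\<bar> - ?E (\<lambda>x. \<bar>?g t (x i)\<bar>))))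
        + (MAX t\<in>?T. card I * infone K B (\<lambda>a b. p a * y a b))" by (rule MAX_add_le[OF T])
    finally show "infone I B (\<lambda>i b. y (x i) b) \<le> (MAX t\<in>?T. (\<Sum>i\<in>I. (\<bar>?g t (x i)\<bar> - ?E (\<lambda>x. \<bar>?g t (x i)\<bar>))))
        + card I * infone K B (\<lambda>a b. p a * y a b)" using T by simp
  qed
  also have "\<dots> = ?E (\<lambda>x. (MAX t\<in>?T. \<Sum>i\<in>I. (\<bar>?g t (x i)\<bar> - ?E (\<lambda>x. \<bar>?g t (x i)\<bar>))))
     + card I * infone K B (\<lambda>a b. p a * y a b)"
    by (simp add: pexp_add pexp_const[OF fin(1) p])
  also have "?E (\<lambda>x. (MAX t\<in>?T. \<Sum>i\<in>I. (\<bar>?g t (x i)\<bar> - ?E (\<lambda>x. \<bar>?g t (x i)\<bar>))))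
     \<le> 2 * ?E (\<lambda>x. rad I (\<lambda>e. MAX t\<in>?T. \<Sum>i\<in>I. e i * \<bar>?g t (x i)\<bar>))"
    by (rule symmetrization[OF fin(1) fin(1) T p, where b = "\<lambda>i. i" and h = "\<lambda>t i x. \<bar>?g t (x i)\<bar>"]) simp
  also have "?E (\<lambda>x. rad I (\<lambda>e. MAX t\<in>?T. \<Sum>i\<in>I. e i * \<bar>?g t (x i)\<bar>)) \<le> ?E (\<lambda>x. \<Sum>b\<in>B. sqrt (\<Sum>i\<in>I. (y (x i) b)\<^sup>2))"
  proof (rule pexp_mono[OF p])
    fix x
    have "rad I (\<lambda>e. MAX t\<in>?T. \<Sum>i\<in>I. e i * \<bar>?g t (x i)\<bar>) \<le> rad I (\<lambda>e. MAX t\<in>?T. \<Sum>i\<in>I. e i * ?g t (x i))"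
      using contraction_abs[OF fin(1) T, of "\<lambda>_. 0" "\<lambda>t i. ?g t (x i)"] by simp
    also have "\<dots> \<le> rad I (\<lambda>e. \<Sum>b\<in>B. \<bar>\<Sum>i\<in>I. e i * y (x i) b\<bar>)"
    proof (intro pexp_mono prob_weights_rad MAX_leI T)
      fix e t assume t: "t \<in> ?T"
      have "(\<Sum>i\<in>I. e i * ?g t (x i)) = (\<Sum>b\<in>B. t b * (\<Sum>i\<in>I. e i * y (x i) b))"
        unfolding sum_distrib_left by (subst sum.swap) (simp add: mult_ac)
      also have "\<dots> \<le> (\<Sum>b\<in>B. \<bar>\<Sum>i\<in>I. e i * y (x i) b\<bar>)"
        by (rule sum_mult_le_sum_abs) (use t in \<open>auto simp: signs_abs\<close>)
      finally show "(\<Sum>i\<in>I. e i * ?g t (x i)) \<le> (\<Sum>b\<in>B. \<bar>\<Sum>i\<in>I. e i * y (x i) b\<bar>)" .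
    qed
    also have "\<dots> \<le> (\<Sum>b\<in>B. sqrt (\<Sum>i\<in>I. (y (x i) b)\<^sup>2))"
      unfolding pexp_sum by (intro sum_mono khintchine fin)
    finally show "rad I (\<lambda>e. MAX t\<in>?T. \<Sum>i\<in>I. e i * \<bar>?g t (x i)\<bar>) \<le> (\<Sum>b\<in>B. sqrt (\<Sum>i\<in>I. (y (x i) b)\<^sup>2))" .
  qed
  finally show ?thesis by simp
qed

lemma sampled_count_rows:
  assumes fin: "finite I" "finite B" and p: "prob_weights K p"
    and Y: "\<And>a b. a \<in> K \<Longrightarrow> b \<in> B \<Longrightarrow> \<bar>Y a b\<bar> \<le> v b"
  shows "pexp I K p (\<lambda>x. infone K B (\<lambda>a b. cnt I x a * Y a b))
    \<le> card I * infone K B (\<lambda>a b. p a * Y a b) + 2 * sqrt (card I) * sum v B"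
proof -
  note KF = prob_weightsD(1)[OF p]
  have "pexp I K p (\<lambda>x. infone K B (\<lambda>a b. cnt I x a * Y a b)) = pexp I K p (\<lambda>x. infone I B (\<lambda>i b. Y (x i) b))"
    by (intro pexp_cong infone_cnt fin KF) auto
  also have "\<dots> \<le> card I * infone K B (\<lambda>a b. p a * Y a b) + 2 * pexp I K p (\<lambda>x. \<Sum>b\<in>B. sqrt (\<Sum>i\<in>I. (Y (x i) b)\<^sup>2))"
    by (rule sampled_rows[OF fin p])
  also have "pexp I K p (\<lambda>x. \<Sum>b\<in>B. sqrt (\<Sum>i\<in>I. (Y (x i) b)\<^sup>2)) \<le> pexp I K p (\<lambda>x. \<Sum>b\<in>B. sqrt (card I) * v b)"
  proof (intro pexp_mono p sum_mono)
    fix x b assume x: "x \<in> I \<rightarrow>\<^sub>E K" and b: "b \<in> B"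
    obtain a where a: "a \<in> K" using prob_weightsD(4)[OF p] by blast
    then have v: "v b \<ge> 0" using Y[OF a b] by linarith
    have "(\<Sum>i\<in>I. (Y (x i) b)\<^sup>2) \<le> (\<Sum>i\<in>I. (v b)\<^sup>2)"
    proof (rule sum_mono)
      fix i assume "i \<in> I"
      then have "\<bar>Y (x i) b\<bar> \<le> \<bar>v b\<bar>" using Y[OF PiE_mem[OF x \<open>i \<in> I\<close>] b] v by simp
      then show "(Y (x i) b)\<^sup>2 \<le> (v b)\<^sup>2" by (simp add: abs_le_square_iff)
    qed
    then have "sqrt (\<Sum>i\<in>I. (Y (x i) b)\<^sup>2) \<le> sqrt (card I * (v b)\<^sup>2)" by simp
    then show "sqrt (\<Sum>i\<in>I. (Y (x i) b)\<^sup>2) \<le> sqrt (card I) * v b" using v by (simp add: real_sqrt_mult)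
  qed
  also have "\<dots> = sqrt (card I) * sum v B"
    by (simp add: pexp_const[OF fin(1) p] sum_distrib_left)
  finally show ?thesis by simp
qed

text \<open>Inequality of arithmetic and geometric means. It makes the square root of a count linear
  in the count; \<open>c\<close> is to be chosen as the typical size of the root.\<close>

lemma sqrt_le_weighted_mean:
  fixes c :: real
  assumes "c > 0" "N \<ge> 0"
  shows "sqrt N \<le> (N / c + c) / 2"
proof -
  have "0 \<le> (sqrt N - c)\<^sup>2" by simp
  also have "(sqrt N - c)\<^sup>2 = N + c * c - 2 * c * sqrt N"
    using assms by (simp add: power2_diff power2_eq_square[of c])
  finally show ?thesis using assms by (simp add: field_simps)
qed

lemma sum_of_bool_sq:
  assumes "finite I"
  shows "(\<Sum>i\<in>I. (of_bool (P i) :: real)\<^sup>2) = card {i\<in>I. P i}"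
proof -
  have "(\<Sum>i\<in>I. (of_bool (P i) :: real)\<^sup>2) = (\<Sum>i\<in>{i\<in>I. P i}. 1)"
    by (rule sum.mono_neutral_cong_right) (use assms in auto)
  then show ?thesis by simp
qed

text \<open>The labels are frozen here. The mean of
  \<open>\<bar>sum e {i\<in>I. x i = a}\<bar>\<close> is at most the root of the count; the
  fluctuation around the mean is symmetrized once more, with one new sign \<open>\<eta> a\<close>
  per label.\<close>

lemma block_sums:
  assumes fin: "finite I" "finite B" "finite K" and x: "\<And>i. i \<in> I \<Longrightarrow> x i \<in> K"
    and Y: "\<And>a b. a \<in> K \<Longrightarrow> b \<in> B \<Longrightarrow> \<bar>Y a b\<bar> \<le> v b" and v: "\<And>b. b \<in> B \<Longrightarrow> v b \<ge> 0"
  shows "rad I (\<lambda>e. MAX t\<in>signs B. \<Sum>a\<in>K. \<bar>sum e {i\<in>I. x i = a}\<bar> * \<bar>\<Sum>b\<in>B. t b * Y a b\<bar>)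
    \<le> (MAX t\<in>signs B. \<Sum>a\<in>K. sqrt (cnt I x a) * \<bar>\<Sum>b\<in>B. t b * Y a b\<bar>) + 2 * sqrt (card I) * sum v B"
proof -
  let ?g = "\<lambda>t a. \<Sum>b\<in>B. t b * Y a b"
  let ?Z = "\<lambda>e a. sum e {i\<in>I. x i = a} :: real"
  let ?T = "signs B"
  let ?h = "\<lambda>t a e. \<bar>?Z e a\<bar> * \<bar>?g t a\<bar>"
  have T: "finite ?T" "?T \<noteq> {}" using fin by auto
  have Zsq: "rad I (\<lambda>e. (?Z e a)\<^sup>2) = cnt I x a" for a
  proof -
    have "(\<Sum>i\<in>I. e i * of_bool (x i = a)) = ?Z e a" for e :: "_ \<Rightarrow> real"
      using fin(1) by (intro sum.mono_neutral_cong_right) auto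
    moreover have "(\<Sum>i\<in>I. (of_bool (x i = a))\<^sup>2) = cnt I x a"
      using fin(1) by (simp add: cnt_def sum_of_bool_sq)
    ultimately show ?thesis using rad_sq[OF fin(1), of 0 "\<lambda>i. of_bool (x i = a)"] by simp
  qed
  have Eh: "rad I (?h t a) \<le> sqrt (cnt I x a) * \<bar>?g t a\<bar>" for t a
    unfolding pexp_cmult_right Zsq[symmetric]
    by (intro mult_right_mono pexp_abs_le_sqrt fin) auto
  have "rad I (\<lambda>e. MAX t\<in>?T. \<Sum>a\<in>K. ?h t a e)
     \<le> rad I (\<lambda>e. (MAX t\<in>?T. \<Sum>a\<in>K. (?h t a e - rad I (?h t a)))
        + (MAX t\<in>?T. \<Sum>a\<in>K. sqrt (cnt I x a) * \<bar>?g t a\<bar>))"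
  proof (intro pexp_mono prob_weights_rad)
    fix e
    have "(MAX t\<in>?T. \<Sum>a\<in>K. ?h t a e)
       \<le> (MAX t\<in>?T. (\<Sum>a\<in>K. (?h t a e - rad I (?h t a))) + (\<Sum>a\<in>K. sqrt (cnt I x a) * \<bar>?g t a\<bar>))"
    proof (rule MAX_mono[OF T])
      fix t
      have "(\<Sum>a\<in>K. rad I (?h t a)) \<le> (\<Sum>a\<in>K. sqrt (cnt I x a) * \<bar>?g t a\<bar>)" by (intro sum_mono Eh)
      then show "(\<Sum>a\<in>K. ?h t a e) \<le> (\<Sum>a\<in>K. (?h t a e - rad I (?h t a))) + (\<Sum>a\<in>K. sqrt (cnt I x a) * \<bar>?g t a\<bar>)"
        by (simp add: sum_subtractf)
    qed
    also note MAX_add_le[OF T]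
    finally show "(MAX t\<in>?T. \<Sum>a\<in>K. ?h t a e) \<le> (MAX t\<in>?T. \<Sum>a\<in>K. (?h t a e - rad I (?h t a)))
        + (MAX t\<in>?T. \<Sum>a\<in>K. sqrt (cnt I x a) * \<bar>?g t a\<bar>)" .
  qed
  also have "\<dots> = rad I (\<lambda>e. (MAX t\<in>?T. \<Sum>a\<in>K. (?h t a e - rad I (?h t a))))
        + (MAX t\<in>?T. \<Sum>a\<in>K. sqrt (cnt I x a) * \<bar>?g t a\<bar>)"
    unfolding pexp_add by (simp add: pexp_const[OF fin(1)])
  \<comment> \<open>The blocks of \<open>symmetrization\<close> are the label classes:
    \<open>?h t a\<close> involves only the signs at indices labelled \<open>a\<close>.\<close>
  also have "rad I (\<lambda>e. (MAX t\<in>?T. \<Sum>a\<in>K. (?h t a e - rad I (?h t a))))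
     \<le> 2 * rad I (\<lambda>e. rad K (\<lambda>\<eta>. MAX t\<in>?T. \<Sum>a\<in>K. \<eta> a * ?h t a e))"
    by (rule symmetrization[OF fin(1,3) T prob_weights_rad, where b = x])
      (intro arg_cong2[of _ _ _ _ "(*)"] arg_cong[of _ _ abs] sum.cong refl, auto)
  also have "rad I (\<lambda>e. rad K (\<lambda>\<eta>. MAX t\<in>?T. \<Sum>a\<in>K. \<eta> a * ?h t a e)) \<le> rad I (\<lambda>e. sum v B * sqrt (\<Sum>a\<in>K. (?Z e a)\<^sup>2))"
  proof (rule pexp_mono[OF prob_weights_rad])
    fix e
    have "rad K (\<lambda>\<eta>. MAX t\<in>?T. \<Sum>a\<in>K. \<eta> a * ?h t a e) \<le> rad K (\<lambda>\<eta>. MAX t\<in>?T. \<Sum>a\<in>K. \<eta> a * (?Z e a * ?g t a))"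
      using contraction_abs[OF fin(3) T, of "\<lambda>_. 0" "\<lambda>t a. ?Z e a * ?g t a"] by (simp add: abs_mult)
    also have "\<dots> \<le> rad K (\<lambda>\<eta>. \<Sum>b\<in>B. \<bar>\<Sum>a\<in>K. \<eta> a * (?Z e a * Y a b)\<bar>)"
    proof (intro pexp_mono prob_weights_rad MAX_leI T)
      fix \<eta> t assume t: "t \<in> ?T"
      have "(\<Sum>a\<in>K. \<eta> a * (?Z e a * ?g t a)) = (\<Sum>b\<in>B. t b * (\<Sum>a\<in>K. \<eta> a * (?Z e a * Y a b)))"
        unfolding sum_distrib_left[of _ _ B] sum_distrib_left[of _ _ K] by (subst sum.swap) (simp add: mult_ac)
      also have "\<dots> \<le> (\<Sum>b\<in>B. \<bar>\<Sum>a\<in>K. \<eta> a * (?Z e a * Y a b)\<bar>)"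
        by (rule sum_mult_le_sum_abs) (use t in \<open>auto simp: signs_abs\<close>)
      finally show "(\<Sum>a\<in>K. \<eta> a * (?Z e a * ?g t a)) \<le> (\<Sum>b\<in>B. \<bar>\<Sum>a\<in>K. \<eta> a * (?Z e a * Y a b)\<bar>)" .
    qed
    also have "\<dots> \<le> (\<Sum>b\<in>B. sqrt (\<Sum>a\<in>K. (?Z e a * Y a b)\<^sup>2))"
      unfolding pexp_sum by (intro sum_mono khintchine fin)
    also have "\<dots> \<le> (\<Sum>b\<in>B. v b * sqrt (\<Sum>a\<in>K. (?Z e a)\<^sup>2))"
    proof (rule sum_mono)
      fix b assume b: "b \<in> B"
      have "(\<Sum>a\<in>K. (?Z e a * Y a b)\<^sup>2) \<le> (\<Sum>a\<in>K. (?Z e a)\<^sup>2 * (v b)\<^sup>2)"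
      proof (rule sum_mono)
        fix a assume "a \<in> K"
        then have "(Y a b)\<^sup>2 \<le> (v b)\<^sup>2" using Y[OF _ b] v[OF b] by (simp add: abs_le_square_iff[symmetric])
        then show "(?Z e a * Y a b)\<^sup>2 \<le> (?Z e a)\<^sup>2 * (v b)\<^sup>2"
          unfolding power_mult_distrib by (rule mult_left_mono) simp
      qed
      then have "sqrt (\<Sum>a\<in>K. (?Z e a * Y a b)\<^sup>2) \<le> sqrt ((\<Sum>a\<in>K. (?Z e a)\<^sup>2) * (v b)\<^sup>2)"
        unfolding sum_distrib_right by (rule real_sqrt_le_mono)
      then show "sqrt (\<Sum>a\<in>K. (?Z e a * Y a b)\<^sup>2) \<le> v b * sqrt (\<Sum>a\<in>K. (?Z e a)\<^sup>2)"
        using v[OF b] by (simp add: real_sqrt_mult mult.commute)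
    qed
    finally show "rad K (\<lambda>\<eta>. MAX t\<in>?T. \<Sum>a\<in>K. \<eta> a * ?h t a e) \<le> sum v B * sqrt (\<Sum>a\<in>K. (?Z e a)\<^sup>2)"
      by (simp add: sum_distrib_right)
  qed
  also have "\<dots> \<le> sum v B * sqrt (rad I (\<lambda>e. \<Sum>a\<in>K. (?Z e a)\<^sup>2))"
    unfolding pexp_cmult by (intro mult_left_mono pexp_sqrt_le fin prob_weights_rad sum_nonneg v) auto
  also have "rad I (\<lambda>e. \<Sum>a\<in>K. (?Z e a)\<^sup>2) = card I"
    unfolding pexp_sum Zsq by (rule cnt_sum_1[OF fin(1,3) x])
  finally have *: "rad I (\<lambda>e. MAX t\<in>?T. \<Sum>a\<in>K. ?h t a e)
     \<le> 2 * (sum v B * sqrt (card I)) + (MAX t\<in>?T. \<Sum>a\<in>K. sqrt (cnt I x a) * \<bar>?g t a\<bar>)"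
    by simp
  have "2 * (sum v B * sqrt (card I)) = 2 * sqrt (card I) * sum v B" by simp
  with * show ?thesis by (simp only: add.commute)
qed

lemma infone_scaled_rows:
  assumes "finite B" "\<And>a. a \<in> K \<Longrightarrow> w a \<ge> 0"
  shows "infone K B (\<lambda>a b. w a * Y a b) = (MAX t\<in>signs B. \<Sum>a\<in>K. w a * \<bar>\<Sum>b\<in>B. t b * Y a b\<bar>)"
proof -
  have "(\<Sum>a\<in>K. \<bar>\<Sum>b\<in>B. t b * (w a * Y a b)\<bar>) = (\<Sum>a\<in>K. w a * \<bar>\<Sum>b\<in>B. t b * Y a b\<bar>)" for t :: "_ \<Rightarrow> real"
  proof (intro sum.cong refl)
    fix a assume a: "a \<in> K"
    have "(\<Sum>b\<in>B. t b * (w a * Y a b)) = w a * (\<Sum>b\<in>B. t b * Y a b)" by (simp add: sum_distrib_left mult_ac)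
    then show "\<bar>\<Sum>b\<in>B. t b * (w a * Y a b)\<bar> = w a * \<bar>\<Sum>b\<in>B. t b * Y a b\<bar>" using assms(2)[OF a] by (simp add: abs_mult)
  qed
  then show ?thesis unfolding infone_def by simp
qed

text \<open>Signs on the labels turn the absolute deviations of the counts into an empirical process.\<close>

lemma sampled_deviation_symmetrized:
  fixes p :: "'b \<Rightarrow> real"
  assumes fin: "finite I" "finite B" and p: "prob_weights K p"
  shows "pexp I K p (\<lambda>x. infone K B (\<lambda>a b. (cnt I x a - card I * p a) * Y a b))
    \<le> 2 * pexp I K p (\<lambda>x. rad I (\<lambda>e. MAX t\<in>signs B. \<Sum>a\<in>K. \<bar>sum e {i\<in>I. x i = a}\<bar> * \<bar>\<Sum>b\<in>B. t b * Y a b\<bar>))"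
proof -
  note KF = prob_weightsD(1)[OF p]
  let ?g = "\<lambda>t a. \<Sum>b\<in>B. t b * Y a b"
  let ?Z = "\<lambda>x e a. sum e {i\<in>I. x i = a} :: real"
  let ?T = "signs B"
  let ?ST = "signs K \<times> signs B"
  let ?E = "pexp I K p"
  let ?f = "\<lambda>(s, t) a. s a * ?g t a"
  have T: "finite ?T" "?T \<noteq> {}" "finite ?ST" "?ST \<noteq> {}" using fin KF by auto
  have E: "?E (\<lambda>x. ?f st (x i)) = (\<Sum>a\<in>K. p a * ?f st a)" if "i \<in> I" for i st
    by (rule pexp_coord[OF fin(1) that p])
  have "?E (\<lambda>x. infone K B (\<lambda>a b. (cnt I x a - card I * p a) * Y a b))
     \<le> ?E (\<lambda>x. MAX st\<in>?ST. \<Sum>i\<in>I. (?f st (x i) - ?E (\<lambda>x. ?f st (x i))))"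
  proof (intro pexp_mono p infone_leI fin)
    fix x s t assume x: "x \<in> I \<rightarrow>\<^sub>E K" and st: "s \<in> signs K" "t \<in> signs B"
    have "(\<Sum>i\<in>I. (?f (s, t) (x i) - ?E (\<lambda>x. ?f (s, t) (x i))))
        = (\<Sum>i\<in>I. ?f (s, t) (x i)) - card I * (\<Sum>a\<in>K. p a * ?f (s, t) a)"
      using E[of _ "(s, t)"] by (simp add: sum_subtractf)
    also have "(\<Sum>i\<in>I. ?f (s, t) (x i)) = (\<Sum>a\<in>K. cnt I x a * ?f (s, t) a)"
      by (rule cnt_sum[symmetric, OF fin(1) KF]) (use x in auto)
    also have "\<dots> - card I * (\<Sum>a\<in>K. p a * ?f (s, t) a) = (\<Sum>a\<in>K. \<Sum>b\<in>B. s a * t b * ((cnt I x a - card I * p a) * Y a b))"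
      by (simp add: sum_distrib_left sum_subtractf algebra_simps)
    finally have *: "(\<Sum>a\<in>K. \<Sum>b\<in>B. s a * t b * ((cnt I x a - card I * p a) * Y a b))
       = (\<Sum>i\<in>I. (?f (s, t) (x i) - ?E (\<lambda>x. ?f (s, t) (x i))))" by simp
    show "(\<Sum>a\<in>K. \<Sum>b\<in>B. s a * t b * ((cnt I x a - card I * p a) * Y a b))
       \<le> (MAX st\<in>?ST. \<Sum>i\<in>I. (?f st (x i) - ?E (\<lambda>x. ?f st (x i))))"
      unfolding * by (rule MAX_geI[OF T(3)]) (use st in auto)
  qed
  also have "\<dots> \<le> 2 * ?E (\<lambda>x. rad I (\<lambda>e. MAX st\<in>?ST. \<Sum>i\<in>I. e i * ?f st (x i)))"
    by (rule symmetrization[OF fin(1) fin(1) T(3,4) p, where b = "\<lambda>i. i" and h = "\<lambda>st i x. ?f st (x i)"]) auto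
  also have "?E (\<lambda>x. rad I (\<lambda>e. MAX st\<in>?ST. \<Sum>i\<in>I. e i * ?f st (x i)))
     \<le> ?E (\<lambda>x. rad I (\<lambda>e. MAX t\<in>?T. \<Sum>a\<in>K. \<bar>?Z x e a\<bar> * \<bar>?g t a\<bar>))"
  proof (intro pexp_mono p prob_weights_rad MAX_leI T)
    fix x e st assume x: "x \<in> I \<rightarrow>\<^sub>E K" and st: "st \<in> ?ST"
    obtain s t where [simp]: "st = (s, t)" by (cases st)
    have st: "s \<in> signs K" "t \<in> ?T" using st by auto
    have "(\<Sum>i\<in>I. e i * ?f st (x i)) = (\<Sum>a\<in>K. \<Sum>i\<in>{i\<in>I. x i = a}. e i * ?f st (x i))"
      by (rule sum.group[symmetric]) (use fin(1) KF x in auto)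
    also have "\<dots> = (\<Sum>a\<in>K. s a * (?Z x e a * ?g t a))"
    proof (intro sum.cong refl)
      fix a
      have "(\<Sum>i\<in>{i\<in>I. x i = a}. e i * ?f st (x i)) = ?Z x e a * (s a * ?g t a)"
        unfolding sum_distrib_right[of e] by (intro sum.cong refl) auto
      then show "(\<Sum>i\<in>{i\<in>I. x i = a}. e i * ?f st (x i)) = s a * (?Z x e a * ?g t a)" by simp
    qed
    also have "\<dots> \<le> (\<Sum>a\<in>K. \<bar>?Z x e a * ?g t a\<bar>)"
      by (rule sum_mult_le_sum_abs) (use st in \<open>auto simp: signs_abs\<close>)
    also have "\<dots> \<le> (MAX t\<in>?T. \<Sum>a\<in>K. \<bar>?Z x e a\<bar> * \<bar>?g t a\<bar>)"
      by (rule MAX_geI[OF T(1) st(2)]) (simp add: abs_mult)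
    finally show "(\<Sum>i\<in>I. e i * ?f st (x i)) \<le> (MAX t\<in>?T. \<Sum>a\<in>K. \<bar>?Z x e a\<bar> * \<bar>?g t a\<bar>)" .
  qed
  finally show ?thesis by simp
qed

text \<open>The natural size of the deviation of a count is \<open>sqrt (n * p a)\<close>, which
  becomes the row weight on the right. The scale \<open>n\<close> may exceed \<open>card I\<close>,
  so that parts of a sample are measured on the scale of the whole.\<close>

lemma sampled_deviation:
  fixes p :: "'b \<Rightarrow> real"
  assumes fin: "finite I" "finite B" and p: "prob_weights K p" and pos: "\<And>a. a \<in> K \<Longrightarrow> p a > 0"
    and Y: "\<And>a b. a \<in> K \<Longrightarrow> b \<in> B \<Longrightarrow> \<bar>Y a b\<bar> \<le> v b"
    and n: "card I \<le> n" "n > 0"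
  shows "pexp I K p (\<lambda>x. infone K B (\<lambda>a b. (cnt I x a - card I * p a) * Y a b))
    \<le> 2 * infone K B (\<lambda>a b. sqrt (n * p a) * Y a b) + (2 * sqrt (card K) + 4 * sqrt n) * sum v B"
proof -
  note KF = prob_weightsD(1)[OF p]
  let ?g = "\<lambda>t a. \<Sum>b\<in>B. t b * Y a b"
  let ?T = "signs B"
  let ?E = "pexp I K p"
  let ?V = "sum v B"
  let ?c = "\<lambda>a. sqrt (n * p a)"
  let ?H = "infone K B (\<lambda>a b. ?c a * Y a b)"
  have T: "finite ?T" "?T \<noteq> {}" using fin by auto
  have c: "?c a > 0" if "a \<in> K" for a using pos[OF that] n by simp
  have v: "v b \<ge> 0" if "b \<in> B" for b
  proof -
    obtain a where "a \<in> K" using prob_weightsD(4)[OF p] by blast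
    then show ?thesis using Y[OF _ that, of a] by linarith
  qed
  have V: "?V \<ge> 0" by (intro sum_nonneg v)
  \<comment> \<open>Roots of counts are awkward to average inside a norm. Linearized at their
    typical size \<open>?c a\<close> they become counts divided by \<open>?c\<close>, to which
    \<open>sampled_rows\<close> applies, and the deterministic \<open>?H\<close>.\<close>
  have 1: "?E (\<lambda>x. MAX t\<in>?T. \<Sum>a\<in>K. sqrt (cnt I x a) * \<bar>?g t a\<bar>)
     \<le> ?E (\<lambda>x. (1/2) * infone I B (\<lambda>i b. Y (x i) b / ?c (x i)) + (1/2) * ?H)"
  proof (rule pexp_mono[OF p])
    fix x assume x: "x \<in> I \<rightarrow>\<^sub>E K"
    have "(MAX t\<in>?T. \<Sum>a\<in>K. sqrt (cnt I x a) * \<bar>?g t a\<bar>)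
       \<le> (1/2) * infone K B (\<lambda>a b. cnt I x a * (Y a b / ?c a)) + (1/2) * ?H"
    proof (rule MAX_leI[OF T])
      fix t assume t: "t \<in> ?T"
      have "(\<Sum>a\<in>K. sqrt (cnt I x a) * \<bar>?g t a\<bar>) \<le> (\<Sum>a\<in>K. (cnt I x a / ?c a + ?c a) / 2 * \<bar>?g t a\<bar>)"
        by (intro sum_mono mult_right_mono sqrt_le_weighted_mean c) auto
      also have "\<dots> = (1/2) * (\<Sum>a\<in>K. (cnt I x a / ?c a) * \<bar>?g t a\<bar>) + (1/2) * (\<Sum>a\<in>K. ?c a * \<bar>?g t a\<bar>)"
        unfolding sum_distrib_left sum.distrib[symmetric] by (intro sum.cong refl) (simp add: field_simps)
      also have "\<dots> \<le> (1/2) * infone K B (\<lambda>a b. (cnt I x a / ?c a) * Y a b) + (1/2) * ?H"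
      proof -
        have "(\<Sum>a\<in>K. (cnt I x a / ?c a) * \<bar>?g t a\<bar>) \<le> infone K B (\<lambda>a b. (cnt I x a / ?c a) * Y a b)"
          by (subst infone_scaled_rows[OF fin(2)])
            (use c in \<open>auto simp: less_imp_le intro!: MAX_geI[OF T(1) t] divide_nonneg_pos\<close>)
        moreover have "(\<Sum>a\<in>K. ?c a * \<bar>?g t a\<bar>) \<le> ?H"
          by (subst infone_scaled_rows[OF fin(2)])
            (use c in \<open>auto simp: less_imp_le intro!: MAX_geI[OF T(1) t]\<close>)
        ultimately show ?thesis by linarith
      qed
      finally show "(\<Sum>a\<in>K. sqrt (cnt I x a) * \<bar>?g t a\<bar>)
          \<le> (1/2) * infone K B (\<lambda>a b. cnt I x a * (Y a b / ?c a)) + (1/2) * ?H" by simp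
    qed
    also have "infone K B (\<lambda>a b. cnt I x a * (Y a b / ?c a)) = infone I B (\<lambda>i b. Y (x i) b / ?c (x i))"
      by (rule infone_cnt[OF fin(1) KF fin(2)]) (use x in auto)
    finally show "(MAX t\<in>?T. \<Sum>a\<in>K. sqrt (cnt I x a) * \<bar>?g t a\<bar>)
      \<le> (1/2) * infone I B (\<lambda>i b. Y (x i) b / ?c (x i)) + (1/2) * ?H" .
  qed
  have 2: "?E (\<lambda>x. infone I B (\<lambda>i b. Y (x i) b / ?c (x i))) \<le> ?H + 2 * (?V * sqrt (card K))"
  proof -
    have "?E (\<lambda>x. infone I B (\<lambda>i b. Y (x i) b / ?c (x i)))
      \<le> card I * infone K B (\<lambda>a b. p a * (Y a b / ?c a)) + 2 * ?E (\<lambda>x. \<Sum>b\<in>B. sqrt (\<Sum>i\<in>I. (Y (x i) b / ?c (x i))\<^sup>2))"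
      by (rule sampled_rows[OF fin p])
    also have "card I * infone K B (\<lambda>a b. p a * (Y a b / ?c a)) \<le> ?H"
    proof -
      have "card I * infone K B (\<lambda>a b. p a * (Y a b / ?c a)) = infone K B (\<lambda>a b. (card I * p a / ?c a) * 1 * Y a b)"
        by (subst infone_cmult[OF fin(2), symmetric]) (auto intro!: infone_cong)
      also have "\<dots> \<le> infone K B (\<lambda>a b. ?c a * 1 * Y a b)"
      proof (rule infone_mono_weights[OF fin(2)])
        fix a assume a: "a \<in> K"
        have "real (card I) * p a \<le> n * p a" using pos[OF a] n by (intro mult_right_mono) auto
        also have "\<dots> = ?c a * ?c a" using pos[OF a] by simp
        finally show "\<bar>card I * p a / ?c a\<bar> \<le> ?c a" using c[OF a] pos[OF a] by (simp add: divide_le_eq)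
      qed auto
      finally show ?thesis by simp
    qed
    also have "?E (\<lambda>x. \<Sum>b\<in>B. sqrt (\<Sum>i\<in>I. (Y (x i) b / ?c (x i))\<^sup>2)) \<le> ?E (\<lambda>x. ?V * sqrt (\<Sum>i\<in>I. 1 / (n * p (x i))))"
    proof (rule pexp_mono[OF p])
      fix x assume x: "x \<in> I \<rightarrow>\<^sub>E K"
      have "sqrt (\<Sum>i\<in>I. (Y (x i) b / ?c (x i))\<^sup>2) \<le> v b * sqrt (\<Sum>i\<in>I. 1 / (n * p (x i)))" if b: "b \<in> B" for b
      proof -
        have "(\<Sum>i\<in>I. (Y (x i) b / ?c (x i))\<^sup>2) \<le> (\<Sum>i\<in>I. (v b)\<^sup>2 * (1 / (n * p (x i))))"
        proof (rule sum_mono)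
          fix i assume i: "i \<in> I"
          then have k: "x i \<in> K" using x by auto
          have "(Y (x i) b)\<^sup>2 \<le> (v b)\<^sup>2" using Y[OF k b] v[OF b] by (simp add: abs_le_square_iff[symmetric])
          moreover have "(Y (x i) b / ?c (x i))\<^sup>2 = (Y (x i) b)\<^sup>2 * (1 / (n * p (x i)))"
            using pos[OF k] by (simp add: power_divide)
          ultimately show "(Y (x i) b / ?c (x i))\<^sup>2 \<le> (v b)\<^sup>2 * (1 / (n * p (x i)))"
            using pos[OF k] by (metis mult_right_mono divide_nonneg_nonneg mult_nonneg_nonneg of_nat_0_le_iff less_imp_le zero_le_one)
        qed
        then have "sqrt (\<Sum>i\<in>I. (Y (x i) b / ?c (x i))\<^sup>2) \<le> sqrt ((v b)\<^sup>2 * (\<Sum>i\<in>I. 1 / (n * p (x i))))"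
          unfolding sum_distrib_left by (rule real_sqrt_le_mono)
        then show ?thesis using v[OF b] by (simp add: real_sqrt_mult)
      qed
      then show "(\<Sum>b\<in>B. sqrt (\<Sum>i\<in>I. (Y (x i) b / ?c (x i))\<^sup>2)) \<le> ?V * sqrt (\<Sum>i\<in>I. 1 / (n * p (x i)))"
        unfolding sum_distrib_right by (intro sum_mono)
    qed
    also have "\<dots> \<le> ?V * sqrt (?E (\<lambda>x. \<Sum>i\<in>I. 1 / (n * p (x i))))"
      unfolding pexp_cmult
      by (intro mult_left_mono pexp_sqrt_le fin p V sum_nonneg) (auto simp: PiE_iff intro!: mult_nonneg_nonneg less_imp_le[OF pos])
    \<comment> \<open>The mean of \<open>1 / p\<close> under \<open>p\<close> is the number of
      labels, each contributing \<open>p a / p a = 1\<close>. This is the source of the term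
      \<open>sqrt (card K)\<close>.\<close>
    also have "?E (\<lambda>x. \<Sum>i\<in>I. 1 / (n * p (x i))) \<le> card K"
    proof -
      have "?E (\<lambda>x. \<Sum>i\<in>I. 1 / (n * p (x i))) = (\<Sum>i\<in>I. \<Sum>a\<in>K. p a * (1 / (n * p a)))"
        unfolding pexp_sum by (intro sum.cong refl pexp_coord fin p)
      also have "\<dots> = (\<Sum>i\<in>I. \<Sum>a\<in>K. 1 / real n)"
        using pos by (intro sum.cong refl) (auto simp: less_imp_neq[THEN not_sym])
      also have "\<dots> = (real (card I) / n) * card K" by simp
      also have "\<dots> \<le> 1 * real (card K)" using n by (intro mult_right_mono) auto
      finally show ?thesis by simp
    qed
    finally show ?thesis using V by (simp add: mult_left_mono)
  qed
  have "?E (\<lambda>x. infone K B (\<lambda>a b. (cnt I x a - card I * p a) * Y a b))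
    \<le> 2 * ?E (\<lambda>x. rad I (\<lambda>e. MAX t\<in>?T. \<Sum>a\<in>K. \<bar>sum e {i\<in>I. x i = a}\<bar> * \<bar>?g t a\<bar>))"
    by (rule sampled_deviation_symmetrized[OF fin p])
  also have "?E (\<lambda>x. rad I (\<lambda>e. MAX t\<in>?T. \<Sum>a\<in>K. \<bar>sum e {i\<in>I. x i = a}\<bar> * \<bar>?g t a\<bar>))
    \<le> ?E (\<lambda>x. (MAX t\<in>?T. \<Sum>a\<in>K. sqrt (cnt I x a) * \<bar>?g t a\<bar>) + 2 * sqrt n * ?V)"
  proof (rule pexp_mono[OF p])
    fix x assume x: "x \<in> I \<rightarrow>\<^sub>E K"
    have "rad I (\<lambda>e. MAX t\<in>?T. \<Sum>a\<in>K. \<bar>sum e {i\<in>I. x i = a}\<bar> * \<bar>?g t a\<bar>)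
       \<le> (MAX t\<in>?T. \<Sum>a\<in>K. sqrt (cnt I x a) * \<bar>?g t a\<bar>) + 2 * sqrt (card I) * ?V"
      by (rule block_sums[OF fin KF _ Y v]) (use x in auto)
    also have "2 * sqrt (card I) * ?V \<le> 2 * sqrt n * ?V"
      using n V by (intro mult_right_mono) auto
    finally show "rad I (\<lambda>e. MAX t\<in>?T. \<Sum>a\<in>K. \<bar>sum e {i\<in>I. x i = a}\<bar> * \<bar>?g t a\<bar>)
       \<le> (MAX t\<in>?T. \<Sum>a\<in>K. sqrt (cnt I x a) * \<bar>?g t a\<bar>) + 2 * sqrt n * ?V" by simp
  qed
  also have "\<dots> = ?E (\<lambda>x. MAX t\<in>?T. \<Sum>a\<in>K. sqrt (cnt I x a) * \<bar>?g t a\<bar>) + 2 * sqrt n * ?V"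
    unfolding pexp_add by (simp add: pexp_const[OF fin(1) p])
  also have "?E (\<lambda>x. MAX t\<in>?T. \<Sum>a\<in>K. sqrt (cnt I x a) * \<bar>?g t a\<bar>) \<le> (1/2) * (?H + 2 * (?V * sqrt (card K))) + (1/2) * ?H"
  proof -
    have *: "A \<le> (1/2) * (H + W) + (1/2) * H" if "A \<le> (1/2) * D + (1/2) * H" "D \<le> H + W" for A D H W :: real
      using that by (simp add: field_simps)
    show ?thesis by (rule *[OF 1[unfolded pexp_add pexp_cmult pexp_const[OF fin(1) p]] 2])
  qed
  finally show ?thesis by (simp add: algebra_simps)
qed

text \<open>One sign per class linearizes the absolute values. After symmetrization the roots of the
  class counts remain, and Cauchy-Schwarz sums them; hence only the number of classes enters, not
  the number of labels.\<close>

lemma sampled_partition_deviation: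
  fixes p :: "'b \<Rightarrow> real"
  assumes fin: "finite I" and p: "prob_weights K p" and P: "finite P" "\<And>a. a \<in> K \<Longrightarrow> c a \<in> P"
  shows "pexp I K p (\<lambda>x. \<Sum>q\<in>P. \<bar>\<Sum>a\<in>{a\<in>K. c a = q}. (cnt I x a - card I * p a)\<bar>) \<le> 2 * sqrt (card P * card I)"
proof -
  note KF = prob_weightsD(1)[OF p]
  let ?E = "pexp I K p"
  let ?T = "signs P"
  let ?f = "\<lambda>s a. s (c a) :: real"
  have T: "finite ?T" "?T \<noteq> {}" using P by auto
  have E: "?E (\<lambda>x. ?f s (x i)) = (\<Sum>a\<in>K. p a * ?f s a)" if "i \<in> I" for i s
    by (rule pexp_coord[OF fin(1) that p])
  have "?E (\<lambda>x. \<Sum>q\<in>P. \<bar>\<Sum>a\<in>{a\<in>K. c a = q}. (cnt I x a - card I * p a)\<bar>)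
     \<le> ?E (\<lambda>x. MAX s\<in>?T. \<Sum>i\<in>I. (?f s (x i) - ?E (\<lambda>x. ?f s (x i))))"
  proof (rule pexp_mono[OF p])
    fix x assume x: "x \<in> I \<rightarrow>\<^sub>E K"
    obtain s where s: "s \<in> ?T" "(\<Sum>q\<in>P. \<bar>\<Sum>a\<in>{a\<in>K. c a = q}. (cnt I x a - card I * p a)\<bar>)
        = (\<Sum>q\<in>P. s q * (\<Sum>a\<in>{a\<in>K. c a = q}. (cnt I x a - card I * p a)))" by (rule sum_abs_signs)
    have "(\<Sum>q\<in>P. s q * (\<Sum>a\<in>{a\<in>K. c a = q}. (cnt I x a - card I * p a)))
        = (\<Sum>q\<in>P. \<Sum>a\<in>{a\<in>K. c a = q}. ?f s a * (cnt I x a - card I * p a))"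
      by (simp add: sum_distrib_left)
    also have "\<dots> = (\<Sum>a\<in>K. ?f s a * (cnt I x a - card I * p a))"
      by (rule sum.group) (use KF P in auto)
    also have "\<dots> = (\<Sum>a\<in>K. cnt I x a * ?f s a) - card I * (\<Sum>a\<in>K. p a * ?f s a)"
      by (simp add: sum_distrib_left sum_subtractf algebra_simps)
    also have "(\<Sum>a\<in>K. cnt I x a * ?f s a) = (\<Sum>i\<in>I. ?f s (x i))"
      by (rule cnt_sum[OF fin(1) KF]) (use x in auto)
    also have "\<dots> - card I * (\<Sum>a\<in>K. p a * ?f s a) = (\<Sum>i\<in>I. (?f s (x i) - ?E (\<lambda>x. ?f s (x i))))"
      using E by (simp add: sum_subtractf)
    finally show "(\<Sum>q\<in>P. \<bar>\<Sum>a\<in>{a\<in>K. c a = q}. (cnt I x a - card I * p a)\<bar>)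
       \<le> (MAX s\<in>?T. \<Sum>i\<in>I. (?f s (x i) - ?E (\<lambda>x. ?f s (x i))))"
      unfolding s(2) by (intro MAX_geI[OF T(1) s(1)]) simp
  qed
  also have "\<dots> \<le> 2 * ?E (\<lambda>x. rad I (\<lambda>e. MAX s\<in>?T. \<Sum>i\<in>I. e i * ?f s (x i)))"
    by (rule symmetrization[OF fin(1) fin(1) T p, where b = "\<lambda>i. i" and h = "\<lambda>s i x. ?f s (x i)"]) auto
  also have "?E (\<lambda>x. rad I (\<lambda>e. MAX s\<in>?T. \<Sum>i\<in>I. e i * ?f s (x i))) \<le> ?E (\<lambda>x. sqrt (card P * card I))"
  proof (rule pexp_mono[OF p])
    fix x assume x: "x \<in> I \<rightarrow>\<^sub>E K"
    let ?Z = "\<lambda>q e. \<Sum>i\<in>I. e i * of_bool (c (x i) = q) :: real"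
    have "rad I (\<lambda>e. MAX s\<in>?T. \<Sum>i\<in>I. e i * ?f s (x i)) \<le> rad I (\<lambda>e. \<Sum>q\<in>P. \<bar>?Z q e\<bar>)"
    proof (intro pexp_mono prob_weights_rad MAX_leI T)
      fix e s assume s: "s \<in> ?T"
      have "(\<Sum>i\<in>I. e i * ?f s (x i)) = (\<Sum>i\<in>I. \<Sum>q\<in>P. s q * (e i * of_bool (c (x i) = q)))"
      proof (rule sum.cong[OF refl])
        fix i assume "i \<in> I"
        then have "c (x i) \<in> P" using x P by auto
        then show "e i * ?f s (x i) = (\<Sum>q\<in>P. s q * (e i * of_bool (c (x i) = q)))"
          using P by (subst sum.remove[of _ "c (x i)"]) (auto intro!: sum.neutral)
      qed
      also have "\<dots> = (\<Sum>q\<in>P. s q * ?Z q e)" by (subst sum.swap) (simp add: sum_distrib_left)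
      also have "\<dots> \<le> (\<Sum>q\<in>P. \<bar>?Z q e\<bar>)"
        by (rule sum_mult_le_sum_abs) (use s in \<open>auto simp: signs_abs\<close>)
      finally show "(\<Sum>i\<in>I. e i * ?f s (x i)) \<le> (\<Sum>q\<in>P. \<bar>?Z q e\<bar>)" .
    qed
    also have "\<dots> \<le> (\<Sum>q\<in>P. sqrt (\<Sum>i\<in>I. (of_bool (c (x i) = q))\<^sup>2))"
      unfolding pexp_sum by (intro sum_mono khintchine fin)
    also have "\<dots> = (\<Sum>q\<in>P. sqrt (cnt I (c \<circ> x) q) * 1)"
      using fin by (simp add: cnt_def sum_of_bool_sq)
    also have "\<dots> \<le> sqrt (\<Sum>q\<in>P. (sqrt (cnt I (c \<circ> x) q))\<^sup>2) * sqrt (\<Sum>q\<in>P. 1\<^sup>2)"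
      using L2_set_mult_ineq[of "\<lambda>q. sqrt (cnt I (c \<circ> x) q)" "\<lambda>_. 1" P] by (simp add: L2_set_def)
    also have "\<dots> = sqrt (card P * card I)"
    proof -
      have "(\<Sum>q\<in>P. cnt I (c \<circ> x) q) = card I"
        by (rule cnt_sum_1[OF fin P(1)]) (use x P(2) in auto)
      then show ?thesis by (simp add: real_sqrt_mult)
    qed
    finally show "rad I (\<lambda>e. MAX s\<in>?T. \<Sum>i\<in>I. e i * ?f s (x i)) \<le> sqrt (card P * card I)" .
  qed
  finally show ?thesis by (simp add: pexp_const[OF fin p])
qed

section \<open>Decoupling of rows and columns\<close>

lemma rad_coord2:
  assumes "finite I" "i \<in> I" "j \<in> I" "i \<noteq> j"
  shows "rad I (\<lambda>e. F (e i) (e j)) = (F 1 1 + F 1 (-1) + F (-1) 1 + F (-1) (-1)) / 4"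
proof -
  have I: "I = insert i (I - {i})" and "finite (I - {i})" "i \<notin> I - {i}" "j \<in> I - {i}" using assms by auto
  have *: "rad (I - {i}) (\<lambda>e. F s ((e(i := s)) j)) = (F s 1 + F s (-1)) / 2" for s
    using assms pexp_coord[of "I - {i}" j "{-1, 1}" "\<lambda>_. 1/2" "F s"] by simp
  have "rad I (\<lambda>e. F (e i) (e j)) = (rad (I - {i}) (\<lambda>e. F 1 ((e(i := 1)) j)) + rad (I - {i}) (\<lambda>e. F (-1) ((e(i := -1)) j))) / 2"
    by (subst I, subst rad_insert) (use assms in auto)
  then show ?thesis unfolding * by (simp add: field_simps)
qed

text \<open>Random signs separate a given ordered pair of distinct indices, \<open>i\<close> to the
  positive and \<open>j\<close> to the negative side, with probability 1/4. So the full sum is 4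
  times the mean of the split sum, and Jensen's inequality moves the maximum inside.\<close>

lemma decoupling:
  fixes u :: "'t \<Rightarrow> 'i \<Rightarrow> 'i \<Rightarrow> real"
  assumes fin: "finite I" "finite T" "T \<noteq> {}"
  shows "(MAX t\<in>T. \<Sum>i\<in>I. \<Sum>j\<in>I. if i = j then 0 else u t i j)
    \<le> 4 * rad I (\<lambda>e. MAX t\<in>T. \<Sum>i\<in>{i\<in>I. e i = 1}. \<Sum>j\<in>{j\<in>I. e j = -1}. u t i j)"
proof -
  have 1: "rad I (\<lambda>e. \<Sum>i\<in>{i\<in>I. e i = 1}. \<Sum>j\<in>{j\<in>I. e j = -1}. u t i j)
      = (1/4) * (\<Sum>i\<in>I. \<Sum>j\<in>I. if i = j then 0 else u t i j)" for t
  proof -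
    have "(\<Sum>i\<in>{i\<in>I. e i = 1}. \<Sum>j\<in>{j\<in>I. e j = -1}. u t i j)
       = (\<Sum>i\<in>I. \<Sum>j\<in>I. (of_bool (e i = 1) * of_bool (e j = -1)) * u t i j)" for e :: "'i \<Rightarrow> real"
    proof -
      have "(\<Sum>j\<in>{j\<in>I. e j = -1}. u t i j) = (\<Sum>j\<in>I. of_bool (e j = -1) * u t i j)" for i
        using fin(1) by (intro sum.mono_neutral_cong_left) auto
      then have "(\<Sum>i\<in>{i\<in>I. e i = 1}. \<Sum>j\<in>{j\<in>I. e j = -1}. u t i j)
        = (\<Sum>i\<in>I. of_bool (e i = 1) * (\<Sum>j\<in>I. of_bool (e j = -1) * u t i j))"
        using fin(1) by (intro sum.mono_neutral_cong_left) auto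
      then show ?thesis by (simp add: sum_distrib_left mult.assoc)
    qed
    then have "rad I (\<lambda>e. \<Sum>i\<in>{i\<in>I. e i = 1}. \<Sum>j\<in>{j\<in>I. e j = -1}. u t i j)
       = (\<Sum>i\<in>I. \<Sum>j\<in>I. rad I (\<lambda>e. of_bool (e i = 1) * of_bool (e j = -1)) * u t i j)"
      by (simp add: pexp_sum pexp_cmult_right)
    also have "\<dots> = (\<Sum>i\<in>I. \<Sum>j\<in>I. (1/4) * (if i = j then 0 else u t i j))"
    proof (intro sum.cong refl)
      fix i j assume ij: "i \<in> I" "j \<in> I"
      show "rad I (\<lambda>e. of_bool (e i = 1) * of_bool (e j = -1)) * u t i j = (1/4) * (if i = j then 0 else u t i j)"
      proof (cases "i = j")
        case True
        have "rad I (\<lambda>e. of_bool (e i = 1) * of_bool (e j = -1)) = rad I (\<lambda>e. 0)"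
          by (intro pexp_cong) (use True in auto)
        then show ?thesis using True by (simp add: pexp_const fin)
      next
        case False
        then show ?thesis
          using rad_coord2[OF fin(1) ij, of "\<lambda>p q. of_bool (p = 1) * of_bool (q = -1)"] by simp
      qed
    qed
    finally show ?thesis by (simp add: sum_distrib_left)
  qed
  have "(MAX t\<in>T. \<Sum>i\<in>I. \<Sum>j\<in>I. if i = j then 0 else u t i j)
      = 4 * (MAX t\<in>T. rad I (\<lambda>e. \<Sum>i\<in>{i\<in>I. e i = 1}. \<Sum>j\<in>{j\<in>I. e j = -1}. u t i j))"
    unfolding 1 by (subst MAX_cmult[symmetric]) (use fin in auto)
  also have "\<dots> \<le> 4 * rad I (\<lambda>e. MAX t\<in>T. \<Sum>i\<in>{i\<in>I. e i = 1}. \<Sum>j\<in>{j\<in>I. e j = -1}. u t i j)"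
    by (intro mult_left_mono MAX_pexp_le fin prob_weights_rad) auto
  finally show ?thesis .
qed

text \<open>
  With \<open>\<theta> = 1\<close> the rows carry the centred counts, with \<open>\<theta> = 0\<close> the counts themselves; the diagonal
  is what decoupling discards.
\<close>

lemma decoupled_counts:
  fixes p :: "'b \<Rightarrow> real"
  assumes fin: "finite I" and KF: "finite K" and x: "\<And>i. i \<in> I \<Longrightarrow> x i \<in> K"
    and p: "\<And>a. a \<in> K \<Longrightarrow> p a \<ge> 0" "(\<Sum>a\<in>K. p a) = 1"
    and U: "\<And>a b. a \<in> K \<Longrightarrow> b \<in> K \<Longrightarrow> \<bar>U a b\<bar> \<le> 1" and \<theta>: "0 \<le> \<theta>" "\<theta> \<le> 1"
  shows "infone K K (\<lambda>a b. (cnt I x a - \<theta> * (card I * p a)) * cnt I x b * U a b)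
    \<le> 2 * card I + 4 * rad I (\<lambda>e. infone K K (\<lambda>a b. (cnt {i\<in>I. e i = 1} x a - \<theta> * (card {i\<in>I. e i = 1} * p a))
          * cnt {i\<in>I. e i = -1} x b * U a b))"
proof -
  let ?ST = "signs K \<times> signs K"
  have T: "finite ?ST" "?ST \<noteq> {}" using KF by auto
  \<comment> \<open>The centring term is spread evenly over the row indices. This makes the form in
    the counts a double sum over pairs of sample indices, the shape that decoupling
    requires.\<close>
  define u :: "('b \<Rightarrow> real) \<times> ('b \<Rightarrow> real) \<Rightarrow> 'a \<Rightarrow> 'a \<Rightarrow> real" where
    "u = (\<lambda>(s, t) i j. t (x j) * (s (x i) * U (x i) (x j) - \<theta> * (\<Sum>a\<in>K. p a * s a * U a (x j))))"
  have rep: "(\<Sum>a\<in>K. \<Sum>b\<in>K. s a * t b * ((cnt S x a - \<theta> * (card S * p a)) * cnt S' x b * U a b))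
     = (\<Sum>i\<in>S. \<Sum>j\<in>S'. u (s, t) i j)" if S: "S \<subseteq> I" "S' \<subseteq> I" for s t :: "'b \<Rightarrow> real" and S S'
  proof -
    have SF: "finite S" "finite S'" using S fin by (auto intro: finite_subset)
    have "(\<Sum>i\<in>S. \<Sum>j\<in>S'. u (s, t) i j) = (\<Sum>j\<in>S'. t (x j) * (\<Sum>i\<in>S. s (x i) * U (x i) (x j)
         - \<theta> * (\<Sum>a\<in>K. p a * s a * U a (x j))))"
      by (subst sum.swap) (simp add: u_def sum_distrib_left)
    also have "\<dots> = (\<Sum>j\<in>S'. t (x j) * (\<Sum>a\<in>K. (cnt S x a - \<theta> * (card S * p a)) * (s a * U a (x j))))"
    proof (intro sum.cong refl arg_cong2[of _ _ _ _ "(*)"])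
      fix j
      have "(\<Sum>i\<in>S. s (x i) * U (x i) (x j) - \<theta> * (\<Sum>a\<in>K. p a * s a * U a (x j)))
         = (\<Sum>i\<in>S. s (x i) * U (x i) (x j)) - card S * \<theta> * (\<Sum>a\<in>K. p a * s a * U a (x j))"
        by (simp add: sum_subtractf)
      also have "(\<Sum>i\<in>S. s (x i) * U (x i) (x j)) = (\<Sum>a\<in>K. cnt S x a * (s a * U a (x j)))"
        by (rule cnt_sum[symmetric]) (use SF KF S x in auto)
      finally show "(\<Sum>i\<in>S. s (x i) * U (x i) (x j) - \<theta> * (\<Sum>a\<in>K. p a * s a * U a (x j)))
         = (\<Sum>a\<in>K. (cnt S x a - \<theta> * (card S * p a)) * (s a * U a (x j)))"
        by (simp add: sum_distrib_left sum_subtractf algebra_simps)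
    qed
    also have "\<dots> = (\<Sum>b\<in>K. cnt S' x b * (t b * (\<Sum>a\<in>K. (cnt S x a - \<theta> * (card S * p a)) * (s a * U a b))))"
      by (rule cnt_sum[symmetric]) (use SF KF S x in auto)
    also have "\<dots> = (\<Sum>a\<in>K. \<Sum>b\<in>K. s a * t b * ((cnt S x a - \<theta> * (card S * p a)) * cnt S' x b * U a b))"
      unfolding sum_distrib_left by (subst sum.swap) (simp add: mult_ac)
    finally show ?thesis by simp
  qed
  \<comment> \<open>A pair \<open>i = i\<close> costs at most 1 for its entry and 1 for the centring
    term; summed over the sample this is the \<open>2 * card I\<close>.\<close>
  have u2: "\<bar>u (s, t) i i\<bar> \<le> 2" if "s \<in> signs K" "t \<in> signs K" "i \<in> I" for s t i
  proof -
    have "\<bar>\<Sum>a\<in>K. p a * s a * U a (x i)\<bar> \<le> (\<Sum>a\<in>K. p a)"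
    proof (rule order_trans[OF sum_abs], rule sum_mono)
      fix a assume "a \<in> K"
      then show "\<bar>p a * s a * U a (x i)\<bar> \<le> p a"
        using p(1)[of a] U[of a "x i"] x[OF that(3)] that(1) by (simp add: abs_mult signs_abs mult_left_le)
    qed
    then have "\<bar>\<theta> * (\<Sum>a\<in>K. p a * s a * U a (x i))\<bar> \<le> 1"
      unfolding p(2) using \<theta> by (simp add: abs_mult mult_le_one)
    moreover have "\<bar>s (x i) * U (x i) (x i)\<bar> \<le> 1"
      using U[of "x i" "x i"] x[OF that(3)] that(1) by (simp add: abs_mult signs_abs)
    moreover have "\<bar>u (s, t) i i\<bar> = \<bar>s (x i) * U (x i) (x i) - \<theta> * (\<Sum>a\<in>K. p a * s a * U a (x i))\<bar>"
      using that x by (simp add: u_def abs_mult signs_abs)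
    ultimately show ?thesis by linarith
  qed
  let ?M = "MAX st\<in>?ST. \<Sum>i\<in>I. \<Sum>j\<in>I. if i = j then 0 else u st i j"
  have "infone K K (\<lambda>a b. (cnt I x a - \<theta> * (card I * p a)) * cnt I x b * U a b) \<le> 2 * card I + ?M"
  proof (rule infone_leI[OF KF])
    fix s t assume st: "s \<in> signs K" "t \<in> signs K"
    have "(\<Sum>i\<in>I. \<Sum>j\<in>I. u (s, t) i j) = (\<Sum>i\<in>I. \<Sum>j\<in>I. (if i = j then u (s, t) i j else 0) + (if i = j then 0 else u (s, t) i j))"
      by (intro sum.cong refl) auto
    also have "\<dots> = (\<Sum>i\<in>I. u (s, t) i i) + (\<Sum>i\<in>I. \<Sum>j\<in>I. if i = j then 0 else u (s, t) i j)"
      using fin by (simp add: sum.distrib)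
    also have "(\<Sum>i\<in>I. u (s, t) i i) \<le> (\<Sum>i\<in>I. 2)"
      by (rule sum_mono) (use u2[OF st] in \<open>auto simp: abs_le_iff\<close>)
    also have "(\<Sum>i\<in>I. \<Sum>j\<in>I. if i = j then 0 else u (s, t) i j) \<le> ?M"
      by (rule MAX_geI[OF T(1), of "(s, t)"]) (use st in auto)
    finally show "(\<Sum>a\<in>K. \<Sum>b\<in>K. s a * t b * ((cnt I x a - \<theta> * (card I * p a)) * cnt I x b * U a b)) \<le> 2 * card I + ?M"
      by (subst rep) auto
  qed
  also have "?M \<le> 4 * rad I (\<lambda>e. MAX st\<in>?ST. \<Sum>i\<in>{i\<in>I. e i = 1}. \<Sum>j\<in>{j\<in>I. e j = -1}. u st i j)"
    by (rule decoupling[OF fin T])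
  also have "rad I (\<lambda>e. MAX st\<in>?ST. \<Sum>i\<in>{i\<in>I. e i = 1}. \<Sum>j\<in>{j\<in>I. e j = -1}. u st i j)
     \<le> rad I (\<lambda>e. infone K K (\<lambda>a b. (cnt {i\<in>I. e i = 1} x a - \<theta> * (card {i\<in>I. e i = 1} * p a))
          * cnt {i\<in>I. e i = -1} x b * U a b))"
  proof (intro pexp_mono prob_weights_rad MAX_leI T)
    fix e st assume "st \<in> ?ST"
    then obtain s t where st: "st = (s, t)" "s \<in> signs K" "t \<in> signs K" by auto
    show "(\<Sum>i\<in>{i\<in>I. e i = 1}. \<Sum>j\<in>{j\<in>I. e j = -1}. u st i j)
      \<le> infone K K (\<lambda>a b. (cnt {i\<in>I. e i = 1} x a - \<theta> * (card {i\<in>I. e i = 1} * p a))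
          * cnt {i\<in>I. e i = -1} x b * U a b)"
      unfolding st(1)
      by (subst rep[symmetric], blast, blast, rule bilinear_le_infone[OF KF]) (use st in \<open>auto simp: signs_abs\<close>)
  qed
  finally show ?thesis by simp
qed

text \<open>The coordinates in disjoint index sets are independent. With one argument of
  \<open>F\<close> per half, the column half can be frozen while the row half is averaged.\<close>

lemma pexp_two_halves:
  assumes fin: "finite I" and S: "S \<union> S' = I" "S \<inter> S' = {}"
    and F: "\<And>x x' y y'. (\<And>i. i \<in> S \<Longrightarrow> x i = x' i) \<Longrightarrow> (\<And>i. i \<in> S' \<Longrightarrow> y i = y' i) \<Longrightarrow> F x y = F x' y'"
  shows "pexp I K p (\<lambda>x. F x x) = pexp S' K p (\<lambda>y. pexp S K p (\<lambda>x. F x y))"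
proof -
  have "finite S" "finite S'" using fin S by auto
  then have "pexp I K p (\<lambda>x. F x x)
     = pexp S K p (\<lambda>x. pexp S' K p (\<lambda>y. F (\<lambda>i. if i \<in> S then x i else y i) (\<lambda>i. if i \<in> S then x i else y i)))"
    using pexp_Un[of S S' K p "\<lambda>x. F x x"] S by simp
  also have "\<dots> = pexp S K p (\<lambda>x. pexp S' K p (\<lambda>y. F x y))"
    by (intro pexp_cong F) (use S in auto)
  also have "\<dots> = pexp S' K p (\<lambda>y. pexp S K p (\<lambda>x. F x y))" by (rule pexp_swap)
  finally show ?thesis .
qed

lemma sum_sqrt_le:
  fixes p :: "'b \<Rightarrow> real"
  assumes "\<And>a. a \<in> K \<Longrightarrow> p a \<ge> 0" "(\<Sum>a\<in>K. p a) = 1"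
  shows "(\<Sum>a\<in>K. sqrt (p a)) \<le> sqrt (card K)"
proof -
  have "(\<Sum>a\<in>K. \<bar>sqrt (p a)\<bar> * \<bar>1\<bar>) \<le> L2_set (\<lambda>a. sqrt (p a)) K * L2_set (\<lambda>_. 1) K" by (rule L2_set_mult_ineq)
  moreover have "L2_set (\<lambda>a. sqrt (p a)) K = 1" using assms by (simp add: L2_set_def)
  ultimately show ?thesis using assms by (simp add: L2_set_def)
qed

text \<open>After decoupling, the rows are sampled with the columns frozen, then the columns with
  deterministic rows; each passage costs \<open>sqrt (card I)\<close> relative to the size of the
  sample. The constants are 4 from decoupling and 18 = 4 * 4 + 2, the 2 being the diagonal.\<close>

lemma sampled_cut_norm:
  fixes p :: "'b \<Rightarrow> real"
  assumes fin: "finite I" and p: "prob_weights K p"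
    and U: "\<And>a b. a \<in> K \<Longrightarrow> b \<in> K \<Longrightarrow> \<bar>U a b\<bar> \<le> 1"
  shows "pexp I K p (\<lambda>x. infone K K (\<lambda>a b. cnt I x a * cnt I x b * U a b))
    \<le> 4 * (card I)\<^sup>2 * infone K K (\<lambda>a b. p a * p b * U a b) + 18 * card I * sqrt (card I)"
proof -
  note pD = prob_weightsD[OF p]
  let ?n = "card I"
  let ?H = "infone K K (\<lambda>a b. p a * p b * U a b)"
  have H0: "?H \<ge> 0" by (rule infone_nonneg[OF pD(1)])
  have half: "pexp I K p (\<lambda>x. infone K K (\<lambda>a b. cnt S x a * cnt S' x b * U a b)) \<le> ?n\<^sup>2 * ?H + 4 * (?n * sqrt ?n)"
    if S: "S \<union> S' = I" "S \<inter> S' = {}" for S S'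
  proof -
    have SF: "finite S" "finite S'" using fin S by auto
    have c: "card S \<le> ?n" "card S' \<le> ?n" using S fin by (auto intro: card_mono)
    have "pexp I K p (\<lambda>x. infone K K (\<lambda>a b. cnt S x a * cnt S' x b * U a b))
       = pexp S' K p (\<lambda>y. pexp S K p (\<lambda>x. infone K K (\<lambda>a b. cnt S x a * (cnt S' y b * U a b))))"
      unfolding mult.assoc
    proof (rule pexp_two_halves[OF fin S])
      fix x x' y y' :: "'a \<Rightarrow> 'b"
      assume "\<And>i. i \<in> S \<Longrightarrow> x i = x' i" "\<And>i. i \<in> S' \<Longrightarrow> y i = y' i"
      then show "infone K K (\<lambda>a b. cnt S x a * (cnt S' y b * U a b)) = infone K K (\<lambda>a b. cnt S x' a * (cnt S' y' b * U a b))"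
        by (intro infone_cong arg_cong2[of _ _ _ _ "(*)"] cnt_cong refl)
    qed
    also have "\<dots> \<le> pexp S' K p (\<lambda>y. ?n * infone K K (\<lambda>b a. cnt S' y b * (p a * U a b)) + 2 * (?n * sqrt ?n))"
    proof (rule pexp_mono[OF p])
      fix y assume y: "y \<in> S' \<rightarrow>\<^sub>E K"
      have "pexp S K p (\<lambda>x. infone K K (\<lambda>a b. cnt S x a * (cnt S' y b * U a b)))
         \<le> card S * infone K K (\<lambda>a b. p a * (cnt S' y b * U a b)) + 2 * sqrt (card S) * (\<Sum>b\<in>K. cnt S' y b)"
        by (rule sampled_count_rows[OF SF(1) pD(1) p]) (use U in \<open>auto simp: abs_mult mult_left_le\<close>)
      also have "(\<Sum>b\<in>K. cnt S' y b) = card S'" by (rule cnt_sum_1[OF SF(2) pD(1)]) (use y in auto)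
      also have "infone K K (\<lambda>a b. p a * (cnt S' y b * U a b)) = infone K K (\<lambda>b a. cnt S' y b * (p a * U a b))"
        by (subst infone_transpose[OF pD(1) pD(1)]) (simp add: mult_ac)
      also have "card S * infone K K (\<lambda>b a. cnt S' y b * (p a * U a b)) \<le> ?n * infone K K (\<lambda>b a. cnt S' y b * (p a * U a b))"
        using c infone_nonneg[OF pD(1)] by (intro mult_right_mono) auto
      also have "2 * sqrt (card S) * card S' \<le> 2 * sqrt ?n * ?n" using c by (intro mult_mono) auto
      finally show "pexp S K p (\<lambda>x. infone K K (\<lambda>a b. cnt S x a * (cnt S' y b * U a b)))
        \<le> ?n * infone K K (\<lambda>b a. cnt S' y b * (p a * U a b)) + 2 * (?n * sqrt ?n)" by (simp add: mult_ac)
    qed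
    also have "\<dots> = ?n * pexp S' K p (\<lambda>y. infone K K (\<lambda>b a. cnt S' y b * (p a * U a b))) + 2 * (?n * sqrt ?n)"
      unfolding pexp_add pexp_cmult pexp_const[OF SF(2) p] ..
    also have "pexp S' K p (\<lambda>y. infone K K (\<lambda>b a. cnt S' y b * (p a * U a b)))
        \<le> card S' * infone K K (\<lambda>b a. p b * (p a * U a b)) + 2 * sqrt (card S') * (\<Sum>a\<in>K. p a)"
      by (rule sampled_count_rows[OF SF(2) pD(1) p]) (use U pD(2) in \<open>auto simp: abs_mult mult_left_le\<close>)
    also have "infone K K (\<lambda>b a. p b * (p a * U a b)) = ?H"
      by (subst infone_transpose[OF pD(1) pD(1)]) (simp add: mult_ac)
    also have "card S' * ?H + 2 * sqrt (card S') * (\<Sum>a\<in>K. p a) \<le> ?n * ?H + 2 * sqrt ?n"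
      using c H0 pD(3) by (intro add_mono mult_right_mono) auto
    finally have "pexp I K p (\<lambda>x. infone K K (\<lambda>a b. cnt S x a * cnt S' x b * U a b))
      \<le> ?n * (?n * ?H + 2 * sqrt ?n) + 2 * (?n * sqrt ?n)" by (simp add: mult_left_mono)
    then show ?thesis by (simp add: power2_eq_square distrib_left mult.assoc)
  qed
  have "pexp I K p (\<lambda>x. infone K K (\<lambda>a b. cnt I x a * cnt I x b * U a b))
     \<le> pexp I K p (\<lambda>x. 2 * ?n + 4 * rad I (\<lambda>e. infone K K (\<lambda>a b. cnt {i\<in>I. e i = 1} x a * cnt {i\<in>I. e i = -1} x b * U a b)))"
  proof (rule pexp_mono[OF p])
    fix x assume x: "x \<in> I \<rightarrow>\<^sub>E K"
    show "infone K K (\<lambda>a b. cnt I x a * cnt I x b * U a b)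
       \<le> 2 * ?n + 4 * rad I (\<lambda>e. infone K K (\<lambda>a b. cnt {i\<in>I. e i = 1} x a * cnt {i\<in>I. e i = -1} x b * U a b))"
      using decoupled_counts[OF fin pD(1) PiE_mem[OF x] pD(2,3), where U = U and \<theta> = 0] U by simp
  qed
  also have "\<dots> = 2 * ?n + 4 * rad I (\<lambda>e. pexp I K p (\<lambda>x. infone K K (\<lambda>a b. cnt {i\<in>I. e i = 1} x a * cnt {i\<in>I. e i = -1} x b * U a b)))"
    unfolding pexp_add pexp_cmult pexp_const[OF fin p] by (simp add: pexp_swap[of I K])
  also have "rad I (\<lambda>e. pexp I K p (\<lambda>x. infone K K (\<lambda>a b. cnt {i\<in>I. e i = 1} x a * cnt {i\<in>I. e i = -1} x b * U a b)))
     \<le> rad I (\<lambda>e. ?n\<^sup>2 * ?H + 4 * (?n * sqrt ?n))"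
    by (intro pexp_mono prob_weights_rad half) (auto dest: signs_cases)
  also have "\<dots> = ?n\<^sup>2 * ?H + 4 * (?n * sqrt ?n)" by (simp add: pexp_const fin)
  also have "real (2 * ?n) \<le> 2 * (?n * sqrt ?n)" by (cases "?n = 0") auto
  finally show ?thesis by simp
qed

text \<open>As for \<open>sampled_cut_norm\<close>, but the row half goes through
  \<open>sampled_deviation\<close>. It leaves row weights \<open>sqrt (n * p a)\<close>, so the
  column step sums roots of \<open>p\<close>, at most \<open>sqrt (card K)\<close> in total. One
  split costs 2, 6 and 4 in front of the three terms; decoupling multiplies by 4 and the diagonal
  adds 2 to the last.\<close>

lemma sampled_deviation_cut_norm:
  fixes p :: "'b \<Rightarrow> real"
  assumes fin: "finite I" "I \<noteq> {}" and p: "prob_weights K p" and pos: "\<And>a. a \<in> K \<Longrightarrow> p a > 0"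
    and U: "\<And>a b. a \<in> K \<Longrightarrow> b \<in> K \<Longrightarrow> \<bar>U a b\<bar> \<le> 1"
  shows "pexp I K p (\<lambda>x. infone K K (\<lambda>a b. (cnt I x a - card I * p a) * cnt I x b * U a b))
    \<le> 8 * card I * sqrt (card I) * infone K K (\<lambda>a b. sqrt (p a) * p b * U a b)
      + card I * (24 * sqrt (card K) + 18 * sqrt (card I))"
proof -
  note pD = prob_weightsD[OF p]
  let ?n = "card I"
  let ?k = "card K"
  let ?H = "infone K K (\<lambda>a b. sqrt (p a) * p b * U a b)"
  have n: "?n > 0" using fin by (simp add: card_gt_0_iff)
  have H0: "?H \<ge> 0" by (rule infone_nonneg[OF pD(1)])
  have half: "pexp I K p (\<lambda>x. infone K K (\<lambda>a b. (cnt S x a - card S * p a) * cnt S' x b * U a b))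
      \<le> 2 * (?n * (sqrt ?n * ?H)) + ?n * (6 * sqrt ?k + 4 * sqrt ?n)"
    if S: "S \<union> S' = I" "S \<inter> S' = {}" for S S'
  proof -
    have SF: "finite S" "finite S'" using fin S by auto
    have c: "card S \<le> ?n" "card S' \<le> ?n" using S fin by (auto intro: card_mono)
    have "pexp I K p (\<lambda>x. infone K K (\<lambda>a b. (cnt S x a - card S * p a) * cnt S' x b * U a b))
       = pexp S' K p (\<lambda>y. pexp S K p (\<lambda>x. infone K K (\<lambda>a b. (cnt S x a - card S * p a) * (cnt S' y b * U a b))))"
      unfolding mult.assoc
    proof (rule pexp_two_halves[OF fin(1) S])
      fix x x' y y' :: "'a \<Rightarrow> 'b"
      assume "\<And>i. i \<in> S \<Longrightarrow> x i = x' i" "\<And>i. i \<in> S' \<Longrightarrow> y i = y' i"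
      then show "infone K K (\<lambda>a b. (cnt S x a - card S * p a) * (cnt S' y b * U a b))
         = infone K K (\<lambda>a b. (cnt S x' a - card S * p a) * (cnt S' y' b * U a b))"
        by (intro infone_cong arg_cong2[of _ _ _ _ "(*)"] arg_cong2[of _ _ _ _ "(-)"] cnt_cong refl)
    qed
    also have "\<dots> \<le> pexp S' K p (\<lambda>y. 2 * infone K K (\<lambda>b a. cnt S' y b * (sqrt (?n * p a) * U a b)) + (2 * sqrt ?k + 4 * sqrt ?n) * ?n)"
    proof (rule pexp_mono[OF p])
      fix y assume y: "y \<in> S' \<rightarrow>\<^sub>E K"
      have "pexp S K p (\<lambda>x. infone K K (\<lambda>a b. (cnt S x a - card S * p a) * (cnt S' y b * U a b)))
         \<le> 2 * infone K K (\<lambda>a b. sqrt (?n * p a) * (cnt S' y b * U a b)) + (2 * sqrt ?k + 4 * sqrt ?n) * (\<Sum>b\<in>K. cnt S' y b)"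
        by (rule sampled_deviation[OF SF(1) pD(1) p pos _ c(1) n]) (use U in \<open>auto simp: abs_mult mult_left_le\<close>)
      also have "(\<Sum>b\<in>K. cnt S' y b) = card S'" by (rule cnt_sum_1[OF SF(2) pD(1)]) (use y in auto)
      also have "(2 * sqrt ?k + 4 * sqrt ?n) * card S' \<le> (2 * sqrt ?k + 4 * sqrt ?n) * ?n"
        using c by (intro mult_left_mono) auto
      also have "infone K K (\<lambda>a b. sqrt (?n * p a) * (cnt S' y b * U a b)) = infone K K (\<lambda>b a. cnt S' y b * (sqrt (?n * p a) * U a b))"
        by (subst infone_transpose[OF pD(1) pD(1)]) (simp add: mult_ac)
      finally show "pexp S K p (\<lambda>x. infone K K (\<lambda>a b. (cnt S x a - card S * p a) * (cnt S' y b * U a b)))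
        \<le> 2 * infone K K (\<lambda>b a. cnt S' y b * (sqrt (?n * p a) * U a b)) + (2 * sqrt ?k + 4 * sqrt ?n) * ?n" by simp
    qed
    also have "\<dots> = 2 * pexp S' K p (\<lambda>y. infone K K (\<lambda>b a. cnt S' y b * (sqrt (?n * p a) * U a b))) + (2 * sqrt ?k + 4 * sqrt ?n) * ?n"
      unfolding pexp_add pexp_cmult pexp_const[OF SF(2) p] ..
    also have "pexp S' K p (\<lambda>y. infone K K (\<lambda>b a. cnt S' y b * (sqrt (?n * p a) * U a b)))
        \<le> card S' * infone K K (\<lambda>b a. p b * (sqrt (?n * p a) * U a b)) + 2 * sqrt (card S') * (\<Sum>a\<in>K. sqrt (?n * p a))"
      by (rule sampled_count_rows[OF SF(2) pD(1) p]) (use U pD(2) in \<open>auto simp: abs_mult mult_left_le\<close>)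
    also have "infone K K (\<lambda>b a. p b * (sqrt (?n * p a) * U a b)) = sqrt ?n * ?H"
      by (subst infone_transpose[OF pD(1) pD(1)], subst infone_cmult[symmetric, OF pD(1)]) (auto simp: real_sqrt_mult mult_ac)
    also have "(\<Sum>a\<in>K. sqrt (?n * p a)) = sqrt ?n * (\<Sum>a\<in>K. sqrt (p a))" by (simp add: real_sqrt_mult sum_distrib_left)
    also have "card S' * (sqrt ?n * ?H) + 2 * sqrt (card S') * (sqrt ?n * (\<Sum>a\<in>K. sqrt (p a)))
        \<le> ?n * (sqrt ?n * ?H) + 2 * sqrt ?n * (sqrt ?n * sqrt ?k)"
      using c H0 sum_sqrt_le[OF pD(2,3)] by (intro add_mono mult_mono sum_nonneg mult_nonneg_nonneg) (auto simp: pD(2))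
    also have "2 * sqrt ?n * (sqrt ?n * sqrt ?k) = 2 * (?n * sqrt ?k)" by simp
    finally show ?thesis by (simp add: algebra_simps)
  qed
  have "pexp I K p (\<lambda>x. infone K K (\<lambda>a b. (cnt I x a - card I * p a) * cnt I x b * U a b))
     \<le> pexp I K p (\<lambda>x. 2 * ?n + 4 * rad I (\<lambda>e. infone K K (\<lambda>a b. (cnt {i\<in>I. e i = 1} x a - card {i\<in>I. e i = 1} * p a)
          * cnt {i\<in>I. e i = -1} x b * U a b)))"
  proof (rule pexp_mono[OF p])
    fix x assume x: "x \<in> I \<rightarrow>\<^sub>E K"
    show "infone K K (\<lambda>a b. (cnt I x a - card I * p a) * cnt I x b * U a b)
       \<le> 2 * ?n + 4 * rad I (\<lambda>e. infone K K (\<lambda>a b. (cnt {i\<in>I. e i = 1} x a - card {i\<in>I. e i = 1} * p a)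
          * cnt {i\<in>I. e i = -1} x b * U a b))"
      using decoupled_counts[OF fin(1) pD(1) PiE_mem[OF x] pD(2,3), where U = U and \<theta> = 1] U by simp
  qed
  also have "\<dots> = 2 * ?n + 4 * rad I (\<lambda>e. pexp I K p (\<lambda>x. infone K K (\<lambda>a b. (cnt {i\<in>I. e i = 1} x a - card {i\<in>I. e i = 1} * p a)
          * cnt {i\<in>I. e i = -1} x b * U a b)))"
    unfolding pexp_add pexp_cmult pexp_const[OF fin(1) p] by (simp add: pexp_swap[of I K])
  also have "rad I (\<lambda>e. pexp I K p (\<lambda>x. infone K K (\<lambda>a b. (cnt {i\<in>I. e i = 1} x a - card {i\<in>I. e i = 1} * p a)
          * cnt {i\<in>I. e i = -1} x b * U a b)))
     \<le> rad I (\<lambda>e. 2 * (?n * (sqrt ?n * ?H)) + ?n * (6 * sqrt ?k + 4 * sqrt ?n))"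
    by (intro pexp_mono prob_weights_rad half) (auto dest: signs_cases)
  also have "\<dots> = 2 * (?n * (sqrt ?n * ?H)) + ?n * (6 * sqrt ?k + 4 * sqrt ?n)" by (simp add: pexp_const fin)
  also have "real (2 * ?n) \<le> 2 * (?n * sqrt ?n)" using n by auto
  finally show ?thesis by (simp add: algebra_simps)
qed

section \<open>Weak regularity\<close>

text \<open>Conditional expectation of \<open>f\<close> given the class, for the weights
  \<open>w\<close>. A class of weight 0 gets the value 0 through division by zero.\<close>

definition class_avg :: "'a set \<Rightarrow> ('a \<Rightarrow> real) \<Rightarrow> ('a \<Rightarrow> nat) \<Rightarrow> ('a \<Rightarrow> real) \<Rightarrow> 'a \<Rightarrow> real" where
  "class_avg K w c f a = (\<Sum>a'\<in>K. of_bool (c a' = c a) * w a' * f a') / (\<Sum>a'\<in>K. of_bool (c a' = c a) * w a')"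

definition block_avg :: "'a set \<Rightarrow> ('a \<Rightarrow> real) \<Rightarrow> ('a \<Rightarrow> nat) \<Rightarrow> ('a \<Rightarrow> 'a \<Rightarrow> real) \<Rightarrow> 'a \<Rightarrow> 'a \<Rightarrow> real" where
  "block_avg K w c Q a b = class_avg K w c (\<lambda>a'. class_avg K w c (Q a') b) a"

lemma class_avg_cong: "c a = c a' \<Longrightarrow> class_avg K w c f a = class_avg K w c f a'"
  by (simp add: class_avg_def)

lemma block_avg_cong: "c a = c a' \<Longrightarrow> c b = c b' \<Longrightarrow> block_avg K w c Q a b = block_avg K w c Q a' b'"
  unfolding block_avg_def by (simp add: class_avg_cong[of c b b'] class_avg_cong[of c a a'])

lemma class_avg_bounds:
  assumes "\<And>a. a \<in> K \<Longrightarrow> w a \<ge> 0" "\<And>a. a \<in> K \<Longrightarrow> 0 \<le> f a \<and> f a \<le> 1"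
  shows "0 \<le> class_avg K w c f a \<and> class_avg K w c f a \<le> 1"
proof -
  have "0 \<le> (\<Sum>a'\<in>K. of_bool (c a' = c a) * w a' * f a')" using assms by (intro sum_nonneg) auto
  moreover have "(\<Sum>a'\<in>K. of_bool (c a' = c a) * w a' * f a') \<le> (\<Sum>a'\<in>K. of_bool (c a' = c a) * w a')"
    using assms by (intro sum_mono) (auto simp: mult_left_le)
  ultimately show ?thesis
    unfolding class_avg_def by (auto simp: divide_le_eq_1 intro!: divide_nonneg_nonneg)
qed

lemma block_avg_bounds:
  assumes "\<And>a. a \<in> K \<Longrightarrow> w a \<ge> 0" "\<And>a b. a \<in> K \<Longrightarrow> b \<in> K \<Longrightarrow> 0 \<le> Q a b \<and> Q a b \<le> 1"
  shows "0 \<le> block_avg K w c Q a b \<and> block_avg K w c Q a b \<le> 1"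
  unfolding block_avg_def by (intro class_avg_bounds assms)

text \<open>Averaging preserves the weighted sum over each class, and \<open>g\<close> is constant
  there.\<close>

lemma class_avg_adjoint:
  assumes "finite K" "\<And>a. a \<in> K \<Longrightarrow> w a \<ge> 0"
    and g: "\<And>a a'. a \<in> K \<Longrightarrow> a' \<in> K \<Longrightarrow> c a = c a' \<Longrightarrow> g a = g a'"
  shows "(\<Sum>a\<in>K. w a * class_avg K w c f a * g a) = (\<Sum>a\<in>K. w a * f a * g a)"
proof -
  let ?m = "\<lambda>a. \<Sum>a'\<in>K. of_bool (c a' = c a) * w a'"
  have "(\<Sum>a\<in>K. w a * class_avg K w c f a * g a)
     = (\<Sum>a\<in>K. \<Sum>a'\<in>K. of_bool (c a' = c a) * w a * w a' * f a' * g a / ?m a)"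
    unfolding class_avg_def by (simp add: sum_distrib_left sum_distrib_right sum_divide_distrib mult_ac)
  also have "\<dots> = (\<Sum>a'\<in>K. \<Sum>a\<in>K. of_bool (c a' = c a) * w a * w a' * f a' * g a / ?m a)" by (rule sum.swap)
  also have "\<dots> = (\<Sum>a'\<in>K. \<Sum>a\<in>K. (of_bool (c a = c a') * w a) * (w a' * f a' * g a' / ?m a'))"
  proof (intro sum.cong refl)
    fix a a' assume *: "a' \<in> K" "a \<in> K"
    show "of_bool (c a' = c a) * w a * w a' * f a' * g a / ?m a
        = (of_bool (c a = c a') * w a) * (w a' * f a' * g a' / ?m a')"
    proof (cases "c a' = c a")
      case True
      then have "g a = g a'" using g[of a a'] * by simp
      with True show ?thesis by simp
    qed auto
  qed
  also have "\<dots> = (\<Sum>a'\<in>K. w a' * f a' * g a')"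
  proof (intro sum.cong refl)
    fix a' assume a': "a' \<in> K"
    \<comment> \<open>In a class of total weight 0 every weight vanishes, so the default value of
      the average does no harm.\<close>
    have z: "w a' = 0" if "?m a' = 0"
    proof -
      have "of_bool (c a' = c a') * w a' = 0"
        using that assms by (subst (asm) sum_nonneg_eq_0_iff) (auto simp: a')
      then show ?thesis by simp
    qed
    have "(\<Sum>a\<in>K. (of_bool (c a = c a') * w a) * (w a' * f a' * g a' / ?m a')) = ?m a' * (w a' * f a' * g a' / ?m a')"
      by (simp only: sum_distrib_right)
    also have "\<dots> = w a' * f a' * g a'" using z by (cases "?m a' = 0") auto
    finally show "(\<Sum>a\<in>K. (of_bool (c a = c a') * w a) * (w a' * f a' * g a' / ?m a')) = w a' * f a' * g a'" .
  qed
  finally show ?thesis .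
qed

text \<open>The L2 inner product of matrices for the product weight, only semidefinite because
  weights may vanish. The value on the diagonal is the energy of the regularity argument.\<close>

definition wip :: "'a set \<Rightarrow> ('a \<Rightarrow> real) \<Rightarrow> ('a \<Rightarrow> 'a \<Rightarrow> real) \<Rightarrow> ('a \<Rightarrow> 'a \<Rightarrow> real) \<Rightarrow> real" where
  "wip K w F G = (\<Sum>a\<in>K. \<Sum>b\<in>K. w a * w b * F a b * G a b)"

lemma wip_add: "wip K w (\<lambda>a b. F a b + F' a b) G = wip K w F G + wip K w F' G"
  unfolding wip_def by (simp add: sum.distrib algebra_simps)

lemma wip_commute: "wip K w F G = wip K w G F"
  unfolding wip_def by (simp add: mult_ac)

lemma wip_self_nonneg: "(\<And>a. a \<in> K \<Longrightarrow> w a \<ge> 0) \<Longrightarrow> wip K w F F \<ge> 0"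
  unfolding wip_def by (intro sum_nonneg) (auto simp: mult.assoc)

lemma wip_cauchy_schwarz:
  assumes "\<And>a. a \<in> K \<Longrightarrow> w a \<ge> 0"
  shows "(wip K w F G)\<^sup>2 \<le> wip K w F F * wip K w G G"
proof -
  let ?W = "\<lambda>(a, b). sqrt (w a * w b)"
  have flat: "wip K w F G = (\<Sum>z\<in>K\<times>K. (?W z * case_prod F z) * (?W z * case_prod G z))" for F G
    unfolding wip_def sum.cartesian_product
  proof (intro sum.cong refl)
    fix z assume "z \<in> K \<times> K"
    then obtain a b where z: "z = (a, b)" "w a * w b \<ge> 0" using assms by auto
    have "(sqrt (w a * w b) * F a b) * (sqrt (w a * w b) * G a b) = (sqrt (w a * w b) * sqrt (w a * w b)) * F a b * G a b"
      by (simp only: mult_ac)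
    also have "sqrt (w a * w b) * sqrt (w a * w b) = w a * w b" using real_sqrt_pow2[OF z(2)] by (simp only: power2_eq_square)
    finally show "(case z of (a, b) \<Rightarrow> w a * w b * F a b * G a b) = (?W z * case_prod F z) * (?W z * case_prod G z)"
      by (simp only: z(1) prod.case)
  qed
  show ?thesis unfolding flat using Cauchy_Schwarz_ineq_sum[of "\<lambda>z. ?W z * case_prod F z" "\<lambda>z. ?W z * case_prod G z" "K\<times>K"]
    by (simp add: power2_eq_square)
qed

text \<open>A block average is a conditional expectation in each argument; both are moved off the
  matrix in turn, against a \<open>G\<close> they leave unchanged.\<close>

lemma block_avg_orthogonal:
  assumes K: "finite K" "\<And>a. a \<in> K \<Longrightarrow> w a \<ge> 0"
    and G: "\<And>a a' b b'. a \<in> K \<Longrightarrow> a' \<in> K \<Longrightarrow> b \<in> K \<Longrightarrow> b' \<in> K \<Longrightarrow> c a = c a' \<Longrightarrow> c b = c b' \<Longrightarrow> G a b = G a' b'"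
  shows "wip K w (\<lambda>a b. Q a b - block_avg K w c Q a b) G = 0"
proof -
  have "wip K w (block_avg K w c Q) G = (\<Sum>b\<in>K. w b * (\<Sum>a\<in>K. w a * class_avg K w c (\<lambda>a'. class_avg K w c (Q a') b) a * G a b))"
    unfolding wip_def block_avg_def sum_distrib_left by (subst sum.swap) (simp add: mult_ac)
  also have "\<dots> = (\<Sum>b\<in>K. w b * (\<Sum>a\<in>K. w a * class_avg K w c (Q a) b * G a b))"
  proof (rule sum.cong[OF refl])
    fix b assume b: "b \<in> K"
    have "(\<Sum>a\<in>K. w a * class_avg K w c (\<lambda>a'. class_avg K w c (Q a') b) a * G a b)
       = (\<Sum>a\<in>K. w a * class_avg K w c (Q a) b * G a b)"
      by (rule class_avg_adjoint[OF K]) (assumption | rule refl | rule G[OF _ _ b b])+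
    then show "w b * (\<Sum>a\<in>K. w a * class_avg K w c (\<lambda>a'. class_avg K w c (Q a') b) a * G a b)
       = w b * (\<Sum>a\<in>K. w a * class_avg K w c (Q a) b * G a b)" by (simp only:)
  qed
  also have "\<dots> = (\<Sum>a\<in>K. w a * (\<Sum>b\<in>K. w b * class_avg K w c (Q a) b * G a b))"
    unfolding sum_distrib_left by (subst sum.swap) (simp add: mult_ac)
  also have "\<dots> = (\<Sum>a\<in>K. w a * (\<Sum>b\<in>K. w b * Q a b * G a b))"
  proof (rule sum.cong[OF refl])
    fix a assume a: "a \<in> K"
    have "(\<Sum>b\<in>K. w b * class_avg K w c (Q a) b * G a b) = (\<Sum>b\<in>K. w b * Q a b * G a b)"
      by (rule class_avg_adjoint[OF K]) (assumption | rule refl | rule G[OF a a])+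
    then show "w a * (\<Sum>b\<in>K. w b * class_avg K w c (Q a) b * G a b) = w a * (\<Sum>b\<in>K. w b * Q a b * G a b)"
      by (simp only:)
  qed
  also have "\<dots> = wip K w Q G" unfolding wip_def by (simp add: sum_distrib_left mult_ac)
  finally have "wip K w (block_avg K w c Q) G = wip K w Q G" .
  then show ?thesis unfolding wip_def by (simp add: sum_subtractf algebra_simps)
qed

text \<open>Energy increment: a sign pair correlating with the residual refines the partition.\<close>

lemma weak_regularity_step:
  fixes Q :: "'a \<Rightarrow> 'a \<Rightarrow> real"
  assumes w: "prob_weights K w" and st: "s \<in> signs K" "t \<in> signs K"
    and c': "\<And>a. c' a = 4 * c a + (if s a = 1 then 2 else 0) + (if t a = 1 then 1 else (0::nat))"
  defines "R \<equiv> \<lambda>c a b. Q a b - block_avg K w c Q a b"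
  shows "wip K w (R c') (R c') \<le> wip K w (R c) (R c) - (wip K w (R c) (\<lambda>a b. s a * t b))\<^sup>2"
proof -
  note wD = prob_weightsD[OF w]
  \<comment> \<open>The last two binary digits of \<open>c'\<close> record the signs of
    \<open>s\<close> and \<open>t\<close>, so \<open>c'\<close> determines the old class and both
    signs.\<close>
  have ref: "c a = c b \<and> (s a = 1 \<longleftrightarrow> s b = 1) \<and> (t a = 1 \<longleftrightarrow> t b = 1)" if "c' a = c' b" for a b
    using that unfolding c' by (cases "s a = 1"; cases "s b = 1"; cases "t a = 1"; cases "t b = 1"; simp; presburger)
  have ref_st: "s a = s b" "t a = t b" if "c' a = c' b" "a \<in> K" "b \<in> K" for a b
    using ref[OF that(1)] signs_cases[OF st(1) that(2)] signs_cases[OF st(1) that(3)]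
      signs_cases[OF st(2) that(2)] signs_cases[OF st(2) that(3)] by auto
  define D where "D = (\<lambda>a b. block_avg K w c' Q a b - block_avg K w c Q a b)"
  have orth: "wip K w (R c') D = 0"
    unfolding R_def
  proof (rule block_avg_orthogonal[OF wD(1,2)])
    fix a a' b b' assume *: "c' a = c' a'" "c' b = c' b'"
    have cc: "c a = c a'" "c b = c b'" using ref[OF *(1)] ref[OF *(2)] by auto
    show "D a b = D a' b'"
      unfolding D_def by (intro arg_cong2[of _ _ _ _ "(-)"] block_avg_cong * cc)
  qed auto
  have orth_st: "wip K w (R c') (\<lambda>a b. s a * t b) = 0"
    unfolding R_def
  proof (rule block_avg_orthogonal[OF wD(1,2)])
    fix a a' b b' assume K: "a \<in> K" "a' \<in> K" "b \<in> K" "b' \<in> K" and *: "c' a = c' a'" "c' b = c' b'"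
    show "s a * t b = s a' * t b'" by (simp only: ref_st(1)[OF *(1) K(1,2)] ref_st(2)[OF *(2) K(3,4)])
  qed
  \<comment> \<open>The new residual is orthogonal to the difference \<open>D\<close> of the block
    averages, so the energy drops by exactly the energy of \<open>D\<close>.\<close>
  have Rc: "R c = (\<lambda>a b. R c' a b + D a b)" by (auto simp: R_def D_def fun_eq_iff)
  have "wip K w (R c) (R c) = wip K w (R c') (R c) + wip K w D (R c)" by (subst Rc, subst wip_add) rule
  also have "wip K w (R c') (R c) = wip K w (R c') (R c') + wip K w D (R c')"
    by (subst wip_commute, subst Rc, subst wip_add) (simp add: wip_commute)
  also have "wip K w D (R c) = wip K w (R c') D + wip K w D D"
    by (subst wip_commute, subst Rc, subst wip_add) rule
  finally have pyth: "wip K w (R c) (R c) = wip K w (R c') (R c') + wip K w D D"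
    using orth by (simp add: wip_commute[of _ _ D "R c'"])
  \<comment> \<open>The sign product is constant on the new blocks and hence orthogonal to the new
    residual: its whole correlation with the old one sits in \<open>D\<close>. As it has norm 1,
    Cauchy-Schwarz bounds the energy of \<open>D\<close> from below.\<close>
  have "wip K w (R c) (\<lambda>a b. s a * t b) = wip K w D (\<lambda>a b. s a * t b)"
    by (subst Rc, subst wip_add) (simp add: orth_st)
  then have "(wip K w (R c) (\<lambda>a b. s a * t b))\<^sup>2 \<le> wip K w D D * wip K w (\<lambda>a b. s a * t b) (\<lambda>a b. s a * t b)"
    by (simp only:) (rule wip_cauchy_schwarz[OF wD(2)])
  also have "wip K w (\<lambda>a b. s a * t b) (\<lambda>a b. s a * t b) = 1"
  proof -
    have "wip K w (\<lambda>a b. s a * t b) (\<lambda>a b. s a * t b) = (\<Sum>a\<in>K. \<Sum>b\<in>K. w a * w b)"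
      unfolding wip_def
    proof (intro sum.cong refl)
      fix a b assume "a \<in> K" "b \<in> K"
      then have "s a * s a = 1" "t b * t b = 1" by (simp_all add: signs_sq[OF st(1)] signs_sq[OF st(2)])
      moreover have "w a * w b * (s a * t b) * (s a * t b) = w a * w b * (s a * s a) * (t b * t b)" by (simp only: mult_ac)
      ultimately show "w a * w b * (s a * t b) * (s a * t b) = w a * w b" by simp
    qed
    also have "\<dots> = (\<Sum>a\<in>K. w a) * (\<Sum>b\<in>K. w b)" by (simp add: sum_product)
    finally show ?thesis using wD(3) by simp
  qed
  finally show ?thesis using pyth by linarith
qed

text \<open>The energy increment argument of Frieze and Kannan. The energy starts at most at 1, and
  a round whose residual exceeds \<open>1 / sqrt r\<close> uses up \<open>1 / r\<close> of it, so
  \<open>r\<close> rounds are enough; a round refines by two sign vectors, whence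
  \<open>4 ^ r\<close> classes.\<close>

lemma weak_regularity:
  assumes w: "prob_weights K w" and Q: "\<And>a b. a \<in> K \<Longrightarrow> b \<in> K \<Longrightarrow> 0 \<le> Q a b \<and> Q a b \<le> 1" and r: "r > 0"
  obtains c :: "'a \<Rightarrow> nat" and V where "\<And>a. c a < 4 ^ r" "\<And>a a' b b'. c a = c a' \<Longrightarrow> c b = c b' \<Longrightarrow> V a b = V a' b'"
    "\<And>a b. 0 \<le> V a b \<and> V a b \<le> 1"
    "infone K K (\<lambda>a b. w a * w b * (Q a b - V a b)) \<le> 1 / sqrt (real r)"
proof -
  note wD = prob_weightsD[OF w]
  define R where "R = (\<lambda>c a b. Q a b - block_avg K w c Q a b)"
  let ?e = "\<lambda>c. wip K w (R c) (R c)"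
  let ?I = "\<lambda>c. infone K K (\<lambda>a b. w a * w b * R c a b)"
  have corr: "\<exists>s\<in>signs K. \<exists>t\<in>signs K. ?I c = wip K w (R c) (\<lambda>a b. s a * t b)" for c
  proof -
    obtain s t where st: "s \<in> signs K" "t \<in> signs K" "?I c = (\<Sum>a\<in>K. \<Sum>b\<in>K. s a * t b * (w a * w b * R c a b))"
      by (rule infone_attained[OF wD(1)])
    then show ?thesis unfolding wip_def by (intro bexI[OF _ st(1)] bexI[OF _ st(2)]) (simp add: mult_ac)
  qed
  have inc: "\<exists>c'. (\<forall>a. c' a < 4 * N) \<and> ?e c' \<le> ?e c - (?I c)\<^sup>2" if c: "\<forall>a. c a < N" for c N
  proof -
    obtain s t where st: "s \<in> signs K" "t \<in> signs K" "?I c = wip K w (R c) (\<lambda>a b. s a * t b)" using corr by blast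
    define c' where "c' = (\<lambda>a. 4 * c a + (if s a = 1 then 2 else 0) + (if t a = 1 then 1 else (0::nat)))"
    have "?e c' \<le> ?e c - (?I c)\<^sup>2"
    proof -
      have "?e c' \<le> ?e c - (wip K w (R c) (\<lambda>a b. s a * t b))\<^sup>2"
        unfolding R_def by (rule weak_regularity_step[OF w st(1,2)]) (simp add: c'_def)
      then show ?thesis by (simp only: st(3))
    qed
    moreover have "c' a < 4 * N" for a using c[rule_format, of a] by (auto simp: c'_def)
    ultimately show ?thesis by blast
  qed
  have e0: "?e (\<lambda>_. 0) \<le> 1"
  proof -
    have "?e (\<lambda>_. 0) \<le> (\<Sum>a\<in>K. \<Sum>b\<in>K. w a * w b)"
      unfolding wip_def
    proof (intro sum_mono)
      fix a b assume ab: "a \<in> K" "b \<in> K"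
      have "\<bar>R (\<lambda>_. 0) a b\<bar> \<le> 1"
        using Q[OF ab] block_avg_bounds[of K w Q "\<lambda>_. 0" a b, OF wD(2) Q] by (auto simp: R_def abs_le_iff)
      then have "(R (\<lambda>_. 0) a b)\<^sup>2 \<le> 1" by (simp add: abs_square_le_1)
      then have "w a * w b * (R (\<lambda>_. 0) a b)\<^sup>2 \<le> w a * w b" using wD(2) ab by (intro mult_left_le) auto
      then show "w a * w b * R (\<lambda>_. 0) a b * R (\<lambda>_. 0) a b \<le> w a * w b" by (simp add: power2_eq_square mult.assoc)
    qed
    also have "\<dots> = (\<Sum>a\<in>K. w a) * (\<Sum>b\<in>K. w b)" by (simp add: sum_product)
    finally show ?thesis using wD(3) by simp
  qed
  have I0: "?I c \<ge> 0" for c by (rule infone_nonneg[OF wD(1)])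
  have "\<exists>c. (\<forall>a. c a < 4 ^ i) \<and> (?I c \<le> 1 / sqrt r \<or> ?e c \<le> 1 - real i / r)" for i
  proof (induction i)
    case 0
    show ?case using e0 by (intro exI[of _ "\<lambda>_. 0"]) simp
  next
    case (Suc i)
    then obtain c where c: "\<forall>a. c a < 4 ^ i" "?I c \<le> 1 / sqrt r \<or> ?e c \<le> 1 - real i / r" by blast
    show ?case
    proof (cases "?I c \<le> 1 / sqrt r")
      case True
      have "(4::nat) ^ i \<le> 4 ^ Suc i" by simp
      then have "\<forall>a. c a < 4 ^ Suc i" using c(1) less_le_trans by blast
      then show ?thesis using True by blast
    next
      case False
      then have "(1 / sqrt r)\<^sup>2 \<le> (?I c)\<^sup>2" by (intro power_mono) auto
      then have "1 / r \<le> (?I c)\<^sup>2" by (simp add: power_divide)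
      moreover obtain c' where "\<forall>a. c' a < 4 * 4 ^ i" "?e c' \<le> ?e c - (?I c)\<^sup>2" using inc[OF c(1)] by blast
      ultimately show ?thesis using False c(2) by (intro exI[of _ c']) (auto simp: add_divide_distrib)
    qed
  qed
  from this[of r] obtain c where c: "\<And>a. c a < 4 ^ r" "?I c \<le> 1 / sqrt r \<or> ?e c \<le> 0" using r by auto
  have "?I c \<le> 1 / sqrt r"
  proof (cases "?e c \<le> 0")
    case True
    \<comment> \<open>If the rounds have used up all energy, one further refinement would have
      negative energy unless \<open>?I c\<close> vanishes.\<close>
    have "(?I c)\<^sup>2 \<le> 0"
    proof -
      obtain c' where "?e c' \<le> ?e c - (?I c)\<^sup>2" using inc[of c "4^r"] c(1) by blast
      moreover have "?e c' \<ge> 0" by (rule wip_self_nonneg[OF wD(2)])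
      ultimately show ?thesis using True by linarith
    qed
    then show ?thesis by simp
  qed (use c in auto)
  then have I: "infone K K (\<lambda>a b. w a * w b * (Q a b - block_avg K w c Q a b)) \<le> 1 / sqrt (real r)"
    by (simp only: R_def)
  show ?thesis
    by (rule that[of c "block_avg K w c Q", OF c(1) block_avg_cong block_avg_bounds[OF wD(2) Q] I])
qed

section \<open>Matching two labellings\<close>

lemma card_filter_remove:
  assumes "finite X" "x \<in> X"
  shows "card {z\<in>X. f z = l} = card {z\<in>X - {x}. f z = l} + of_bool (f x = l)"
proof (cases "f x = l")
  case True
  have "{z\<in>X. f z = l} = insert x {z\<in>X - {x}. f z = l}" using True assms by auto
  then show ?thesis using True assms by simp
next
  case False
  have "{z\<in>X. f z = l} = {z\<in>X - {x}. f z = l}" using False by auto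
  then show ?thesis using False by simp
qed

text \<open>Greedy pairing of elements with equal labels. When it stops, every label is exhausted on
  one side, and truncated subtraction expresses the surplus on either side.\<close>

lemma partial_matching:
  assumes "finite X" "finite Y"
  shows "\<exists>X' Y' h. X' \<subseteq> X \<and> Y' \<subseteq> Y \<and> bij_betw h X' Y' \<and> (\<forall>x\<in>X'. g (h x) = f x)
    \<and> (\<forall>l. card {x\<in>X - X'. f x = l} = card {x\<in>X. f x = l} - card {y\<in>Y. g y = l})
    \<and> (\<forall>l. card {y\<in>Y - Y'. g y = l} = card {y\<in>Y. g y = l} - card {x\<in>X. f x = l})"
  using assms
proof (induction "card X" arbitrary: X Y)
  case 0
  then show ?case by (intro exI[of _ "{}"] exI[of _ "\<lambda>_. undefined"]) (auto simp: bij_betw_def)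
next
  case (Suc n)
  show ?case
  proof (cases "\<exists>x\<in>X. \<exists>y\<in>Y. f x = g y")
    case True
    then obtain x y where xy: "x \<in> X" "y \<in> Y" "f x = g y" by blast
    obtain X' Y' h where IH: "X' \<subseteq> X - {x}" "Y' \<subseteq> Y - {y}" "bij_betw h X' Y'" "\<forall>x\<in>X'. g (h x) = f x"
      "\<forall>l. card {z\<in>X - {x} - X'. f z = l} = card {z\<in>X - {x}. f z = l} - card {z\<in>Y - {y}. g z = l}"
      "\<forall>l. card {z\<in>Y - {y} - Y'. g z = l} = card {z\<in>Y - {y}. g z = l} - card {z\<in>X - {x}. f z = l}"
    proof -
      have "n = card (X - {x})" "finite (X - {x})" "finite (Y - {y})" using Suc.hyps(2) Suc.prems xy by auto
      from Suc.hyps(1)[OF this] show ?thesis by (elim exE conjE) (rule that)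
    qed
    have 1: "X - insert x X' = X - {x} - X'" "Y - insert y Y' = Y - {y} - Y'" by auto
    have "bij_betw (h(x := y)) (insert x X') (insert y Y')"
    proof -
      have "bij_betw (h(x := y)) X' Y' = bij_betw h X' Y'" by (rule bij_betw_cong) (use IH in auto)
      then have "bij_betw (h(x := y)) (X' \<union> {x}) (Y' \<union> {(h(x := y)) x})"
        by (intro notIn_Un_bij_betw) (use IH in auto)
      then show ?thesis by simp
    qed
    moreover have "\<forall>z\<in>insert x X'. g ((h(x := y)) z) = f z" using IH xy by auto
    moreover have "card {z\<in>X - insert x X'. f z = l} = card {z\<in>X. f z = l} - card {z\<in>Y. g z = l}"
      "card {z\<in>Y - insert y Y'. g z = l} = card {z\<in>Y. g z = l} - card {z\<in>X. f z = l}" for l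
      unfolding 1 card_filter_remove[OF Suc.prems(1) xy(1), of f l] card_filter_remove[OF Suc.prems(2) xy(2), of g l]
      using IH(5,6) xy(3) by (auto simp: of_bool_def)
    ultimately show ?thesis
      using IH(1,2) xy by (intro exI[of _ "insert x X'"] exI[of _ "insert y Y'"] exI[of _ "h(x := y)"]) auto
  next
    case False
    have "card {x\<in>X. f x = l} = card {x\<in>X. f x = l} - card {y\<in>Y. g y = l}"
      "card {y\<in>Y. g y = l} = card {y\<in>Y. g y = l} - card {x\<in>X. f x = l}" for l
    proof -
      have "{x\<in>X. f x = l} = {} \<or> {y\<in>Y. g y = l} = {}" using False by auto
      then have "card {x\<in>X. f x = l} = 0 \<or> card {y\<in>Y. g y = l} = 0" by (elim disjE) (simp_all only: card.empty simp_thms)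
      then show "card {x\<in>X. f x = l} = card {x\<in>X. f x = l} - card {y\<in>Y. g y = l}"
        "card {y\<in>Y. g y = l} = card {y\<in>Y. g y = l} - card {x\<in>X. f x = l}" by auto
    qed
    then show ?thesis by (intro exI[of _ "{}"] exI[of _ "\<lambda>_. undefined"]) (auto simp: bij_betw_def)
  qed
qed

lemma bij_betw_card_filter:
  assumes "bij_betw h X Y" "\<And>x. x \<in> X \<Longrightarrow> P x \<longleftrightarrow> R (h x)"
  shows "card {x\<in>X. P x} = card {y\<in>Y. R y}"
proof (rule bij_betw_same_card[of h])
  show "bij_betw h {x\<in>X. P x} {y\<in>Y. R y}"
    using assms unfolding bij_betw_def inj_on_def by auto
qed

text \<open>Match equal labels first, then equal classes, then the rest arbitrarily.\<close>

lemma two_level_matching: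
  fixes c :: "'b \<Rightarrow> nat"
  assumes fin: "finite X" "finite Y" and card: "card X = card Y" and c: "\<And>x. x \<in> X \<Longrightarrow> c (\<alpha> x) < m"
  obtains \<sigma> where "bij_betw \<sigma> X Y"
    "\<And>a. card {x\<in>X. \<alpha> x = a \<and> \<beta> (\<sigma> x) \<noteq> a} \<le> card {x\<in>X. \<alpha> x = a} - card {y\<in>Y. \<beta> y = a}"
    "\<And>a. card {x\<in>X. \<beta> (\<sigma> x) = a \<and> \<alpha> x \<noteq> a} \<le> card {y\<in>Y. \<beta> y = a} - card {x\<in>X. \<alpha> x = a}"
    "card {x\<in>X. c (\<alpha> x) \<noteq> c (\<beta> (\<sigma> x))} \<le> (\<Sum>q<m. card {x\<in>X. c (\<alpha> x) = q} - card {y\<in>Y. c (\<beta> y) = q})"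
proof -
  obtain X1 Y1 h1 where 1: "X1 \<subseteq> X" "Y1 \<subseteq> Y" "bij_betw h1 X1 Y1" "\<forall>x\<in>X1. \<beta> (h1 x) = \<alpha> x"
    "\<And>l. card {x\<in>X - X1. \<alpha> x = l} = card {x\<in>X. \<alpha> x = l} - card {y\<in>Y. \<beta> y = l}"
    "\<And>l. card {y\<in>Y - Y1. \<beta> y = l} = card {y\<in>Y. \<beta> y = l} - card {x\<in>X. \<alpha> x = l}"
    using partial_matching[OF fin, of \<beta> \<alpha>] by (elim exE conjE) (rule that, assumption+, blast+)
  have fin1: "finite (X - X1)" "finite (Y - Y1)" using fin by auto
  obtain X2 Y2 h2 where 2: "X2 \<subseteq> X - X1" "Y2 \<subseteq> Y - Y1" "bij_betw h2 X2 Y2" "\<forall>x\<in>X2. c (\<beta> (h2 x)) = c (\<alpha> x)"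
    "\<And>l. card {x\<in>X - X1 - X2. c (\<alpha> x) = l} = card {x\<in>X - X1. c (\<alpha> x) = l} - card {y\<in>Y - Y1. c (\<beta> y) = l}"
    using partial_matching[OF fin1, of "\<lambda>y. c (\<beta> y)" "\<lambda>x. c (\<alpha> x)"] by (elim exE conjE) (rule that, assumption+, blast+)
  let ?X3 = "X - X1 - X2" and ?Y3 = "Y - Y1 - Y2"
  have sub: "finite X1" "finite X2" "finite Y1" "finite Y2" using finite_subset[OF 1(1) fin(1)] finite_subset[OF 2(1) fin1(1)]
    finite_subset[OF 1(2) fin(2)] finite_subset[OF 2(2) fin1(2)] by simp_all
  have "card ?X3 = card ?Y3"
    using bij_betw_same_card[OF 1(3)] bij_betw_same_card[OF 2(3)] card 1(1,2) 2(1,2) sub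
    by (simp add: card_Diff_subset)
  then obtain h3 where h3: "bij_betw h3 ?X3 ?Y3" using finite_same_card_bij[of ?X3 ?Y3] fin by (metis finite_Diff)
  define \<sigma> where "\<sigma> = (\<lambda>x. if x \<in> X1 then h1 x else if x \<in> X2 then h2 x else h3 x)"
  have b1: "bij_betw \<sigma> X1 Y1" using 1(3) bij_betw_cong[of X1 \<sigma> h1 Y1] by (simp add: \<sigma>_def)
  have b2: "bij_betw \<sigma> X2 Y2" proof -
    have "\<sigma> x = h2 x" if "x \<in> X2" for x using that 2(1) by (auto simp: \<sigma>_def)
    then show ?thesis using 2(3) bij_betw_cong[of X2 \<sigma> h2 Y2] by simp
  qed
  have b3: "bij_betw \<sigma> ?X3 ?Y3" using h3 bij_betw_cong[of ?X3 \<sigma> h3 ?Y3] by (simp add: \<sigma>_def)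
  have b12: "bij_betw \<sigma> (X1 \<union> X2) (Y1 \<union> Y2)" by (rule bij_betw_combine[OF b1 b2]) (use 2 in auto)
  have "bij_betw \<sigma> ((X1 \<union> X2) \<union> ?X3) ((Y1 \<union> Y2) \<union> ?Y3)" by (rule bij_betw_combine[OF b12 b3]) auto
  moreover have "(X1 \<union> X2) \<union> ?X3 = X" "(Y1 \<union> Y2) \<union> ?Y3 = Y" using 1 2 by auto
  ultimately have b: "bij_betw \<sigma> X Y" by simp
  have s1: "\<beta> (\<sigma> x) = \<alpha> x" if "x \<in> X1" for x using that 1(4) by (simp add: \<sigma>_def)
  have s2: "c (\<beta> (\<sigma> x)) = c (\<alpha> x)" if "x \<in> X2" for x
  proof -
    have "x \<notin> X1" using that 2(1) by auto
    then show ?thesis using that 2(4) by (simp add: \<sigma>_def)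
  qed
  have m1: "card {x\<in>X. \<alpha> x = a \<and> \<beta> (\<sigma> x) \<noteq> a} \<le> card {x\<in>X. \<alpha> x = a} - card {y\<in>Y. \<beta> y = a}" for a
  proof -
    have "card {x\<in>X. \<alpha> x = a \<and> \<beta> (\<sigma> x) \<noteq> a} \<le> card {x\<in>X - X1. \<alpha> x = a}"
      by (rule card_mono) (use fin s1 in auto)
    then show ?thesis using 1(5) by simp
  qed
  have m2: "card {x\<in>X. \<beta> (\<sigma> x) = a \<and> \<alpha> x \<noteq> a} \<le> card {y\<in>Y. \<beta> y = a} - card {x\<in>X. \<alpha> x = a}" for a
  proof -
    have "card {x\<in>X. \<beta> (\<sigma> x) = a \<and> \<alpha> x \<noteq> a} \<le> card {x\<in>X - X1. \<beta> (\<sigma> x) = a}"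
      by (rule card_mono) (use fin s1 in auto)
    also have "\<dots> = card {y\<in>Y - Y1. \<beta> y = a}"
    proof (rule bij_betw_card_filter[of \<sigma>])
      have "bij_betw \<sigma> (X2 \<union> ?X3) (Y2 \<union> ?Y3)" by (rule bij_betw_combine[OF b2 b3]) auto
      moreover have "X2 \<union> ?X3 = X - X1" "Y2 \<union> ?Y3 = Y - Y1" using 2 by auto
      ultimately show "bij_betw \<sigma> (X - X1) (Y - Y1)" by simp
    qed auto
    finally show ?thesis using 1(6) by simp
  qed
  have m3: "card {x\<in>X. c (\<alpha> x) \<noteq> c (\<beta> (\<sigma> x))} \<le> (\<Sum>q<m. card {x\<in>X. c (\<alpha> x) = q} - card {y\<in>Y. c (\<beta> y) = q})"
  proof -
    have "{x\<in>X. c (\<alpha> x) \<noteq> c (\<beta> (\<sigma> x))} \<subseteq> ?X3" using s1 s2 by force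
    then have "card {x\<in>X. c (\<alpha> x) \<noteq> c (\<beta> (\<sigma> x))} \<le> card ?X3" using fin by (intro card_mono) auto
    also have "?X3 = (\<Union>q<m. {x\<in>?X3. c (\<alpha> x) = q})" using c by auto
    also have "card \<dots> \<le> (\<Sum>q<m. card {x\<in>?X3. c (\<alpha> x) = q})" by (rule card_UN_le) auto
    also have "\<dots> = (\<Sum>q<m. card {x\<in>X. c (\<alpha> x) = q} - card {y\<in>Y. c (\<beta> y) = q})"
    proof (rule sum.cong[OF refl])
      fix q
      \<comment> \<open>The first round removes equally many elements of each class from both sides,
        so the surplus of a class is the same before and after it.\<close>
      have e: "card {x\<in>X1. c (\<alpha> x) = q} = card {y\<in>Y1. c (\<beta> y) = q}"
        by (rule bij_betw_card_filter[OF 1(3)]) (use 1(4) in auto)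
      have "{x\<in>X - X1. c (\<alpha> x) = q} = {x\<in>X. c (\<alpha> x) = q} - {x\<in>X1. c (\<alpha> x) = q}"
        "{y\<in>Y - Y1. c (\<beta> y) = q} = {y\<in>Y. c (\<beta> y) = q} - {y\<in>Y1. c (\<beta> y) = q}" by auto
      moreover have "{x\<in>X1. c (\<alpha> x) = q} \<subseteq> {x\<in>X. c (\<alpha> x) = q}" "{y\<in>Y1. c (\<beta> y) = q} \<subseteq> {y\<in>Y. c (\<beta> y) = q}"
        using 1 by auto
      moreover have "card {x\<in>X1. c (\<alpha> x) = q} \<le> card {x\<in>X. c (\<alpha> x) = q}" "card {y\<in>Y1. c (\<beta> y) = q} \<le> card {y\<in>Y. c (\<beta> y) = q}"
        using 1 fin by (auto intro!: card_mono)
      ultimately show "card {x\<in>?X3. c (\<alpha> x) = q} = card {x\<in>X. c (\<alpha> x) = q} - card {y\<in>Y. c (\<beta> y) = q}"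
        unfolding 2(5) using e sub by (simp add: card_Diff_subset)
    qed
    finally show ?thesis .
  qed
  show ?thesis by (rule that[OF b m1 m2 m3])
qed

text \<open>The entries depend on labels only, so coefficients can be collected by label;
  \<open>\<mu>\<close> and \<open>\<nu>\<close> bound the collected mass.\<close>

lemma labelled_bilinear_le_infone:
  assumes fin: "finite X" "finite Y" "finite K"
    and \<alpha>: "\<And>x. x \<in> X \<Longrightarrow> \<alpha> x \<in> K" "\<And>y. y \<in> Y \<Longrightarrow> \<beta> y \<in> K"
    and \<mu>: "\<And>a. a \<in> K \<Longrightarrow> (\<Sum>x\<in>{x\<in>X. \<alpha> x = a}. \<bar>p x\<bar>) \<le> \<mu> a"
    and \<nu>: "\<And>b. b \<in> K \<Longrightarrow> (\<Sum>y\<in>{y\<in>Y. \<beta> y = b}. \<bar>q y\<bar>) \<le> \<nu> b"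
  shows "(\<Sum>x\<in>X. \<Sum>y\<in>Y. p x * q y * F (\<alpha> x) (\<beta> y)) \<le> infone K K (\<lambda>a b. \<mu> a * \<nu> b * F a b)"
proof -
  have "(\<Sum>x\<in>X. \<Sum>y\<in>Y. p x * q y * F (\<alpha> x) (\<beta> y))
      = (\<Sum>x\<in>X. \<Sum>b\<in>K. \<Sum>y\<in>{y\<in>Y. \<beta> y = b}. p x * q y * F (\<alpha> x) (\<beta> y))"
    by (intro sum.cong refl sum.group[symmetric]) (use fin \<alpha> in auto)
  also have "\<dots> = (\<Sum>x\<in>X. \<Sum>b\<in>K. p x * sum q {y\<in>Y. \<beta> y = b} * F (\<alpha> x) b)"
    by (intro sum.cong refl) (auto simp: sum_distrib_left sum_distrib_right)
  also have "\<dots> = (\<Sum>a\<in>K. \<Sum>x\<in>{x\<in>X. \<alpha> x = a}. \<Sum>b\<in>K. p x * sum q {y\<in>Y. \<beta> y = b} * F (\<alpha> x) b)"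
    by (rule sum.group[symmetric]) (use fin \<alpha> in auto)
  also have "\<dots> = (\<Sum>a\<in>K. \<Sum>b\<in>K. sum p {x\<in>X. \<alpha> x = a} * sum q {y\<in>Y. \<beta> y = b} * F a b)"
  proof (rule sum.cong[OF refl])
    fix a
    have "(\<Sum>x\<in>{x\<in>X. \<alpha> x = a}. \<Sum>b\<in>K. p x * sum q {y\<in>Y. \<beta> y = b} * F (\<alpha> x) b)
       = (\<Sum>b\<in>K. \<Sum>x\<in>{x\<in>X. \<alpha> x = a}. p x * (sum q {y\<in>Y. \<beta> y = b} * F a b))"
      by (subst sum.swap) (auto intro!: sum.cong simp: mult.assoc)
    then show "(\<Sum>x\<in>{x\<in>X. \<alpha> x = a}. \<Sum>b\<in>K. p x * sum q {y\<in>Y. \<beta> y = b} * F (\<alpha> x) b)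
       = (\<Sum>b\<in>K. sum p {x\<in>X. \<alpha> x = a} * sum q {y\<in>Y. \<beta> y = b} * F a b)"
      by (simp add: sum_distrib_right[symmetric] mult.assoc)
  qed
  also have "\<dots> \<le> infone K K (\<lambda>a b. \<mu> a * \<nu> b * F a b)"
    by (rule weighted_bilinear_le_infone[OF fin(3)]) (use \<mu> \<nu> in \<open>auto intro: order_trans[OF sum_abs]\<close>)
  finally show ?thesis .
qed

text \<open>Where both indices keep their class, \<open>V\<close> takes the same value at old and
  new labels, so \<open>Q\<close> may be replaced by the residual \<open>U\<close>. The first bound
  estimates the two residual forms separately and in full; the second uses that they differ only at
  indices whose label moved, so one factor shrinks from a count to \<open>d\<close>.\<close>

lemma matched_difference:
  assumes fin: "finite X" "finite K"
    and \<alpha>: "\<And>x. x \<in> X \<Longrightarrow> \<alpha> x \<in> K" "\<And>x. x \<in> X \<Longrightarrow> \<alpha>' x \<in> K"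
    and Q: "\<And>a b. a \<in> K \<Longrightarrow> b \<in> K \<Longrightarrow> 0 \<le> Q a b \<and> Q a b \<le> 1"
    and V: "\<And>a a' b b'. c a = c a' \<Longrightarrow> c b = c b' \<Longrightarrow> V a b = V a' b'"
    and st: "\<And>x. x \<in> X \<Longrightarrow> \<bar>s x\<bar> \<le> 1" "\<And>x. x \<in> X \<Longrightarrow> \<bar>t x\<bar> \<le> 1"
    and d: "\<And>a. a \<in> K \<Longrightarrow> real (card {x\<in>X. \<alpha> x = a \<and> \<alpha>' x \<noteq> a}) \<le> d a"
      "\<And>a. a \<in> K \<Longrightarrow> real (card {x\<in>X. \<alpha>' x = a \<and> \<alpha> x \<noteq> a}) \<le> d a"
  defines "U \<equiv> \<lambda>a b. Q a b - V a b"
    and "bad \<equiv> 2 * real (card {x\<in>X. c (\<alpha> x) \<noteq> c (\<alpha>' x)}) * card X"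
    and "tot \<equiv> (\<Sum>x\<in>X. \<Sum>y\<in>X. s x * t y * (Q (\<alpha> x) (\<alpha> y) - Q (\<alpha>' x) (\<alpha>' y)))"
  shows "tot \<le> bad + infone K K (\<lambda>a b. cnt X \<alpha> a * cnt X \<alpha> b * U a b) + infone K K (\<lambda>a b. cnt X \<alpha>' a * cnt X \<alpha>' b * U a b)"
    and "tot \<le> bad + 2 * infone K K (\<lambda>a b. d a * cnt X \<alpha> b * U a b) + 2 * infone K K (\<lambda>a b. cnt X \<alpha>' a * d b * U a b)"
proof -
  let ?B = "{x\<in>X. c (\<alpha> x) \<noteq> c (\<alpha>' x)}"
  let ?D = "\<lambda>x y. Q (\<alpha> x) (\<alpha> y) - Q (\<alpha>' x) (\<alpha>' y)"
  define s0 where "s0 = (\<lambda>x. if x \<in> ?B then 0 else s x)"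
  define t0 where "t0 = (\<lambda>x. if x \<in> ?B then 0 else t x)"
  have st0: "\<bar>s0 x\<bar> \<le> 1" "\<bar>t0 x\<bar> \<le> 1" if "x \<in> X" for x using st that by (auto simp: s0_def t0_def)
  have D1: "\<bar>?D x y\<bar> \<le> 1" if "x \<in> X" "y \<in> X" for x y
    using Q[of "\<alpha> x" "\<alpha> y"] Q[of "\<alpha>' x" "\<alpha>' y"] \<alpha> that by (auto simp: abs_le_iff)
  \<comment> \<open>Setting the coefficients at class-changing indices to 0 costs 1 for a bad row
    and 1 for a bad column; this is the factor 2 in \<open>bad\<close>.\<close>
  have drop: "\<sigma> * \<tau> * z \<le> (if P then 0 else \<sigma>) * (if R then 0 else \<tau>) * z + (of_bool P + of_bool R)"
    if "\<bar>\<sigma> * \<tau> * z\<bar> \<le> 1" for \<sigma> \<tau> z :: real and P R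
    using that by (cases P; cases R) (simp_all add: abs_le_iff)
  have "tot \<le> (\<Sum>x\<in>X. \<Sum>y\<in>X. s0 x * t0 y * ?D x y + (of_bool (x \<in> ?B) + of_bool (y \<in> ?B)))"
    unfolding tot_def
  proof (intro sum_mono)
    fix x y assume xy: "x \<in> X" "y \<in> X"
    have "\<bar>s x * t y * ?D x y\<bar> \<le> 1"
      unfolding abs_mult using st xy D1[OF xy] by (intro mult_le_one) auto
    then show "s x * t y * ?D x y \<le> s0 x * t0 y * ?D x y + (of_bool (x \<in> ?B) + of_bool (y \<in> ?B))"
      unfolding s0_def t0_def by (rule drop)
  qed
  also have "\<dots> = (\<Sum>x\<in>X. \<Sum>y\<in>X. s0 x * t0 y * ?D x y) + bad"
  proof -
    have "(\<Sum>x\<in>X. of_bool (x \<in> ?B)) = real (card ?B)" using fin(1) by (simp add: Int_def)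
    moreover have "(\<Sum>x\<in>X. \<Sum>y\<in>X. F x y + (u x + u y)) = (\<Sum>x\<in>X. \<Sum>y\<in>X. F x y) + 2 * sum u X * card X"
      for F and u :: "_ \<Rightarrow> real"
      by (simp add: sum.distrib sum_distrib_left sum_distrib_right mult_ac)
    ultimately show ?thesis unfolding bad_def by simp
  qed
  also have "(\<Sum>x\<in>X. \<Sum>y\<in>X. s0 x * t0 y * ?D x y) = (\<Sum>x\<in>X. \<Sum>y\<in>X. s0 x * t0 y * (U (\<alpha> x) (\<alpha> y) - U (\<alpha>' x) (\<alpha>' y)))"
  proof (intro sum.cong refl)
    fix x y assume "x \<in> X" "y \<in> X"
    have "c (\<alpha> x) = c (\<alpha>' x) \<Longrightarrow> c (\<alpha> y) = c (\<alpha>' y) \<Longrightarrow> V (\<alpha> x) (\<alpha> y) = V (\<alpha>' x) (\<alpha>' y)" by (rule V)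
    then have "s0 x = 0 \<or> t0 y = 0 \<or> V (\<alpha> x) (\<alpha> y) = V (\<alpha>' x) (\<alpha>' y)"
      using \<open>x \<in> X\<close> \<open>y \<in> X\<close> by (auto simp: s0_def t0_def)
    then show "s0 x * t0 y * ?D x y = s0 x * t0 y * (U (\<alpha> x) (\<alpha> y) - U (\<alpha>' x) (\<alpha>' y))"
      unfolding U_def by auto
  qed
  finally have main: "tot \<le> (\<Sum>x\<in>X. \<Sum>y\<in>X. s0 x * t0 y * (U (\<alpha> x) (\<alpha> y) - U (\<alpha>' x) (\<alpha>' y))) + bad" .
  have count: "(\<Sum>x\<in>{x\<in>X. \<gamma> x = a}. \<bar>p x\<bar>) \<le> cnt X \<gamma> a" if "\<And>x. x \<in> X \<Longrightarrow> \<bar>p x\<bar> \<le> 1" for \<gamma> :: "_ \<Rightarrow> _" and p :: "_ \<Rightarrow> real" and a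
  proof -
    have "(\<Sum>x\<in>{x\<in>X. \<gamma> x = a}. \<bar>p x\<bar>) \<le> (\<Sum>x\<in>{x\<in>X. \<gamma> x = a}. 1)" by (intro sum_mono) (use that in auto)
    then show ?thesis by (simp add: cnt_def)
  qed
  have "(\<Sum>x\<in>X. \<Sum>y\<in>X. s0 x * t0 y * U (\<alpha> x) (\<alpha> y)) \<le> infone K K (\<lambda>a b. cnt X \<alpha> a * cnt X \<alpha> b * U a b)"
    by (rule labelled_bilinear_le_infone) (use fin \<alpha> st0 in \<open>auto intro!: count\<close>)
  moreover have "(\<Sum>x\<in>X. \<Sum>y\<in>X. - s0 x * t0 y * U (\<alpha>' x) (\<alpha>' y)) \<le> infone K K (\<lambda>a b. cnt X \<alpha>' a * cnt X \<alpha>' b * U a b)"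
    by (rule labelled_bilinear_le_infone) (use fin \<alpha> st0 in \<open>auto intro!: count\<close>)
  moreover have "(\<Sum>x\<in>X. \<Sum>y\<in>X. s0 x * t0 y * (U (\<alpha> x) (\<alpha> y) - U (\<alpha>' x) (\<alpha>' y)))
     = (\<Sum>x\<in>X. \<Sum>y\<in>X. s0 x * t0 y * U (\<alpha> x) (\<alpha> y)) + (\<Sum>x\<in>X. \<Sum>y\<in>X. - s0 x * t0 y * U (\<alpha>' x) (\<alpha>' y))"
    by (simp add: sum.distrib[symmetric] algebra_simps)
  ultimately show "tot \<le> bad + infone K K (\<lambda>a b. cnt X \<alpha> a * cnt X \<alpha> b * U a b) + infone K K (\<lambda>a b. cnt X \<alpha>' a * cnt X \<alpha>' b * U a b)"
    using main by linarith
  define s1 where "s1 = (\<lambda>x. s0 x * of_bool (\<alpha> x \<noteq> \<alpha>' x))"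
  define t1 where "t1 = (\<lambda>x. t0 x * of_bool (\<alpha> x \<noteq> \<alpha>' x))"
  have moved: "(\<Sum>x\<in>{x\<in>X. \<alpha> x = a}. \<bar>p x * of_bool (\<alpha> x \<noteq> \<alpha>' x)\<bar>) \<le> d a"
    "(\<Sum>x\<in>{x\<in>X. \<alpha>' x = a}. \<bar>p x * of_bool (\<alpha> x \<noteq> \<alpha>' x)\<bar>) \<le> d a"
    if "\<And>x. x \<in> X \<Longrightarrow> \<bar>p x\<bar> \<le> 1" "a \<in> K" for p :: "_ \<Rightarrow> real" and a
  proof -
    have *: "(\<Sum>x\<in>{x\<in>X. \<gamma> x = a}. \<bar>p x * of_bool (\<alpha> x \<noteq> \<alpha>' x)\<bar>) \<le> card {x\<in>X. \<gamma> x = a \<and> \<alpha> x \<noteq> \<alpha>' x}" for \<gamma>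
    proof -
      have "(\<Sum>x\<in>{x\<in>X. \<gamma> x = a}. \<bar>p x * of_bool (\<alpha> x \<noteq> \<alpha>' x)\<bar>) = (\<Sum>x\<in>{x\<in>X. \<gamma> x = a \<and> \<alpha> x \<noteq> \<alpha>' x}. \<bar>p x\<bar>)"
        by (rule sum.mono_neutral_cong_right) (use fin in auto)
      also have "\<dots> \<le> (\<Sum>x\<in>{x\<in>X. \<gamma> x = a \<and> \<alpha> x \<noteq> \<alpha>' x}. 1)" by (intro sum_mono) (use that in auto)
      finally show ?thesis by simp
    qed
    have "{x\<in>X. \<alpha> x = a \<and> \<alpha> x \<noteq> \<alpha>' x} = {x\<in>X. \<alpha> x = a \<and> \<alpha>' x \<noteq> a}"
      "{x\<in>X. \<alpha>' x = a \<and> \<alpha> x \<noteq> \<alpha>' x} = {x\<in>X. \<alpha>' x = a \<and> \<alpha> x \<noteq> a}" by auto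
    then show "(\<Sum>x\<in>{x\<in>X. \<alpha> x = a}. \<bar>p x * of_bool (\<alpha> x \<noteq> \<alpha>' x)\<bar>) \<le> d a"
      "(\<Sum>x\<in>{x\<in>X. \<alpha>' x = a}. \<bar>p x * of_bool (\<alpha> x \<noteq> \<alpha>' x)\<bar>) \<le> d a"
      using *[of \<alpha>] *[of \<alpha>'] d[OF that(2)] by auto
  qed
  have m0: "\<And>x. x \<in> X \<Longrightarrow> \<bar>- s0 x\<bar> \<le> 1" "\<And>x. x \<in> X \<Longrightarrow> \<bar>- t0 x\<bar> \<le> 1" using st0 by auto
  have e1: "(\<Sum>x\<in>X. \<Sum>y\<in>X. (s0 x * of_bool (\<alpha> x \<noteq> \<alpha>' x)) * t0 y * U (\<alpha> x) (\<alpha> y)) \<le> infone K K (\<lambda>a b. d a * cnt X \<alpha> b * U a b)"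
    by (rule labelled_bilinear_le_infone[OF fin(1) fin(1) fin(2) \<alpha>(1) \<alpha>(1) moved(1)[OF st0(1)] count[OF st0(2)]])
  have e2: "(\<Sum>x\<in>X. \<Sum>y\<in>X. (- s0 x * of_bool (\<alpha> x \<noteq> \<alpha>' x)) * t0 y * U (\<alpha>' x) (\<alpha> y)) \<le> infone K K (\<lambda>a b. d a * cnt X \<alpha> b * U a b)"
    by (rule labelled_bilinear_le_infone[OF fin(1) fin(1) fin(2) \<alpha>(2) \<alpha>(1) moved(2)[OF m0(1)] count[OF st0(2)]])
  have e3: "(\<Sum>x\<in>X. \<Sum>y\<in>X. s0 x * (t0 y * of_bool (\<alpha> y \<noteq> \<alpha>' y)) * U (\<alpha>' x) (\<alpha> y)) \<le> infone K K (\<lambda>a b. cnt X \<alpha>' a * d b * U a b)"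
    by (rule labelled_bilinear_le_infone[OF fin(1) fin(1) fin(2) \<alpha>(2) \<alpha>(1) count[OF st0(1)] moved(1)[OF st0(2)]])
  have e4: "(\<Sum>x\<in>X. \<Sum>y\<in>X. s0 x * (- t0 y * of_bool (\<alpha> y \<noteq> \<alpha>' y)) * U (\<alpha>' x) (\<alpha>' y)) \<le> infone K K (\<lambda>a b. cnt X \<alpha>' a * d b * U a b)"
    by (rule labelled_bilinear_le_infone[OF fin(1) fin(1) fin(2) \<alpha>(2) \<alpha>(2) count[OF st0(1)] moved(2)[OF m0(2)]])
  \<comment> \<open>The mixed value \<open>U (\<alpha>' x) (\<alpha> y)\<close> lets one argument
    change at a time. At an index whose label did not move the two terms of a change cancel, so the
    indicator may be inserted.\<close>
  have "(\<Sum>x\<in>X. \<Sum>y\<in>X. s0 x * t0 y * (U (\<alpha> x) (\<alpha> y) - U (\<alpha>' x) (\<alpha>' y)))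
     = (\<Sum>x\<in>X. \<Sum>y\<in>X. ((s0 x * of_bool (\<alpha> x \<noteq> \<alpha>' x)) * t0 y * U (\<alpha> x) (\<alpha> y)
       + (- s0 x * of_bool (\<alpha> x \<noteq> \<alpha>' x)) * t0 y * U (\<alpha>' x) (\<alpha> y))
       + (s0 x * (t0 y * of_bool (\<alpha> y \<noteq> \<alpha>' y)) * U (\<alpha>' x) (\<alpha> y)
       + s0 x * (- t0 y * of_bool (\<alpha> y \<noteq> \<alpha>' y)) * U (\<alpha>' x) (\<alpha>' y)))"
    by (intro sum.cong refl) (auto simp: algebra_simps)
  also have "\<dots> = ((\<Sum>x\<in>X. \<Sum>y\<in>X. (s0 x * of_bool (\<alpha> x \<noteq> \<alpha>' x)) * t0 y * U (\<alpha> x) (\<alpha> y))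
       + (\<Sum>x\<in>X. \<Sum>y\<in>X. (- s0 x * of_bool (\<alpha> x \<noteq> \<alpha>' x)) * t0 y * U (\<alpha>' x) (\<alpha> y)))
       + ((\<Sum>x\<in>X. \<Sum>y\<in>X. s0 x * (t0 y * of_bool (\<alpha> y \<noteq> \<alpha>' y)) * U (\<alpha>' x) (\<alpha> y))
       + (\<Sum>x\<in>X. \<Sum>y\<in>X. s0 x * (- t0 y * of_bool (\<alpha> y \<noteq> \<alpha>' y)) * U (\<alpha>' x) (\<alpha>' y)))"
    by (simp only: sum.distrib)
  finally show "tot \<le> bad + 2 * infone K K (\<lambda>a b. d a * cnt X \<alpha> b * U a b) + 2 * infone K K (\<lambda>a b. cnt X \<alpha>' a * d b * U a b)"
    using main e1 e2 e3 e4 by linarith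
qed

section \<open>Adjacency noise\<close>

text \<open>For \<open>u = - v\<close> negative the estimate is inverted:
  \<open>1 - v + v\<^sup>2\<close> times the quadratic lower bound of \<open>exp v\<close> is at
  least 1.\<close>

lemma exp_le_quadratic:
  fixes u :: real
  assumes "\<bar>u\<bar> \<le> 1"
  shows "exp u \<le> 1 + u + u\<^sup>2"
proof (cases "u \<ge> 0")
  case True
  then show ?thesis using exp_bound[of u] assms by simp
next
  case False
  define v where "v = - u"
  have v: "0 \<le> v" "v \<le> 1" using False assms by (auto simp: v_def)
  have e: "exp v \<ge> 1 + v + v\<^sup>2 / 2" by (rule exp_lower_Taylor_quadratic[OF v(1)])
  have q: "1 - v + v\<^sup>2 \<ge> 0" using v by simp
  have "(1 - v + v\<^sup>2) * (1 + v + v\<^sup>2 / 2) = 1 + (v\<^sup>2 + v ^ 3 + v ^ 4) / 2"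
    by (simp add: power2_eq_square power3_eq_cube power4_eq_xxxx field_simps)
  also have "\<dots> \<ge> 1" using v by simp
  finally have "1 \<le> (1 - v + v\<^sup>2) * exp v" using mult_left_mono[OF e q] by linarith
  then have "exp (- v) \<le> 1 - v + v\<^sup>2" by (simp add: exp_minus field_simps)
  then show ?thesis by (simp add: v_def)
qed

text \<open>The exponent must carry the factor \<open>\<rho>\<close>, which bounds the variance; a
  bound for general variables of range 1 would lose it, and with it the factor
  \<open>sqrt \<rho>\<close> in the noise.\<close>

lemma bernoulli_mgf:
  fixes q u :: real
  assumes "0 \<le> q" "q \<le> \<rho>" "\<rho> \<le> 1" "\<bar>u\<bar> \<le> 1"
  shows "measure_pmf.expectation (bernoulli_pmf q) (\<lambda>b. exp (u * (of_bool b - q))) \<le> exp (\<rho> * u\<^sup>2)"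
proof -
  have "measure_pmf.expectation (bernoulli_pmf q) (\<lambda>b. exp (u * (of_bool b - q)))
     = exp (- (u * q)) * (1 + q * (exp u - 1))"
    using assms by (subst integral_measure_pmf[where A = UNIV])
      (auto simp: UNIV_bool exp_diff exp_minus right_diff_distrib field_simps)
  also have "\<dots> \<le> exp (- (u * q)) * exp (q * (exp u - 1))"
    by (intro mult_left_mono) (auto simp: exp_ge_add_one_self add.commute)
  also have "\<dots> = exp (q * (exp u - 1 - u))" by (simp add: exp_add[symmetric] algebra_simps)
  also have "\<dots> \<le> exp (\<rho> * u\<^sup>2)"
  proof -
    have "q * (exp u - 1 - u) \<le> q * u\<^sup>2" using exp_le_quadratic[OF assms(4)] assms by (intro mult_left_mono) auto
    also have "\<dots> \<le> \<rho> * u\<^sup>2" using assms by (intro mult_right_mono) auto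
    finally show ?thesis by simp
  qed
  finally show ?thesis .
qed

definition edge_pairs :: "nat \<Rightarrow> (nat \<times> nat) set" where
  "edge_pairs n = {(i, j). 1 \<le> i \<and> i < j \<and> j \<le> n}"

abbreviation edge_pmf :: "nat \<Rightarrow> (nat \<Rightarrow> nat \<Rightarrow> real) \<Rightarrow> (nat \<times> nat \<Rightarrow> bool) pmf" where
  "edge_pmf n \<Theta> \<equiv> Pi_pmf (edge_pairs n) False (\<lambda>(i, j). bernoulli_pmf (\<Theta> i j))"

lemma finite_edge_pairs [simp]: "finite (edge_pairs n)"
  by (rule finite_subset[of _ "{1..n} \<times> {1..n}"]) (auto simp: edge_pairs_def)

lemma finite_set_edge_pmf: "finite (set_pmf (edge_pmf n \<Theta>))"
proof -
  have "set_pmf (edge_pmf n \<Theta>) \<subseteq> PiE_dflt (edge_pairs n) False (\<lambda>_. UNIV)"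
    by (subst set_Pi_pmf) (auto simp: PiE_dflt_def)
  then show ?thesis by (rule finite_subset) (auto intro!: finite_PiE_dflt)
qed

lemma finite_set_adjacency_pmf: "finite (set_pmf (adjacency_pmf n \<Theta>))"
  unfolding adjacency_pmf_def edge_pairs_def[symmetric] by (simp add: finite_set_edge_pmf)

lemma sum_offdiag:
  fixes H :: "nat \<Rightarrow> nat \<Rightarrow> real"
  assumes "\<And>i. H i i = 0"
  shows "(\<Sum>i\<in>{1..n}. \<Sum>j\<in>{1..n}. H i j) = (\<Sum>(i, j)\<in>edge_pairs n. H i j + H j i)"
proof -
  let ?S = "{1..n} \<times> {1..n}"
  let ?D = "{z\<in>?S. fst z = snd z}" and ?L = "{z\<in>?S. fst z > snd z}"
  have S: "?S = (edge_pairs n \<union> ?L) \<union> ?D" by (auto simp: edge_pairs_def)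
  have "(\<Sum>i\<in>{1..n}. \<Sum>j\<in>{1..n}. H i j) = (\<Sum>(i, j)\<in>?S. H i j)" by (simp add: sum.cartesian_product)
  also have "\<dots> = (\<Sum>(i, j)\<in>edge_pairs n \<union> ?L. H i j)"
    by (rule sum.mono_neutral_right) (use assms in \<open>auto simp: edge_pairs_def not_less le_less\<close>)
  also have "\<dots> = (\<Sum>(i, j)\<in>edge_pairs n. H i j) + (\<Sum>(i, j)\<in>?L. H i j)"
    by (rule sum.union_disjoint[OF finite_edge_pairs]) (auto simp: edge_pairs_def)
  also have "(\<Sum>(i, j)\<in>?L. H i j) = (\<Sum>(i, j)\<in>edge_pairs n. H j i)"
    by (rule sum.reindex_bij_witness[of _ "\<lambda>(i, j). (j, i)" "\<lambda>(i, j). (j, i)"]) (auto simp: edge_pairs_def)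
  finally show ?thesis by (simp add: sum.distrib case_prod_unfold)
qed

lemma card_edge_pairs: "2 * card (edge_pairs n) \<le> n\<^sup>2"
proof -
  have "real (2 * card (edge_pairs n)) = (\<Sum>(i, j)\<in>edge_pairs n. (of_bool (i \<noteq> j) + of_bool (j \<noteq> i) :: real))"
    by (subst sum.cong[of _ "edge_pairs n" _ "\<lambda>_. 2"]) (auto simp: edge_pairs_def)
  also have "\<dots> = (\<Sum>i\<in>{1..n}. \<Sum>j\<in>{1..n}. of_bool (i \<noteq> j))"
    by (rule sum_offdiag[symmetric]) simp
  also have "\<dots> \<le> (\<Sum>i\<in>{1..n}. \<Sum>j\<in>{1..n}. 1)" by (intro sum_mono) auto
  also have "\<dots> = real (n\<^sup>2)" by (simp add: power2_eq_square)
  finally show ?thesis by linarith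
qed

lemma expectation_affine_sum:
  assumes "finite (set_pmf p)"
  shows "measure_pmf.expectation p (\<lambda>e. (L + (\<Sum>z\<in>Z. f z e * c)) / l)
    = (L + (\<Sum>z\<in>Z. measure_pmf.expectation p (f z) * c)) / (l::real)"
  by (simp add: integrable_measure_pmf_finite[OF assms])

text \<open>The union bound over sign pairs needs a parameter \<open>l\<close> of order
  \<open>1 / sqrt (\<rho> * n)\<close>, admissible only if \<open>\<rho> * n \<ge> 1\<close>. In the
  sparser case the sum of all absolute values suffices: its mean is of order
  \<open>n\<^sup>2 * \<rho>\<close>, and \<open>\<rho> \<le> sqrt (\<rho> / n)\<close>
  there.\<close>

lemma adjacency_noise:
  assumes n: "n \<ge> 1" and \<rho>: "0 < \<rho>" "\<rho> \<le> 1"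
    and \<Theta>: "\<And>i j. i \<in> {1..n} \<Longrightarrow> j \<in> {1..n} \<Longrightarrow> 0 \<le> \<Theta> i j \<and> \<Theta> i j \<le> \<rho> \<and> \<Theta> i j = \<Theta> j i" "\<And>i. \<Theta> i i = 0"
  shows "measure_pmf.expectation (adjacency_pmf n \<Theta>) (\<lambda>A. infone {1..n} {1..n} (\<lambda>i j. A i j - \<Theta> i j))
    \<le> 9 * n\<^sup>2 * sqrt (\<rho> / n)"
proof -
  let ?P = "edge_pairs n" and ?I = "{1..n}"
  let ?E = "measure_pmf.expectation (edge_pmf n \<Theta>)"
  let ?q = "\<lambda>z. \<Theta> (fst z) (snd z)"
  note int = integrable_measure_pmf_finite[OF finite_set_edge_pmf, of n \<Theta>]
  define A where "A = (\<lambda>e i (j::nat). of_bool (e (min i j, max i j)) :: real)"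
  have pe: "edge_pmf n \<Theta> = Pi_pmf ?P False (\<lambda>z. bernoulli_pmf (?q z))"
    by (simp add: case_prod_unfold)
  have supp: "\<not> e (i, i)" if "e \<in> set_pmf (edge_pmf n \<Theta>)" for e i
  proof -
    have "(i, i) \<notin> edge_pairs n" by (simp add: edge_pairs_def)
    then show ?thesis using that by (subst (asm) set_Pi_pmf) (auto simp: PiE_dflt_def)
  qed
  have q01: "0 \<le> ?q z" "?q z \<le> \<rho>" "?q z \<le> 1" if "z \<in> ?P" for z using \<Theta>(1)[of "fst z" "snd z"] that \<rho> by (auto simp: edge_pairs_def)
  have rep: "(\<Sum>i\<in>?I. \<Sum>j\<in>?I. s i * t j * (A e i j - \<Theta> i j))
     = (\<Sum>z\<in>?P. (s (fst z) * t (snd z) + s (snd z) * t (fst z)) * (of_bool (e z) - ?q z))"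
    if "e \<in> set_pmf (edge_pmf n \<Theta>)" for e and s t :: "nat \<Rightarrow> real"
  proof -
    have "(\<Sum>i\<in>?I. \<Sum>j\<in>?I. s i * t j * (A e i j - \<Theta> i j))
      = (\<Sum>(i, j)\<in>?P. s i * t j * (A e i j - \<Theta> i j) + s j * t i * (A e j i - \<Theta> j i))"
      by (rule sum_offdiag) (simp add: A_def supp[OF that] \<Theta>(2))
    also have "\<dots> = (\<Sum>z\<in>?P. (s (fst z) * t (snd z) + s (snd z) * t (fst z)) * (of_bool (e z) - ?q z))"
    proof (rule sum.cong[OF refl])
      fix z assume z: "z \<in> ?P"
      then obtain i j where ij: "z = (i, j)" "1 \<le> i" "i < j" "j \<le> n" by (auto simp: edge_pairs_def)
      then show "(case z of (i, j) \<Rightarrow> s i * t j * (A e i j - \<Theta> i j) + s j * t i * (A e j i - \<Theta> j i))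
        = (s (fst z) * t (snd z) + s (snd z) * t (fst z)) * (of_bool (e z) - ?q z)"
        using \<Theta>(1)[of i j] by (simp add: A_def algebra_simps)
    qed
    finally show ?thesis .
  qed
  have "measure_pmf.expectation (adjacency_pmf n \<Theta>) (\<lambda>A. infone ?I ?I (\<lambda>i j. A i j - \<Theta> i j))
     = ?E (\<lambda>e. infone ?I ?I (\<lambda>i j. A e i j - \<Theta> i j))"
    unfolding adjacency_pmf_def edge_pairs_def[symmetric] A_def by simp
  also have "\<dots> \<le> 9 * n\<^sup>2 * sqrt (\<rho> / n)"
  proof (cases "\<rho> * n \<ge> 1")
    case True
    \<comment> \<open>This \<open>l\<close> makes the exponent
      \<open>2 * n\<^sup>2 * \<rho> * l\<^sup>2\<close> comparable to the entropy
      \<open>n * ln 4\<close> of the sign pairs, and keeps \<open>2 * l\<close> in the range of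
      \<open>bernoulli_mgf\<close>. \<open>L\<close> is the logarithm of the union bound.\<close>
    define l where "l = 1 / (2 * sqrt (\<rho> * n))"
    define L where "L = n * ln 4 + 2 * (real n)\<^sup>2 * \<rho> * l\<^sup>2"
    have sq: "sqrt (\<rho> * n) \<ge> 1" using True by simp
    have l: "l > 0" "2 * l \<le> 1" using sq by (auto simp: l_def field_simps)
    have l2: "l\<^sup>2 = 1 / (4 * (\<rho> * n))" using \<rho> by (simp add: l_def power_divide power_mult_distrib)
    have L2: "2 * (real n)\<^sup>2 * \<rho> * l\<^sup>2 = n / 2" unfolding l2 using n \<rho> by (simp add: power2_eq_square field_simps)
    let ?X = "\<lambda>s t e. \<Sum>i\<in>?I. \<Sum>j\<in>?I. s i * t j * (A e i j - \<Theta> i j)"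
    have mgf: "?E (\<lambda>e. exp (l * ?X s t e)) \<le> exp (2 * (real n)\<^sup>2 * \<rho> * l\<^sup>2)"
      if st: "s \<in> signs ?I" "t \<in> signs ?I" for s t
    proof -
      let ?u = "\<lambda>z. l * (s (fst z) * t (snd z) + s (snd z) * t (fst z))"
      have u: "\<bar>?u z\<bar> \<le> 2 * l" if "z \<in> ?P" for z
      proof -
        have "\<bar>s (fst z) * t (snd z)\<bar> = 1" "\<bar>s (snd z) * t (fst z)\<bar> = 1"
          using st that by (auto simp: abs_mult signs_abs edge_pairs_def)
        then have "\<bar>s (fst z) * t (snd z) + s (snd z) * t (fst z)\<bar> \<le> 2" by linarith
        then show ?thesis using l by (simp add: abs_mult)
      qed
      have "?E (\<lambda>e. exp (l * ?X s t e)) = ?E (\<lambda>e. \<Prod>z\<in>?P. exp (?u z * (of_bool (e z) - ?q z)))"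
      proof (rule integral_cong_AE)
        show "AE e in measure_pmf (edge_pmf n \<Theta>). exp (l * ?X s t e) = (\<Prod>z\<in>?P. exp (?u z * (of_bool (e z) - ?q z)))"
          unfolding AE_measure_pmf_iff
        proof
        fix e assume "e \<in> set_pmf (edge_pmf n \<Theta>)"
        then show "exp (l * ?X s t e) = (\<Prod>z\<in>?P. exp (?u z * (of_bool (e z) - ?q z)))"
          by (simp only: rep) (simp add: exp_sum[symmetric] sum_distrib_left mult.assoc)
        qed
      qed simp_all
      also have "\<dots> = (\<Prod>z\<in>?P. measure_pmf.expectation (bernoulli_pmf (?q z)) (\<lambda>b. exp (?u z * (of_bool b - ?q z))))"
        unfolding pe by (rule expectation_prod_Pi_pmf) (auto intro!: integrable_measure_pmf_finite)
      also have "\<dots> \<le> (\<Prod>z\<in>?P. exp (\<rho> * (2 * l)\<^sup>2))"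
      proof (intro prod_mono conjI)
        fix z assume z: "z \<in> ?P"
        have "measure_pmf.expectation (bernoulli_pmf (?q z)) (\<lambda>b. exp (?u z * (of_bool b - ?q z))) \<le> exp (\<rho> * (?u z)\<^sup>2)"
          by (rule bernoulli_mgf) (use q01[OF z] \<rho> u[OF z] l in auto)
        also have "\<dots> \<le> exp (\<rho> * (2 * l)\<^sup>2)"
        proof -
          have "\<bar>?u z\<bar> \<le> \<bar>2 * l\<bar>" using u[OF z] l by linarith
          then have "(?u z)\<^sup>2 \<le> (2 * l)\<^sup>2" by (simp only: abs_le_square_iff)
          then show ?thesis using \<rho> by (simp add: mult_left_mono)
        qed
        finally show "measure_pmf.expectation (bernoulli_pmf (?q z)) (\<lambda>b. exp (?u z * (of_bool b - ?q z))) \<le> exp (\<rho> * (2 * l)\<^sup>2)" .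
      qed (auto intro!: integral_nonneg_AE)
      also have "\<dots> = exp (card ?P * (\<rho> * (2 * l)\<^sup>2))" by (simp add: exp_of_nat_mult)
      also have "\<dots> \<le> exp (2 * (real n)\<^sup>2 * \<rho> * l\<^sup>2)"
      proof -
        have "real (2 * card ?P) * (2 * \<rho> * l\<^sup>2) \<le> real (n\<^sup>2) * (2 * \<rho> * l\<^sup>2)"
          using \<rho> by (intro mult_right_mono of_nat_mono card_edge_pairs) auto
        then show ?thesis by (simp add: power_mult_distrib mult_ac)
      qed
      finally show ?thesis .
    qed
    let ?ST = "signs ?I \<times> signs ?I"
    have card_ST: "real (card ?ST) = exp (n * ln 4)"
    proof -
      have "card ?ST = 2 ^ n * 2 ^ n" by (simp add: card_cartesian_product card_PiE numeral_2_eq_2)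
      also have "\<dots> = (4::nat) ^ n" by (simp only: power_mult_distrib[symmetric]) simp
      finally show ?thesis by (simp add: exp_of_nat_mult)
    qed
    have "?E (\<lambda>e. infone ?I ?I (\<lambda>i j. A e i j - \<Theta> i j)) \<le> ?E (\<lambda>e. (L + (\<Sum>z\<in>?ST. exp (l * ?X (fst z) (snd z) e) * exp (- L))) / l)"
    proof (rule integral_mono[OF int int])
      fix e
      obtain s t where st: "s \<in> signs ?I" "t \<in> signs ?I" "infone ?I ?I (\<lambda>i j. A e i j - \<Theta> i j) = ?X s t e"
        by (rule infone_attained[OF finite_atLeastAtMost])
      \<comment> \<open>Replacing the exponent by its exponential allows the maximum to be bounded
        by the sum over all sign pairs; the choice of \<open>L\<close> makes the mean of that sum at
        most 1.\<close>
      have "l * ?X s t e - L \<le> exp (l * ?X s t e - L)" using exp_ge_add_one_self[of "l * ?X s t e - L"] by linarith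
      also have "\<dots> = exp (l * ?X s t e) * exp (- L)" by (simp add: exp_add[symmetric])
      also have "\<dots> \<le> (\<Sum>z\<in>?ST. exp (l * ?X (fst z) (snd z) e) * exp (- L))"
        using member_le_sum[of "(s, t)" ?ST "\<lambda>z. exp (l * ?X (fst z) (snd z) e) * exp (- L)"] st(1,2) by auto
      finally show "infone ?I ?I (\<lambda>i j. A e i j - \<Theta> i j) \<le> (L + (\<Sum>z\<in>?ST. exp (l * ?X (fst z) (snd z) e) * exp (- L))) / l"
        unfolding st(3) using l by (simp add: field_simps)
    qed
    also have "\<dots> = (L + (\<Sum>z\<in>?ST. ?E (\<lambda>e. exp (l * ?X (fst z) (snd z) e)) * exp (- L))) / l"
      by (rule expectation_affine_sum[OF finite_set_edge_pmf])
    also have "\<dots> \<le> (L + (\<Sum>z\<in>?ST. exp (2 * (real n)\<^sup>2 * \<rho> * l\<^sup>2) * exp (- L))) / l"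
      by (intro divide_right_mono add_left_mono sum_mono) (use l mgf in \<open>auto intro!: mult_right_mono\<close>)
    also have "(\<Sum>z\<in>?ST. exp (2 * (real n)\<^sup>2 * \<rho> * l\<^sup>2) * exp (- L)) = real (card ?ST) * (exp (2 * (real n)\<^sup>2 * \<rho> * l\<^sup>2) * exp (- L))"
      by simp
    also have "\<dots> = 1" unfolding card_ST L_def by (simp add: exp_add[symmetric])
    also have "(L + 1) / l = (n * ln 4 + n / 2 + 1) * (2 * sqrt (\<rho> * n))" unfolding L_def L2 by (simp add: l_def)
    also have "\<dots> \<le> (9/2 * n) * (2 * sqrt (\<rho> * n))"
    proof (rule mult_right_mono)
      \<comment> \<open>The crude bounds \<open>ln 4 \<le> 3\<close> and \<open>1 \<le> n\<close>
        give 3 + 1/2 + 1 = 9/2.\<close>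
      have "ln 4 \<le> (3::real)" using ln_le_minus_one[of "4::real"] by simp
      then have "real n * ln 4 \<le> real n * 3" by (intro mult_left_mono) auto
      moreover have "real n \<ge> 1" using n by simp
      ultimately show "n * ln 4 + n / 2 + 1 \<le> 9/2 * n" by linarith
    qed (use \<rho> in auto)
    also have "\<dots> = 9 * n\<^sup>2 * sqrt (\<rho> / n)"
    proof -
      have "sqrt (\<rho> * n) = sqrt (n\<^sup>2 * (\<rho> / n))" using n by (simp add: power2_eq_square)
      also have "\<dots> = n * sqrt (\<rho> / n)" by (simp only: real_sqrt_mult of_nat_power) simp
      finally show ?thesis by (simp add: power2_eq_square)
    qed
    finally show ?thesis .
  next
    case False
    have "?E (\<lambda>e. infone ?I ?I (\<lambda>i j. A e i j - \<Theta> i j)) \<le> ?E (\<lambda>e. \<Sum>z\<in>?P. 2 * (of_bool (e z) + ?q z))"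
    proof (rule integral_mono_AE[OF int int], unfold AE_measure_pmf_iff, rule ballI)
      fix e assume e: "e \<in> set_pmf (edge_pmf n \<Theta>)"
      obtain s t where st: "s \<in> signs ?I" "t \<in> signs ?I"
        "infone ?I ?I (\<lambda>i j. A e i j - \<Theta> i j) = (\<Sum>i\<in>?I. \<Sum>j\<in>?I. s i * t j * (A e i j - \<Theta> i j))"
        by (rule infone_attained[OF finite_atLeastAtMost])
      show "infone ?I ?I (\<lambda>i j. A e i j - \<Theta> i j) \<le> (\<Sum>z\<in>?P. 2 * (of_bool (e z) + ?q z))"
        unfolding st(3) rep[OF e]
      proof (rule sum_mono)
        fix z assume z: "z \<in> ?P"
        have "\<bar>s (fst z) * t (snd z)\<bar> = 1" "\<bar>s (snd z) * t (fst z)\<bar> = 1"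
          using st z by (auto simp: abs_mult signs_abs edge_pairs_def)
        then have "\<bar>s (fst z) * t (snd z) + s (snd z) * t (fst z)\<bar> \<le> 2" by linarith
        moreover have "\<bar>of_bool (e z) - ?q z\<bar> \<le> of_bool (e z) + ?q z" using q01[OF z] by auto
        ultimately have "\<bar>s (fst z) * t (snd z) + s (snd z) * t (fst z)\<bar> * \<bar>of_bool (e z) - ?q z\<bar> \<le> 2 * (of_bool (e z) + ?q z)"
          by (intro mult_mono) auto
        then show "(s (fst z) * t (snd z) + s (snd z) * t (fst z)) * (of_bool (e z) - ?q z) \<le> 2 * (of_bool (e z) + ?q z)"
          unfolding abs_mult[symmetric] by linarith
      qed
    qed
    also have "\<dots> = (\<Sum>z\<in>?P. 2 * (?E (\<lambda>e. of_bool (e z)) + ?q z))"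
      by (simp add: int)
    also have "\<dots> \<le> (\<Sum>z\<in>?P. 4 * \<rho>)"
    proof (rule sum_mono)
      fix z assume z: "z \<in> ?P"
      have "?E (\<lambda>e. of_bool (e z)) = measure_pmf.expectation (map_pmf (\<lambda>e. e z) (edge_pmf n \<Theta>)) (\<lambda>b. of_bool b :: real)"
        by (simp only: integral_map_pmf)
      also have "map_pmf (\<lambda>e. e z) (edge_pmf n \<Theta>) = bernoulli_pmf (?q z)"
        unfolding pe using z by (subst Pi_pmf_component) auto
      also have "measure_pmf.expectation (bernoulli_pmf (?q z)) (\<lambda>b. of_bool b :: real) = ?q z"
        using q01[OF z] by (subst integral_measure_pmf[where A = UNIV]) (auto simp: UNIV_bool)
      finally show "2 * (?E (\<lambda>e. of_bool (e z)) + ?q z) \<le> 4 * \<rho>" using q01[OF z] by simp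
    qed
    also have "\<dots> = real (2 * card ?P) * (2 * \<rho>)" by simp
    also have "\<dots> \<le> real (n\<^sup>2) * (2 * \<rho>)" using \<rho> by (intro mult_right_mono of_nat_mono card_edge_pairs) auto
    also have "\<dots> \<le> n\<^sup>2 * (9 * sqrt (\<rho> / n))"
    proof (rule mult_left_mono)
      have "\<rho> * n \<le> 1" using False by simp
      then have "\<rho> \<le> 1 / n" using n by (simp add: field_simps)
      then have "\<rho> * \<rho> \<le> \<rho> * (1 / n)" using \<rho> by (intro mult_left_mono) auto
      then have "\<rho> \<le> sqrt (\<rho> / n)" by (intro real_le_rsqrt) (simp add: power2_eq_square)
      then show "2 * \<rho> \<le> 9 * sqrt (\<rho> / n)" using \<rho> by linarith
    qed auto
    finally show ?thesis by simp
  qed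
  finally show ?thesis by simp
qed

section \<open>Cut norms on grids\<close>

lemma complete_lebesgue: "complete_measure lebesgue"
  by (rule completion.complete_measure_axioms)

text \<open>Lebesgue measure of the plane completes a product of Borel measures and is not a product
  of completions. The Borel main parts of \<open>S\<close> and \<open>T\<close> change the rectangle
  only inside two null strips.\<close>

lemma lebesgue_Times:
  fixes S T :: "real set"
  assumes "S \<in> sets lebesgue" "T \<in> sets lebesgue"
  shows "S \<times> T \<in> sets lebesgue" "emeasure lebesgue (S \<times> T) = emeasure lebesgue S * emeasure lebesgue T"
proof -
  let ?S = "main_part lborel S" and ?T = "main_part lborel T"
  obtain N where N: "N \<in> null_sets lborel" "null_part lborel S \<subseteq> N" using null_part[OF assms(1)] by blast
  obtain N' where N': "N' \<in> null_sets lborel" "null_part lborel T \<subseteq> N'" using null_part[OF assms(2)] by blast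
  have S: "?S \<in> sets lborel" "?S \<union> null_part lborel S = S"
    using main_part_sets[OF assms(1)] main_part_null_part_Un[OF assms(1)] by blast+
  have T: "?T \<in> sets lborel" "?T \<union> null_part lborel T = T"
    using main_part_sets[OF assms(2)] main_part_null_part_Un[OF assms(2)] by blast+
  have times: "A \<times> B \<in> sets lborel" "emeasure lborel (A \<times> B) = emeasure lborel A * emeasure lborel B"
    if "A \<in> sets lborel" "B \<in> sets lborel" for A B :: "real set"
  proof -
    have "A \<times> B \<in> sets (lborel \<Otimes>\<^sub>M lborel)" using that by (rule pair_measureI)
    then show "A \<times> B \<in> sets lborel" unfolding lborel_prod .
    show "emeasure lborel (A \<times> B) = emeasure lborel A * emeasure lborel B"
      unfolding lborel_prod[symmetric] by (rule lborel.emeasure_pair_measure_Times) (use that in auto)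
  qed
  have nulls: "N \<times> (UNIV :: real set) \<in> null_sets lborel" "(UNIV :: real set) \<times> N' \<in> null_sets lborel"
    using times[of N UNIV] times[of UNIV N'] N N' by (auto simp: null_sets_def)
  have "AE z in lborel. z \<notin> N \<times> (UNIV :: real set) \<union> (UNIV :: real set) \<times> N'"
    by (rule AE_not_in) (rule null_sets.Un[OF nulls])
  then have "AE z in lebesgue. z \<notin> N \<times> (UNIV :: real set) \<union> (UNIV :: real set) \<times> N'" by (rule AE_completion)
  then have ae: "AE z in lebesgue. z \<in> ?S \<times> ?T \<longleftrightarrow> z \<in> S \<times> T"
  proof eventually_elim
    case (elim z)
    then show ?case using S(2) T(2) N(2) N'(2) by (cases z) blast
  qed
  show st: "S \<times> T \<in> sets lebesgue"
    by (rule complete_measure.in_sets_AE[OF complete_lebesgue ae]) (use times[OF S(1) T(1)] in auto)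
  have "emeasure lebesgue (S \<times> T) = emeasure lebesgue (?S \<times> ?T)"
    by (rule emeasure_eq_AE[symmetric, OF ae]) (use st times[OF S(1) T(1)] in auto)
  also have "\<dots> = emeasure lborel (?S \<times> ?T)" using times(1)[OF S(1) T(1)] by simp
  also have "\<dots> = emeasure lebesgue S * emeasure lebesgue T" using times(2)[OF S(1) T(1)] assms by simp
  finally show "emeasure lebesgue (S \<times> T) = emeasure lebesgue S * emeasure lebesgue T" .
qed

lemma sets_unit_leb: "S \<in> sets unit_leb \<longleftrightarrow> S \<in> sets lebesgue \<and> S \<subseteq> {0..1}"
  by (auto simp: sets_restrict_space_iff)

lemma emeasure_unit_leb: "S \<in> sets unit_leb \<Longrightarrow> emeasure unit_leb S = emeasure lebesgue S"
  by (simp add: sets_unit_leb emeasure_restrict_space)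

lemma emeasure_subset_unit:
  fixes S :: "real set"
  assumes "S \<in> sets lebesgue" "S \<subseteq> {0..1}"
  shows "emeasure lebesgue S = ennreal (measure lebesgue S)" "measure lebesgue S \<le> 1"
proof -
  have "emeasure lebesgue S \<le> emeasure lebesgue {0..1::real}" by (rule emeasure_mono) (use assms in auto)
  then have le: "emeasure lebesgue S \<le> 1" by simp
  then have "emeasure lebesgue S \<noteq> \<infinity>" by (auto simp: top_unique)
  then show e: "emeasure lebesgue S = ennreal (measure lebesgue S)" by (simp add: emeasure_eq_ennreal_measure)
  show "measure lebesgue S \<le> 1" using le unfolding e by simp
qed

lemma measure_Times_unit:
  fixes S T :: "real set"
  assumes "S \<in> sets lebesgue" "S \<subseteq> {0..1}" "T \<in> sets lebesgue" "T \<subseteq> {0..1}"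
  shows "measure lebesgue (S \<times> T) = measure lebesgue S * measure lebesgue T"
    "integrable lebesgue (indicator (S \<times> T) :: real \<times> real \<Rightarrow> real)"
proof -
  have "emeasure lebesgue (S \<times> T) = ennreal (measure lebesgue S * measure lebesgue T)"
    using lebesgue_Times(2)[OF assms(1,3)] emeasure_subset_unit(1)[OF assms(1,2)] emeasure_subset_unit(1)[OF assms(3,4)]
    by (simp add: ennreal_mult)
  then show "measure lebesgue (S \<times> T) = measure lebesgue S * measure lebesgue T"
    "integrable lebesgue (indicator (S \<times> T) :: real \<times> real \<Rightarrow> real)"
    using lebesgue_Times(1)[OF assms(1,3)] by (auto simp: measure_def integrable_indicator_iff)
qed

text \<open>The half-open intervals on which \<open>empirical_graphon\<close> is constant. The
  condition \<open>0 < x\<close> keeps nonpositive points, whose index is 0, out of all cells, so 0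
  always counts as exceptional.\<close>

definition cell :: "nat \<Rightarrow> nat \<Rightarrow> real set" where
  "cell N j = {x. 0 < x \<and> nat \<lceil>real N * x\<rceil> = j}"

lemma cell_eq:
  assumes "N \<ge> 1" "j \<ge> 1"
  shows "cell N j = {(real j - 1) / N <.. real j / N}"
proof -
  have "0 < x \<and> nat \<lceil>real N * x\<rceil> = j \<longleftrightarrow> (real j - 1) / N < x \<and> x \<le> real j / N" for x
  proof -
    have "nat \<lceil>real N * x\<rceil> = j \<longleftrightarrow> \<lceil>real N * x\<rceil> = int j" using assms by auto
    also have "\<dots> \<longleftrightarrow> real j - 1 < N * x \<and> N * x \<le> real j" by (auto simp: ceiling_eq_iff)
    also have "\<dots> \<longleftrightarrow> (real j - 1) / N < x \<and> x \<le> real j / N" using assms by (auto simp: field_simps)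
    finally have *: "nat \<lceil>real N * x\<rceil> = j \<longleftrightarrow> (real j - 1) / N < x \<and> x \<le> real j / N" .
    have "0 \<le> (real j - 1) / N" using assms by simp
    then show ?thesis unfolding * by linarith
  qed
  then show ?thesis unfolding cell_def set_eq_iff mem_Collect_eq greaterThanAtMost_iff by blast
qed

lemma cell_measure:
  assumes "N \<ge> 1" "j \<ge> 1"
  shows "cell N j \<in> sets lebesgue" "measure lebesgue (cell N j) = 1 / N"
proof -
  show "cell N j \<in> sets lebesgue" unfolding cell_eq[OF assms] by simp
  have "(real j - 1) / N \<le> real j / N" by (intro divide_right_mono) auto
  then show "measure lebesgue (cell N j) = 1 / N"
    unfolding cell_eq[OF assms] using assms by (simp add: diff_divide_distrib)
qed

lemma in_cell:
  assumes "N \<ge> 1" "0 < x" "x \<le> 1"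
  shows "nat \<lceil>real N * x\<rceil> \<in> {1..N}" "x \<in> cell N (nat \<lceil>real N * x\<rceil>)"
proof -
  have "real N * x \<le> N" using assms by (simp add: mult_left_le)
  then have 1: "\<lceil>real N * x\<rceil> \<le> int N" by (simp add: ceiling_le_iff)
  have 2: "0 < \<lceil>real N * x\<rceil>" using assms by simp
  have "nat c \<in> {1..N}" if "c \<le> int N" "0 < c" for c using that by auto
  then show "nat \<lceil>real N * x\<rceil> \<in> {1..N}" using 1 2 by blast
  show "x \<in> cell N (nat \<lceil>real N * x\<rceil>)" using assms by (simp add: cell_def)
qed

lemma cell_disjoint: "x \<in> cell N j \<Longrightarrow> x \<in> cell N j' \<Longrightarrow> j = j'"
  by (simp add: cell_def)

lemma cell_subset:
  assumes "N \<ge> 1" "j \<in> {1..N}"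
  shows "cell N j \<subseteq> {0<..1}"
proof
  fix x assume x: "x \<in> cell N j"
  have "x \<le> real j / N" using x cell_eq[OF assms(1), of j] assms(2) by simp
  also have "\<dots> \<le> 1" using assms by simp
  finally show "x \<in> {0<..1}" using x by (simp add: cell_def)
qed

lemma Un_cells:
  assumes "N \<ge> 1"
  shows "(\<Union>j\<in>{1..N}. cell N j) = {0<..1}"
proof
  show "(\<Union>j\<in>{1..N}. cell N j) \<subseteq> {0<..1}" using cell_subset[OF assms] by (rule UN_least)
  show "{0<..1} \<subseteq> (\<Union>j\<in>{1..N}. cell N j)"
  proof
    fix x :: real assume "x \<in> {0<..1}"
    then have x: "0 < x" "x \<le> 1" by auto
    show "x \<in> (\<Union>j\<in>{1..N}. cell N j)" using in_cell[OF assms x] by blast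
  qed
qed

text \<open>
  Up to the exceptional set \<open>Bad\<close> the function is constant on the cells of a grid, and there the cut
  norm is a bilinear form in the occupation fractions of the cells.
\<close>

lemma cut_integral_bound:
  fixes h :: "real \<Rightarrow> real \<Rightarrow> real"
  assumes N: "N \<ge> 1" and Bad: "Bad \<in> sets lebesgue" "Bad \<subseteq> {0..1}" "0 \<in> Bad"
    and h: "\<And>x y. x \<in> {0..1} - Bad \<Longrightarrow> y \<in> {0..1} - Bad \<Longrightarrow> h x y = F (nat \<lceil>real N * x\<rceil>) (nat \<lceil>real N * y\<rceil>)"
    and h1: "\<And>x y. x \<in> {0..1} \<Longrightarrow> y \<in> {0..1} \<Longrightarrow> \<bar>h x y\<bar> \<le> 1"
    and F1: "\<And>j l. j \<in> {1..N} \<Longrightarrow> l \<in> {1..N} \<Longrightarrow> \<bar>F j l\<bar> \<le> 1"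
    and c: "\<And>s t. (\<And>j. j \<in> {1..N} \<Longrightarrow> \<bar>s j\<bar> \<le> 1) \<Longrightarrow> (\<And>j. j \<in> {1..N} \<Longrightarrow> \<bar>t j\<bar> \<le> 1) \<Longrightarrow>
        (\<Sum>j\<in>{1..N}. \<Sum>l\<in>{1..N}. s j * t l * F j l) \<le> c"
    and ST: "S \<in> sets unit_leb" "T \<in> sets unit_leb"
  shows "\<bar>LINT z:S \<times> T|lebesgue. h (fst z) (snd z)\<bar> \<le> c / (real N)\<^sup>2 + 4 * measure lebesgue Bad"
proof (cases "integrable lebesgue (\<lambda>z. indicator (S \<times> T) z *\<^sub>R h (fst z) (snd z))")
  \<comment> \<open>A set integral that does not exist has the default value 0, so nonnegativity of
    the bound is enough.\<close>
  case False
  have "c \<ge> 0" using c[of "\<lambda>_. 0" "\<lambda>_. 0"] by simp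
  then show ?thesis using False by (simp add: set_lebesgue_integral_def not_integrable_integral_eq)
next
  case True
  let ?I = "{1..N}"
  let ?f = "\<lambda>z. indicator (S \<times> T) z *\<^sub>R h (fst z) (snd z)"
  define G where "G = (\<lambda>z::real\<times>real. \<Sum>j\<in>?I. \<Sum>l\<in>?I. F j l * indicator ((S \<inter> cell N j) \<times> (T \<inter> cell N l)) z)"
  \<comment> \<open>The integrand agrees with \<open>G\<close> off the two strips over
    \<open>Bad\<close>. On them both functions are at most 1 in absolute value, whence the factor 2,
    and the two strips together give the constant 4.\<close>
  define R where "R = (\<lambda>z::real\<times>real. 2 * (indicator (Bad \<times> {0..1}) z + indicator ({0..1} \<times> Bad) z) :: real)"
  have ST': "S \<in> sets lebesgue" "S \<subseteq> {0..1}" "T \<in> sets lebesgue" "T \<subseteq> {0..1}" using ST by (auto simp: sets_unit_leb)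
  have cm: "cell N j \<in> sets lebesgue" if "j \<in> ?I" for j using cell_measure[OF N, of j] that by auto
  have part: "S \<inter> cell N j \<in> sets lebesgue" "S \<inter> cell N j \<subseteq> {0..1}" "T \<inter> cell N j \<in> sets lebesgue" "T \<inter> cell N j \<subseteq> {0..1}"
    if "j \<in> ?I" for j using ST' cm[OF that] by auto
  note prod = measure_Times_unit[OF part(1,2) part(3,4)]
  have intG: "integrable lebesgue G" unfolding G_def by (intro Bochner_Integration.integrable_sum integrable_mult_right prod(2))
  have valG: "integral\<^sup>L lebesgue G = (\<Sum>j\<in>?I. \<Sum>l\<in>?I. F j l * (measure lebesgue (S \<inter> cell N j) * measure lebesgue (T \<inter> cell N l)))"
  proof -
    have "integral\<^sup>L lebesgue G = (\<Sum>j\<in>?I. \<Sum>l\<in>?I. integral\<^sup>L lebesgue (\<lambda>z. F j l * indicator ((S \<inter> cell N j) \<times> (T \<inter> cell N l)) z))"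
      unfolding G_def
    proof (subst Bochner_Integration.integral_sum)
      show "integrable lebesgue (\<lambda>z. \<Sum>l\<in>?I. F j l * indicator ((S \<inter> cell N j) \<times> (T \<inter> cell N l)) z)" if "j \<in> ?I" for j
        by (intro Bochner_Integration.integrable_sum integrable_mult_right prod(2) that)
      show "(\<Sum>j\<in>?I. integral\<^sup>L lebesgue (\<lambda>z. \<Sum>l\<in>?I. F j l * indicator ((S \<inter> cell N j) \<times> (T \<inter> cell N l)) z))
        = (\<Sum>j\<in>?I. \<Sum>l\<in>?I. integral\<^sup>L lebesgue (\<lambda>z. F j l * indicator ((S \<inter> cell N j) \<times> (T \<inter> cell N l)) z))"
        by (intro sum.cong refl Bochner_Integration.integral_sum integrable_mult_right prod(2))
    qed
    also have "\<dots> = (\<Sum>j\<in>?I. \<Sum>l\<in>?I. F j l * (measure lebesgue (S \<inter> cell N j) * measure lebesgue (T \<inter> cell N l)))"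
      by (intro sum.cong refl) (simp add: prod(1))
    finally show ?thesis .
  qed
  have frac: "\<bar>N * measure lebesgue (A \<inter> cell N j)\<bar> \<le> 1" if "j \<in> ?I" "A \<in> sets lebesgue" for A j
  proof -
    have "measure lebesgue (A \<inter> cell N j) \<le> measure lebesgue (cell N j)"
    proof (rule measure_mono_fmeasurable)
      have "cell N j \<subseteq> {0..1}" using cell_subset[OF N that(1)] by auto
      then show "cell N j \<in> fmeasurable lebesgue"
        by (rule bounded_set_imp_lmeasurable[OF bounded_subset[OF bounded_closed_interval] cm[OF that(1)]])
    qed (use that cm[OF that(1)] in auto)
    then have "N * measure lebesgue (A \<inter> cell N j) \<le> N * (1 / N)"
      using cell_measure(2)[OF N, of j] that by (intro mult_left_mono) auto
    then show ?thesis using N by simp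
  qed
  have absG: "\<bar>integral\<^sup>L lebesgue G\<bar> \<le> c / (real N)\<^sup>2"
  proof -
    have sc: "(real N)\<^sup>2 * integral\<^sup>L lebesgue G = (\<Sum>j\<in>?I. \<Sum>l\<in>?I. (N * measure lebesgue (S \<inter> cell N j)) * (N * measure lebesgue (T \<inter> cell N l)) * F j l)"
      unfolding valG sum_distrib_left by (intro sum.cong refl) (simp add: power2_eq_square)
    have "(real N)\<^sup>2 * integral\<^sup>L lebesgue G \<le> c"
      unfolding sc by (rule c) (use frac ST' in auto)
    moreover have "- ((real N)\<^sup>2 * integral\<^sup>L lebesgue G) \<le> c"
    proof -
      have "- ((real N)\<^sup>2 * integral\<^sup>L lebesgue G) = (\<Sum>j\<in>?I. \<Sum>l\<in>?I. (- (N * measure lebesgue (S \<inter> cell N j))) * (N * measure lebesgue (T \<inter> cell N l)) * F j l)"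
        unfolding sc by (simp add: sum_negf)
      also have "\<dots> \<le> c" by (rule c) (use frac ST' in auto)
      finally show ?thesis .
    qed
    ultimately have "\<bar>integral\<^sup>L lebesgue G\<bar> * (real N)\<^sup>2 \<le> c" by (simp add: abs_le_iff abs_mult[symmetric] mult.commute)
    then show ?thesis using N by (simp add: pos_le_divide_eq)
  qed
  have B: "Bad \<in> sets lebesgue" "Bad \<subseteq> {0..1}" "{0..1::real} \<in> sets lebesgue" "{0..1::real} \<subseteq> {0..1}" using Bad by auto
  have intR: "integrable lebesgue R"
    unfolding R_def by (intro integrable_mult_right Bochner_Integration.integrable_add measure_Times_unit B)
  have valR: "integral\<^sup>L lebesgue R = 4 * measure lebesgue Bad"
    unfolding R_def using measure_Times_unit[OF B(1,2) B(3,4)] measure_Times_unit[OF B(3,4) B(1,2)] by simp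
  have Gval: "G (x, y) = (if x \<in> S \<and> y \<in> T \<and> 0 < x \<and> 0 < y then F (nat \<lceil>real N * x\<rceil>) (nat \<lceil>real N * y\<rceil>) else 0)" for x y
  proof (cases "x \<in> S \<and> y \<in> T \<and> 0 < x \<and> 0 < y")
    case True
    then have xy: "x \<in> S" "y \<in> T" "0 < x" "x \<le> 1" "0 < y" "y \<le> 1" using ST' by auto
    have "G (x, y) = (\<Sum>j\<in>?I. \<Sum>l\<in>?I. if j = nat \<lceil>real N * x\<rceil> then if l = nat \<lceil>real N * y\<rceil> then F j l else 0 else 0)"
      unfolding G_def by (intro sum.cong refl) (use xy in \<open>auto simp: cell_def indicator_def\<close>)
    also have "\<dots> = (\<Sum>j\<in>?I. if j = nat \<lceil>real N * x\<rceil> then (\<Sum>l\<in>?I. if l = nat \<lceil>real N * y\<rceil> then F j l else 0) else 0)"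
      by (intro sum.cong refl) auto
    also have "\<dots> = F (nat \<lceil>real N * x\<rceil>) (nat \<lceil>real N * y\<rceil>)"
      using in_cell(1)[OF N xy(3,4)] in_cell(1)[OF N xy(5,6)] by simp
    finally show ?thesis using True by simp
  next
    case False
    have "G (x, y) = (\<Sum>j\<in>?I. \<Sum>l\<in>?I. 0)"
      unfolding G_def by (intro sum.cong refl) (use False in \<open>auto simp: cell_def indicator_def\<close>)
    then show ?thesis using False by auto
  qed
  have diff: "\<bar>?f z - G z\<bar> \<le> R z" for z
  proof (cases z)
    case (Pair x y)
    show ?thesis
    proof (cases "x \<in> S \<and> y \<in> T")
      case False
      then show ?thesis unfolding Pair by (auto simp: Gval R_def)
    next
      case True
      then have xy: "x \<in> {0..1}" "y \<in> {0..1}" using ST' by auto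
      have G1: "\<bar>G (x, y)\<bar> \<le> 1" unfolding Gval using in_cell(1)[OF N, of x] in_cell(1)[OF N, of y] xy F1 by auto
      show ?thesis
      proof (cases "x \<in> Bad \<or> y \<in> Bad")
        case True
        have "\<bar>?f z\<bar> \<le> 1" using h1[OF xy] unfolding Pair by (auto simp: indicator_def)
        then have "\<bar>?f z - G z\<bar> \<le> 2" using G1 unfolding Pair by linarith
        moreover have "R z \<ge> 2" using True xy unfolding Pair R_def by (auto simp: indicator_def)
        ultimately show ?thesis by linarith
      next
        case False
        then have "x \<noteq> 0" "y \<noteq> 0" using Bad(3) by auto
        then have "0 < x" "0 < y" using xy by auto
        then have "?f z = G z" using True False xy h[of x y] unfolding Pair Gval by (auto simp: indicator_def)
        moreover have "R z \<ge> 0" unfolding R_def by simp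
        ultimately show ?thesis by simp
      qed
    qed
  qed
  have "\<bar>integral\<^sup>L lebesgue ?f - integral\<^sup>L lebesgue G\<bar> = \<bar>integral\<^sup>L lebesgue (\<lambda>z. ?f z - G z)\<bar>"
    using True intG by simp
  also have "\<dots> \<le> integral\<^sup>L lebesgue (\<lambda>z. \<bar>?f z - G z\<bar>)" by (rule integral_abs_bound)
  also have "\<dots> \<le> integral\<^sup>L lebesgue R"
    by (rule integral_mono[OF _ intR diff]) (use True intG in auto)
  finally have "\<bar>integral\<^sup>L lebesgue ?f - integral\<^sup>L lebesgue G\<bar> \<le> 4 * measure lebesgue Bad" unfolding valR .
  then show ?thesis using absG unfolding set_lebesgue_integral_def by linarith
qed

lemma cut_norm_leI:
  assumes "\<And>S T. S \<in> sets unit_leb \<Longrightarrow> T \<in> sets unit_leb \<Longrightarrow> \<bar>LINT z:S \<times> T|lebesgue. h (fst z) (snd z)\<bar> \<le> c"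
  shows "cut_norm h \<le> c"
  unfolding cut_norm_def by (rule cSUP_least) (use assms sets.empty_sets in auto)

text \<open>The real \<open>SUP\<close> is meaningful only for a bounded set, which boundedness of
  \<open>h\<close> ensures; the empty rectangle then contributes 0.\<close>

lemma cut_norm_nonneg:
  assumes "\<And>x y. x \<in> {0..1} \<Longrightarrow> y \<in> {0..1} \<Longrightarrow> \<bar>h x y\<bar> \<le> 1"
  shows "cut_norm h \<ge> 0"
proof -
  have bd: "\<bar>LINT z:S \<times> T|lebesgue. h (fst z) (snd z)\<bar> \<le> 1" if "S \<in> sets unit_leb" "T \<in> sets unit_leb" for S T
  proof (cases "integrable lebesgue (\<lambda>z. indicator (S \<times> T) z *\<^sub>R h (fst z) (snd z))")
    case False
    then show ?thesis by (simp add: set_lebesgue_integral_def not_integrable_integral_eq)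
  next
    case True
    have u: "{0..1::real} \<in> sets lebesgue" "{0..1::real} \<subseteq> {0..1}" by auto
    have "\<bar>LINT z:S \<times> T|lebesgue. h (fst z) (snd z)\<bar> \<le> integral\<^sup>L lebesgue (\<lambda>z. \<bar>indicator (S \<times> T) z *\<^sub>R h (fst z) (snd z)\<bar>)"
      unfolding set_lebesgue_integral_def by (rule integral_abs_bound)
    also have "\<dots> \<le> integral\<^sup>L lebesgue (indicator ({0..1::real} \<times> {0..1::real}))"
    proof (rule integral_mono)
      show "integrable lebesgue (\<lambda>z. \<bar>indicator (S \<times> T) z *\<^sub>R h (fst z) (snd z)\<bar>)" using True by (rule integrable_abs)
      show "integrable lebesgue (indicator ({0..1} \<times> {0..1}) :: real \<times> real \<Rightarrow> real)" by (rule measure_Times_unit(2)[OF u u])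
      fix z :: "real \<times> real"
      show "\<bar>indicator (S \<times> T) z *\<^sub>R h (fst z) (snd z)\<bar> \<le> indicator ({0..1} \<times> {0..1}) z"
        using that assms[of "fst z" "snd z"] by (cases z) (auto simp: sets_unit_leb indicator_def split: if_splits)
    qed
    also have "\<dots> = 1" using measure_Times_unit(1)[OF u u] by simp
    finally show ?thesis .
  qed
  have "(case ({}, {}) of (S, T) \<Rightarrow> \<bar>LINT z:S \<times> T|lebesgue. h (fst z) (snd z)\<bar>) \<le> cut_norm h"
    unfolding cut_norm_def by (rule cSUP_upper, simp, rule bdd_aboveI[of _ 1]) (use bd in auto)
  then show ?thesis by (simp add: set_lebesgue_integral_def)
qed

section \<open>Measure preserving rearrangements of cells\<close>

lemma mp_bijectionsD: "\<tau> \<in> mp_bijections \<Longrightarrow> x \<in> {0..1} \<Longrightarrow> \<tau> x \<in> {0..1}"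
  unfolding mp_bijections_def using bij_betwE by blast

text \<open>Values in the unit interval make all cut norms in question nonnegative, so the infimum
  is over a set bounded below.\<close>

lemma cut_distance_le:
  assumes "\<tau> \<in> mp_bijections" "\<And>x y. x \<in> {0..1} \<Longrightarrow> y \<in> {0..1} \<Longrightarrow> 0 \<le> W1 x y \<and> W1 x y \<le> 1"
    "\<And>x y. x \<in> {0..1} \<Longrightarrow> y \<in> {0..1} \<Longrightarrow> 0 \<le> W2 x y \<and> W2 x y \<le> 1"
  shows "cut_distance W1 W2 \<le> cut_norm (\<lambda>x y. W1 x y - W2 (\<tau> x) (\<tau> y))"
  unfolding cut_distance_def
proof (rule cINF_lower[OF _ assms(1)], rule bdd_belowI2[of _ 0])
  fix \<tau> assume t: "\<tau> \<in> mp_bijections"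
  show "0 \<le> cut_norm (\<lambda>x y. W1 x y - W2 (\<tau> x) (\<tau> y))"
  proof (rule cut_norm_nonneg)
    fix x y :: real assume xy: "x \<in> {0..1}" "y \<in> {0..1}"
    show "\<bar>W1 x y - W2 (\<tau> x) (\<tau> y)\<bar> \<le> 1"
      using assms(2)[OF xy] assms(3)[OF mp_bijectionsD[OF t xy(1)] mp_bijectionsD[OF t xy(2)]] by (simp add: abs_le_iff)
  qed
qed

text \<open>Translates each cell onto its image under \<open>\<sigma>\<close>. The point 0, which
  lies in no cell, is fixed, so that the closed interval is mapped onto itself.\<close>

definition cell_perm :: "nat \<Rightarrow> (nat \<Rightarrow> nat) \<Rightarrow> real \<Rightarrow> real" where
  "cell_perm N \<sigma> x = (if 0 < x \<and> x \<le> 1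
     then x + (real (\<sigma> (nat \<lceil>real N * x\<rceil>)) - real (nat \<lceil>real N * x\<rceil>)) / N else x)"

lemma cell_perm_in_cell:
  assumes N: "N \<ge> 1" and \<sigma>: "\<sigma> j \<in> {1..N}" "j \<in> {1..N}" and x: "x \<in> cell N j"
  shows "cell_perm N \<sigma> x = x + (real (\<sigma> j) - real j) / N" "cell_perm N \<sigma> x \<in> cell N (\<sigma> j)"
proof -
  have "0 < x" "x \<le> 1" "nat \<lceil>real N * x\<rceil> = j" using cell_subset[OF N \<sigma>(2)] x by (auto simp: cell_def)
  then show e: "cell_perm N \<sigma> x = x + (real (\<sigma> j) - real j) / N" by (simp add: cell_perm_def)
  have c: "cell N j = {(real j - 1) / N <.. real j / N}" "cell N (\<sigma> j) = {(real (\<sigma> j) - 1) / N <.. real (\<sigma> j) / N}"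
    using cell_eq[OF N] \<sigma> by auto
  show "cell_perm N \<sigma> x \<in> cell N (\<sigma> j)"
    using x unfolding e c by (auto simp: diff_divide_distrib)
qed

text \<open>Within one cell the preimage of a set is a translate of the part of the set in the image
  cell. Translation invariance settles each cell, and \<open>\<sigma>\<close> only permutes the
  terms of the sum.\<close>

lemma cell_perm_mp:
  assumes N: "N \<ge> 1" and \<sigma>: "bij_betw \<sigma> {1..N} {1..N}"
  shows "cell_perm N \<sigma> \<in> mp_bijections"
proof -
  let ?I = "{1..N}" and ?t = "cell_perm N \<sigma>"
  have \<sigma>I: "\<sigma> j \<in> ?I" if "j \<in> ?I" for j using \<sigma> that by (rule bij_betwE[THEN bspec])
  have t0: "?t 0 = 0" by (simp add: cell_perm_def)
  have dec: "{0..1::real} = {0} \<union> (\<Union>j\<in>?I. cell N j)" using Un_cells[OF N] by auto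
  have img: "?t x \<in> {0<..1}" if "0 < x" "x \<le> 1" for x
    using cell_perm_in_cell(2)[where \<sigma> = \<sigma>, OF N \<sigma>I[OF in_cell(1)[OF N that]] in_cell(1)[OF N that] in_cell(2)[OF N that]]
      cell_subset[OF N \<sigma>I[OF in_cell(1)[OF N that]]] by auto
  have inj: "inj_on ?t {0..1}"
  proof (rule inj_onI)
    fix x y assume x: "x \<in> {0..1}" and y: "y \<in> {0..1}" and e: "?t x = ?t y"
    show "x = y"
    proof (cases "x = 0 \<or> y = 0")
      case True
      then show ?thesis using img[of x] img[of y] x y e t0 by force
    next
      case False
      then have p: "0 < x" "x \<le> 1" "0 < y" "y \<le> 1" using x y by auto
      let ?j = "nat \<lceil>real N * x\<rceil>" and ?l = "nat \<lceil>real N * y\<rceil>"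
      note j = in_cell[OF N p(1,2)] and l = in_cell[OF N p(3,4)]
      have "\<sigma> ?j = \<sigma> ?l"
        using cell_perm_in_cell(2)[where \<sigma> = \<sigma>, OF N \<sigma>I[OF j(1)] j(1) j(2)] cell_perm_in_cell(2)[where \<sigma> = \<sigma>, OF N \<sigma>I[OF l(1)] l(1) l(2)] e
        by (metis cell_disjoint)
      then have jl: "?j = ?l" by (rule inj_onD[OF bij_betw_imp_inj_on[OF \<sigma>] _ j(1) l(1)])
      let ?D = "\<lambda>i. (real (\<sigma> i) - real i) / N"
      have "x = ?t x - ?D ?j"
        unfolding cell_perm_in_cell(1)[where \<sigma> = \<sigma>, OF N \<sigma>I[OF j(1)] j(1) j(2)] by (simp only: add_diff_cancel_right')
      also have "?t x - ?D ?j = ?t y - ?D ?j" by (simp only: e)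
      also have "?D ?j = ?D ?l" by (rule arg_cong[OF jl])
      also have "?t y - ?D ?l = y"
        unfolding cell_perm_in_cell(1)[where \<sigma> = \<sigma>, OF N \<sigma>I[OF l(1)] l(1) l(2)] by (simp only: add_diff_cancel_right')
      finally show ?thesis .
    qed
  qed
  have pre: "?t -` B \<inter> cell N j = (+) (- ((real (\<sigma> j) - real j) / N)) ` (B \<inter> cell N (\<sigma> j))" if j: "j \<in> ?I" for B j
  proof -
    let ?d = "(real (\<sigma> j) - real j) / N"
    have c: "x \<in> cell N j \<longleftrightarrow> x + ?d \<in> cell N (\<sigma> j)" for x
      using cell_eq[OF N, of j] cell_eq[OF N, of "\<sigma> j"] j \<sigma>I[OF j] by (auto simp: diff_divide_distrib)
    have "x \<in> ?t -` B \<inter> cell N j \<longleftrightarrow> x + ?d \<in> B \<inter> cell N (\<sigma> j)" for x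
      using cell_perm_in_cell(1)[where \<sigma> = \<sigma>, OF N \<sigma>I[OF j] j, of x] c[of x] by auto
    then show ?thesis by (force simp: image_iff)
  qed
  have surj: "?t ` {0..1} = {0..1}"
  proof
    show "?t ` {0..1} \<subseteq> {0..1}" using img t0 by (force simp: le_less)
    show "{0..1} \<subseteq> ?t ` {0..1}"
    proof
      fix y :: real assume y: "y \<in> {0..1}"
      show "y \<in> ?t ` {0..1}"
      proof (cases "y = 0")
        case True
        then show ?thesis using t0 by force
      next
        case False
        then have p: "0 < y" "y \<le> 1" using y by auto
        obtain j where j: "j \<in> ?I" "\<sigma> j = nat \<lceil>real N * y\<rceil>"
          using in_cell(1)[OF N p] bij_betw_imp_surj_on[OF \<sigma>] by (metis imageE)
        have "- ((real (\<sigma> j) - real j) / N) + y \<in> ?t -` {y} \<inter> cell N j"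
          unfolding pre[OF j(1)] using in_cell(2)[OF N p] j(2) by auto
        then obtain z where z: "?t z = y" "z \<in> cell N j" by blast
        then have "z \<in> {0..1}" using cell_subset[OF N j(1)] by auto
        then show ?thesis using z(1) by blast
      qed
    qed
  qed
  have piece: "?t -` B \<inter> cell N j \<in> sets lebesgue" "measure lebesgue (?t -` B \<inter> cell N j) = measure lebesgue (B \<inter> cell N (\<sigma> j))"
    if "B \<in> sets lebesgue" "j \<in> ?I" for B j
  proof -
    have "1 \<le> \<sigma> j" using \<sigma>I[OF that(2)] by simp
    then have s: "B \<inter> cell N (\<sigma> j) \<in> sets lebesgue" using cell_measure(1)[OF N] that(1) by auto
    show "?t -` B \<inter> cell N j \<in> sets lebesgue" unfolding pre[OF that(2)] by (rule lebesgue_sets_translation[OF s])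
    show "measure lebesgue (?t -` B \<inter> cell N j) = measure lebesgue (B \<inter> cell N (\<sigma> j))"
      unfolding pre[OF that(2)] by (rule measure_translation)
  qed
  have whole: "?t -` B \<inter> {0..1} = (B \<inter> {0}) \<union> (\<Union>j\<in>?I. ?t -` B \<inter> cell N j)" for B
    unfolding dec using t0 by auto
  have meas: "?t -` B \<inter> {0..1} \<in> sets unit_leb \<and> emeasure unit_leb (?t -` B \<inter> {0..1}) = emeasure unit_leb B"
    if B: "B \<in> sets unit_leb" for B
  proof -
    have B': "B \<in> sets lebesgue" "B \<subseteq> {0..1}" using B by (auto simp: sets_unit_leb)
    have s0: "B \<inter> {0} \<in> sets lebesgue" using B' by auto
    have s: "?t -` B \<inter> {0..1} \<in> sets lebesgue"
      unfolding whole using s0 piece(1)[OF B'(1)] by (intro sets.Un sets.finite_UN) auto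
    then have s': "?t -` B \<inter> {0..1} \<in> sets unit_leb" by (simp add: sets_unit_leb)
    have fin: "A \<in> fmeasurable lebesgue" if "A \<in> sets lebesgue" "A \<subseteq> {0..1}" for A :: "real set"
      using that by (meson bounded_set_imp_lmeasurable bounded_subset bounded_closed_interval)
    have sum: "measure lebesgue (\<Union>j\<in>?I. C j) = (\<Sum>j\<in>?I. measure lebesgue (C j))"
      if "\<And>j. j \<in> ?I \<Longrightarrow> C j \<in> sets lebesgue" "\<And>j. C j \<subseteq> cell N (g j)" "inj_on g ?I" "\<And>j. j \<in> ?I \<Longrightarrow> g j \<in> ?I" for C g
    proof (rule measure_UNION_AE)
      show "C j \<in> fmeasurable lebesgue" if "j \<in> ?I" for j
        by (rule fin) (use \<open>\<And>j. j \<in> ?I \<Longrightarrow> C j \<in> sets lebesgue\<close> that \<open>\<And>j. C j \<subseteq> cell N (g j)\<close>[of j] cell_subset[OF N \<open>\<And>j. j \<in> ?I \<Longrightarrow> g j \<in> ?I\<close>[OF that]] in auto)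
      show "pairwise (\<lambda>i j. AE x in lebesgue. x \<notin> C i \<or> x \<notin> C j) ?I"
      proof (rule pairwiseI, rule AE_I2)
        fix i j x assume ij: "i \<in> ?I" "j \<in> ?I" "i \<noteq> j"
        show "x \<notin> C i \<or> x \<notin> C j"
          using that(2)[of i] that(2)[of j] cell_disjoint[of x N "g i" "g j"] inj_onD[OF that(3) _ ij(1,2)] ij(3) by blast
      qed
    qed auto
    have zero: "measure lebesgue (A \<union> C) = measure lebesgue C" if "A \<subseteq> {0}" "C \<in> sets lebesgue" for A C :: "real set"
    proof -
      have "A \<in> null_sets lebesgue" using that(1) by (metis negligible_iff_null_sets negligible_sing negligible_subset)
      then show ?thesis using measure_Un_null_set[OF that(2), of A] by (simp add: Un_commute)
    qed
    have "measure lebesgue (?t -` B \<inter> {0..1}) = measure lebesgue (\<Union>j\<in>?I. ?t -` B \<inter> cell N j)"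
      unfolding whole
    proof (rule zero)
      show "B \<inter> {0} \<subseteq> {0}" by blast
      show "(\<Union>j\<in>?I. ?t -` B \<inter> cell N j) \<in> sets lebesgue"
        by (rule sets.finite_UN[OF finite_atLeastAtMost]) (rule piece(1)[OF B'(1)])
    qed
    also have "\<dots> = (\<Sum>j\<in>?I. measure lebesgue (?t -` B \<inter> cell N j))"
      by (rule sum[of _ "\<lambda>j. j"], erule piece(1)[OF B'(1)], blast, simp, assumption)
    also have "\<dots> = (\<Sum>j\<in>?I. measure lebesgue (B \<inter> cell N (\<sigma> j)))"
      by (intro sum.cong refl piece(2) B')
    also have "\<dots> = (\<Sum>j\<in>?I. measure lebesgue (B \<inter> cell N j))"
      by (rule sum.reindex_bij_betw[OF \<sigma>])
    also have "\<dots> = measure lebesgue (\<Union>j\<in>?I. B \<inter> cell N j)"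
    proof (rule sum[of _ "\<lambda>j. j", symmetric])
      show "B \<inter> cell N j \<in> sets lebesgue" if "j \<in> ?I" for j using B' cell_measure(1)[OF N, of j] that by auto
    qed (blast, simp, assumption)
    also have "\<dots> = measure lebesgue ((B \<inter> {0}) \<union> (\<Union>j\<in>?I. B \<inter> cell N j))"
    proof (rule zero[symmetric])
      show "(\<Union>j\<in>?I. B \<inter> cell N j) \<in> sets lebesgue"
        by (rule sets.finite_UN[OF finite_atLeastAtMost]) (use B' cell_measure(1)[OF N] in auto)
    qed blast
    also have "(B \<inter> {0}) \<union> (\<Union>j\<in>?I. B \<inter> cell N j) = B" using B'(2) dec by blast
    finally have "measure lebesgue (?t -` B \<inter> {0..1}) = measure lebesgue B" .
    then have "emeasure lebesgue (?t -` B \<inter> {0..1}) = emeasure lebesgue B"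
      using emeasure_subset_unit(1)[OF s] emeasure_subset_unit(1)[OF B'] by simp
    then show ?thesis using s' by (simp add: emeasure_unit_leb[OF s'] emeasure_unit_leb[OF B])
  qed
  have m: "?t \<in> measurable unit_leb unit_leb"
    by (rule measurableI) (use surj meas in auto)
  have "distr unit_leb unit_leb ?t = unit_leb"
    by (rule measure_eqI) (use m meas in \<open>auto simp: emeasure_distr\<close>)
  then show ?thesis unfolding mp_bijections_def using inj surj m by (auto simp: bij_betw_def)
qed

section \<open>Step graphons and their samples\<close>

definition label_class :: "(real \<Rightarrow> nat) \<Rightarrow> nat \<Rightarrow> real set" where
  "label_class \<phi> a = {x \<in> {0..1}. \<phi> x = a}"

text \<open>By inner regularity each class contains a compact set of nearly full measure. Finitely
  many disjoint compact sets have positive distance, so a cell shorter than that distance meets at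
  most one of them and takes its label; \<open>Bad\<close> collects the rest.\<close>

lemma grid_labels:
  assumes K: "finite K" "\<And>x. x \<in> {0..1} \<Longrightarrow> \<phi> x \<in> K" and meas: "\<And>a. a \<in> K \<Longrightarrow> label_class \<phi> a \<in> sets lebesgue"
    and \<eta>: "\<eta> > 0"
  obtains N0 where "\<And>N. N \<ge> N0 \<Longrightarrow> N \<ge> 1 \<Longrightarrow> \<exists>\<beta> Bad. (\<forall>j. \<beta> j \<in> K) \<and> Bad \<in> sets lebesgue \<and> Bad \<subseteq> {0..1} \<and> 0 \<in> Bad
     \<and> measure lebesgue Bad \<le> \<eta> \<and> (\<forall>x\<in>{0..1} - Bad. \<phi> x = \<beta> (nat \<lceil>real N * x\<rceil>))"
proof -
  have Kne: "K \<noteq> {}" using K(2)[of 0] by auto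
  then have cK: "card K > 0" using K(1) by (simp add: card_gt_0_iff)
  let ?e = "\<eta> / card K"
  have e: "?e > 0" using \<eta> cK by simp
  have "\<forall>a\<in>K. \<exists>C. closed C \<and> C \<subseteq> label_class \<phi> a \<and> emeasure lebesgue (label_class \<phi> a - C) < ennreal ?e"
  proof
    fix a assume a: "a \<in> K"
    obtain C where "closed C" "C \<subseteq> label_class \<phi> a" "emeasure lebesgue (label_class \<phi> a - C) < ennreal ?e"
      by (rule sets_lebesgue_inner_closed[OF meas[OF a] e])
    then show "\<exists>C. closed C \<and> C \<subseteq> label_class \<phi> a \<and> emeasure lebesgue (label_class \<phi> a - C) < ennreal ?e" by blast
  qed
  from bchoice[OF this] obtain C where
    "\<forall>a\<in>K. closed (C a) \<and> C a \<subseteq> label_class \<phi> a \<and> emeasure lebesgue (label_class \<phi> a - C a) < ennreal ?e" ..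
  then have C: "\<And>a. a \<in> K \<Longrightarrow> closed (C a)" "\<And>a. a \<in> K \<Longrightarrow> C a \<subseteq> label_class \<phi> a"
    "\<And>a. a \<in> K \<Longrightarrow> emeasure lebesgue (label_class \<phi> a - C a) < ennreal ?e" by blast+
  have Cu: "C a \<subseteq> {0..1}" if "a \<in> K" for a using C(2)[OF that] by (auto simp: label_class_def)
  have comp: "compact (C a)" if "a \<in> K" for a
    using C(1)[OF that] bounded_subset[OF bounded_closed_interval Cu[OF that]] by (simp add: compact_eq_bounded_closed)
  have "\<exists>d>0. \<forall>x\<in>C a. \<forall>y\<in>C b. d \<le> dist x y" if "a \<in> K" "b \<in> K" "a \<noteq> b" for a b
  proof (rule separate_compact_closed[OF comp[OF that(1)] C(1)[OF that(2)]])
    show "C a \<inter> C b = {}" using C(2)[OF that(1)] C(2)[OF that(2)] that(3) by (auto simp: label_class_def)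
  qed
  then have "\<forall>z\<in>{(a, b). a \<in> K \<and> b \<in> K \<and> a \<noteq> b}. \<exists>d>0. \<forall>x\<in>C (fst z). \<forall>y\<in>C (snd z). d \<le> dist x y" by auto
  from bchoice[OF this] obtain d where
    "\<forall>z\<in>{(a, b). a \<in> K \<and> b \<in> K \<and> a \<noteq> b}. d z > 0 \<and> (\<forall>x\<in>C (fst z). \<forall>y\<in>C (snd z). d z \<le> dist x y)" ..
  then have d: "\<And>z. z \<in> {(a, b). a \<in> K \<and> b \<in> K \<and> a \<noteq> b} \<Longrightarrow> d z > 0 \<and> (\<forall>x\<in>C (fst z). \<forall>y\<in>C (snd z). d z \<le> dist x y)"
    by (rule bspec)
  let ?P = "{(a, b). a \<in> K \<and> b \<in> K \<and> a \<noteq> b}"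
  have finP: "finite ?P" by (rule finite_subset[of _ "K \<times> K"]) (use K(1) in auto)
  define \<delta> where "\<delta> = Min (insert 1 (d ` ?P))"
  have \<delta>: "\<delta> > 0" unfolding \<delta>_def using finP d by (subst Min_gr_iff) auto
  have sep: "\<delta> \<le> dist x y" if "a \<in> K" "b \<in> K" "a \<noteq> b" "x \<in> C a" "y \<in> C b" for a b x y
  proof -
    have "\<delta> \<le> d (a, b)" unfolding \<delta>_def using finP that by (intro Min_le) auto
    also have "d (a, b) \<le> dist x y" using d[of "(a, b)"] that by simp
    finally show ?thesis .
  qed
  \<comment> \<open>The point 0 is added because it belongs to no cell.\<close>
  define Bad where "Bad = insert 0 (\<Union>a\<in>K. label_class \<phi> a - C a)"
  have Cs: "C a \<in> sets lebesgue" if "a \<in> K" for a using C(1)[OF that] by simp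
  have Ds: "label_class \<phi> a - C a \<in> sets lebesgue" if "a \<in> K" for a using meas[OF that] Cs[OF that] by auto
  have Us: "(\<Union>a\<in>K. label_class \<phi> a - C a) \<in> sets lebesgue" by (rule sets.finite_UN[OF K(1) Ds])
  have Bs: "Bad \<in> sets lebesgue" unfolding Bad_def using sets.Un[OF _ Us, of "{0}"] by simp
  have Bu: "Bad \<subseteq> {0..1}" unfolding Bad_def by (auto simp: label_class_def)
  have Bm: "measure lebesgue Bad \<le> \<eta>"
  proof -
    have "measure lebesgue Bad \<le> measure lebesgue {0::real} + measure lebesgue (\<Union>a\<in>K. label_class \<phi> a - C a)"
    proof -
      have "Bad = {0} \<union> (\<Union>a\<in>K. label_class \<phi> a - C a)" unfolding Bad_def by (rule insert_is_Un)
      then show ?thesis using measure_Un_le[OF _ Us, of "{0}"] by simp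
    qed
    also have "\<dots> = measure lebesgue (\<Union>a\<in>K. label_class \<phi> a - C a)" by simp
    also have "\<dots> \<le> (\<Sum>a\<in>K. measure lebesgue (label_class \<phi> a - C a))" by (rule measure_UNION_le[OF K(1) Ds])
    also have "\<dots> \<le> (\<Sum>a\<in>K. ?e)"
    proof (rule sum_mono)
      fix a assume a: "a \<in> K"
      show "measure lebesgue (label_class \<phi> a - C a) \<le> ?e"
        unfolding measure_def using C(3)[OF a] e by (intro enn2real_leI) auto
    qed
    also have "\<dots> = \<eta>" using cK by simp
    finally show ?thesis .
  qed
  show thesis
  proof (rule that[of "nat \<lceil>1 / \<delta>\<rceil> + 1"])
    fix N :: nat assume N: "nat \<lceil>1 / \<delta>\<rceil> + 1 \<le> N" "N \<ge> 1"
    have "1 / \<delta> < N" using N(1) by linarith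
    then have N\<delta>: "1 / N < \<delta>" using \<delta> N(2) by (simp add: field_simps)
    obtain a0 where a0: "a0 \<in> K" using Kne by blast
    \<comment> \<open>A cell that meets none of the compact sets contains only points of
      \<open>Bad\<close>, so any label will do for it.\<close>
    define \<beta> where "\<beta> = (\<lambda>j. if \<exists>a\<in>K. C a \<inter> cell N j \<noteq> {} then SOME a. a \<in> K \<and> C a \<inter> cell N j \<noteq> {} else a0)"
    have \<beta>: "\<beta> j \<in> K \<and> C (\<beta> j) \<inter> cell N j \<noteq> {}" if "\<exists>a\<in>K. C a \<inter> cell N j \<noteq> {}" for j
    proof -
      have "\<exists>a. a \<in> K \<and> C a \<inter> cell N j \<noteq> {}" using that by blast
      from someI_ex[OF this] show ?thesis using that unfolding \<beta>_def by simp
    qed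
    have \<beta>K: "\<beta> j \<in> K" for j using \<beta>[of j] a0 by (cases "\<exists>a\<in>K. C a \<inter> cell N j \<noteq> {}") (auto simp: \<beta>_def)
    have lab: "\<phi> x = \<beta> (nat \<lceil>real N * x\<rceil>)" if x: "x \<in> {0..1} - Bad" for x
    proof -
      let ?j = "nat \<lceil>real N * x\<rceil>"
      have x01: "x \<in> {0..1}" "x \<noteq> 0" using x by (auto simp: Bad_def)
      then have xp: "0 < x" "x \<le> 1" by auto
      have k: "\<phi> x \<in> K" using K(2) x01 by blast
      have xC: "x \<in> C (\<phi> x)" using x k x01 by (auto simp: Bad_def label_class_def)
      have xj: "x \<in> cell N ?j" by (rule in_cell(2)[OF N(2) xp])
      have "\<exists>a\<in>K. C a \<inter> cell N ?j \<noteq> {}" using k xC xj by blast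
      from \<beta>[OF this] obtain y where b: "\<beta> ?j \<in> K" "y \<in> C (\<beta> ?j)" "y \<in> cell N ?j" by blast
      have "?j \<ge> 1" using in_cell(1)[OF N(2) xp] by simp
      from cell_eq[OF N(2) this] have "dist x y < 1 / N"
        using xj b(3) by (auto simp: dist_real_def diff_divide_distrib)
      then have "dist x y < \<delta>" using N\<delta> by linarith
      then show ?thesis using sep[OF k b(1) _ xC b(2)] by (meson not_le)
    qed
    show "\<exists>\<beta> Bad. (\<forall>j. \<beta> j \<in> K) \<and> Bad \<in> sets lebesgue \<and> Bad \<subseteq> {0..1} \<and> 0 \<in> Bad
     \<and> measure lebesgue Bad \<le> \<eta> \<and> (\<forall>x\<in>{0..1} - Bad. \<phi> x = \<beta> (nat \<lceil>real N * x\<rceil>))"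
      using \<beta>K Bs Bu Bm lab by (intro exI[of _ \<beta>] exI[of _ Bad]) (auto simp: Bad_def)
  qed
qed

text \<open>The cells labelled \<open>a\<close> and the class of \<open>a\<close> differ only inside
  \<open>Bad\<close>.\<close>

lemma grid_frequency:
  assumes N: "N \<ge> 1" and Bad: "Bad \<in> sets lebesgue" "Bad \<subseteq> {0..1}" "0 \<in> Bad"
    and \<beta>: "\<And>x. x \<in> {0..1} - Bad \<Longrightarrow> \<phi> x = \<beta> (nat \<lceil>real N * x\<rceil>)"
    and meas: "label_class \<phi> a \<in> sets lebesgue"
  shows "\<bar>cnt {1..N} \<beta> a / N - measure lebesgue (label_class \<phi> a)\<bar> \<le> measure lebesgue Bad"
proof -
  let ?J = "{j\<in>{1..N}. \<beta> j = a}" and ?L = "label_class \<phi> a"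
  let ?G = "\<Union>j\<in>?J. cell N j"
  have cs: "cell N j \<in> sets lebesgue" if "j \<in> ?J" for j using cell_measure(1)[OF N, of j] that by auto
  have cu: "cell N j \<subseteq> {0..1}" if "j \<in> ?J" for j using cell_subset[OF N, of j] that by auto
  have Gs: "?G \<in> sets lebesgue" by (rule sets.finite_UN[OF _ cs]) auto
  have Gu: "?G \<subseteq> {0..1}" using cu by blast
  have "measure lebesgue ?G = (\<Sum>j\<in>?J. measure lebesgue (cell N j))"
  proof (rule measure_finite_Union)
    show "disjoint_family_on (cell N) ?J" unfolding disjoint_family_on_def using cell_disjoint by blast
    show "cell N ` ?J \<subseteq> sets lebesgue" using cs by blast
    show "emeasure lebesgue (cell N j) \<noteq> \<infinity>" if "j \<in> ?J" for j
      using emeasure_subset_unit(1)[OF cs[OF that] cu[OF that]] by simp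
  qed auto
  also have "\<dots> = (\<Sum>j\<in>?J. 1 / N)" by (intro sum.cong refl) (use cell_measure(2)[OF N] in auto)
  also have "\<dots> = cnt {1..N} \<beta> a / N" by (simp add: cnt_def)
  finally have G: "measure lebesgue ?G = cnt {1..N} \<beta> a / N" .
  have le: "measure lebesgue A \<le> measure lebesgue B + measure lebesgue Bad"
    if "A \<subseteq> B \<union> Bad" "A \<in> sets lebesgue" "B \<in> sets lebesgue" "B \<subseteq> {0..1}" for A B :: "real set"
  proof -
    have "measure lebesgue A \<le> measure lebesgue (B \<union> Bad)"
    proof (rule measure_mono_fmeasurable[OF that(1,2)])
      show "B \<union> Bad \<in> fmeasurable lebesgue"
        using that Bad by (intro bounded_set_imp_lmeasurable[OF bounded_subset[OF bounded_closed_interval[of 0 1]]]) auto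
    qed
    also have "\<dots> \<le> measure lebesgue B + measure lebesgue Bad" by (rule measure_Un_le[OF that(3) Bad(1)])
    finally show ?thesis .
  qed
  have sub: "?G \<subseteq> ?L \<union> Bad" "?L \<subseteq> ?G \<union> Bad"
  proof -
    show "?G \<subseteq> ?L \<union> Bad"
    proof
      fix x assume "x \<in> ?G"
      then obtain j where j: "j \<in> ?J" "x \<in> cell N j" by blast
      then have "nat \<lceil>real N * x\<rceil> = j" "x \<in> {0..1}" using cu[OF j(1)] by (auto simp: cell_def)
      then show "x \<in> ?L \<union> Bad" using \<beta>[of x] j(1) by (auto simp: label_class_def)
    qed
    show "?L \<subseteq> ?G \<union> Bad"
    proof
      fix x assume x: "x \<in> ?L"
      show "x \<in> ?G \<union> Bad"
      proof (cases "x \<in> Bad")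
        case False
        then have "x \<noteq> 0" "x \<in> {0..1}" using Bad(3) x by (auto simp: label_class_def)
        then have xp: "0 < x" "x \<le> 1" by auto
        have "\<beta> (nat \<lceil>real N * x\<rceil>) = a" using \<beta>[of x] False x by (auto simp: label_class_def)
        then show ?thesis using in_cell[OF N xp] by blast
      qed simp
    qed
  qed
  have "?L \<subseteq> {0..1}" by (auto simp: label_class_def)
  then show ?thesis
    using le[OF sub(1) Gs meas] le[OF sub(2) meas Gs Gu] unfolding G by linarith
qed

text \<open>Cells are numbered from 1 while \<open>div\<close> counts from 0, hence the shift before
  and after the division.\<close>

lemma refined_index:
  assumes "n \<ge> 1" "M \<ge> 1" "0 < x"
  shows "nat \<lceil>real n * x\<rceil> = (nat \<lceil>real (n * M) * x\<rceil> - 1) div M + 1"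
proof -
  let ?i = "nat \<lceil>real n * x\<rceil>" and ?j = "nat \<lceil>real (n * M) * x\<rceil>"
  have bounds: "real (nat \<lceil>y\<rceil>) - 1 < y" "y \<le> real (nat \<lceil>y\<rceil>)" "nat \<lceil>y\<rceil> \<ge> 1" if "y > 0" for y :: real
    using that by linarith+
  have pos: "real n * x > 0" "real (n * M) * x > 0" using assms by auto
  note i = bounds[OF pos(1)] and j = bounds[OF pos(2)]
  have e: "real (n * M) * x = real M * (real n * x)" by simp
  have "real M * (real ?i - 1) < real (n * M) * x" unfolding e using i(1) assms by (intro mult_strict_left_mono) auto
  also have "\<dots> \<le> real ?j" by (rule j(2))
  finally have "real (M * (?i - 1)) < real ?j" using i(3) by (simp add: of_nat_diff)
  then have 1: "M * (?i - 1) \<le> ?j - 1" by linarith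
  have "real ?j - 1 < real (n * M) * x" by (rule j(1))
  also have "\<dots> \<le> real M * real ?i" unfolding e using i(2) by (intro mult_left_mono) auto
  finally have "real (?j - 1) < real (M * ?i)" using j(3) by (simp add: of_nat_diff)
  then have 2: "?j - 1 < M * ?i" by linarith
  have "(?j - 1) div M = ?i - 1"
  proof (rule div_nat_eqI)
    show "M * (?i - 1) \<le> ?j - 1" by (rule 1)
    show "?j - 1 < M * Suc (?i - 1)" using 2 Suc_diff_1[of ?i] i(3) by (simp only: Suc_le_eq One_nat_def)
  qed
  then show ?thesis using i(3) by simp
qed

lemma sum_refined:
  fixes f :: "nat \<Rightarrow> real"
  assumes "M \<ge> 1"
  shows "(\<Sum>j\<in>{1..n * M}. f ((j - 1) div M + 1)) = M * (\<Sum>i\<in>{1..n}. f i)"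
proof (induction n)
  case (Suc n)
  have "{1..Suc n * M} = {1..n * M} \<union> {n * M + 1..n * M + M}" by auto
  then have "(\<Sum>j\<in>{1..Suc n * M}. f ((j - 1) div M + 1))
      = (\<Sum>j\<in>{1..n * M}. f ((j - 1) div M + 1)) + (\<Sum>j\<in>{n * M + 1..n * M + M}. f ((j - 1) div M + 1))"
    by (simp only:) (rule sum.union_disjoint, auto)
  also have "(\<Sum>j\<in>{n * M + 1..n * M + M}. f ((j - 1) div M + 1)) = (\<Sum>j\<in>{n * M + 1..n * M + M}. f (Suc n))"
  proof (rule sum.cong[OF refl])
    fix j assume j: "j \<in> {n * M + 1..n * M + M}"
    have "(j - 1) div M = n" by (rule div_nat_eqI) (use j assms in \<open>auto simp: mult.commute[of M]\<close>)
    then show "f ((j - 1) div M + 1) = f (Suc n)" by simp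
  qed
  finally show ?case unfolding Suc.IH by (simp add: algebra_simps)
qed simp

lemma cnt_eq_sum: "finite I \<Longrightarrow> cnt I x a = (\<Sum>i\<in>I. of_bool (x i = a))"
  by (simp add: cnt_def Int_def)

lemma cnt_refined:
  fixes n M :: nat
  assumes "M \<ge> 1"
  shows "cnt {1..n * M} (\<lambda>j. x ((j - 1) div M + 1)) a = M * cnt {1..n} x a"
  using sum_refined[OF assms, of "\<lambda>i. of_bool (x i = a)" n] by (simp add: cnt_eq_sum)

lemma refined_index_range:
  fixes j n M :: nat
  assumes "j \<in> {1..n * M}"
  shows "(j - 1) div M + 1 \<in> {1..n}"
proof -
  have "j - 1 < n * M" using assms by auto
  from less_mult_imp_div_less[OF this] show ?thesis by simp
qed

text \<open>Crude on purpose: each of the \<open>(card K)\<^sup>2\<close> entries changes by at most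
  \<open>2 * \<eta>\<close>. The number of labels is harmless because \<open>\<eta>\<close> tends to
  0 with \<open>K\<close> fixed.\<close>

lemma infone_perturb:
  fixes \<eta> :: real
  assumes fin: "finite K" and U: "\<And>a b. a \<in> K \<Longrightarrow> b \<in> K \<Longrightarrow> \<bar>U a b\<bar> \<le> 1"
    and ranges: "\<And>a. a \<in> K \<Longrightarrow> 0 \<le> \<mu>' a \<and> \<mu>' a \<le> 1" "\<And>a. a \<in> K \<Longrightarrow> 0 \<le> \<nu> a \<and> \<nu> a \<le> 1"
    and close: "\<And>a. a \<in> K \<Longrightarrow> \<bar>\<mu>' a - \<mu> a\<bar> \<le> \<eta>" "\<And>a. a \<in> K \<Longrightarrow> \<bar>\<nu>' a - \<nu> a\<bar> \<le> \<eta>"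
  shows "infone K K (\<lambda>a b. \<mu>' a * \<nu>' b * U a b) \<le> infone K K (\<lambda>a b. \<mu> a * \<nu> b * U a b) + 2 * (card K)\<^sup>2 * \<eta>"
proof -
  let ?D = "\<lambda>a b. (\<mu>' a * \<nu>' b - \<mu> a * \<nu> b) * U a b"
  have "infone K K (\<lambda>a b. \<mu>' a * \<nu>' b * U a b) = infone K K (\<lambda>a b. \<mu> a * \<nu> b * U a b + ?D a b)"
    by (rule infone_cong) (simp add: algebra_simps)
  also have "\<dots> \<le> infone K K (\<lambda>a b. \<mu> a * \<nu> b * U a b) + infone K K ?D" by (rule infone_add_le[OF fin])
  also have "infone K K ?D \<le> (\<Sum>a\<in>K. \<Sum>b\<in>K. \<bar>?D a b\<bar>)" by (rule infone_le_sum_abs[OF fin])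
  also have "\<dots> \<le> (\<Sum>a\<in>K. \<Sum>b\<in>K. 2 * \<eta>)"
  proof (intro sum_mono)
    fix a b assume ab: "a \<in> K" "b \<in> K"
    have "\<mu>' a * \<nu>' b - \<mu> a * \<nu> b = \<mu>' a * (\<nu>' b - \<nu> b) + (\<mu>' a - \<mu> a) * \<nu> b" by (simp add: algebra_simps)
    moreover have "\<bar>\<mu>' a * (\<nu>' b - \<nu> b)\<bar> \<le> 1 * \<eta>"
      unfolding abs_mult using ranges(1)[OF ab(1)] close(2)[OF ab(2)] by (intro mult_mono) auto
    moreover have "\<bar>(\<mu>' a - \<mu> a) * \<nu> b\<bar> \<le> \<eta> * 1"
      unfolding abs_mult using ranges(2)[OF ab(2)] close(1)[OF ab(1)] by (intro mult_mono) auto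
    ultimately have "\<bar>\<mu>' a * \<nu>' b - \<mu> a * \<nu> b\<bar> \<le> 2 * \<eta>" by linarith
    then have "\<bar>\<mu>' a * \<nu>' b - \<mu> a * \<nu> b\<bar> * \<bar>U a b\<bar> \<le> 2 * \<eta> * 1" using U[OF ab] by (intro mult_mono) auto
    then show "\<bar>?D a b\<bar> \<le> 2 * \<eta>" by (simp add: abs_mult)
  qed
  also have "\<dots> = 2 * (card K)\<^sup>2 * \<eta>" by (simp add: power2_eq_square)
  finally show ?thesis by simp
qed

lemma card_class:
  assumes "finite X" "finite K" "\<And>x. x \<in> X \<Longrightarrow> \<alpha> x \<in> K"
  shows "real (card {x\<in>X. c (\<alpha> x) = q}) = (\<Sum>a\<in>{a\<in>K. c a = q}. cnt X \<alpha> a)"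
proof -
  have "(\<Sum>a\<in>{a\<in>K. c a = q}. cnt X \<alpha> a) = (\<Sum>a\<in>K. cnt X \<alpha> a * of_bool (c a = q))"
    by (rule sum.mono_neutral_cong_left) (use assms in auto)
  also have "\<dots> = (\<Sum>x\<in>X. of_bool (c (\<alpha> x) = q))" by (rule cnt_sum[OF assms])
  also have "\<dots> = real (card {x\<in>X. c (\<alpha> x) = q})" using assms(1) by (simp add: Int_def)
  finally show ?thesis by simp
qed

text \<open>The normal form of a step graphon: labels with measurable classes of positive measure,
  which represent \<open>W\<close> off a null set \<open>Z\<close> of points. Positivity permits
  dividing by class probabilities in \<open>sampled_deviation\<close>.\<close>

locale measurable_step =
  fixes K :: "nat set" and \<phi> :: "real \<Rightarrow> nat" and Q :: "nat \<Rightarrow> nat \<Rightarrow> real"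
    and W :: "real \<Rightarrow> real \<Rightarrow> real" and Z :: "real set"
  assumes finite_K: "finite K"
    and \<phi>_K: "x \<in> {0..1} \<Longrightarrow> \<phi> x \<in> K"
    and class_sets: "a \<in> K \<Longrightarrow> label_class \<phi> a \<in> sets lebesgue"
    and class_pos: "a \<in> K \<Longrightarrow> measure lebesgue (label_class \<phi> a) > 0"
    and Q01: "a \<in> K \<Longrightarrow> b \<in> K \<Longrightarrow> 0 \<le> Q a b \<and> Q a b \<le> 1"
    and Q_sym: "a \<in> K \<Longrightarrow> b \<in> K \<Longrightarrow> Q a b = Q b a"
    and Z_null: "Z \<in> null_sets lebesgue"
    and W_eq: "x \<in> {0..1} - Z \<Longrightarrow> y \<in> {0..1} - Z \<Longrightarrow> W x y = Q (\<phi> x) (\<phi> y)"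
    and W01: "x \<in> {0..1} \<Longrightarrow> y \<in> {0..1} \<Longrightarrow> 0 \<le> W x y \<and> W x y \<le> 1"
begin

definition lam :: "nat \<Rightarrow> real" where
  "lam a = measure lebesgue (label_class \<phi> a)"

lemma class_subset: "label_class \<phi> a \<subseteq> {0..1}"
  by (auto simp: label_class_def)

lemma lam_pos: "a \<in> K \<Longrightarrow> lam a > 0"
  unfolding lam_def by (rule class_pos)

lemma lam_le_1: "a \<in> K \<Longrightarrow> lam a \<le> 1"
  unfolding lam_def by (rule emeasure_subset_unit(2)[OF class_sets class_subset])

lemma prob_weights_lam: "prob_weights K lam"
proof -
  have "(\<Sum>a\<in>K. lam a) = measure lebesgue (\<Union>a\<in>K. label_class \<phi> a)"
    unfolding lam_def
  proof (rule measure_finite_Union[symmetric, OF finite_K])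
    show "label_class \<phi> ` K \<subseteq> sets lebesgue" using class_sets by blast
    show "disjoint_family_on (label_class \<phi>) K" by (auto simp: disjoint_family_on_def label_class_def)
    show "emeasure lebesgue (label_class \<phi> a) \<noteq> \<infinity>" if "a \<in> K" for a
      using emeasure_subset_unit(1)[OF class_sets[OF that] class_subset] by simp
  qed
  also have "(\<Union>a\<in>K. label_class \<phi> a) = {0..1}" using \<phi>_K by (auto simp: label_class_def)
  finally show ?thesis using finite_K lam_pos by (auto simp: prob_weights_def less_imp_le)
qed

text \<open>
  \<open>\<beta>\<close> labels the cells of a fine grid like \<open>\<phi>\<close>, \<open>\<alpha>\<close> like the sample, and \<open>\<sigma>\<close> matches the cells.
  Rearranging the cells along \<open>\<sigma>\<close> is a measure preserving bijection.
\<close>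

lemma grid_matching:
  fixes n m :: nat and \<rho> \<eta> :: real and c :: "nat \<Rightarrow> nat"
  assumes n: "n \<ge> 1" and x: "\<And>i. i \<in> {1..n} \<Longrightarrow> x i \<in> K" and A: "\<And>i j. A i j \<in> {0, 1::real}"
    and \<rho>: "0 \<le> \<rho>" "\<rho> \<le> 1" and c: "\<And>a. c a < m" and \<eta>: "\<eta> > 0"
  obtains N \<alpha> \<beta> \<sigma> where "N \<ge> 1" "\<And>j. j \<in> {1..N} \<Longrightarrow> \<alpha> j \<in> K" "\<And>j. \<beta> j \<in> K" "bij_betw \<sigma> {1..N} {1..N}"
    "\<And>a. cnt {1..N} \<alpha> a = N * (cnt {1..n} x a / n)"
    "\<And>a. a \<in> K \<Longrightarrow> \<bar>cnt {1..N} \<beta> a / N - lam a\<bar> \<le> \<eta>"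
    "\<And>a. card {j\<in>{1..N}. \<alpha> j = a \<and> \<beta> (\<sigma> j) \<noteq> a} \<le> card {j\<in>{1..N}. \<alpha> j = a} - card {j\<in>{1..N}. \<beta> j = a}"
    "\<And>a. card {j\<in>{1..N}. \<beta> (\<sigma> j) = a \<and> \<alpha> j \<noteq> a} \<le> card {j\<in>{1..N}. \<beta> j = a} - card {j\<in>{1..N}. \<alpha> j = a}"
    "card {j\<in>{1..N}. c (\<alpha> j) \<noteq> c (\<beta> (\<sigma> j))} \<le> (\<Sum>q<m. card {j\<in>{1..N}. c (\<alpha> j) = q} - card {j\<in>{1..N}. c (\<beta> j) = q})"
    "\<forall>B. (\<forall>s t. (\<forall>j\<in>{1..N}. \<bar>s j\<bar> \<le> 1) \<longrightarrow> (\<forall>j\<in>{1..N}. \<bar>t j\<bar> \<le> 1) \<longrightarrow>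
        (\<Sum>j\<in>{1..N}. \<Sum>l\<in>{1..N}. s j * t l * (Q (\<alpha> j) (\<alpha> l) - Q (\<beta> (\<sigma> j)) (\<beta> (\<sigma> l)))) \<le> B) \<longrightarrow>
      cut_distance (empirical_graphon n A) (\<lambda>x y. \<rho> * W x y)
        \<le> infone {1..n} {1..n} (\<lambda>i j. A i j - \<rho> * Q (x i) (x j)) / (real n)\<^sup>2 + \<rho> * B / (real N)\<^sup>2 + 4 * \<eta>"
proof -
  obtain N0 where N0: "\<And>N. N \<ge> N0 \<Longrightarrow> N \<ge> 1 \<Longrightarrow> \<exists>\<beta> Bad. (\<forall>j. \<beta> j \<in> K) \<and> Bad \<in> sets lebesgue \<and> Bad \<subseteq> {0..1} \<and> 0 \<in> Bad
     \<and> measure lebesgue Bad \<le> \<eta> \<and> (\<forall>x\<in>{0..1} - Bad. \<phi> x = \<beta> (nat \<lceil>real N * x\<rceil>))"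
    using grid_labels[OF finite_K \<phi>_K class_sets \<eta>] by blast
  \<comment> \<open>The fine grid must have a multiple of \<open>n\<close> cells, so that each lies
    in a single cell of the empirical graphon, and at least \<open>N0\<close> cells, so that it
    resolves \<open>\<phi>\<close>.\<close>
  define M where "M = max 1 N0"
  define N where "N = n * M"
  have M: "M \<ge> 1" by (simp add: M_def)
  have "1 * N0 \<le> N" unfolding N_def by (rule mult_le_mono) (use n in \<open>auto simp: M_def\<close>)
  moreover have N: "N \<ge> 1" unfolding N_def using n M by simp
  ultimately obtain \<beta> Bad where g: "\<forall>j. \<beta> j \<in> K" "Bad \<in> sets lebesgue" "Bad \<subseteq> {0..1}" "0 \<in> Bad"
     "measure lebesgue Bad \<le> \<eta>" "\<forall>x\<in>{0..1} - Bad. \<phi> x = \<beta> (nat \<lceil>real N * x\<rceil>)"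
    using N0[of N] by auto
  let ?idx = "\<lambda>j. (j - 1) div M + 1"
  define \<alpha> where "\<alpha> = (\<lambda>j. x (?idx j))"
  have idx: "?idx j \<in> {1..n}" if "j \<in> {1..N}" for j using refined_index_range[of j n M] that by (simp add: N_def)
  have \<alpha>K: "\<alpha> j \<in> K" if "j \<in> {1..N}" for j unfolding \<alpha>_def by (rule x[OF idx[OF that]])
  obtain \<sigma> where \<sigma>: "bij_betw \<sigma> {1..N} {1..N}"
    "\<And>a. card {j\<in>{1..N}. \<alpha> j = a \<and> \<beta> (\<sigma> j) \<noteq> a} \<le> card {j\<in>{1..N}. \<alpha> j = a} - card {j\<in>{1..N}. \<beta> j = a}"
    "\<And>a. card {j\<in>{1..N}. \<beta> (\<sigma> j) = a \<and> \<alpha> j \<noteq> a} \<le> card {j\<in>{1..N}. \<beta> j = a} - card {j\<in>{1..N}. \<alpha> j = a}"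
    "card {j\<in>{1..N}. c (\<alpha> j) \<noteq> c (\<beta> (\<sigma> j))} \<le> (\<Sum>q<m. card {j\<in>{1..N}. c (\<alpha> j) = q} - card {j\<in>{1..N}. c (\<beta> j) = q})"
    by (rule two_level_matching[OF finite_atLeastAtMost finite_atLeastAtMost refl, of 1 N c \<alpha> m \<beta>]) (use c in auto)
  let ?t = "cell_perm N \<sigma>"
  have t: "?t \<in> mp_bijections" by (rule cell_perm_mp[OF N \<sigma>(1)])
  then have tm: "?t \<in> measurable unit_leb unit_leb" "distr unit_leb unit_leb ?t = unit_leb"
    by (auto simp: mp_bijections_def)
  \<comment> \<open>The labelling fails on \<open>Bad\<close> and the representation of
    \<open>W\<close> on \<open>Z\<close>. Both are evaluated at the moved point \<open>?t z\<close>,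
    so the exceptional set of the integrand is a preimage under \<open>?t\<close>, with the same
    measure.\<close>
  define Bad2 where "Bad2 = Bad \<union> (Z \<inter> {0..1})"
  have Zs: "Z \<inter> {0..1} \<in> null_sets lebesgue" using Z_null by (rule null_set_Int2) simp
  have B2: "Bad2 \<in> sets unit_leb" unfolding Bad2_def sets_unit_leb using g Zs by auto
  have B2': "Bad2 \<in> sets lebesgue" "Bad2 \<subseteq> {0..1}" using B2 by (auto simp: sets_unit_leb)
  have B2m: "measure lebesgue Bad2 \<le> \<eta>"
    unfolding Bad2_def using measure_Un_null_set[OF g(2) Zs] g(5) by simp
  define Bad' where "Bad' = ?t -` Bad2 \<inter> {0..1}"
  have B': "Bad' \<in> sets unit_leb" using measurable_sets[OF tm(1) B2] by (simp add: Bad'_def)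
  have B'': "Bad' \<in> sets lebesgue" "Bad' \<subseteq> {0..1}" using B' by (auto simp: sets_unit_leb)
  have B'm: "measure lebesgue Bad' \<le> \<eta>"
  proof -
    have "emeasure unit_leb Bad' = emeasure (distr unit_leb unit_leb ?t) Bad2"
      using emeasure_distr[OF tm(1) B2] by (simp add: Bad'_def)
    then have "emeasure lebesgue Bad' = emeasure lebesgue Bad2"
      unfolding tm(2) by (simp add: emeasure_unit_leb[OF B'] emeasure_unit_leb[OF B2])
    then show ?thesis using B2m by (simp add: measure_def)
  qed
  have B0: "0 \<in> Bad'" using g(4) by (simp add: Bad'_def Bad2_def cell_perm_def)
  have good: "\<phi> (?t z) = \<beta> (\<sigma> (nat \<lceil>real N * z\<rceil>))" "?t z \<in> {0..1} - Z" "z > 0" if z: "z \<in> {0..1} - Bad'" for z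
  proof -
    have "z \<noteq> 0" using z B0 by auto
    then have zp: "0 < z" "z \<le> 1" using z by auto
    then show "z > 0" by simp
    let ?j = "nat \<lceil>real N * z\<rceil>"
    note j = in_cell[OF N zp]
    have \<sigma>j: "\<sigma> ?j \<in> {1..N}" using bij_betwE[OF \<sigma>(1)] j(1) by blast
    have "?t z \<in> cell N (\<sigma> ?j)" by (rule cell_perm_in_cell(2)[where \<sigma> = \<sigma>, OF N \<sigma>j j(1) j(2)])
    then have e: "nat \<lceil>real N * ?t z\<rceil> = \<sigma> ?j" by (simp add: cell_def)
    have "?t z \<in> {0..1}" using mp_bijectionsD[OF t] z by blast
    moreover have nb: "?t z \<notin> Bad2" using z by (auto simp: Bad'_def)
    ultimately show "?t z \<in> {0..1} - Z" by (auto simp: Bad2_def)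
    have "?t z \<in> {0..1} - Bad" using nb \<open>?t z \<in> {0..1}\<close> by (auto simp: Bad2_def)
    from bspec[OF g(6) this] show "\<phi> (?t z) = \<beta> (\<sigma> ?j)" unfolding e .
  qed
  have final: "cut_distance (empirical_graphon n A) (\<lambda>x y. \<rho> * W x y)
        \<le> infone {1..n} {1..n} (\<lambda>i j. A i j - \<rho> * Q (x i) (x j)) / (real n)\<^sup>2 + \<rho> * B / (real N)\<^sup>2 + 4 * \<eta>"
    if B: "\<And>s t. (\<And>j. j \<in> {1..N} \<Longrightarrow> \<bar>s j\<bar> \<le> 1) \<Longrightarrow> (\<And>j. j \<in> {1..N} \<Longrightarrow> \<bar>t j\<bar> \<le> 1) \<Longrightarrow>
        (\<Sum>j\<in>{1..N}. \<Sum>l\<in>{1..N}. s j * t l * (Q (\<alpha> j) (\<alpha> l) - Q (\<beta> (\<sigma> j)) (\<beta> (\<sigma> l)))) \<le> B" for B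
  proof -
    let ?I = "infone {1..n} {1..n} (\<lambda>i j. A i j - \<rho> * Q (x i) (x j))"
    define F where "F = (\<lambda>j l. A (?idx j) (?idx l) - \<rho> * Q (\<beta> (\<sigma> j)) (\<beta> (\<sigma> l)))"
    let ?h = "\<lambda>x y. empirical_graphon n A x y - \<rho> * W (?t x) (?t y)"
    have A01: "0 \<le> A i j \<and> A i j \<le> 1" for i j using A[of i j] by auto
    have r01: "0 \<le> \<rho> * w \<and> \<rho> * w \<le> 1" if "0 \<le> w \<and> w \<le> 1" for w using \<rho> that by (auto intro: mult_le_one)
    have "cut_distance (empirical_graphon n A) (\<lambda>x y. \<rho> * W x y) \<le> cut_norm ?h"
      by (rule cut_distance_le[OF t]) (use A01 r01[OF W01] in \<open>auto simp: empirical_graphon_def\<close>)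
    also have "\<dots> \<le> ((real M)\<^sup>2 * ?I + \<rho> * B) / (real N)\<^sup>2 + 4 * measure lebesgue Bad'"
    proof (rule cut_norm_leI, rule cut_integral_bound[OF N B'' B0, where F = F])
      fix y z assume yz: "y \<in> {0..1} - Bad'" "z \<in> {0..1} - Bad'"
      show "?h y z = F (nat \<lceil>real N * y\<rceil>) (nat \<lceil>real N * z\<rceil>)"
        unfolding F_def empirical_graphon_def N_def
        using good[OF yz(1)] good[OF yz(2)] W_eq[OF good(2)[OF yz(1)] good(2)[OF yz(2)]]
          refined_index[OF n M good(3)[OF yz(1)]] refined_index[OF n M good(3)[OF yz(2)]]
        by (simp add: N_def)
    next
      fix y z :: real assume yz: "y \<in> {0..1}" "z \<in> {0..1}"
      show "\<bar>?h y z\<bar> \<le> 1"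
        using A01[of "nat \<lceil>real n * y\<rceil>" "nat \<lceil>real n * z\<rceil>"] r01[OF W01[OF mp_bijectionsD[OF t yz(1)] mp_bijectionsD[OF t yz(2)]]]
        by (simp add: empirical_graphon_def abs_le_iff)
    next
      fix j l
      show "\<bar>F j l\<bar> \<le> 1"
        using A01[of "?idx j" "?idx l"] r01[OF Q01[OF g(1)[rule_format] g(1)[rule_format]], of "\<sigma> j" "\<sigma> l"]
        by (simp add: F_def abs_le_iff)
    next
      fix s u :: "nat \<Rightarrow> real" assume s: "\<And>j. j \<in> {1..N} \<Longrightarrow> \<bar>s j\<bar> \<le> 1" and u: "\<And>j. j \<in> {1..N} \<Longrightarrow> \<bar>u j\<bar> \<le> 1"
      \<comment> \<open>A cell of the coarse grid consists of \<open>M\<close> fine cells and so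
        carries coefficient at most \<open>M\<close>. Rows and columns together give
        \<open>M\<^sup>2\<close>, which cancels against
        \<open>N\<^sup>2 = n\<^sup>2 * M\<^sup>2\<close>.\<close>
      have blk: "(\<Sum>j\<in>{j\<in>{1..N}. ?idx j = i}. \<bar>v j\<bar>) \<le> M" if "i \<in> {1..n}" "\<And>j. j \<in> {1..N} \<Longrightarrow> \<bar>v j\<bar> \<le> 1" for v :: "nat \<Rightarrow> real" and i
      proof -
        have "(\<Sum>j\<in>{j\<in>{1..N}. ?idx j = i}. \<bar>v j\<bar>) \<le> (\<Sum>j\<in>{j\<in>{1..N}. ?idx j = i}. 1)" by (rule sum_mono) (use that(2) in auto)
        also have "\<dots> = cnt {1..n * M} ?idx i" unfolding cnt_def N_def by simp
        also have "\<dots> = M * cnt {1..n} (\<lambda>i. i) i" by (rule cnt_refined[OF M])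
        also have "cnt {1..n} (\<lambda>i. i) i = 1"
        proof -
          have "{l \<in> {1..n}. l = i} = {i}" using that(1) by auto
          then show ?thesis by (simp add: cnt_def)
        qed
        finally show ?thesis by simp
      qed
      have "(\<Sum>j\<in>{1..N}. \<Sum>l\<in>{1..N}. s j * u l * F j l)
         = (\<Sum>j\<in>{1..N}. \<Sum>l\<in>{1..N}. s j * u l * (A (?idx j) (?idx l) - \<rho> * Q (x (?idx j)) (x (?idx l)))
            + \<rho> * (s j * u l * (Q (\<alpha> j) (\<alpha> l) - Q (\<beta> (\<sigma> j)) (\<beta> (\<sigma> l)))))"
        by (intro sum.cong refl) (simp add: F_def \<alpha>_def algebra_simps)
      also have "\<dots> = (\<Sum>j\<in>{1..N}. \<Sum>l\<in>{1..N}. s j * u l * (A (?idx j) (?idx l) - \<rho> * Q (x (?idx j)) (x (?idx l))))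
         + \<rho> * (\<Sum>j\<in>{1..N}. \<Sum>l\<in>{1..N}. s j * u l * (Q (\<alpha> j) (\<alpha> l) - Q (\<beta> (\<sigma> j)) (\<beta> (\<sigma> l))))"
        by (simp only: sum.distrib sum_distrib_left)
      also have "\<dots> \<le> infone {1..n} {1..n} (\<lambda>i l. real M * real M * (A i l - \<rho> * Q (x i) (x l))) + \<rho> * B"
        by (intro add_mono mult_left_mono B s u \<rho>
          labelled_bilinear_le_infone[OF finite_atLeastAtMost finite_atLeastAtMost finite_atLeastAtMost idx idx blk[OF _ s] blk[OF _ u]]) assumption+
      also have "infone {1..n} {1..n} (\<lambda>i l. real M * real M * (A i l - \<rho> * Q (x i) (x l))) = (real M)\<^sup>2 * ?I"
        by (subst infone_cmult) (simp_all add: power2_eq_square)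
      finally show "(\<Sum>j\<in>{1..N}. \<Sum>l\<in>{1..N}. s j * u l * F j l) \<le> (real M)\<^sup>2 * ?I + \<rho> * B" .
    qed
    also have "((real M)\<^sup>2 * ?I + \<rho> * B) / (real N)\<^sup>2 = ?I / (real n)\<^sup>2 + \<rho> * B / (real N)\<^sup>2"
      using n M by (simp add: N_def add_divide_distrib power_mult_distrib)
    finally show ?thesis using B'm by linarith
  qed
  show thesis
  proof (rule that[OF N \<alpha>K _ \<sigma>(1) _ _ \<sigma>(2,3,4)])
    show "\<beta> j \<in> K" for j using g(1) by blast
    show "cnt {1..N} \<alpha> a = N * (cnt {1..n} x a / n)" for a
      using cnt_refined[OF M, of n x a] n by (simp add: N_def \<alpha>_def)
    show "\<bar>cnt {1..N} \<beta> a / N - lam a\<bar> \<le> \<eta>" if "a \<in> K" for a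
      using grid_frequency[OF N g(2,3,4) _ class_sets[OF that], of \<beta>] g(5,6) unfolding lam_def by force
    show "\<forall>B. (\<forall>s t. (\<forall>j\<in>{1..N}. \<bar>s j\<bar> \<le> 1) \<longrightarrow> (\<forall>j\<in>{1..N}. \<bar>t j\<bar> \<le> 1) \<longrightarrow>
        (\<Sum>j\<in>{1..N}. \<Sum>l\<in>{1..N}. s j * t l * (Q (\<alpha> j) (\<alpha> l) - Q (\<beta> (\<sigma> j)) (\<beta> (\<sigma> l)))) \<le> B) \<longrightarrow>
      cut_distance (empirical_graphon n A) (\<lambda>x y. \<rho> * W x y)
        \<le> infone {1..n} {1..n} (\<lambda>i j. A i j - \<rho> * Q (x i) (x j)) / (real n)\<^sup>2 + \<rho> * B / (real N)\<^sup>2 + 4 * \<eta>"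
    proof (intro allI impI)
      fix B assume B: "\<forall>s t. (\<forall>j\<in>{1..N}. \<bar>s j\<bar> \<le> 1) \<longrightarrow> (\<forall>j\<in>{1..N}. \<bar>t j\<bar> \<le> 1) \<longrightarrow>
        (\<Sum>j\<in>{1..N}. \<Sum>l\<in>{1..N}. s j * t l * (Q (\<alpha> j) (\<alpha> l) - Q (\<beta> (\<sigma> j)) (\<beta> (\<sigma> l)))) \<le> B"
      show "cut_distance (empirical_graphon n A) (\<lambda>x y. \<rho> * W x y)
        \<le> infone {1..n} {1..n} (\<lambda>i j. A i j - \<rho> * Q (x i) (x j)) / (real n)\<^sup>2 + \<rho> * B / (real N)\<^sup>2 + 4 * \<eta>"
        by (rule final[OF B[rule_format]]) auto
    qed
  qed
qed

end

context measurable_step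
begin

definition freq :: "nat \<Rightarrow> (nat \<Rightarrow> nat) \<Rightarrow> nat \<Rightarrow> real" where
  "freq n x a = cnt {1..n} x a / n"

text \<open>The l1 distance between the empirical and the true distribution of the classes.\<close>

definition class_deviation :: "nat \<Rightarrow> (nat \<Rightarrow> nat) \<Rightarrow> nat \<Rightarrow> (nat \<Rightarrow> nat) \<Rightarrow> real" where
  "class_deviation m c n x = (\<Sum>q<m. \<bar>\<Sum>a\<in>{a\<in>K. c a = q}. (freq n x a - lam a)\<bar>)"

lemma freq01:
  assumes "n \<ge> 1"
  shows "0 \<le> freq n x a \<and> freq n x a \<le> 1"
proof -
  have "card {i \<in> {1..n}. x i = a} \<le> card {1..n}" by (rule card_mono) auto
  then show ?thesis using assms by (simp add: freq_def cnt_def)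
qed

lemma infone_scale2:
  assumes "r \<ge> 0"
  shows "infone K K (\<lambda>a b. (r * \<mu> a) * (r * \<nu> b) * U a b) = r\<^sup>2 * infone K K (\<lambda>a b. \<mu> a * \<nu> b * U a b)"
  by (subst infone_cmult[symmetric, OF finite_K]) (auto intro!: infone_cong simp: power2_eq_square)

text \<open>Rescales \<open>matched_difference\<close> from grid counts to frequencies. In
  \<open>err\<close> the 4 comes from the exceptional set of the grid, \<open>2 * card K\<close>
  from class frequencies, and \<open>8 * (card K)\<^sup>2\<close> covers up to four uses of
  \<open>infone_perturb\<close>.\<close>

lemma matched_bound:
  fixes n m :: nat and \<rho> \<eta> :: real and c :: "nat \<Rightarrow> nat" and V :: "nat \<Rightarrow> nat \<Rightarrow> real"
  assumes n: "n \<ge> 1" and x: "\<And>i. i \<in> {1..n} \<Longrightarrow> x i \<in> K" and A: "\<And>i j. A i j \<in> {0, 1::real}"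
    and \<rho>: "0 \<le> \<rho>" "\<rho> \<le> 1" and c: "\<And>a. c a < m" and \<eta>: "\<eta> > 0"
    and V: "\<And>a a' b b'. c a = c a' \<Longrightarrow> c b = c b' \<Longrightarrow> V a b = V a' b'" "\<And>a b. 0 \<le> V a b \<and> V a b \<le> 1"
  defines "U \<equiv> \<lambda>a b. Q a b - V a b"
    and "D \<equiv> \<lambda>a. \<bar>freq n x a - lam a\<bar>"
    and "err \<equiv> (4 + 2 * real (card K) + 8 * (real (card K))\<^sup>2) * \<eta>"
    and "cd \<equiv> cut_distance (empirical_graphon n A) (\<lambda>x y. \<rho> * W x y)"
    and "noise \<equiv> infone {1..n} {1..n} (\<lambda>i j. A i j - \<rho> * Q (x i) (x j)) / (real n)\<^sup>2"
  shows "cd \<le> noise + \<rho> * (2 * class_deviation m c n x + infone K K (\<lambda>a b. freq n x a * freq n x b * U a b)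
      + infone K K (\<lambda>a b. lam a * lam b * U a b)) + err"
    and "cd \<le> noise + \<rho> * (2 * class_deviation m c n x + 2 * infone K K (\<lambda>a b. D a * freq n x b * U a b)
      + 2 * infone K K (\<lambda>a b. lam a * D b * U a b)) + err"
proof -
  let ?p = "freq n x" and ?k = "real (card K)"
  obtain N \<alpha> \<beta> \<sigma> where N: "N \<ge> 1" and \<alpha>K: "\<And>j. j \<in> {1..N} \<Longrightarrow> \<alpha> j \<in> K" and \<beta>K: "\<And>j. \<beta> j \<in> K" and \<sigma>: "bij_betw \<sigma> {1..N} {1..N}"
    and cnt\<alpha>: "\<And>a. cnt {1..N} \<alpha> a = N * (cnt {1..n} x a / n)"
    and cnt\<beta>: "\<And>a. a \<in> K \<Longrightarrow> \<bar>cnt {1..N} \<beta> a / N - lam a\<bar> \<le> \<eta>"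
    and m1: "\<And>a. card {j\<in>{1..N}. \<alpha> j = a \<and> \<beta> (\<sigma> j) \<noteq> a} \<le> card {j\<in>{1..N}. \<alpha> j = a} - card {j\<in>{1..N}. \<beta> j = a}"
    and m2: "\<And>a. card {j\<in>{1..N}. \<beta> (\<sigma> j) = a \<and> \<alpha> j \<noteq> a} \<le> card {j\<in>{1..N}. \<beta> j = a} - card {j\<in>{1..N}. \<alpha> j = a}"
    and m3: "card {j\<in>{1..N}. c (\<alpha> j) \<noteq> c (\<beta> (\<sigma> j))} \<le> (\<Sum>q<m. card {j\<in>{1..N}. c (\<alpha> j) = q} - card {j\<in>{1..N}. c (\<beta> j) = q})"
    and final: "\<forall>B. (\<forall>s t. (\<forall>j\<in>{1..N}. \<bar>s j\<bar> \<le> 1) \<longrightarrow> (\<forall>j\<in>{1..N}. \<bar>t j\<bar> \<le> 1) \<longrightarrow>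
        (\<Sum>j\<in>{1..N}. \<Sum>l\<in>{1..N}. s j * t l * (Q (\<alpha> j) (\<alpha> l) - Q (\<beta> (\<sigma> j)) (\<beta> (\<sigma> l)))) \<le> B) \<longrightarrow>
      cut_distance (empirical_graphon n A) (\<lambda>x y. \<rho> * W x y)
        \<le> infone {1..n} {1..n} (\<lambda>i j. A i j - \<rho> * Q (x i) (x j)) / (real n)\<^sup>2 + \<rho> * B / (real N)\<^sup>2 + 4 * \<eta>"
    by (rule grid_matching[OF n x A \<rho> c \<eta>], assumption) (rule that, assumption+)
  let ?X = "{1..N}"
  \<comment> \<open>The label frequencies on the grid stand in for \<open>lam\<close>, from which
    they differ by at most \<open>\<eta>\<close>.\<close>
  define l where "l = (\<lambda>a. cnt ?X \<beta> a / N)"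
  define \<alpha>' where "\<alpha>' = (\<lambda>j. \<beta> (\<sigma> j))"
  have Npos: "real N > 0" using N by simp
  have c\<alpha>: "cnt ?X \<alpha> a = N * ?p a" for a using cnt\<alpha> by (simp add: freq_def)
  have c\<beta>: "cnt ?X \<beta> a = N * l a" for a using N by (simp add: l_def)
  have c\<alpha>': "cnt ?X \<alpha>' a = N * l a" for a
  proof -
    have "card {j\<in>?X. \<alpha>' j = a} = card {j\<in>?X. \<beta> j = a}" by (rule bij_betw_card_filter[OF \<sigma>]) (simp add: \<alpha>'_def)
    then show ?thesis unfolding c\<beta>[symmetric] cnt_def by simp
  qed
  have l01: "0 \<le> l a \<and> l a \<le> 1" for a
  proof -
    have "card {j\<in>?X. \<beta> j = a} \<le> card ?X" by (rule card_mono) auto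
    then show ?thesis using N by (simp add: l_def cnt_def)
  qed
  have p01: "0 \<le> ?p a \<and> ?p a \<le> 1" for a by (rule freq01[OF n])
  have lam01: "0 \<le> lam a \<and> lam a \<le> 1" if "a \<in> K" for a using lam_pos[OF that] lam_le_1[OF that] by simp
  have ll: "\<bar>l a - lam a\<bar> \<le> \<eta>" if "a \<in> K" for a unfolding l_def by (rule cnt\<beta>[OF that])
  have U1: "\<bar>U a b\<bar> \<le> 1" if "a \<in> K" "b \<in> K" for a b using Q01[OF that] V(2)[of a b] by (auto simp: U_def abs_le_iff)
  define d where "d = (\<lambda>a. N * \<bar>?p a - l a\<bar>)"
  have dd: "real (a - b) \<le> \<bar>real a - real b\<bar>" for a b :: nat by linarith
  have dcnt: "d a = \<bar>cnt ?X \<alpha> a - cnt ?X \<beta> a\<bar>" for a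
    unfolding c\<alpha> c\<beta> d_def using Npos by (simp add: abs_mult right_diff_distrib[symmetric])
  have d1: "real (card {j\<in>?X. \<alpha> j = a \<and> \<alpha>' j \<noteq> a}) \<le> d a" for a
    using m1[of a] dd[of "card {j\<in>?X. \<alpha> j = a}" "card {j\<in>?X. \<beta> j = a}"] unfolding dcnt cnt_def \<alpha>'_def by linarith
  have d2: "real (card {j\<in>?X. \<alpha>' j = a \<and> \<alpha> j \<noteq> a}) \<le> d a" for a
    using m2[of a] dd[of "card {j\<in>?X. \<beta> j = a}" "card {j\<in>?X. \<alpha> j = a}"] unfolding dcnt cnt_def \<alpha>'_def by linarith
  have \<alpha>'K: "\<alpha>' j \<in> K" for j by (simp add: \<alpha>'_def \<beta>K)
  have card3: "real (card {j\<in>?X. c (\<alpha> j) \<noteq> c (\<alpha>' j)}) \<le> N * (class_deviation m c n x + ?k * \<eta>)"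
  proof -
    have "real (card {j\<in>?X. c (\<alpha> j) \<noteq> c (\<alpha>' j)}) \<le> (\<Sum>q<m. real (card {j\<in>?X. c (\<alpha> j) = q} - card {j\<in>?X. c (\<beta> j) = q}))"
      using m3 unfolding \<alpha>'_def of_nat_sum[symmetric] of_nat_le_iff .
    also have "\<dots> \<le> (\<Sum>q<m. \<bar>real (card {j\<in>?X. c (\<alpha> j) = q}) - real (card {j\<in>?X. c (\<beta> j) = q})\<bar>)"
      by (intro sum_mono dd)
    also have "\<dots> = (\<Sum>q<m. \<bar>\<Sum>a\<in>{a\<in>K. c a = q}. N * (?p a - l a)\<bar>)"
    proof (intro sum.cong refl arg_cong[where f = abs])
      fix q
      show "real (card {j\<in>?X. c (\<alpha> j) = q}) - real (card {j\<in>?X. c (\<beta> j) = q}) = (\<Sum>a\<in>{a\<in>K. c a = q}. N * (?p a - l a))"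
      proof -
        have 1: "real (card {j\<in>?X. c (\<alpha> j) = q}) = (\<Sum>a\<in>{a\<in>K. c a = q}. N * ?p a)"
          by (subst card_class[OF finite_atLeastAtMost finite_K \<alpha>K], assumption) (rule sum.cong[OF refl c\<alpha>])
        have 2: "real (card {j\<in>?X. c (\<beta> j) = q}) = (\<Sum>a\<in>{a\<in>K. c a = q}. N * l a)"
          by (subst card_class[OF finite_atLeastAtMost finite_K \<beta>K]) (rule sum.cong[OF refl c\<beta>])
        show ?thesis unfolding 1 2 by (simp add: sum_subtractf right_diff_distrib)
      qed
    qed
    also have "\<dots> \<le> (\<Sum>q<m. N * (\<bar>\<Sum>a\<in>{a\<in>K. c a = q}. (?p a - lam a)\<bar> + (\<Sum>a\<in>{a\<in>K. c a = q}. \<bar>lam a - l a\<bar>)))"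
    proof (rule sum_mono)
      fix q
      have "(\<Sum>a\<in>{a\<in>K. c a = q}. N * (?p a - l a)) = N * ((\<Sum>a\<in>{a\<in>K. c a = q}. (?p a - lam a)) + (\<Sum>a\<in>{a\<in>K. c a = q}. (lam a - l a)))"
        unfolding sum.distrib[symmetric] sum_distrib_left by (intro sum.cong refl) simp
      then have "\<bar>\<Sum>a\<in>{a\<in>K. c a = q}. N * (?p a - l a)\<bar> = N * \<bar>(\<Sum>a\<in>{a\<in>K. c a = q}. (?p a - lam a)) + (\<Sum>a\<in>{a\<in>K. c a = q}. (lam a - l a))\<bar>"
        by (simp add: abs_mult)
      also have "\<dots> \<le> N * (\<bar>\<Sum>a\<in>{a\<in>K. c a = q}. (?p a - lam a)\<bar> + (\<Sum>a\<in>{a\<in>K. c a = q}. \<bar>lam a - l a\<bar>))"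
        by (intro mult_left_mono order_trans[OF abs_triangle_ineq] add_mono order_refl sum_abs) auto
      finally show "\<bar>\<Sum>a\<in>{a\<in>K. c a = q}. N * (?p a - l a)\<bar>
         \<le> N * (\<bar>\<Sum>a\<in>{a\<in>K. c a = q}. (?p a - lam a)\<bar> + (\<Sum>a\<in>{a\<in>K. c a = q}. \<bar>lam a - l a\<bar>))" .
    qed
    also have "\<dots> = N * (class_deviation m c n x + (\<Sum>q<m. \<Sum>a\<in>{a\<in>K. c a = q}. \<bar>lam a - l a\<bar>))"
      unfolding class_deviation_def by (simp only: sum_distrib_left sum.distrib distrib_left)
    also have "(\<Sum>q<m. \<Sum>a\<in>{a\<in>K. c a = q}. \<bar>lam a - l a\<bar>) = (\<Sum>a\<in>K. \<bar>lam a - l a\<bar>)"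
      by (rule sum.group) (use finite_K c in auto)
    also have "\<dots> \<le> (\<Sum>a\<in>K. \<eta>)" by (intro sum_mono) (use ll in \<open>simp add: abs_minus_commute\<close>)
    finally show ?thesis using Npos by (simp add: mult_left_mono)
  qed
  have bad: "2 * real (card {j\<in>?X. c (\<alpha> j) \<noteq> c (\<alpha>' j)}) * card ?X \<le> (real N)\<^sup>2 * (2 * class_deviation m c n x + 2 * ?k * \<eta>)"
  proof -
    have "2 * real (card {j\<in>?X. c (\<alpha> j) \<noteq> c (\<alpha>' j)}) * card ?X \<le> 2 * (N * (class_deviation m c n x + ?k * \<eta>)) * N"
      using card3 by (intro mult_mono) auto
    then show ?thesis by (simp add: power2_eq_square algebra_simps)
  qed
  have cN: "N * \<bar>?p a - l a\<bar> = d a" for a by (simp add: d_def)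
  have i1: "infone K K (\<lambda>a b. cnt ?X \<alpha> a * cnt ?X \<alpha> b * U a b) = (real N)\<^sup>2 * infone K K (\<lambda>a b. ?p a * ?p b * U a b)"
    unfolding c\<alpha> by (rule infone_scale2) simp
  have i2: "infone K K (\<lambda>a b. cnt ?X \<alpha>' a * cnt ?X \<alpha>' b * U a b) = (real N)\<^sup>2 * infone K K (\<lambda>a b. l a * l b * U a b)"
    unfolding c\<alpha>' by (rule infone_scale2) simp
  have i3: "infone K K (\<lambda>a b. d a * cnt ?X \<alpha> b * U a b) = (real N)\<^sup>2 * infone K K (\<lambda>a b. \<bar>?p a - l a\<bar> * ?p b * U a b)"
    unfolding c\<alpha> d_def by (rule infone_scale2) simp
  have i4: "infone K K (\<lambda>a b. cnt ?X \<alpha>' a * d b * U a b) = (real N)\<^sup>2 * infone K K (\<lambda>a b. l a * \<bar>?p b - l b\<bar> * U a b)"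
    unfolding c\<alpha>' d_def by (rule infone_scale2) simp
  have Dl: "\<bar>\<bar>?p a - l a\<bar> - D a\<bar> \<le> \<eta>" "0 \<le> \<bar>?p a - l a\<bar> \<and> \<bar>?p a - l a\<bar> \<le> 1" "0 \<le> D a \<and> D a \<le> 1" if "a \<in> K" for a
    using ll[OF that] l01[of a] p01[of a] lam01[OF that] unfolding D_def by (auto simp: abs_le_iff)
  have q2: "infone K K (\<lambda>a b. l a * l b * U a b) \<le> infone K K (\<lambda>a b. lam a * lam b * U a b) + 2 * (card K)\<^sup>2 * \<eta>"
    by (rule infone_perturb[OF finite_K U1]) (use l01 lam01 ll in auto)
  have q3: "infone K K (\<lambda>a b. \<bar>?p a - l a\<bar> * ?p b * U a b) \<le> infone K K (\<lambda>a b. D a * ?p b * U a b) + 2 * (card K)\<^sup>2 * \<eta>"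
    by (rule infone_perturb[OF finite_K U1]) (use Dl p01 \<eta> in auto)
  have q4: "infone K K (\<lambda>a b. l a * \<bar>?p b - l b\<bar> * U a b) \<le> infone K K (\<lambda>a b. lam a * D b * U a b) + 2 * (card K)\<^sup>2 * \<eta>"
    by (rule infone_perturb[OF finite_K U1]) (use Dl l01 ll in auto)
  have wrap: "cd \<le> noise + \<rho> * G + err"
    if B: "\<And>s t. (\<And>j. j \<in> ?X \<Longrightarrow> \<bar>s j\<bar> \<le> 1) \<Longrightarrow> (\<And>j. j \<in> ?X \<Longrightarrow> \<bar>t j\<bar> \<le> 1) \<Longrightarrow>
        (\<Sum>j\<in>?X. \<Sum>i\<in>?X. s j * t i * (Q (\<alpha> j) (\<alpha> i) - Q (\<alpha>' j) (\<alpha>' i))) \<le> B"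
      and BG: "B \<le> (real N)\<^sup>2 * (G + (2 * ?k + 8 * ?k\<^sup>2) * \<eta>)" for B G
  proof -
    have "cd \<le> noise + \<rho> * B / (real N)\<^sup>2 + 4 * \<eta>"
      unfolding cd_def noise_def by (rule final[rule_format, OF B[unfolded \<alpha>'_def]]) auto
    also have "\<rho> * B / (real N)\<^sup>2 \<le> \<rho> * (G + (2 * ?k + 8 * ?k\<^sup>2) * \<eta>)"
    proof -
      have "\<rho> * B \<le> \<rho> * ((real N)\<^sup>2 * (G + (2 * ?k + 8 * ?k\<^sup>2) * \<eta>))" using BG \<rho> by (intro mult_left_mono) auto
      then show ?thesis using Npos by (simp add: divide_le_eq mult_ac)
    qed
    also have "\<dots> \<le> \<rho> * G + (2 * ?k + 8 * ?k\<^sup>2) * \<eta>"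
    proof -
      have "\<rho> * ((2 * ?k + 8 * ?k\<^sup>2) * \<eta>) \<le> 1 * ((2 * ?k + 8 * ?k\<^sup>2) * \<eta>)" using \<rho> \<eta> by (intro mult_right_mono) auto
      then show ?thesis by (simp add: distrib_left)
    qed
    finally show ?thesis unfolding err_def by (simp add: algebra_simps)
  qed
  have k2: "2 * real ((card K)\<^sup>2) * \<eta> = 2 * (?k\<^sup>2 * \<eta>)" "0 \<le> ?k\<^sup>2 * \<eta>" "0 \<le> ?k * \<eta>" using \<eta> by auto
  show "cd \<le> noise + \<rho> * (2 * class_deviation m c n x + infone K K (\<lambda>a b. ?p a * ?p b * U a b)
      + infone K K (\<lambda>a b. lam a * lam b * U a b)) + err"
  proof (rule wrap)
    show "(\<Sum>j\<in>?X. \<Sum>i\<in>?X. s j * t i * (Q (\<alpha> j) (\<alpha> i) - Q (\<alpha>' j) (\<alpha>' i)))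
       \<le> 2 * real (card {j\<in>?X. c (\<alpha> j) \<noteq> c (\<alpha>' j)}) * card ?X + infone K K (\<lambda>a b. cnt ?X \<alpha> a * cnt ?X \<alpha> b * U a b)
          + infone K K (\<lambda>a b. cnt ?X \<alpha>' a * cnt ?X \<alpha>' b * U a b)"
      if st: "\<And>j. j \<in> ?X \<Longrightarrow> \<bar>s j\<bar> \<le> 1" "\<And>j. j \<in> ?X \<Longrightarrow> \<bar>t j\<bar> \<le> 1" for s t
      unfolding U_def by (rule matched_difference(1)[OF finite_atLeastAtMost finite_K \<alpha>K \<alpha>'K Q01 V(1) st d1 d2])
    show "2 * real (card {j\<in>?X. c (\<alpha> j) \<noteq> c (\<alpha>' j)}) * card ?X + infone K K (\<lambda>a b. cnt ?X \<alpha> a * cnt ?X \<alpha> b * U a b)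
          + infone K K (\<lambda>a b. cnt ?X \<alpha>' a * cnt ?X \<alpha>' b * U a b)
      \<le> (real N)\<^sup>2 * ((2 * class_deviation m c n x + infone K K (\<lambda>a b. ?p a * ?p b * U a b)
      + infone K K (\<lambda>a b. lam a * lam b * U a b)) + (2 * ?k + 8 * ?k\<^sup>2) * \<eta>)"
      (is "?b + ?i1 + ?i2 \<le> (real N)\<^sup>2 * (?dv + ?h1 + ?h2 + ?e)")
    proof -
      have "?b + ?i1 + ?i2 \<le> (real N)\<^sup>2 * (2 * class_deviation m c n x + 2 * ?k * \<eta>) + (real N)\<^sup>2 * ?h1 + (real N)\<^sup>2 * (?h2 + 2 * (card K)\<^sup>2 * \<eta>)"
        unfolding i1 i2 by (intro add_mono bad mult_left_mono q2) auto
      also have "\<dots> = (real N)\<^sup>2 * (2 * class_deviation m c n x + 2 * ?k * \<eta> + ?h1 + (?h2 + 2 * (card K)\<^sup>2 * \<eta>))"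
        by (simp add: algebra_simps)
      also have "\<dots> \<le> (real N)\<^sup>2 * (?dv + ?h1 + ?h2 + ?e)"
      proof (rule mult_left_mono)
        have "2 * ?k * \<eta> + 2 * real ((card K)\<^sup>2) * \<eta> \<le> ?e" using k2 by (simp add: algebra_simps)
        then show "2 * class_deviation m c n x + 2 * ?k * \<eta> + ?h1 + (?h2 + 2 * (card K)\<^sup>2 * \<eta>) \<le> ?dv + ?h1 + ?h2 + ?e" by simp
      qed simp
      finally show ?thesis .
    qed
  qed
  show "cd \<le> noise + \<rho> * (2 * class_deviation m c n x + 2 * infone K K (\<lambda>a b. D a * ?p b * U a b)
      + 2 * infone K K (\<lambda>a b. lam a * D b * U a b)) + err"
  proof (rule wrap)
    show "(\<Sum>j\<in>?X. \<Sum>i\<in>?X. s j * t i * (Q (\<alpha> j) (\<alpha> i) - Q (\<alpha>' j) (\<alpha>' i)))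
       \<le> 2 * real (card {j\<in>?X. c (\<alpha> j) \<noteq> c (\<alpha>' j)}) * card ?X + 2 * infone K K (\<lambda>a b. d a * cnt ?X \<alpha> b * U a b)
          + 2 * infone K K (\<lambda>a b. cnt ?X \<alpha>' a * d b * U a b)"
      if st: "\<And>j. j \<in> ?X \<Longrightarrow> \<bar>s j\<bar> \<le> 1" "\<And>j. j \<in> ?X \<Longrightarrow> \<bar>t j\<bar> \<le> 1" for s t
      unfolding U_def by (rule matched_difference(2)[OF finite_atLeastAtMost finite_K \<alpha>K \<alpha>'K Q01 V(1) st d1 d2])
    show "2 * real (card {j\<in>?X. c (\<alpha> j) \<noteq> c (\<alpha>' j)}) * card ?X + 2 * infone K K (\<lambda>a b. d a * cnt ?X \<alpha> b * U a b)
          + 2 * infone K K (\<lambda>a b. cnt ?X \<alpha>' a * d b * U a b)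
      \<le> (real N)\<^sup>2 * ((2 * class_deviation m c n x + 2 * infone K K (\<lambda>a b. D a * ?p b * U a b)
      + 2 * infone K K (\<lambda>a b. lam a * D b * U a b)) + (2 * ?k + 8 * ?k\<^sup>2) * \<eta>)"
      (is "?b + 2 * ?i1 + 2 * ?i2 \<le> (real N)\<^sup>2 * (?dv + 2 * ?h1 + 2 * ?h2 + ?e)")
    proof -
      have "?b + 2 * ?i1 + 2 * ?i2 \<le> (real N)\<^sup>2 * (2 * class_deviation m c n x + 2 * ?k * \<eta>)
         + 2 * ((real N)\<^sup>2 * (?h1 + 2 * (card K)\<^sup>2 * \<eta>)) + 2 * ((real N)\<^sup>2 * (?h2 + 2 * (card K)\<^sup>2 * \<eta>))"
        unfolding i3 i4 by (intro add_mono bad mult_left_mono q3 q4) auto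
      also have "\<dots> = (real N)\<^sup>2 * (2 * class_deviation m c n x + 2 * ?k * \<eta> + 2 * (?h1 + 2 * (card K)\<^sup>2 * \<eta>) + 2 * (?h2 + 2 * (card K)\<^sup>2 * \<eta>))"
        by (simp add: algebra_simps)
      also have "\<dots> \<le> (real N)\<^sup>2 * (?dv + 2 * ?h1 + 2 * ?h2 + ?e)"
      proof (rule mult_left_mono)
        have "2 * ?k * \<eta> + 2 * (2 * real ((card K)\<^sup>2) * \<eta>) + 2 * (2 * real ((card K)\<^sup>2) * \<eta>) \<le> ?e" using k2 by (simp add: algebra_simps)
        then show "2 * class_deviation m c n x + 2 * ?k * \<eta> + 2 * (?h1 + 2 * (card K)\<^sup>2 * \<eta>) + 2 * (?h2 + 2 * (card K)\<^sup>2 * \<eta>) \<le> ?dv + 2 * ?h1 + 2 * ?h2 + ?e" by simp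
      qed simp
      finally show ?thesis .
    qed
  qed
qed

lemma le_of_linear_error:
  fixes u v C :: real
  assumes "\<And>\<eta>. \<eta> > 0 \<Longrightarrow> u \<le> v + C * \<eta>" "C > 0"
  shows "u \<le> v"
proof (rule field_le_epsilon)
  fix e :: real assume "e > 0"
  then show "u \<le> v + e" using assms(1)[of "e / C"] assms(2) by simp
qed

text \<open>With the sample fixed, the grid can be refined until its error vanishes. The zero
  diagonal of \<open>\<Theta>\<close> differs from the step values in \<open>n\<close> entries of
  size at most \<open>\<rho>\<close>, which after division by \<open>n\<^sup>2\<close> gives
  \<open>\<rho> / n\<close>.\<close>

lemma empirical_cut_distance:
  fixes n m :: nat and \<rho> :: real and c :: "nat \<Rightarrow> nat" and V :: "nat \<Rightarrow> nat \<Rightarrow> real"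
  assumes n: "n \<ge> 1" and x: "\<And>i. i \<in> {1..n} \<Longrightarrow> x i \<in> K" and A: "\<And>i j. A i j \<in> {0, 1::real}"
    and \<rho>: "0 \<le> \<rho>" "\<rho> \<le> 1" and c: "\<And>a. c a < m"
    and V: "\<And>a a' b b'. c a = c a' \<Longrightarrow> c b = c b' \<Longrightarrow> V a b = V a' b'" "\<And>a b. 0 \<le> V a b \<and> V a b \<le> 1"
  defines "U \<equiv> \<lambda>a b. Q a b - V a b"
    and "D \<equiv> \<lambda>a. \<bar>freq n x a - lam a\<bar>"
    and "\<Theta> \<equiv> \<lambda>i j. if i = j then 0 else \<rho> * Q (x i) (x j)"
    and "cd \<equiv> cut_distance (empirical_graphon n A) (\<lambda>x y. \<rho> * W x y)"
  shows "cd \<le> infone {1..n} {1..n} (\<lambda>i j. A i j - \<Theta> i j) / (real n)\<^sup>2 + \<rho> / n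
      + \<rho> * (2 * class_deviation m c n x + infone K K (\<lambda>a b. freq n x a * freq n x b * U a b)
      + infone K K (\<lambda>a b. lam a * lam b * U a b))"
    and "cd \<le> infone {1..n} {1..n} (\<lambda>i j. A i j - \<Theta> i j) / (real n)\<^sup>2 + \<rho> / n
      + \<rho> * (2 * class_deviation m c n x + 2 * infone K K (\<lambda>a b. D a * freq n x b * U a b)
      + 2 * infone K K (\<lambda>a b. lam a * D b * U a b))"
proof -
  let ?I = "{1..n}"
  have Cpos: "4 + 2 * real (card K) + 8 * (real (card K))\<^sup>2 > 0" by (intro add_pos_nonneg) auto
  have "infone ?I ?I (\<lambda>i j. A i j - \<rho> * Q (x i) (x j)) = infone ?I ?I (\<lambda>i j. (A i j - \<Theta> i j) + (\<Theta> i j - \<rho> * Q (x i) (x j)))"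
    by simp
  also have "\<dots> \<le> infone ?I ?I (\<lambda>i j. A i j - \<Theta> i j) + infone ?I ?I (\<lambda>i j. \<Theta> i j - \<rho> * Q (x i) (x j))"
    by (rule infone_add_le) simp
  also have "infone ?I ?I (\<lambda>i j. \<Theta> i j - \<rho> * Q (x i) (x j)) \<le> (\<Sum>i\<in>?I. \<Sum>j\<in>?I. \<bar>\<Theta> i j - \<rho> * Q (x i) (x j)\<bar>)"
    by (rule infone_le_sum_abs) simp
  also have "\<dots> \<le> (\<Sum>i\<in>?I. \<Sum>j\<in>?I. if j = i then \<rho> else 0)"
  proof (intro sum_mono)
    fix i j assume "i \<in> ?I" "j \<in> ?I"
    then show "\<bar>\<Theta> i j - \<rho> * Q (x i) (x j)\<bar> \<le> (if j = i then \<rho> else 0)"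
      using Q01[OF x x, of i j] \<rho> by (auto simp: \<Theta>_def abs_mult mult_left_le)
  qed
  also have "\<dots> = n * \<rho>" by simp
  finally have "infone ?I ?I (\<lambda>i j. A i j - \<rho> * Q (x i) (x j)) \<le> infone ?I ?I (\<lambda>i j. A i j - \<Theta> i j) + n * \<rho>"
    by simp
  then have "infone ?I ?I (\<lambda>i j. A i j - \<rho> * Q (x i) (x j)) / (real n)\<^sup>2
      \<le> (infone ?I ?I (\<lambda>i j. A i j - \<Theta> i j) + n * \<rho>) / (real n)\<^sup>2"
    by (rule divide_right_mono) simp
  moreover have "n * \<rho> / (real n)\<^sup>2 = \<rho> / n" using n by (simp add: power2_eq_square)
  ultimately have diag: "infone ?I ?I (\<lambda>i j. A i j - \<rho> * Q (x i) (x j)) / (real n)\<^sup>2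
      \<le> infone ?I ?I (\<lambda>i j. A i j - \<Theta> i j) / (real n)\<^sup>2 + \<rho> / n"
    by (simp only: add_divide_distrib)
  have 1: "cd \<le> infone ?I ?I (\<lambda>i j. A i j - \<rho> * Q (x i) (x j)) / (real n)\<^sup>2
      + \<rho> * (2 * class_deviation m c n x + infone K K (\<lambda>a b. freq n x a * freq n x b * U a b)
      + infone K K (\<lambda>a b. lam a * lam b * U a b))"
    by (rule le_of_linear_error[OF _ Cpos]) (use matched_bound(1)[OF n x A \<rho> c _ V] in \<open>simp only: cd_def U_def\<close>)
  have 2: "cd \<le> infone ?I ?I (\<lambda>i j. A i j - \<rho> * Q (x i) (x j)) / (real n)\<^sup>2
      + \<rho> * (2 * class_deviation m c n x + 2 * infone K K (\<lambda>a b. D a * freq n x b * U a b)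
      + 2 * infone K K (\<lambda>a b. lam a * D b * U a b))"
    by (rule le_of_linear_error[OF _ Cpos]) (use matched_bound(2)[OF n x A \<rho> c _ V] in \<open>simp only: cd_def U_def D_def\<close>)
  show "cd \<le> infone {1..n} {1..n} (\<lambda>i j. A i j - \<Theta> i j) / (real n)\<^sup>2 + \<rho> / n
      + \<rho> * (2 * class_deviation m c n x + infone K K (\<lambda>a b. freq n x a * freq n x b * U a b)
      + infone K K (\<lambda>a b. lam a * lam b * U a b))"
    by (rule order_trans[OF 1]) (rule add_right_mono[OF diag])
  show "cd \<le> infone {1..n} {1..n} (\<lambda>i j. A i j - \<Theta> i j) / (real n)\<^sup>2 + \<rho> / n
      + \<rho> * (2 * class_deviation m c n x + 2 * infone K K (\<lambda>a b. D a * freq n x b * U a b)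
      + 2 * infone K K (\<lambda>a b. lam a * D b * U a b))"
    by (rule order_trans[OF 2]) (rule add_right_mono[OF diag])
qed

end

section \<open>Measurable labellings of step graphons\<close>

lemma null_subset_lebesgue: "A \<subseteq> B \<Longrightarrow> B \<in> null_sets lebesgue \<Longrightarrow> A \<in> null_sets lebesgue"
  by (rule null_sets_completion_subset)

text \<open>A Lebesgue measurable function may have nonmeasurable sections. It agrees almost
  everywhere with a Borel function, and by Fubini almost every section agrees almost everywhere with
  a Borel section; completeness does the rest.\<close>

lemma section_measurable:
  fixes W :: "real \<Rightarrow> real \<Rightarrow> real"
  assumes W: "(\<lambda>z. W (fst z) (snd z)) \<in> borel_measurable (lebesgue_on ({0..1} \<times> {0..1}))"
  obtains N where "N \<in> null_sets lebesgue"
    "\<And>x v. x \<in> {0..1} - N \<Longrightarrow> {y\<in>{0..1}. W x y = (v::real)} \<in> sets lebesgue"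
proof -
  let ?S = "{0..1::real} \<times> {0..1::real}"
  have S: "?S \<in> sets lebesgue" by (rule lebesgue_Times) auto
  let ?f = "\<lambda>z. indicator ?S z *\<^sub>R W (fst z) (snd z)"
  have "?f \<in> borel_measurable lebesgue"
    using W S by (subst (asm) borel_measurable_restrict_space_iff) auto
  then obtain g where g: "g \<in> borel_measurable lborel" "AE z in lborel. ?f z = g z"
    using completion_ex_borel_measurable_real by blast
  have "AE z in lborel \<Otimes>\<^sub>M lborel. ?f z = g z" unfolding lborel_prod by (rule g(2))
  from lborel_pair.AE_pair[OF this] have "AE x in lborel. AE y in lborel. ?f (x, y) = g (x, y)" .
  then obtain N where N: "\<And>x. x \<in> space lborel - N \<Longrightarrow> AE y in lborel. ?f (x, y) = g (x, y)" "N \<in> null_sets lborel"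
    by (rule AE_E3) (rule that, assumption+)
  show thesis
  proof (rule that[of N])
    show "N \<in> null_sets lebesgue" by (rule null_sets_completionI[OF N(2)])
    fix x v assume x: "x \<in> {0..1} - N"
    let ?A = "{y\<in>{0..1}. g (x, y) = v}"
    have "(\<lambda>y::real. (x, y)) \<in> borel \<rightarrow>\<^sub>M borel"
      by (intro borel_measurable_continuous_onI continuous_intros)
    moreover have "g \<in> borel \<rightarrow>\<^sub>M borel" using g(1) by simp
    ultimately have "(\<lambda>y. g (x, y)) \<in> borel_measurable borel" by (rule measurable_compose)
    from measurable_sets[OF this, of "{v}"] have "{y. g (x, y) = v} \<in> sets borel" by (simp add: vimage_def)
    moreover have "?A = {0..1} \<inter> {y. g (x, y) = v}" by auto
    ultimately have A: "?A \<in> sets lebesgue" by auto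
    have "AE y in lborel. ?f (x, y) = g (x, y)" using N(1) x by auto
    then have "AE y in lebesgue. ?f (x, y) = g (x, y)" by (rule AE_completion)
    then have ae: "AE y in lebesgue. y \<in> ?A \<longleftrightarrow> y \<in> {y\<in>{0..1}. W x y = v}"
      by eventually_elim (use x in \<open>auto simp: indicator_def\<close>)
    show "{y\<in>{0..1}. W x y = v} \<in> sets lebesgue"
      by (rule complete_measure.in_sets_AE[OF complete_lebesgue ae A]) simp
  qed
qed

lemma unit_interval_not_null: "{0..1::real} \<notin> null_sets lebesgue"
  by (simp add: null_sets_def)

text \<open>
  The given labelling need not be measurable. Reading off the class of \<open>y\<close> from its values against
  representatives \<open>X a\<close> of the non-null classes gives a measurable one.
\<close>

lemma measurable_labelling:
  assumes "W \<in> step_graphons k"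
  obtains K \<phi> and Q :: "nat \<Rightarrow> nat \<Rightarrow> real" and Z where "finite K" "card K \<le> k" "\<And>x. x \<in> {0..1} \<Longrightarrow> \<phi> x \<in> K"
    "\<And>a. a \<in> K \<Longrightarrow> label_class \<phi> a \<in> sets lebesgue"
    "\<And>a b. a \<in> K \<Longrightarrow> b \<in> K \<Longrightarrow> 0 \<le> Q a b \<and> Q a b \<le> 1 \<and> Q a b = Q b a"
    "Z \<in> null_sets lebesgue" "\<And>x y. x \<in> {0..1} - Z \<Longrightarrow> y \<in> {0..1} - Z \<Longrightarrow> W x y = Q (\<phi> x) (\<phi> y)"
proof -
  obtain Q :: "nat \<Rightarrow> nat \<Rightarrow> real" and \<phi>0 where W: "W \<in> graphons"
    and Q: "\<forall>a\<in>{1..k}. \<forall>b\<in>{1..k}. Q a b = Q b a \<and> Q a b \<in> {0..1}" and \<phi>0: "\<phi>0 \<in> {0..1} \<rightarrow> {1..k}"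
    and WQ: "\<forall>x\<in>{0..1}. \<forall>y\<in>{0..1}. W x y = Q (\<phi>0 x) (\<phi>0 y)"
    using assms unfolding step_graphons_def by blast
  have \<phi>0k: "\<phi>0 x \<in> {1..k}" if "x \<in> {0..1}" for x using \<phi>0 that by blast
  \<comment> \<open>The class of a label may be nonmeasurable, so not being a null set takes the
    place of positive measure.\<close>
  define K where "K = {b\<in>{1..k}. label_class \<phi>0 b \<notin> null_sets lebesgue}"
  have K: "finite K" "K \<subseteq> {1..k}" by (auto simp: K_def)
  define Z where "Z = (\<Union>b\<in>{1..k} - K. label_class \<phi>0 b)"
  have Z: "Z \<in> null_sets lebesgue"
    unfolding Z_def by (rule null_sets_UN') (auto simp: K_def intro: countable_finite)
  have \<phi>0K: "\<phi>0 x \<in> K" if "x \<in> {0..1} - Z" for x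
    using \<phi>0k[of x] that by (auto simp: Z_def label_class_def)
  have "\<exists>x\<in>{0..1}. x \<notin> Z" using null_subset_lebesgue[OF _ Z, of "{0..1}"] unit_interval_not_null by blast
  then obtain b0 where b0: "b0 \<in> K" using \<phi>0K by blast
  obtain N where N: "N \<in> null_sets lebesgue" "\<And>x v. x \<in> {0..1} - N \<Longrightarrow> {y\<in>{0..1}. W x y = (v::real)} \<in> sets lebesgue"
    by (rule section_measurable[of W]) (use W in \<open>auto simp: graphons_def\<close>)
  have "\<forall>a\<in>K. \<exists>x. x \<in> {0..1} - N \<and> \<phi>0 x = a"
  proof
    fix a assume "a \<in> K"
    then have "\<not> label_class \<phi>0 a \<subseteq> N" using null_subset_lebesgue[OF _ N(1)] by (auto simp: K_def)
    then show "\<exists>x. x \<in> {0..1} - N \<and> \<phi>0 x = a" by (auto simp: label_class_def)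
  qed
  from bchoice[OF this] obtain X where X: "\<forall>a\<in>K. X a \<in> {0..1} - N \<and> \<phi>0 (X a) = a" ..
  \<comment> \<open>The points that have the same values against all representatives as a point
    labelled \<open>b\<close>. Each representative avoids \<open>N\<close>, so these conditions are
    measurable.\<close>
  define G where "G = (\<lambda>b. {y\<in>{0..1}. \<forall>a\<in>K. W (X a) y = Q a b})"
  have G: "G b \<in> sets lebesgue" for b
  proof -
    have "(\<Inter>a\<in>K. {y\<in>{0..1}. W (X a) y = Q a b}) \<in> sets lebesgue"
      by (rule sets.finite_INT[OF K(1)]) (use b0 X N(2) in auto)
    moreover have "G b = (\<Inter>a\<in>K. {y\<in>{0..1}. W (X a) y = Q a b})" using b0 by (auto simp: G_def)
    ultimately show ?thesis by simp
  qed
  have WX: "W (X a) y = Q a (\<phi>0 y)" if "a \<in> K" "y \<in> {0..1}" for a y using X WQ that by auto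
  \<comment> \<open>Two sets \<open>G b\<close> are equal or disjoint; \<open>LEAST\<close> picks
    one label among duplicates in a measurable way, and \<open>b0\<close> is used only inside the
    null set \<open>Z\<close>.\<close>
  define \<phi> where "\<phi> = (\<lambda>y. if \<exists>b\<in>K. y \<in> G b then (LEAST b. b \<in> K \<and> y \<in> G b) else b0)"
  have least: "(LEAST b. b \<in> K \<and> y \<in> G b) \<in> K \<and> y \<in> G (LEAST b. b \<in> K \<and> y \<in> G b)" if ex: "\<exists>b\<in>K. y \<in> G b" for y
  proof -
    obtain b where "b \<in> K \<and> y \<in> G b" using ex by blast
    then show ?thesis by (rule LeastI)
  qed
  have \<phi>K: "\<phi> y \<in> K" for y using least[of y] b0 by (simp add: \<phi>_def)
  have \<phi>G: "y \<in> G (\<phi> y)" if "y \<in> {0..1} - Z" for y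
  proof -
    have "y \<in> G (\<phi>0 y)" using WX that by (auto simp: G_def)
    then have "\<exists>b\<in>K. y \<in> G b" using \<phi>0K[OF that] by blast
    then show ?thesis using least[of y] by (simp add: \<phi>_def)
  qed
  have \<phi>Q: "Q a (\<phi>0 y) = Q a (\<phi> y)" if "a \<in> K" "y \<in> {0..1} - Z" for a y
    using \<phi>G[OF that(2)] WX[OF that(1), of y] that by (auto simp: G_def)
  have sym: "Q a b = Q b a" if "a \<in> K" "b \<in> K" for a b using Q that K(2) by blast
  have meas: "label_class \<phi> a \<in> sets lebesgue" if "a \<in> K" for a
  proof -
    let ?U = "\<lambda>A. \<Union>b\<in>A. G b"
    have U: "?U A \<in> sets lebesgue" if "A \<subseteq> K" for A
      by (rule sets.finite_UN) (use finite_subset[OF that K(1)] G in auto)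
    have "label_class \<phi> a = (G a - ?U {b\<in>K. b < a}) \<union> (if a = b0 then {0..1} - ?U K else {})"
    proof (intro set_eqI)
      fix y
      have "(LEAST b. b \<in> K \<and> y \<in> G b) = a \<longleftrightarrow> y \<in> G a \<and> (\<forall>b\<in>K. b < a \<longrightarrow> y \<notin> G b)" if "\<exists>b\<in>K. y \<in> G b"
      proof
        assume "(LEAST b. b \<in> K \<and> y \<in> G b) = a"
        then show "y \<in> G a \<and> (\<forall>b\<in>K. b < a \<longrightarrow> y \<notin> G b)" using least[OF that] not_less_Least by blast
      next
        assume *: "y \<in> G a \<and> (\<forall>b\<in>K. b < a \<longrightarrow> y \<notin> G b)"
        show "(LEAST b. b \<in> K \<and> y \<in> G b) = a"
          by (rule Least_equality) (use * \<open>a \<in> K\<close> not_less in auto)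
      qed
      moreover have "y \<in> {0..1}" if "y \<in> G b" for b using that by (auto simp: G_def)
      ultimately show "y \<in> label_class \<phi> a \<longleftrightarrow> y \<in> (G a - ?U {b\<in>K. b < a}) \<union> (if a = b0 then {0..1} - ?U K else {})"
        using \<open>a \<in> K\<close> by (cases "\<exists>b\<in>K. y \<in> G b") (auto simp: label_class_def \<phi>_def)
    qed
    moreover have "(G a - ?U {b\<in>K. b < a}) \<union> (if a = b0 then {0..1} - ?U K else {}) \<in> sets lebesgue"
    proof -
      have "G a - ?U {b\<in>K. b < a} \<in> sets lebesgue" by (rule sets.Diff[OF G U]) auto
      moreover have "{0..1} - ?U K \<in> sets lebesgue" by (rule sets.Diff[OF _ U]) auto
      ultimately show ?thesis by (auto intro: sets.Un)
    qed
    ultimately show ?thesis by simp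
  qed
  have "card K \<le> k" using card_mono[OF _ K(2)] by simp
  \<comment> \<open>Since \<open>\<phi>Q\<close> exchanges the label in the second argument only,
    symmetry of \<open>Q\<close> brings the other label into that place.\<close>
  moreover have "W x y = Q (\<phi> x) (\<phi> y)" if "x \<in> {0..1} - Z" "y \<in> {0..1} - Z" for x y
  proof -
    have "W x y = Q (\<phi>0 x) (\<phi>0 y)" using WQ that by auto
    also have "\<dots> = Q (\<phi>0 x) (\<phi> y)" by (rule \<phi>Q[OF \<phi>0K[OF that(1)] that(2)])
    also have "\<dots> = Q (\<phi> y) (\<phi>0 x)" by (rule sym[OF \<phi>0K[OF that(1)] \<phi>K])
    also have "\<dots> = Q (\<phi> y) (\<phi> x)" by (rule \<phi>Q[OF \<phi>K that(1)])
    also have "\<dots> = Q (\<phi> x) (\<phi> y)" by (rule sym[OF \<phi>K \<phi>K])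
    finally show ?thesis .
  qed
  moreover have "0 \<le> Q a b \<and> Q a b \<le> 1 \<and> Q a b = Q b a" if "a \<in> K" "b \<in> K" for a b
    using Q that K(2) by (metis atLeastAtMost_iff subsetD)
  ultimately show thesis by (intro that[of K \<phi> Q Z] K(1) \<phi>K meas Z)
qed

text \<open>A class of the measurable labelling may still be null, for instance one emptied by the
  choice among duplicates. Such classes are merged into a class of positive measure, at the price of
  a larger null set.\<close>

lemma step_graphon_measurable_step:
  assumes W: "W \<in> step_graphons k"
  obtains K \<phi> Q Z where "measurable_step K \<phi> Q W Z" "card K \<le> k"
proof -
  obtain K \<phi> and Q :: "nat \<Rightarrow> nat \<Rightarrow> real" and Z where K: "finite K" "card K \<le> k" and \<phi>: "\<And>x. x \<in> {0..1} \<Longrightarrow> \<phi> x \<in> K"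
    and meas: "\<And>a. a \<in> K \<Longrightarrow> label_class \<phi> a \<in> sets lebesgue"
    and Q: "\<And>a b. a \<in> K \<Longrightarrow> b \<in> K \<Longrightarrow> 0 \<le> Q a b \<and> Q a b \<le> 1 \<and> Q a b = Q b a"
    and Z: "Z \<in> null_sets lebesgue" "\<And>x y. x \<in> {0..1} - Z \<Longrightarrow> y \<in> {0..1} - Z \<Longrightarrow> W x y = Q (\<phi> x) (\<phi> y)"
    by (rule measurable_labelling[OF W]) (rule that, assumption+)
  have sub: "label_class \<phi> a \<subseteq> {0..1}" for a by (auto simp: label_class_def)
  define K2 where "K2 = {a\<in>K. measure lebesgue (label_class \<phi> a) > 0}"
  define Z2 where "Z2 = (\<Union>a\<in>K - K2. label_class \<phi> a)"
  have null: "label_class \<phi> a \<in> null_sets lebesgue" if "a \<in> K - K2" for a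
  proof -
    have "measure lebesgue (label_class \<phi> a) = 0" using that by (auto simp: K2_def not_less measure_le_0_iff)
    then show ?thesis using emeasure_subset_unit(1)[OF meas[of a] sub] meas[of a] that by (auto simp: null_sets_def)
  qed
  have Z2: "Z2 \<in> null_sets lebesgue" unfolding Z2_def
    by (rule null_sets_UN') (use null K(1) in \<open>auto intro: countable_finite\<close>)
  have "\<exists>x\<in>{0..1}. x \<notin> Z2" using null_subset_lebesgue[OF _ Z2, of "{0..1}"] unit_interval_not_null by blast
  then obtain a0 where a0: "a0 \<in> K2" using \<phi> by (auto simp: Z2_def label_class_def)
  define \<psi> where "\<psi> = (\<lambda>x. if \<phi> x \<in> K2 then \<phi> x else a0)"
  have K2: "K2 \<subseteq> K" "finite K2" using K(1) by (auto simp: K2_def)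
  have cls: "label_class \<psi> a = (if a = a0 then label_class \<phi> a \<union> Z2 else label_class \<phi> a)" if "a \<in> K2" for a
    using that \<phi> by (auto simp: \<psi>_def label_class_def Z2_def)
  have cs: "label_class \<psi> a \<in> sets lebesgue" if "a \<in> K2" for a
    unfolding cls[OF that] using meas[of a] that K2(1) Z2 by auto
  have "measurable_step K2 \<psi> Q W (Z \<union> Z2)"
  proof
    show "finite K2" by (rule K2(2))
    show "\<psi> x \<in> K2" if "x \<in> {0..1}" for x using a0 by (simp add: \<psi>_def)
    show "label_class \<psi> a \<in> sets lebesgue" if "a \<in> K2" for a by (rule cs[OF that])
    show "measure lebesgue (label_class \<psi> a) > 0" if "a \<in> K2" for a
    proof -
      have "measure lebesgue (label_class \<psi> a) = measure lebesgue (label_class \<phi> a)"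
        unfolding cls[OF that] using measure_Un_null_set[OF meas[of a] Z2] that K2(1) by auto
      then show ?thesis using that by (simp add: K2_def)
    qed
    show "0 \<le> Q a b \<and> Q a b \<le> 1" "Q a b = Q b a" if "a \<in> K2" "b \<in> K2" for a b using Q that K2(1) by blast+
    show "Z \<union> Z2 \<in> null_sets lebesgue" by (rule null_sets.Un[OF Z(1) Z2])
    show "W x y = Q (\<psi> x) (\<psi> y)" if "x \<in> {0..1} - (Z \<union> Z2)" "y \<in> {0..1} - (Z \<union> Z2)" for x y
    proof -
      have "\<psi> z = \<phi> z" if "z \<in> {0..1} - (Z \<union> Z2)" for z
        using that \<phi>[of z] by (auto simp: \<psi>_def Z2_def label_class_def)
      then show ?thesis using Z(2)[of x y] that by auto
    qed
    show "0 \<le> W x y \<and> W x y \<le> 1" if "x \<in> {0..1}" "y \<in> {0..1}" for x y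
      using W that unfolding step_graphons_def graphons_def by fastforce
  qed
  moreover have "card K2 \<le> k" using card_mono[OF K(1) K2(1)] K(2) by linarith
  ultimately show thesis by (rule that)
qed

section \<open>Integration against the law of the random graph\<close>

lemma cut_distance_nonneg:
  assumes "\<And>x y. x \<in> {0..1} \<Longrightarrow> y \<in> {0..1} \<Longrightarrow> 0 \<le> W1 x y \<and> W1 x y \<le> 1"
    "\<And>x y. x \<in> {0..1} \<Longrightarrow> y \<in> {0..1} \<Longrightarrow> 0 \<le> W2 x y \<and> W2 x y \<le> 1"
  shows "cut_distance W1 W2 \<ge> 0"
  unfolding cut_distance_def
proof (rule cINF_greatest)
  \<comment> \<open>The identity, as the permutation of a single cell: the infimum must not range
    over the empty set.\<close>
  have "cell_perm 1 (\<lambda>j. j) \<in> mp_bijections" by (rule cell_perm_mp) (auto simp: bij_betw_def)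
  then show "mp_bijections \<noteq> {}" by blast
  fix \<tau> assume t: "\<tau> \<in> mp_bijections"
  show "0 \<le> cut_norm (\<lambda>x y. W1 x y - W2 (\<tau> x) (\<tau> y))"
  proof (rule cut_norm_nonneg)
    fix x y :: real assume xy: "x \<in> {0..1}" "y \<in> {0..1}"
    show "\<bar>W1 x y - W2 (\<tau> x) (\<tau> y)\<bar> \<le> 1"
      using assms(1)[OF xy] assms(2)[OF mp_bijectionsD[OF t xy(1)] mp_bijectionsD[OF t xy(2)]] by (simp add: abs_le_iff)
  qed
qed

text \<open>A function that is not integrable has integral 0, so upper bounds can be proved with
  nonnegative integrals and no integrability.\<close>

lemma integral_le_enn2real:
  fixes f :: "'a \<Rightarrow> real"
  shows "integral\<^sup>L M f \<le> enn2real (\<integral>\<^sup>+x. ennreal (f x) \<partial>M)"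
proof (cases "integrable M f")
  case True
  then show ?thesis by (simp add: real_lebesgue_integral_def)
next
  case False
  then show ?thesis by (simp add: not_integrable_integral_eq)
qed

lemma adjacency_pmf_binary: "A \<in> set_pmf (adjacency_pmf n \<Theta>) \<Longrightarrow> A i j \<in> {0, 1}"
  by (auto simp: adjacency_pmf_def)

lemma adjacency_pmf_cong:
  assumes "\<And>i j. i \<in> {1..n} \<Longrightarrow> j \<in> {1..n} \<Longrightarrow> \<Theta> i j = \<Theta>' i j"
  shows "adjacency_pmf n \<Theta> = adjacency_pmf n \<Theta>'"
proof -
  have "edge_pmf n \<Theta> = edge_pmf n \<Theta>'"
    by (rule Pi_pmf_cong) (use assms in \<open>auto simp: edge_pairs_def\<close>)
  then show ?thesis unfolding adjacency_pmf_def edge_pairs_def[symmetric] by simp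
qed

lemma prob_space_unit_leb: "prob_space unit_leb"
  by (rule prob_spaceI) (simp add: emeasure_restrict_space)

context measurable_step
begin

definition label_matrix :: "real \<Rightarrow> (nat \<Rightarrow> nat) \<Rightarrow> nat \<Rightarrow> nat \<Rightarrow> real" where
  "label_matrix \<rho> x i j = (if i = j then 0 else \<rho> * Q (x i) (x j))"

abbreviation sample_space :: "nat \<Rightarrow> (nat \<Rightarrow> real) measure" where
  "sample_space n \<equiv> Pi\<^sub>M {1..n} (\<lambda>_. unit_leb)"

definition labels :: "nat \<Rightarrow> (nat \<Rightarrow> real) \<Rightarrow> nat \<Rightarrow> nat" where
  "labels n \<xi> = (\<lambda>i\<in>{1..n}. \<phi> (\<xi> i))"

definition sample_cell :: "nat \<Rightarrow> (nat \<Rightarrow> nat) \<Rightarrow> (nat \<Rightarrow> real) set" where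
  "sample_cell n x = (\<Pi>\<^sub>E i\<in>{1..n}. label_class \<phi> (x i))"

lemma space_sample: "space (sample_space n) = {1..n} \<rightarrow>\<^sub>E {0..1}"
  by (simp add: space_PiM)

lemma labels_in: "\<xi> \<in> space (sample_space n) \<Longrightarrow> labels n \<xi> \<in> {1..n} \<rightarrow>\<^sub>E K"
  unfolding space_sample labels_def by (auto intro!: \<phi>_K)

lemma in_sample_cell:
  assumes "\<xi> \<in> space (sample_space n)" "x \<in> {1..n} \<rightarrow>\<^sub>E K"
  shows "\<xi> \<in> sample_cell n x \<longleftrightarrow> labels n \<xi> = x"
proof
  assume a: "\<xi> \<in> sample_cell n x"
  show "labels n \<xi> = x"
  proof
    fix i
    show "labels n \<xi> i = x i"
    proof (cases "i \<in> {1..n}")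
      case True
      have "\<xi> i \<in> label_class \<phi> (x i)" by (rule PiE_mem[OF a[unfolded sample_cell_def] True])
      then show ?thesis using True by (simp add: labels_def label_class_def)
    next
      case False
      then show ?thesis using assms(2) by (auto simp: labels_def PiE_def extensional_def)
    qed
  qed
next
  assume l: "labels n \<xi> = x"
  show "\<xi> \<in> sample_cell n x"
    unfolding sample_cell_def
  proof (rule PiE_I)
    fix i assume i: "i \<in> {1..n}"
    have "\<xi> i \<in> {0..1}" by (rule PiE_mem[OF assms(1)[unfolded space_sample] i])
    moreover have "\<phi> (\<xi> i) = x i" using l i by (auto simp: labels_def)
    ultimately show "\<xi> i \<in> label_class \<phi> (x i)" by (simp add: label_class_def)
  next
    fix i assume "i \<notin> {1..n}"
    then show "\<xi> i = undefined" by (rule PiE_arb[OF assms(1)[unfolded space_sample]])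
  qed
qed

lemma sample_cell_measure:
  assumes "x \<in> {1..n} \<rightarrow>\<^sub>E K"
  shows "sample_cell n x \<in> sets (sample_space n)"
    "emeasure (sample_space n) (sample_cell n x) = ennreal (\<Prod>i\<in>{1..n}. lam (x i))"
proof -
  have xi: "x i \<in> K" if "i \<in> {1..n}" for i using assms that by (rule PiE_mem)
  have c: "label_class \<phi> (x i) \<in> sets unit_leb" if "i \<in> {1..n}" for i
    unfolding sets_unit_leb using class_sets[OF xi[OF that]] class_subset by blast
  show "sample_cell n x \<in> sets (sample_space n)"
    unfolding sample_cell_def by (rule sets_PiM_I_finite) (use c in auto)
  interpret prob_space unit_leb by (rule prob_space_unit_leb)
  interpret product_sigma_finite "\<lambda>_::nat. unit_leb" ..
  have "emeasure (sample_space n) (sample_cell n x) = (\<Prod>i\<in>{1..n}. emeasure unit_leb (label_class \<phi> (x i)))"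
    unfolding sample_cell_def by (rule emeasure_PiM) (use c in auto)
  also have "\<dots> = (\<Prod>i\<in>{1..n}. ennreal (lam (x i)))"
    by (intro prod.cong refl)
       (simp add: emeasure_unit_leb[OF c] lam_def emeasure_subset_unit(1)[OF class_sets[OF xi] class_subset])
  also have "\<dots> = ennreal (\<Prod>i\<in>{1..n}. lam (x i))"
    by (rule prod_ennreal) (simp add: lam_def)
  finally show "emeasure (sample_space n) (sample_cell n x) = ennreal (\<Prod>i\<in>{1..n}. lam (x i))" .
qed

lemma AE_sample_good: "AE \<xi> in sample_space n. \<forall>i\<in>{1..n}. \<xi> i \<notin> Z"
proof (rule AE_finite_allI)
  fix i assume i: "i \<in> {1..n}"
  have "AE x in lebesgue. x \<notin> Z" by (rule AE_not_in[OF Z_null])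
  then have "AE x in unit_leb. x \<notin> Z" by (subst AE_restrict_space_iff) auto
  then show "AE \<xi> in sample_space n. \<xi> i \<notin> Z"
    by (intro AE_PiM_component[where P = "\<lambda>x. x \<notin> Z"] prob_space_unit_leb i)
qed simp

lemma adjacency_on_good:
  assumes "\<xi> \<in> space (sample_space n)" "\<forall>i\<in>{1..n}. \<xi> i \<notin> Z"
  shows "adjacency_pmf n (prob_matrix \<rho> W \<xi>) = adjacency_pmf n (label_matrix \<rho> (labels n \<xi>))"
proof (rule adjacency_pmf_cong)
  fix i j assume ij: "i \<in> {1..n}" "j \<in> {1..n}"
  have "\<xi> i \<in> {0..1} - Z" "\<xi> j \<in> {0..1} - Z"
    using assms ij unfolding space_sample by (auto dest: PiE_mem)
  then show "prob_matrix \<rho> W \<xi> i j = label_matrix \<rho> (labels n \<xi>) i j"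
    using W_eq ij by (simp add: prob_matrix_def label_matrix_def labels_def)
qed

text \<open>Almost surely the conditional law of the graph depends only on the labels, of which
  there are finitely many configurations. A preimage is therefore a finite union of sample cells up
  to a null set, and measurable because \<open>latent_measure\<close> is complete.\<close>

lemma graph_kernel_measurable:
  "(\<lambda>\<xi>. measure_pmf (adjacency_pmf n (prob_matrix \<rho> W \<xi>))) \<in> measurable (latent_measure n) (subprob_algebra (count_space UNIV))"
proof (rule measurableI)
  let ?k = "\<lambda>\<xi>. measure_pmf (adjacency_pmf n (prob_matrix \<rho> W \<xi>))"
  let ?kx = "\<lambda>x. measure_pmf (adjacency_pmf n (label_matrix \<rho> x))"
  show "?k \<xi> \<in> space (subprob_algebra (count_space UNIV))" for \<xi> by (rule measure_pmf_in_subprob_algebra)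
  fix S assume "S \<in> sets (subprob_algebra (count_space (UNIV :: (nat \<Rightarrow> nat \<Rightarrow> real) set)))"
  let ?A = "\<Union>x\<in>{x \<in> {1..n} \<rightarrow>\<^sub>E K. ?kx x \<in> S}. sample_cell n x"
  have A: "?A \<in> sets (sample_space n)"
  proof (rule sets.finite_UN)
    show "finite {x \<in> {1..n} \<rightarrow>\<^sub>E K. ?kx x \<in> S}" using finite_PiE[of "{1..n}" "\<lambda>_. K"] finite_K by simp
  qed (use sample_cell_measure(1) in auto)
  have "AE \<xi> in sample_space n. \<xi> \<in> ?A \<longleftrightarrow> \<xi> \<in> ?k -` S \<inter> space (sample_space n)"
    using AE_sample_good[of n] AE_space
  proof eventually_elim
    case (elim \<xi>)
    have "\<xi> \<in> ?A \<longleftrightarrow> ?kx (labels n \<xi>) \<in> S"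
      using in_sample_cell[OF elim(2)] labels_in[OF elim(2)] by blast
    then show ?case using adjacency_on_good[OF elim(2,1)] elim(2) by simp
  qed
  then have "AE \<xi> in completion (sample_space n). \<xi> \<in> ?A \<longleftrightarrow> \<xi> \<in> ?k -` S \<inter> space (sample_space n)" by (rule AE_completion)
  from complete_measure.in_sets_AE[OF completion.complete_measure_axioms this]
  show "?k -` S \<inter> space (latent_measure n) \<in> sets (latent_measure n)"
    unfolding latent_measure_def using A by auto
qed

text \<open>The passage from the model to finite sums: the labels of the latent points are
  independent with law \<open>lam\<close>, and given the labels the graph has a fixed finitely
  supported law.\<close>

lemma graph_law_integral_le:
  assumes F0: "\<And>A. (\<And>i j. A i j \<in> {0, 1}) \<Longrightarrow> F A \<ge> 0"
    and G: "\<And>x. x \<in> {1..n} \<rightarrow>\<^sub>E K \<Longrightarrow> measure_pmf.expectation (adjacency_pmf n (label_matrix \<rho> x)) F \<le> G x"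
  shows "(LINT A|graph_law n \<rho> W. F A) \<le> pexp {1..n} K lam G"
proof -
  let ?P = "{1..n} \<rightarrow>\<^sub>E K"
  have finP: "finite ?P" by (rule finite_PiE) (use finite_K in auto)
  have exp_eq: "(\<integral>\<^sup>+A. ennreal (F A) \<partial>measure_pmf (adjacency_pmf n \<Theta>)) = ennreal (measure_pmf.expectation (adjacency_pmf n \<Theta>) F)" for \<Theta>
  proof (rule nn_integral_eq_integral)
    show "integrable (measure_pmf (adjacency_pmf n \<Theta>)) F" by (rule integrable_measure_pmf_finite[OF finite_set_adjacency_pmf])
    show "AE A in measure_pmf (adjacency_pmf n \<Theta>). 0 \<le> F A"
      unfolding AE_measure_pmf_iff using F0 adjacency_pmf_binary by blast
  qed
  have G0: "G x \<ge> 0" if "x \<in> ?P" for x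
  proof -
    have "0 \<le> measure_pmf.expectation (adjacency_pmf n (label_matrix \<rho> x)) F"
      by (rule integral_nonneg_AE) (unfold AE_measure_pmf_iff, use F0 adjacency_pmf_binary in blast)
    then show ?thesis using G[OF that] by linarith
  qed
  have lamp: "0 \<le> (\<Prod>i\<in>{1..n}. lam (x i))" for x by (rule prod_nonneg) (simp add: lam_def)
  have pe0: "0 \<le> pexp {1..n} K lam G" unfolding pexp_def by (intro sum_nonneg mult_nonneg_nonneg lamp G0)
  have "(\<integral>\<^sup>+A. ennreal (F A) \<partial>graph_law n \<rho> W)
     = (\<integral>\<^sup>+\<xi>. \<integral>\<^sup>+A. ennreal (F A) \<partial>measure_pmf (adjacency_pmf n (prob_matrix \<rho> W \<xi>)) \<partial>latent_measure n)"
    unfolding graph_law_def by (rule nn_integral_bind[OF _ graph_kernel_measurable]) simp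
  also have "\<dots> \<le> (\<integral>\<^sup>+\<xi>. ennreal (G (labels n \<xi>)) \<partial>latent_measure n)"
  proof (rule nn_integral_mono_AE)
    have "AE \<xi> in sample_space n. (\<integral>\<^sup>+A. ennreal (F A) \<partial>measure_pmf (adjacency_pmf n (prob_matrix \<rho> W \<xi>))) \<le> ennreal (G (labels n \<xi>))"
      using AE_sample_good[of n] AE_space
    proof eventually_elim
      case (elim \<xi>)
      show ?case
        unfolding adjacency_on_good[OF elim(2,1)] exp_eq by (rule ennreal_leI[OF G[OF labels_in[OF elim(2)]]])
    qed
    then show "AE \<xi> in latent_measure n. (\<integral>\<^sup>+A. ennreal (F A) \<partial>measure_pmf (adjacency_pmf n (prob_matrix \<rho> W \<xi>))) \<le> ennreal (G (labels n \<xi>))"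
      unfolding latent_measure_def by (rule AE_completion)
  qed
  also have "\<dots> = (\<integral>\<^sup>+\<xi>. ennreal (G (labels n \<xi>)) \<partial>sample_space n)"
    unfolding latent_measure_def by (rule nn_integral_completion)
  also have "\<dots> = (\<integral>\<^sup>+\<xi>. (\<Sum>x\<in>?P. ennreal (G x) * indicator (sample_cell n x) \<xi>) \<partial>sample_space n)"
  proof (rule nn_integral_cong)
    fix \<xi> assume \<xi>: "\<xi> \<in> space (sample_space n)"
    have "(\<Sum>x\<in>?P. ennreal (G x) * indicator (sample_cell n x) \<xi>) = (\<Sum>x\<in>?P. if x = labels n \<xi> then ennreal (G x) else 0)"
      by (intro sum.cong refl) (use in_sample_cell[OF \<xi>] in \<open>auto simp: indicator_def\<close>)
    then show "ennreal (G (labels n \<xi>)) = (\<Sum>x\<in>?P. ennreal (G x) * indicator (sample_cell n x) \<xi>)"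
      using finP labels_in[OF \<xi>] by simp
  qed
  also have "\<dots> = (\<Sum>x\<in>?P. \<integral>\<^sup>+\<xi>. ennreal (G x) * indicator (sample_cell n x) \<xi> \<partial>sample_space n)"
    by (rule nn_integral_sum) (use sample_cell_measure(1) in auto)
  also have "\<dots> = (\<Sum>x\<in>?P. ennreal ((\<Prod>i\<in>{1..n}. lam (x i)) * G x))"
  proof (rule sum.cong[OF refl])
    fix x assume x: "x \<in> ?P"
    show "(\<integral>\<^sup>+\<xi>. ennreal (G x) * indicator (sample_cell n x) \<xi> \<partial>sample_space n) = ennreal ((\<Prod>i\<in>{1..n}. lam (x i)) * G x)"
      using sample_cell_measure[OF x] G0[OF x] lamp[of x]
      by (simp add: nn_integral_cmult_indicator ennreal_mult mult.commute)
  qed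
  also have "\<dots> = ennreal (pexp {1..n} K lam G)"
    unfolding pexp_def by (rule sum_ennreal) (intro mult_nonneg_nonneg lamp G0)
  finally have "(\<integral>\<^sup>+A. ennreal (F A) \<partial>graph_law n \<rho> W) \<le> ennreal (pexp {1..n} K lam G)" .
  then have "enn2real (\<integral>\<^sup>+A. ennreal (F A) \<partial>graph_law n \<rho> W) \<le> pexp {1..n} K lam G"
    by (rule enn2real_leI[OF pe0, rotated -1])
  then show ?thesis using integral_le_enn2real[of "graph_law n \<rho> W" F] by linarith
qed

end

text \<open>Row signs vanish in the absolute values. This turns absolute deviations of frequencies
  back into centred counts.\<close>

lemma infone_abs_rows:
  "infone A B (\<lambda>a b. \<bar>\<mu> a\<bar> * X a b) = infone A B (\<lambda>a b. \<mu> a * X a b)"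
proof -
  have "\<bar>\<Sum>b\<in>B. t b * (\<bar>\<mu> a\<bar> * X a b)\<bar> = \<bar>\<Sum>b\<in>B. t b * (\<mu> a * X a b)\<bar>" for t :: "_ \<Rightarrow> real" and a
  proof -
    have "(\<Sum>b\<in>B. t b * (m * X a b)) = m * (\<Sum>b\<in>B. t b * X a b)" for m
      by (simp add: sum_distrib_left mult_ac)
    then show ?thesis by (simp add: abs_mult)
  qed
  then show ?thesis unfolding infone_def by simp
qed

section \<open>The expected cut distance for a fixed depth\<close>

context measurable_step
begin

text \<open>The adjacency noise contributes 9 and the diagonal 1 to the constant 10, as
  \<open>\<rho> / n\<close> is at most its own square root.\<close>

lemma expected_cut_distance_le:
  assumes n: "n \<ge> 1" and \<rho>: "0 < \<rho>" "\<rho> \<le> 1"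
    and g: "\<And>x A. x \<in> {1..n} \<rightarrow>\<^sub>E K \<Longrightarrow> (\<And>i j. A i j \<in> {0, 1}) \<Longrightarrow>
      cut_distance (empirical_graphon n A) (\<lambda>x y. \<rho> * W x y)
        \<le> infone {1..n} {1..n} (\<lambda>i j. A i j - label_matrix \<rho> x i j) / (real n)\<^sup>2 + \<rho> / n + \<rho> * g x"
  shows "(LINT A|graph_law n \<rho> W. cut_distance (empirical_graphon n A) (\<lambda>x y. \<rho> * W x y))
    \<le> 10 * sqrt (\<rho> / n) + \<rho> * pexp {1..n} K lam g"
proof -
  let ?F = "\<lambda>A. cut_distance (empirical_graphon n A) (\<lambda>x y. \<rho> * W x y)"
  let ?N = "\<lambda>x A. infone {1..n} {1..n} (\<lambda>i j. A i j - label_matrix \<rho> x i j)"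
  have F0: "?F A \<ge> 0" if A: "\<And>i j. A i j \<in> {0, 1}" for A
  proof (rule cut_distance_nonneg)
    fix x y :: real assume xy: "x \<in> {0..1}" "y \<in> {0..1}"
    show "0 \<le> empirical_graphon n A x y \<and> empirical_graphon n A x y \<le> 1"
      using A[of "nat \<lceil>real n * x\<rceil>" "nat \<lceil>real n * y\<rceil>"] by (auto simp: empirical_graphon_def)
    show "0 \<le> \<rho> * W x y \<and> \<rho> * W x y \<le> 1" using W01[OF xy] \<rho> by (auto intro: mult_le_one)
  qed
  have sq: "\<rho> / n \<le> sqrt (\<rho> / n)"
  proof (rule real_le_rsqrt)
    have "\<rho> / n \<le> 1" using \<rho> n by (simp add: divide_le_eq)
    moreover have "0 \<le> \<rho> / n" using \<rho> by simp
    ultimately show "(\<rho> / n)\<^sup>2 \<le> \<rho> / n" unfolding power2_eq_square by (rule mult_left_le)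
  qed
  have G: "measure_pmf.expectation (adjacency_pmf n (label_matrix \<rho> x)) ?F \<le> 10 * sqrt (\<rho> / n) + \<rho> * g x"
    if x: "x \<in> {1..n} \<rightarrow>\<^sub>E K" for x
  proof -
    let ?E = "measure_pmf.expectation (adjacency_pmf n (label_matrix \<rho> x))"
    note int = integrable_measure_pmf_finite[OF finite_set_adjacency_pmf, of n "label_matrix \<rho> x"]
    have "?E ?F \<le> ?E (\<lambda>A. ?N x A / (real n)\<^sup>2 + (\<rho> / n + \<rho> * g x))"
    proof (rule integral_mono_AE[OF int int], unfold AE_measure_pmf_iff, rule ballI)
      fix A assume "A \<in> set_pmf (adjacency_pmf n (label_matrix \<rho> x))"
      from adjacency_pmf_binary[OF this] show "?F A \<le> ?N x A / (real n)\<^sup>2 + (\<rho> / n + \<rho> * g x)"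
        using g[OF x, of A] by simp
    qed
    also have "\<dots> = ?E (?N x) / (real n)\<^sup>2 + (\<rho> / n + \<rho> * g x)" by (simp add: int)
    also have "?E (?N x) \<le> 9 * (real n)\<^sup>2 * sqrt (\<rho> / n)"
    proof (rule adjacency_noise[OF n \<rho>])
      fix i j assume ij: "i \<in> {1..n}" "j \<in> {1..n}"
      then have "x i \<in> K" "x j \<in> K" using x by (auto dest: PiE_mem)
      then show "0 \<le> label_matrix \<rho> x i j \<and> label_matrix \<rho> x i j \<le> \<rho> \<and> label_matrix \<rho> x i j = label_matrix \<rho> x j i"
        using Q01[of "x i" "x j"] Q_sym[of "x i" "x j"] \<rho> by (auto simp: label_matrix_def mult_left_le)
    qed (simp add: label_matrix_def)
    also have "9 * (real n)\<^sup>2 * sqrt (\<rho> / n) / (real n)\<^sup>2 = 9 * sqrt (\<rho> / n)" using n by simp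
    finally show ?thesis using sq by (simp add: divide_right_mono)
  qed
  have "(LINT A|graph_law n \<rho> W. ?F A) \<le> pexp {1..n} K lam (\<lambda>x. 10 * sqrt (\<rho> / n) + \<rho> * g x)"
    by (rule graph_law_integral_le[OF F0 G])
  also have "\<dots> = 10 * sqrt (\<rho> / n) + \<rho> * pexp {1..n} K lam g"
    unfolding pexp_add pexp_cmult pexp_const[OF finite_atLeastAtMost prob_weights_lam] ..
  finally show ?thesis .
qed

text \<open>
  One partition serves both weightings: the regularity lemma is applied to the mean of \<open>lam\<close> and of
  the normalized \<open>sqrt lam\<close>, the scale of the fluctuations of the class frequencies.
\<close>

lemma weighted_regularity:
  assumes r: "r > 0"
  obtains c :: "nat \<Rightarrow> nat" and V where "\<And>a. c a < 4 ^ r" "\<And>a a' b b'. c a = c a' \<Longrightarrow> c b = c b' \<Longrightarrow> V a b = V a' b'"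
    "\<And>a b. 0 \<le> V a b \<and> V a b \<le> 1"
    "infone K K (\<lambda>a b. lam a * lam b * (Q a b - V a b)) \<le> 4 / sqrt r"
    "infone K K (\<lambda>a b. sqrt (lam a) * lam b * (Q a b - V a b)) \<le> 4 * sqrt (card K) / sqrt r"
    "infone K K (\<lambda>a b. lam a * sqrt (lam b) * (Q a b - V a b)) \<le> 4 * sqrt (card K) / sqrt r"
proof -
  note pD = prob_weightsD[OF prob_weights_lam]
  define S where "S = (\<Sum>a\<in>K. sqrt (lam a))"
  have Spos: "S > 0" unfolding S_def using pD(1,4) lam_pos by (intro sum_pos) auto
  have Sle: "S \<le> sqrt (card K)" unfolding S_def by (rule sum_sqrt_le[OF pD(2,3)])
  define w where "w = (\<lambda>a. (lam a + sqrt (lam a) / S) / 2)"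
  have w: "prob_weights K w"
  proof -
    have "(\<Sum>a\<in>K. w a) = ((\<Sum>a\<in>K. lam a) + (\<Sum>a\<in>K. sqrt (lam a)) / S) / 2"
      unfolding w_def by (simp only: sum_divide_distrib[symmetric] sum.distrib)
    then have "(\<Sum>a\<in>K. w a) = ((\<Sum>a\<in>K. lam a) + S / S) / 2" by (simp only: S_def[symmetric])
    then show ?thesis using pD(1-3) Spos by (auto simp: prob_weights_def w_def)
  qed
  obtain c :: "nat \<Rightarrow> nat" and V where cV: "\<And>a. c a < 4 ^ r" "\<And>a a' b b'. c a = c a' \<Longrightarrow> c b = c b' \<Longrightarrow> V a b = V a' b'"
    "\<And>a b. 0 \<le> V a b \<and> V a b \<le> 1"
    and I: "infone K K (\<lambda>a b. w a * w b * (Q a b - V a b)) \<le> 1 / sqrt (real r)"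
    by (rule weak_regularity[OF w Q01 r]) (assumption+, rule that, assumption+)
  \<comment> \<open>The mixture dominates \<open>lam\<close> up to the factor 2 and
    \<open>sqrt lam\<close> up to \<open>2 * S\<close>, where \<open>S \<le> sqrt (card K)\<close>.
    Monotonicity in the weights then carries one regularity bound to all three weightings.\<close>
  have w1: "\<bar>lam a\<bar> \<le> 2 * w a" if "a \<in> K" for a using pD(2)[OF that] Spos by (simp add: w_def)
  have w2: "\<bar>sqrt (lam a)\<bar> \<le> (2 * S) * w a" if "a \<in> K" for a
  proof -
    have "(2 * S) * w a = S * lam a + sqrt (lam a)" using Spos by (simp add: w_def field_simps)
    then show ?thesis using pD(2)[OF that] Spos by simp
  qed
  have sc: "infone K K (\<lambda>a b. (x * w a) * (y * w b) * (Q a b - V a b)) \<le> x * y / sqrt r" if "x \<ge> 0" "y \<ge> 0" for x y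
  proof -
    have "infone K K (\<lambda>a b. (x * w a) * (y * w b) * (Q a b - V a b)) = (x * y) * infone K K (\<lambda>a b. w a * w b * (Q a b - V a b))"
      by (subst infone_cmult[symmetric, OF pD(1)]) (use that in \<open>auto intro!: infone_cong\<close>)
    also have "\<dots> \<le> (x * y) * (1 / sqrt r)" using that by (intro mult_left_mono I) auto
    finally show ?thesis by simp
  qed
  have S4: "4 * S / sqrt r \<le> 4 * sqrt (card K) / sqrt r" using Sle by (intro divide_right_mono) auto
  show thesis
  proof (rule that[OF cV])
    have "infone K K (\<lambda>a b. lam a * lam b * (Q a b - V a b)) \<le> infone K K (\<lambda>a b. (2 * w a) * (2 * w b) * (Q a b - V a b))"
      by (rule infone_mono_weights[OF pD(1) w1 w1])
    also have "\<dots> \<le> 2 * 2 / sqrt r" by (rule sc) auto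
    finally show "infone K K (\<lambda>a b. lam a * lam b * (Q a b - V a b)) \<le> 4 / sqrt r" by simp
    have "infone K K (\<lambda>a b. sqrt (lam a) * lam b * (Q a b - V a b)) \<le> infone K K (\<lambda>a b. (2 * S * w a) * (2 * w b) * (Q a b - V a b))"
      by (rule infone_mono_weights[OF pD(1) w2 w1])
    also have "\<dots> \<le> (2 * S) * 2 / sqrt r" by (rule sc) (use Spos in auto)
    finally show "infone K K (\<lambda>a b. sqrt (lam a) * lam b * (Q a b - V a b)) \<le> 4 * sqrt (card K) / sqrt r" using S4 by simp
    have "infone K K (\<lambda>a b. lam a * sqrt (lam b) * (Q a b - V a b)) \<le> infone K K (\<lambda>a b. (2 * w a) * (2 * S * w b) * (Q a b - V a b))"
      by (rule infone_mono_weights[OF pD(1) w1 w2])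
    also have "\<dots> \<le> 2 * (2 * S) / sqrt r" by (rule sc) (use Spos in auto)
    finally show "infone K K (\<lambda>a b. lam a * sqrt (lam b) * (Q a b - V a b)) \<le> 4 * sqrt (card K) / sqrt r" using S4 by simp
  qed
qed

lemma expected_class_deviation:
  assumes n: "n \<ge> 1" and c: "\<And>a. c a < (4::nat) ^ r"
  shows "pexp {1..n} K lam (class_deviation (4 ^ r) c n) \<le> 2 * 2 ^ r / sqrt n"
proof -
  have e: "class_deviation (4 ^ r) c n x = (1 / n) * (\<Sum>q\<in>{..<4 ^ r}. \<bar>\<Sum>a\<in>{a\<in>K. c a = q}. (cnt {1..n} x a - card {1..n} * lam a)\<bar>)" for x
    unfolding class_deviation_def sum_distrib_left
  proof (rule sum.cong[OF refl])
    fix q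
    have "(\<Sum>a\<in>{a\<in>K. c a = q}. (freq n x a - lam a)) = (1 / n) * (\<Sum>a\<in>{a\<in>K. c a = q}. (cnt {1..n} x a - card {1..n} * lam a))"
      unfolding sum_distrib_left by (intro sum.cong refl) (use n in \<open>simp add: freq_def field_simps\<close>)
    then show "\<bar>\<Sum>a\<in>{a\<in>K. c a = q}. (freq n x a - lam a)\<bar> = (1 / n) * \<bar>\<Sum>a\<in>{a\<in>K. c a = q}. (cnt {1..n} x a - card {1..n} * lam a)\<bar>"
      by (simp add: abs_mult)
  qed
  have "pexp {1..n} K lam (class_deviation (4 ^ r) c n)
     = (1 / n) * pexp {1..n} K lam (\<lambda>x. \<Sum>q\<in>{..<4 ^ r}. \<bar>\<Sum>a\<in>{a\<in>K. c a = q}. (cnt {1..n} x a - card {1..n} * lam a)\<bar>)"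
    unfolding pexp_cmult[symmetric] by (rule pexp_cong) (rule e)
  also have "\<dots> \<le> (1 / n) * (2 * sqrt (card {..<(4::nat) ^ r} * card {1..n}))"
    by (intro mult_left_mono sampled_partition_deviation prob_weights_lam) (use c in auto)
  also have "\<dots> = 2 * 2 ^ r / sqrt n"
  proof -
    have "sqrt (4 ^ r) = (2::real) ^ r" by (simp add: real_sqrt_power)
    then have "(1 / n) * (2 * sqrt (card {..<(4::nat) ^ r} * card {1..n})) = 2 * 2 ^ r * (sqrt n / n)"
      by (simp add: real_sqrt_mult)
    also have "sqrt n / n = 1 / sqrt n" using n by (simp add: field_simps)
    finally show ?thesis by simp
  qed
  finally show ?thesis .
qed

lemma sqrt_ratio: "n \<ge> 1 \<Longrightarrow> n * sqrt n / (real n)\<^sup>2 = 1 / sqrt n" "n \<ge> 1 \<Longrightarrow> sqrt n / real n = 1 / sqrt n" for n :: nat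
  by (simp_all add: power2_eq_square field_simps)

text \<open>The number of labels must not appear, so both residual forms are bounded in full. The
  sampled form costs 4 times the population form \<open>?H\<close> and the population form once
  more; with \<open>?H \<le> 4 / sqrt r\<close> this is the 20.\<close>

lemma cut_bound_any_steps:
  assumes n: "n \<ge> 1" and \<rho>: "0 < \<rho>" "\<rho> \<le> 1" and r: "r > 0"
  shows "(LINT A|graph_law n \<rho> W. cut_distance (empirical_graphon n A) (\<lambda>x y. \<rho> * W x y))
    \<le> 10 * sqrt (\<rho> / n) + \<rho> * (4 * 2 ^ r / sqrt n + 20 / sqrt r + 18 / sqrt n)"
proof -
  obtain c :: "nat \<Rightarrow> nat" and V where c: "\<And>a. c a < 4 ^ r" and V: "\<And>a a' b b'. c a = c a' \<Longrightarrow> c b = c b' \<Longrightarrow> V a b = V a' b'"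
    "\<And>a b. 0 \<le> V a b \<and> V a b \<le> 1"
    and H: "infone K K (\<lambda>a b. lam a * lam b * (Q a b - V a b)) \<le> 4 / sqrt r"
    by (rule weighted_regularity[OF r]) (rule that, assumption+)
  let ?U = "\<lambda>a b. Q a b - V a b" and ?E = "pexp {1..n} K lam"
  let ?H = "infone K K (\<lambda>a b. lam a * lam b * ?U a b)"
  define g where "g = (\<lambda>x. 2 * class_deviation (4 ^ r) c n x + infone K K (\<lambda>a b. freq n x a * freq n x b * ?U a b) + ?H)"
  have U1: "\<bar>?U a b\<bar> \<le> 1" if "a \<in> K" "b \<in> K" for a b using Q01[OF that] V(2)[of a b] by (auto simp: abs_le_iff)
  have "(LINT A|graph_law n \<rho> W. cut_distance (empirical_graphon n A) (\<lambda>x y. \<rho> * W x y)) \<le> 10 * sqrt (\<rho> / n) + \<rho> * ?E g"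
  proof (rule expected_cut_distance_le[OF n \<rho>])
    fix x and A :: "nat \<Rightarrow> nat \<Rightarrow> real" assume x: "x \<in> {1..n} \<rightarrow>\<^sub>E K" and A: "\<And>i j. A i j \<in> {0, 1::real}"
    show "cut_distance (empirical_graphon n A) (\<lambda>x y. \<rho> * W x y)
        \<le> infone {1..n} {1..n} (\<lambda>i j. A i j - label_matrix \<rho> x i j) / (real n)\<^sup>2 + \<rho> / n + \<rho> * g x"
      unfolding g_def label_matrix_def
      by (rule empirical_cut_distance(1)[OF n PiE_mem[OF x] A less_imp_le[OF \<rho>(1)] \<rho>(2) c V])
  qed
  also have "?E g \<le> 4 * 2 ^ r / sqrt n + 20 / sqrt r + 18 / sqrt n"
  proof -
    have "?E (\<lambda>x. infone K K (\<lambda>a b. freq n x a * freq n x b * ?U a b))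
       = (1 / (real n)\<^sup>2) * ?E (\<lambda>x. infone K K (\<lambda>a b. cnt {1..n} x a * cnt {1..n} x b * ?U a b))"
      unfolding pexp_cmult[symmetric]
    proof (rule pexp_cong)
      fix x
      show "infone K K (\<lambda>a b. freq n x a * freq n x b * ?U a b) = 1 / (real n)\<^sup>2 * infone K K (\<lambda>a b. cnt {1..n} x a * cnt {1..n} x b * ?U a b)"
        by (subst infone_cmult[symmetric, OF finite_K]) (auto intro!: infone_cong simp: freq_def power2_eq_square)
    qed
    also have "\<dots> \<le> (1 / (real n)\<^sup>2) * (4 * (real n)\<^sup>2 * ?H + 18 * n * sqrt n)"
      using sampled_cut_norm[of "{1..n}" K lam ?U, OF _ prob_weights_lam U1] by (intro mult_left_mono) auto
    also have "\<dots> = 4 * ?H + 18 * (n * sqrt n / (real n)\<^sup>2)" using n by (simp add: distrib_left)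
    also have "\<dots> = 4 * ?H + 18 / sqrt n" unfolding sqrt_ratio(1)[OF n] by simp
    finally have f: "?E (\<lambda>x. infone K K (\<lambda>a b. freq n x a * freq n x b * ?U a b)) \<le> 4 * ?H + 18 / sqrt n" .
    have "?E g = 2 * ?E (class_deviation (4 ^ r) c n) + ?E (\<lambda>x. infone K K (\<lambda>a b. freq n x a * freq n x b * ?U a b)) + ?H"
      unfolding g_def pexp_add pexp_cmult pexp_const[OF finite_atLeastAtMost prob_weights_lam] ..
    also have "\<dots> \<le> 2 * (2 * 2 ^ r / sqrt n) + (4 * ?H + 18 / sqrt n) + ?H"
      by (intro add_mono mult_left_mono expected_class_deviation n c f order_refl) simp
    also have "\<dots> = 4 * 2 ^ r / sqrt n + 5 * ?H + 18 / sqrt n" by simp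
    also have "\<dots> \<le> 4 * 2 ^ r / sqrt n + 5 * (4 / sqrt r) + 18 / sqrt n" using H by simp
    finally show ?thesis by simp
  qed
  finally show ?thesis using \<rho> by (simp add: mult_left_mono)
qed

text \<open>Here one factor of each residual form is a deviation, of scale
  \<open>sqrt (lam a / n)\<close>, which is what the root-weighted regularity bounds are for. The
  hypothesis \<open>k \<le> n\<close> absorbs \<open>sqrt (card K) / n\<close> into
  \<open>1 / sqrt n\<close>. The constants are 80 = 2 * (32 + 8) and 96 = 2 * (42 + 6).\<close>

lemma cut_bound_few_steps:
  assumes n: "n \<ge> 1" and \<rho>: "0 < \<rho>" "\<rho> \<le> 1" and r: "r > 0" and k: "card K \<le> k" "k \<le> n"
  shows "(LINT A|graph_law n \<rho> W. cut_distance (empirical_graphon n A) (\<lambda>x y. \<rho> * W x y))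
    \<le> 10 * sqrt (\<rho> / n) + \<rho> * (4 * 2 ^ r / sqrt n + 80 * (sqrt k / (sqrt n * sqrt r)) + 96 / sqrt n)"
proof -
  obtain c :: "nat \<Rightarrow> nat" and V where c: "\<And>a. c a < 4 ^ r" and V: "\<And>a a' b b'. c a = c a' \<Longrightarrow> c b = c b' \<Longrightarrow> V a b = V a' b'"
    "\<And>a b. 0 \<le> V a b \<and> V a b \<le> 1"
    and H1: "infone K K (\<lambda>a b. sqrt (lam a) * lam b * (Q a b - V a b)) \<le> 4 * sqrt (card K) / sqrt r"
    and H2: "infone K K (\<lambda>a b. lam a * sqrt (lam b) * (Q a b - V a b)) \<le> 4 * sqrt (card K) / sqrt r"
    by (rule weighted_regularity[OF r]) (rule that, assumption+)
  let ?U = "\<lambda>a b. Q a b - V a b" and ?E = "pexp {1..n} K lam" and ?K = "real (card K)"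
  let ?H1 = "infone K K (\<lambda>a b. sqrt (lam a) * lam b * ?U a b)"
  let ?H2 = "infone K K (\<lambda>a b. lam a * sqrt (lam b) * ?U a b)"
  let ?D = "\<lambda>x a. \<bar>freq n x a - lam a\<bar>"
  define g1 where "g1 = (\<lambda>x. infone K K (\<lambda>a b. ?D x a * freq n x b * ?U a b))"
  define g2 where "g2 = (\<lambda>x. infone K K (\<lambda>a b. lam a * ?D x b * ?U a b))"
  have U1: "\<bar>?U a b\<bar> \<le> 1" if "a \<in> K" "b \<in> K" for a b using Q01[OF that] V(2)[of a b] by (auto simp: abs_le_iff)
  have dev: "freq n x a - lam a = (1 / n) * (cnt {1..n} x a - n * lam a)" for x a
    using n by (simp add: freq_def field_simps)
  have "(LINT A|graph_law n \<rho> W. cut_distance (empirical_graphon n A) (\<lambda>x y. \<rho> * W x y))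
     \<le> 10 * sqrt (\<rho> / n) + \<rho> * ?E (\<lambda>x. 2 * class_deviation (4 ^ r) c n x + 2 * g1 x + 2 * g2 x)"
  proof (rule expected_cut_distance_le[OF n \<rho>])
    fix x and A :: "nat \<Rightarrow> nat \<Rightarrow> real" assume x: "x \<in> {1..n} \<rightarrow>\<^sub>E K" and A: "\<And>i j. A i j \<in> {0, 1::real}"
    show "cut_distance (empirical_graphon n A) (\<lambda>x y. \<rho> * W x y)
        \<le> infone {1..n} {1..n} (\<lambda>i j. A i j - label_matrix \<rho> x i j) / (real n)\<^sup>2 + \<rho> / n
          + \<rho> * (2 * class_deviation (4 ^ r) c n x + 2 * g1 x + 2 * g2 x)"
      unfolding g1_def g2_def label_matrix_def
      by (rule empirical_cut_distance(2)[OF n PiE_mem[OF x] A less_imp_le[OF \<rho>(1)] \<rho>(2) c V])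
  qed
  also have "?E (\<lambda>x. 2 * class_deviation (4 ^ r) c n x + 2 * g1 x + 2 * g2 x)
     = 2 * ?E (class_deviation (4 ^ r) c n) + 2 * ?E g1 + 2 * ?E g2"
    unfolding pexp_add pexp_cmult ..
  also have "\<dots> \<le> 4 * 2 ^ r / sqrt n + 80 * (sqrt k / (sqrt n * sqrt r)) + 96 / sqrt n"
  proof -
    have kn: "sqrt ?K \<le> sqrt n" "sqrt ?K \<le> sqrt k" using k by auto
    have Kn: "sqrt ?K / n \<le> 1 / sqrt n"
      using divide_right_mono[OF kn(1), of "real n"] sqrt_ratio(2)[OF n] by simp
    have Hle: "4 * sqrt ?K / sqrt r / sqrt n \<le> 4 * (sqrt k / (sqrt n * sqrt r))"
    proof -
      have "4 * sqrt ?K / sqrt r / sqrt n \<le> 4 * sqrt k / sqrt r / sqrt n" using kn by (intro divide_right_mono mult_left_mono) auto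
      then show ?thesis by (simp add: mult.commute)
    qed
    have "?E g1 = (1 / (real n)\<^sup>2) * ?E (\<lambda>x. infone K K (\<lambda>a b. (cnt {1..n} x a - card {1..n} * lam a) * cnt {1..n} x b * ?U a b))"
      unfolding pexp_cmult[symmetric] g1_def
    proof (rule pexp_cong)
      fix x
      have "infone K K (\<lambda>a b. ?D x a * freq n x b * ?U a b) = infone K K (\<lambda>a b. (freq n x a - lam a) * (freq n x b * ?U a b))"
        unfolding mult.assoc by (rule infone_abs_rows)
      also have "\<dots> = 1 / (real n)\<^sup>2 * infone K K (\<lambda>a b. (cnt {1..n} x a - card {1..n} * lam a) * cnt {1..n} x b * ?U a b)"
        unfolding dev by (subst infone_cmult[symmetric, OF finite_K]) (auto intro!: infone_cong simp: freq_def power2_eq_square)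
      finally show "infone K K (\<lambda>a b. ?D x a * freq n x b * ?U a b)
         = 1 / (real n)\<^sup>2 * infone K K (\<lambda>a b. (cnt {1..n} x a - card {1..n} * lam a) * cnt {1..n} x b * ?U a b)" .
    qed
    also have "\<dots> \<le> (1 / (real n)\<^sup>2) * (8 * n * sqrt n * ?H1 + n * (24 * sqrt ?K + 18 * sqrt n))"
      using sampled_deviation_cut_norm[of "{1..n}" K lam ?U, OF _ _ prob_weights_lam lam_pos U1] n by (intro mult_left_mono) auto
    also have "\<dots> = 8 * (n * sqrt n / (real n)\<^sup>2) * ?H1 + 24 * (sqrt ?K / n) + 18 * (n * sqrt n / (real n)\<^sup>2)"
      using n by (simp add: distrib_left power2_eq_square)
    also have "\<dots> = 8 * (?H1 / sqrt n) + 24 * (sqrt ?K / n) + 18 / sqrt n" unfolding sqrt_ratio(1)[OF n] by simp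
    also have "\<dots> \<le> 8 * (4 * (sqrt k / (sqrt n * sqrt r))) + 24 * (1 / sqrt n) + 18 / sqrt n"
    proof (intro add_mono mult_left_mono Kn)
      have "?H1 / sqrt n \<le> 4 * sqrt ?K / sqrt r / sqrt n" using H1 by (rule divide_right_mono) simp
      then show "?H1 / sqrt n \<le> 4 * (sqrt k / (sqrt n * sqrt r))" using Hle by (rule order_trans)
    qed auto
    finally have E1: "?E g1 \<le> 32 * (sqrt k / (sqrt n * sqrt r)) + 42 / sqrt n" by simp
    have "?E g2 = (1 / n) * ?E (\<lambda>x. infone K K (\<lambda>b a. (cnt {1..n} x b - card {1..n} * lam b) * (lam a * ?U a b)))"
      unfolding pexp_cmult[symmetric] g2_def
    proof (rule pexp_cong)
      fix x
      have "infone K K (\<lambda>a b. lam a * ?D x b * ?U a b) = infone K K (\<lambda>b a. ?D x b * (lam a * ?U a b))"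
        by (subst infone_transpose[OF finite_K finite_K]) (simp add: mult_ac)
      also have "\<dots> = infone K K (\<lambda>b a. (freq n x b - lam b) * (lam a * ?U a b))" by (rule infone_abs_rows)
      also have "\<dots> = 1 / n * infone K K (\<lambda>b a. (cnt {1..n} x b - card {1..n} * lam b) * (lam a * ?U a b))"
        unfolding dev by (subst infone_cmult[symmetric, OF finite_K]) (auto intro!: infone_cong)
      finally show "infone K K (\<lambda>a b. lam a * ?D x b * ?U a b)
         = 1 / n * infone K K (\<lambda>b a. (cnt {1..n} x b - card {1..n} * lam b) * (lam a * ?U a b))" .
    qed
    also have "\<dots> \<le> (1 / n) * (2 * infone K K (\<lambda>b a. sqrt (n * lam b) * (lam a * ?U a b)) + (2 * sqrt ?K + 4 * sqrt n) * (\<Sum>a\<in>K. lam a))"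
    proof (rule mult_left_mono)
      show "?E (\<lambda>x. infone K K (\<lambda>b a. (cnt {1..n} x b - card {1..n} * lam b) * (lam a * ?U a b)))
         \<le> 2 * infone K K (\<lambda>b a. sqrt (n * lam b) * (lam a * ?U a b)) + (2 * sqrt ?K + 4 * sqrt n) * (\<Sum>a\<in>K. lam a)"
      proof (rule sampled_deviation[OF finite_atLeastAtMost finite_K prob_weights_lam lam_pos])
        fix b a assume "b \<in> K" "a \<in> K"
        then show "\<bar>lam a * ?U a b\<bar> \<le> lam a" using U1[of a b] lam_pos[of a] by (simp add: abs_mult mult_left_le)
      qed (use n in auto)
    qed simp
    also have "infone K K (\<lambda>b a. sqrt (n * lam b) * (lam a * ?U a b)) = sqrt n * ?H2"
      by (subst infone_transpose[OF finite_K finite_K], subst infone_cmult[symmetric, OF finite_K])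
         (auto intro!: infone_cong simp: real_sqrt_mult)
    also have "(\<Sum>a\<in>K. lam a) = 1" by (rule prob_weightsD(3)[OF prob_weights_lam])
    also have "(1 / n) * (2 * (sqrt n * ?H2) + (2 * sqrt ?K + 4 * sqrt n) * 1) = 2 * ((sqrt n / n) * ?H2) + 2 * (sqrt ?K / n) + 4 * (sqrt n / n)"
      using n by (simp add: field_simps)
    also have "\<dots> = 2 * (?H2 / sqrt n) + 2 * (sqrt ?K / n) + 4 / sqrt n" unfolding sqrt_ratio(2)[OF n] by simp
    also have "\<dots> \<le> 2 * (4 * (sqrt k / (sqrt n * sqrt r))) + 2 * (1 / sqrt n) + 4 / sqrt n"
    proof (intro add_mono mult_left_mono Kn)
      have "?H2 / sqrt n \<le> 4 * sqrt ?K / sqrt r / sqrt n" using H2 by (rule divide_right_mono) simp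
      then show "?H2 / sqrt n \<le> 4 * (sqrt k / (sqrt n * sqrt r))" using Hle by (rule order_trans)
    qed auto
    finally have E2: "?E g2 \<le> 8 * (sqrt k / (sqrt n * sqrt r)) + 6 / sqrt n" by simp
    have "2 * ?E (class_deviation (4 ^ r) c n) \<le> 4 * 2 ^ r / sqrt n"
      using expected_class_deviation[where c = c and r = r, OF n c] by simp
    then show ?thesis using E1 E2 by simp
  qed
  finally show ?thesis using \<rho> by (simp add: mult_left_mono)
qed

end

section \<open>Choice of the depth\<close>

lemma ln_le_two_sqrt:
  fixes y :: real
  assumes "y > 0"
  shows "ln y \<le> 2 * sqrt y"
  using ln_le_minus_one[of "sqrt y"] assms by (simp add: ln_sqrt)

text \<open>A depth of about \<open>ln y / 4\<close> gives \<open>2 ^ r\<close> at most twice the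
  fourth root of \<open>y\<close>; as \<open>sqrt (ln y)\<close> is at most \<open>sqrt 2\<close>
  times the same root, there is just enough room. The \<open>+ 1\<close> makes \<open>r\<close>
  positive and at least \<open>ln y / 4\<close>.\<close>

lemma regularity_depth:
  fixes y :: nat
  assumes "y \<ge> 2"
  obtains r :: nat where "r > 0" "2 ^ r \<le> 4 * (sqrt y / sqrt (ln y))" "1 / sqrt r \<le> 2 / sqrt (ln y)"
proof -
  define r where "r = nat \<lfloor>ln y / 4\<rfloor> + 1"
  have L: "ln y > 0" using assms by simp
  have r1: "real r \<ge> ln y / 4" unfolding r_def by linarith
  have r2: "real r \<le> ln y / 4 + 1" using L unfolding r_def by linarith
  have q: "sqrt (ln y) \<le> sqrt (2 * sqrt y)" using ln_le_two_sqrt[of y] assms by simp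
  have "(2::real) ^ r = 2 powr r" by (simp add: powr_realpow)
  also have "\<dots> \<le> 2 powr (ln y / 4 + 1)" using r2 by (intro powr_mono) auto
  also have "\<dots> = 2 * exp (ln 2 * (ln y / 4))"
    by (simp add: powr_add) (simp add: powr_def mult.commute)
  also have "\<dots> \<le> 2 * exp (ln y / 4)"
  proof -
    have "ln 2 \<le> (1::real)" using ln_le_minus_one[of "2::real"] by simp
    then have "ln 2 * (ln y / 4) \<le> 1 * (ln y / 4)" using L by (intro mult_right_mono) auto
    then show ?thesis by simp
  qed
  also have "exp (ln y / 4) = sqrt (sqrt y)"
  proof -
    have "exp (ln y / 4) * exp (ln y / 4) = exp (ln y / 2)" by (simp add: exp_add[symmetric])
    moreover have "exp (ln y / 2) * exp (ln y / 2) = real y" using assms by (simp add: exp_add[symmetric])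
    ultimately have "sqrt y = exp (ln y / 4) * exp (ln y / 4)"
      using real_sqrt_unique[of "exp (ln y / 2)" "real y"] by (simp add: power2_eq_square)
    then show ?thesis by simp
  qed
  finally have p: "2 ^ r \<le> 2 * sqrt (sqrt y)" .
  have "2 ^ r * sqrt (ln y) \<le> (2 * sqrt (sqrt y)) * sqrt (2 * sqrt y)"
    using p q L by (intro mult_mono) auto
  also have "\<dots> = 2 * sqrt 2 * sqrt y" by (simp add: real_sqrt_mult)
  also have "\<dots> \<le> 4 * sqrt y"
    using real_sqrt_le_mono[of 2 4] by (intro mult_right_mono) auto
  finally have a: "2 ^ r \<le> 4 * (sqrt y / sqrt (ln y))" using L by (simp add: field_simps)
  have "sqrt (ln y / 4) \<le> sqrt r" using r1 by simp
  then have s: "sqrt (ln y) / 2 \<le> sqrt r" by (simp add: real_sqrt_divide)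
  have "1 / sqrt r \<le> 1 / (sqrt (ln y) / 2)" using s L by (intro frac_le) auto
  then have b: "1 / sqrt r \<le> 2 / sqrt (ln y)" by simp
  show thesis by (rule that[OF _ a b]) (simp add: r_def)
qed

text \<open>The function \<open>k / ln k\<close> is increasing up to a constant, from
  \<open>ln (k / n) \<le> k / n - 1\<close> and \<open>1 \<le> 3 * ln n\<close>. So for
  \<open>k > n\<close> the bound free of \<open>k\<close> also yields the one with
  \<open>k\<close>.\<close>

lemma log_ratio_mono:
  fixes n k :: nat
  assumes "n \<ge> 2" "n < k"
  shows "1 / sqrt (ln n) \<le> 2 * sqrt (k / (n * ln k))"
proof -
  have n: "real n > 0" "ln n > 0" "ln k > 0" using assms by auto
  have "ln k = ln n + ln (k / n)" using assms by (simp add: ln_div)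
  also have "\<dots> \<le> ln n + (k / n - 1)" using assms by (intro add_left_mono ln_le_minus_one) auto
  finally have "n * ln k \<le> n * (ln n + (k / n - 1))" using n by (intro mult_left_mono) auto
  also have "\<dots> = n * ln n + k - n" using n by (simp add: field_simps)
  also have "\<dots> \<le> k * ln n + k"
  proof -
    have "n * ln n \<le> k * ln n" using assms n by (intro mult_right_mono) auto
    then show ?thesis using n by linarith
  qed
  also have "\<dots> \<le> k * ln n + k * (3 * ln n)"
  proof -
    have "ln 2 \<le> ln (real n)" using assms by simp
    then have "1 \<le> 3 * ln (real n)" using ln2_ge_two_thirds by linarith
    then have "real k * 1 \<le> real k * (3 * ln n)" by (intro mult_left_mono) auto
    then show ?thesis by simp
  qed
  finally have "n * ln k \<le> 4 * (k * ln n)" by simp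
  then have "1 / ln n \<le> 4 * (k / (n * ln k))" using n by (simp add: field_simps)
  then have "sqrt (1 / ln n) \<le> sqrt (4 * (k / (n * ln k)))" by (rule real_sqrt_le_mono)
  then show ?thesis by (simp add: real_sqrt_divide real_sqrt_mult)
qed

text \<open>The constant 300 covers all cases: 272 = 16 + 160 + 96 for \<open>2 \<le> n\<close> and
  \<open>k \<le> n\<close>, 74 = 16 + 40 + 18 for the bound free of \<open>k\<close>, doubled by
  \<open>log_ratio_mono\<close> when \<open>2 \<le> n < k\<close>, and 10 for the noise.\<close>

lemma step_graphon_cut_bound:
  assumes W: "W \<in> step_graphons k" and n: "n \<ge> 1" and k: "k \<ge> 2" and \<rho>: "0 < \<rho>" "\<rho> \<le> 1"
  defines "D \<equiv> LINT A|graph_law n \<rho> W. cut_distance (empirical_graphon n A) (\<lambda>x y. \<rho> * W x y)"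
  shows "D \<le> 300 * (\<rho> * sqrt (k / (n * ln k)) + sqrt (\<rho> / n))"
    and "n \<noteq> 1 \<Longrightarrow> D \<le> 300 * (\<rho> * (1 / sqrt (ln n)) + sqrt (\<rho> / n))"
proof -
  obtain K \<phi> Q Z where "measurable_step K \<phi> Q W Z" and K: "card K \<le> k"
    by (rule step_graphon_measurable_step[OF W])
  then interpret measurable_step K \<phi> Q W Z by simp
  have s0: "sqrt (\<rho> / n) \<ge> 0" using \<rho> by simp
  have wrap: "D \<le> 300 * (\<rho> * B + sqrt (\<rho> / n))" if "D \<le> 10 * sqrt (\<rho> / n) + \<rho> * G" "G \<le> 300 * B" for G B
  proof -
    have "\<rho> * G \<le> \<rho> * (300 * B)" using that(2) \<rho> by (intro mult_left_mono) auto
    moreover have "300 * (\<rho> * B + sqrt (\<rho> / n)) = \<rho> * (300 * B) + 300 * sqrt (\<rho> / n)" by simp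
    ultimately show ?thesis using that(1) s0 by linarith
  qed
  have any: "\<exists>G \<le> 74 * (1 / sqrt (ln n)). D \<le> 10 * sqrt (\<rho> / n) + \<rho> * G" if n2: "n \<ge> 2"
  proof -
    obtain r :: nat where r: "r > 0" "2 ^ r \<le> 4 * (sqrt n / sqrt (ln n))" "1 / sqrt r \<le> 2 / sqrt (ln n)"
      by (rule regularity_depth[OF n2])
    have np: "sqrt n > 0" "ln n > 0" using n2 by auto
    have "2 ^ r / sqrt n \<le> 4 * (sqrt n / sqrt (ln n)) / sqrt n" using r(2) by (rule divide_right_mono) simp
    then have a: "2 ^ r / sqrt n \<le> 4 * (1 / sqrt (ln n))" using np by simp
    have "ln n \<le> n" using ln_le_minus_one[of "real n"] n2 by simp
    then have b: "1 / sqrt n \<le> 1 / sqrt (ln n)" using np by (intro divide_left_mono) auto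
    have "4 * 2 ^ r / sqrt n + 20 / sqrt r + 18 / sqrt n = 4 * (2 ^ r / sqrt n) + 20 * (1 / sqrt r) + 18 * (1 / sqrt n)" by simp
    also have "\<dots> \<le> 4 * (4 * (1 / sqrt (ln n))) + 20 * (2 / sqrt (ln n)) + 18 * (1 / sqrt (ln n))"
      by (intro add_mono mult_left_mono a b r(3)) auto
    also have "\<dots> = 74 * (1 / sqrt (ln n))" by simp
    finally show ?thesis using cut_bound_any_steps[OF n \<rho> r(1)] unfolding D_def by blast
  qed
  show "n \<noteq> 1 \<Longrightarrow> D \<le> 300 * (\<rho> * (1 / sqrt (ln n)) + sqrt (\<rho> / n))"
  proof -
    assume "n \<noteq> 1"
    then obtain G where G: "G \<le> 74 * (1 / sqrt (ln n))" "D \<le> 10 * sqrt (\<rho> / n) + \<rho> * G" using any n by auto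
    have "0 \<le> 1 / sqrt (ln n)" using n by simp
    then show ?thesis using G(1) by (intro wrap[OF G(2)]) linarith
  qed
  have lk: "ln k > 0" "ln k \<le> k" using k ln_le_minus_one[of "real k"] by auto
  have B1: "sqrt (k / (n * ln k)) = sqrt k / sqrt (ln k) / sqrt n" by (simp add: real_sqrt_divide real_sqrt_mult mult.commute)
  have one: "1 \<le> sqrt k / sqrt (ln k)" using lk by simp
  show "D \<le> 300 * (\<rho> * sqrt (k / (n * ln k)) + sqrt (\<rho> / n))"
  proof (cases "n = 1")
    case True
    \<comment> \<open>For \<open>n = 1\<close> there is no logarithm to gain: depth 1 gives 8 + 20 +
      18 = 46, and \<open>sqrt (k / ln k)\<close> is at least 1.\<close>
    have "D \<le> 10 * sqrt (\<rho> / n) + \<rho> * (4 * 2 ^ 1 / sqrt n + 20 / sqrt (1::nat) + 18 / sqrt n)"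
      unfolding D_def by (rule cut_bound_any_steps[OF n \<rho>]) simp
    then show ?thesis by (rule wrap) (use True one in \<open>simp add: real_sqrt_divide\<close>)
  next
    case False
    then have n2: "n \<ge> 2" using n by simp
    show ?thesis
    proof (cases "k \<le> n")
      case True
      obtain r :: nat where r: "r > 0" "2 ^ r \<le> 4 * (sqrt k / sqrt (ln k))" "1 / sqrt r \<le> 2 / sqrt (ln k)"
        by (rule regularity_depth[OF k])
      have sn: "sqrt n > 0" using n by simp
      let ?b = "sqrt k / sqrt (ln k)"
      have "4 * 2 ^ r / sqrt n + 80 * (sqrt k / (sqrt n * sqrt r)) + 96 / sqrt n
         = (4 * 2 ^ r + 80 * (sqrt k * (1 / sqrt r)) + 96 * 1) / sqrt n"
        using sn by (simp add: add_divide_distrib mult.commute)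
      also have "\<dots> \<le> (4 * (4 * ?b) + 80 * (sqrt k * (2 / sqrt (ln k))) + 96 * ?b) / sqrt n"
        by (intro divide_right_mono add_mono mult_left_mono r one) auto
      also have "\<dots> = 272 * (?b / sqrt n)" by (simp add: field_simps)
      also have "\<dots> \<le> 300 * (?b / sqrt n)" using lk by (intro mult_right_mono) auto
      finally have "4 * 2 ^ r / sqrt n + 80 * (sqrt k / (sqrt n * sqrt r)) + 96 / sqrt n \<le> 300 * sqrt (k / (n * ln k))"
        unfolding B1 .
      then show ?thesis by (rule wrap[OF cut_bound_few_steps[OF n \<rho> r(1) K True, folded D_def]])
    next
      case False
      obtain G where G: "G \<le> 74 * (1 / sqrt (ln n))" "D \<le> 10 * sqrt (\<rho> / n) + \<rho> * G" using any[OF n2] by blast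
      have "1 / sqrt (ln n) \<le> 2 * sqrt (k / (n * ln k))" by (rule log_ratio_mono[OF n2]) (use False in simp)
      moreover have "0 \<le> sqrt (k / (n * ln k))" using lk by simp
      ultimately show ?thesis using G(1) by (intro wrap[OF G(2)]) linarith
    qed
  qed
qed

theorem mainTheorem3:
  shows "\<exists>C::real. C > 0 \<and>
    (\<forall>(n::nat) (k::nat) (\<rho>::real). n \<ge> 1 \<longrightarrow> k \<ge> 2 \<longrightarrow> 0 < \<rho> \<longrightarrow> \<rho> \<le> 1 \<longrightarrow>
      (SUP W\<^sub>0\<in>step_graphons k.
         ereal (LINT A|graph_law n \<rho> W\<^sub>0.
           cut_distance (empirical_graphon n A) (\<lambda>x y. \<rho> * W\<^sub>0 x y)))
      \<le> ereal C *
         (ereal \<rho> * min (ereal (sqrt (real k / (real n * ln (real k)))))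
                          (if n = 1 then \<infinity> else ereal (1 / sqrt (ln (real n))))
          + ereal (sqrt (\<rho> / real n))))"
proof (intro exI[of _ 300] conjI allI impI SUP_least)
  fix n k :: nat and \<rho> :: real and W
  assume n: "1 \<le> n" and k: "2 \<le> k" and \<rho>: "0 < \<rho>" "\<rho> \<le> 1" and W: "W \<in> step_graphons k"
  note b = step_graphon_cut_bound[OF W n k \<rho>]
  show "ereal (LINT A|graph_law n \<rho> W. cut_distance (empirical_graphon n A) (\<lambda>x y. \<rho> * W x y))
      \<le> ereal 300 *
         (ereal \<rho> * min (ereal (sqrt (real k / (real n * ln (real k)))))
                          (if n = 1 then \<infinity> else ereal (1 / sqrt (ln (real n))))
          + ereal (sqrt (\<rho> / real n)))"
  proof (cases "n = 1")
    case True
    then show ?thesis using b(1) by (simp add: min_absorb1)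
  next
    case False
    have m: "min (ereal x) (ereal y) = ereal (min x y)" for x y :: real by (simp add: min_def)
    show ?thesis using b(1) b(2)[OF False] False unfolding m if_not_P[OF False] by (simp add: min_def)
  qed
qed simp

end
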